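(* Let $\mathcal{H}_A,\mathcal{H}_B,\mathcal{H}_C$ be finite-dimensional Hilbert spaces, let $\rho_{ABC}$ be a pure state on $\mathcal{H}_A\otimes\mathcal{H}_B\otimes\mathcal{H}_C$, and let $Z=\{Z_j\}_{j=1}^N$ be a type of information about $A$. Let $\tilde\rho_{M_ZAB}=V_Z\rho_{AB}V_Z^\dagger$. Then, with entanglement measured across the bipartition $M_Z|AB$ of $\tilde\rho_{M_ZAB}$, (i) $E_D^{M_Z|AB}=E_R^{M_Z|AB}=H(Z|C)$; (ii) $E_G^{M_Z|AB}=1-p_{\mathrm{guess}}(Z|C)$.
   Context: A type of information $Z=\{Z_j\}_{j=1}^N$ about $A$ is a set of mutually orthogonal projectors on $\mathcal{H}_A$ with $\sum_j Z_j=I_A$. Let $M_Z$ be a register with orthonormal basis $\{|j\rangle\}_{j=1}^N$ and $V_Z=\sum_j |j\rangle_{M_Z}\otimes Z_j$ (identity on the other systems); $\rho_{AB}=\mathrm{Tr}_C\rho_{ABC}$. Let $\tilde\rho_{M_ZC}$ be the $M_ZC$ marginal of $V_Z\rho_{ABC}V_Z^\dagger$, which has the form $\sum_j p_j|j\rangle\langle j|\otimes\rho_{C,j}$ with $p_j=\mathrm{Tr}(Z_j\rho_A)$ and $p_j\rho_{C,j}=\mathrm{Tr}_A[(Z_j\otimes I_C)\rho_{AC}]$. Definitions: $H(\rho)=-\mathrm{Tr}(\rho\log_2\rho)$; $H(Z|C)=H(\tilde\rho_{M_ZC})-H(\rho_C)$; $p_{\mathrm{guess}}(Z|C)=\max_Q\sum_j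 p_j\mathrm{Tr}(Q_j\rho_{C,j})$ over POVMs $\{Q_j\}$ on $\mathcal{H}_C$. For a bipartite state $\rho_{XY}$: $E_D^{X|Y}$ is the distillable entanglement (optimal asymptotic rate of EPR pairs obtainable by LOCC); $E_R^{X|Y}(\rho_{XY})=\min_{\sigma\ \text{separable}}D(\rho_{XY}\|\sigma)$ with $D(\rho\|\sigma)=-H(\rho)-\mathrm{Tr}(\rho\log_2\sigma)$; $E_G^{X|Y}(\rho_{XY})=\min_{\sigma\ \text{separable}}[1-F(\rho_{XY},\sigma)]$ with $F(\rho,\sigma)=[\mathrm{Tr}(\sqrt{\rho}\sigma\sqrt{\rho})^{1/2}]^2$; separable means of the form $\sum_k q_k\sigma_{X,k}\otimes\sigma_{Y,k}$. *)

theory Defs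
  imports "Jordan_Normal_Form.Schur_Decomposition" "HOL-Library.Extended_Real"
begin

definition mtrace :: "complex mat \<Rightarrow> complex" where
  "mtrace A = (\<Sum>i<dim_row A. A $$ (i,i))"

definition cinner :: "complex vec \<Rightarrow> complex vec \<Rightarrow> complex" where
  "cinner v w = (\<Sum>i<dim_vec v. cnj (v $ i) * w $ i)"

definition outer :: "complex vec \<Rightarrow> complex vec \<Rightarrow> complex mat" where
  "outer v w = mat (dim_vec v) (dim_vec w) (\<lambda>(i,j). v $ i * cnj (w $ j))"

definition msum :: "nat \<Rightarrow> nat \<Rightarrow> ('i \<Rightarrow> complex mat) \<Rightarrow> 'i set \<Rightarrow> complex mat" where
  "msum n m A S = mat n m (\<lambda>ij. \<Sum>k\<in>S. A k $$ ij)"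

text \<open>Tensor (Kronecker) product; index of the product space is i * dim2 + i2.\<close>
definition kron :: "complex mat \<Rightarrow> complex mat \<Rightarrow> complex mat" where
  "kron A B = mat (dim_row A * dim_row B) (dim_col A * dim_col B)
     (\<lambda>(i,j). A $$ (i div dim_row B, j div dim_col B) * B $$ (i mod dim_row B, j mod dim_col B))"

definition ket :: "nat \<Rightarrow> nat \<Rightarrow> complex mat" where
  "ket N j = mat N 1 (\<lambda>(i,_). if i = j then 1 else 0)"

definition hermitian :: "nat \<Rightarrow> complex mat \<Rightarrow> bool" where
  "hermitian n A \<longleftrightarrow> A \<in> carrier_mat n n \<and> mat_adjoint A = A"

definition psd :: "nat \<Rightarrow> complex mat \<Rightarrow> bool" where
  "psd n A \<longleftrightarrow> hermitian n A \<and> (\<forall>v\<in>carrier_vec n. 0 \<le> Re (cinner v (A *\<^sub>v v)))"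

definition density :: "nat \<Rightarrow> complex mat \<Rightarrow> bool" where
  "density n \<rho> \<longleftrightarrow> psd n \<rho> \<and> mtrace \<rho> = 1"

definition unitary :: "nat \<Rightarrow> complex mat \<Rightarrow> bool" where
  "unitary n U \<longleftrightarrow> U \<in> carrier_mat n n \<and> U * mat_adjoint U = 1\<^sub>m n \<and> mat_adjoint U * U = 1\<^sub>m n"

definition spec_decomp :: "complex mat \<Rightarrow> complex mat \<Rightarrow> (nat \<Rightarrow> real) \<Rightarrow> bool" where
  "spec_decomp A U d \<longleftrightarrow> unitary (dim_row A) U \<and>
     A = U * mat_diag (dim_row A) (\<lambda>i. complex_of_real (d i)) * mat_adjoint U"

definition mfun :: "(real \<Rightarrow> real) \<Rightarrow> complex mat \<Rightarrow> complex mat" where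
  "mfun f A = (SOME B. \<exists>U d. spec_decomp A U d \<and>
      B = U * mat_diag (dim_row A) (\<lambda>i. complex_of_real (f (d i))) * mat_adjoint U)"

definition eta :: "real \<Rightarrow> real" where
  "eta x = (if x \<le> 0 then 0 else - x * log 2 x)"

definition vN_entropy :: "complex mat \<Rightarrow> real" where
  "vN_entropy \<rho> = (SOME h. \<exists>U d. spec_decomp \<rho> U d \<and> h = (\<Sum>i<dim_row \<rho>. eta (d i)))"

definition ptr_first :: "nat \<Rightarrow> nat \<Rightarrow> complex mat \<Rightarrow> complex mat" where
  "ptr_first d1 d2 \<rho> = mat d2 d2 (\<lambda>(i,j). \<Sum>k<d1. \<rho> $$ (k * d2 + i, k * d2 + j))"

definition ptr_last :: "nat \<Rightarrow> nat \<Rightarrow> complex mat \<Rightarrow> complex mat" where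
  "ptr_last d1 d2 \<rho> = mat d1 d1 (\<lambda>(i,j). \<Sum>k<d2. \<rho> $$ (i * d2 + k, j * d2 + k))"

definition ptr_mid :: "nat \<Rightarrow> nat \<Rightarrow> nat \<Rightarrow> complex mat \<Rightarrow> complex mat" where
  "ptr_mid d1 d2 d3 \<rho> = mat (d1 * d3) (d1 * d3) (\<lambda>(i,j). \<Sum>k<d2.
      \<rho> $$ ((i div d3) * (d2 * d3) + k * d3 + i mod d3, (j div d3) * (d2 * d3) + k * d3 + j mod d3))"

definition is_projector :: "nat \<Rightarrow> complex mat \<Rightarrow> bool" where
  "is_projector n P \<longleftrightarrow> hermitian n P \<and> P * P = P"

definition info_type :: "nat \<Rightarrow> nat \<Rightarrow> (nat \<Rightarrow> complex mat) \<Rightarrow> bool" where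
  "info_type dA N Z \<longleftrightarrow> (\<forall>j<N. is_projector dA (Z j)) \<and>
     (\<forall>j<N. \<forall>k<N. j \<noteq> k \<longrightarrow> Z j * Z k = 0\<^sub>m dA dA) \<and>
     msum dA dA Z {..<N} = 1\<^sub>m dA"

definition VZ :: "nat \<Rightarrow> nat \<Rightarrow> nat \<Rightarrow> (nat \<Rightarrow> complex mat) \<Rightarrow> complex mat" where
  "VZ N dA m Z = msum (N * (dA * m)) (dA * m) (\<lambda>j. kron (ket N j) (kron (Z j) (1\<^sub>m m))) {..<N}"

definition cond_entropy_Z :: "nat \<Rightarrow> nat \<Rightarrow> nat \<Rightarrow> nat \<Rightarrow> (nat \<Rightarrow> complex mat) \<Rightarrow> complex mat \<Rightarrow> real" where
  "cond_entropy_Z dA dB dC N Z \<rho> =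
     (let V = VZ N dA (dB * dC) Z;
          \<rho>MC = ptr_mid N (dA * dB) dC (V * \<rho> * mat_adjoint V);
          \<rho>C = ptr_first (dA * dB) dC \<rho>
      in vN_entropy \<rho>MC - vN_entropy \<rho>C)"

definition povm :: "nat \<Rightarrow> nat \<Rightarrow> (nat \<Rightarrow> complex mat) \<Rightarrow> bool" where
  "povm d N Q \<longleftrightarrow> (\<forall>j<N. psd d (Q j)) \<and> msum d d Q {..<N} = 1\<^sub>m d"

text \<open>p_guess(Z|C) = max_Q sum_j Tr(Q_j p_j rho_{C,j}), with p_j rho_{C,j} = Tr_A[(Z_j (x) I_C) rho_AC].\<close>
definition p_guess :: "nat \<Rightarrow> nat \<Rightarrow> nat \<Rightarrow> nat \<Rightarrow> (nat \<Rightarrow> complex mat) \<Rightarrow> complex mat \<Rightarrow> real" where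
  "p_guess dA dB dC N Z \<rho> =
     (let \<rho>AC = ptr_mid dA dB dC \<rho>;
          \<sigma> = (\<lambda>j. ptr_first dA dC (kron (Z j) (1\<^sub>m dC) * \<rho>AC))
      in Sup {(\<Sum>j<N. Re (mtrace (Q j * \<sigma> j))) | Q. povm dC N Q})"

definition sep_state :: "nat \<Rightarrow> nat \<Rightarrow> complex mat \<Rightarrow> bool" where
  "sep_state dX dY \<sigma> \<longleftrightarrow> (\<exists>(K::nat) (q::nat\<Rightarrow>real) (sx::nat\<Rightarrow>complex mat) (sy::nat\<Rightarrow>complex mat).
     (\<forall>k<K. 0 \<le> q k \<and> density dX (sx k) \<and> density dY (sy k)) \<and> (\<Sum>k<K. q k) = 1 \<and>
     \<sigma> = msum (dX * dY) (dX * dY) (\<lambda>k. complex_of_real (q k) \<cdot>\<^sub>m kron (sx k) (sy k)) {..<K})"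

text \<open>Relative entropy D(rho||sigma) = -H(rho) - Tr(rho log2 sigma), +infinity unless supp rho <= supp sigma.\<close>
definition rel_entropy :: "complex mat \<Rightarrow> complex mat \<Rightarrow> ereal" where
  "rel_entropy \<rho> \<sigma> =
     (if (\<forall>v\<in>carrier_vec (dim_row \<sigma>). \<sigma> *\<^sub>v v = 0\<^sub>v (dim_row \<sigma>) \<longrightarrow> \<rho> *\<^sub>v v = 0\<^sub>v (dim_row \<rho>))
      then ereal (- vN_entropy \<rho> - Re (mtrace (\<rho> * mfun (\<lambda>x. if 0 < x then log 2 x else 0) \<sigma>)))
      else \<infinity>)"

definition E_R :: "nat \<Rightarrow> nat \<Rightarrow> complex mat \<Rightarrow> ereal" where
  "E_R dX dY \<rho> = Inf {rel_entropy \<rho> \<sigma> | \<sigma>. sep_state dX dY \<sigma>}"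

definition fidelity :: "complex mat \<Rightarrow> complex mat \<Rightarrow> real" where
  "fidelity \<rho> \<sigma> = (Re (mtrace (mfun sqrt (mfun sqrt \<rho> * \<sigma> * mfun sqrt \<rho>))))\<^sup>2"

definition E_G :: "nat \<Rightarrow> nat \<Rightarrow> complex mat \<Rightarrow> real" where
  "E_G dX dY \<rho> = Inf {1 - fidelity \<rho> \<sigma> | \<sigma>. sep_state dX dY \<sigma>}"

text \<open>locc a b a' b' Ks: Ks is a list of Kraus operators of a finite-round LOCC protocol
  from C^a (x) C^b to C^a' (x) C^b'. In each round one party applies a (fine-grained)
  instrument with Kraus operators A_k : C^a -> C^(c k) (sum_k A_k^dagger A_k = I), the outcome k
  is communicated, and the rest of the protocol may depend on k.\<close>
inductive locc :: "nat \<Rightarrow> nat \<Rightarrow> nat \<Rightarrow> nat \<Rightarrow> complex mat list \<Rightarrow> bool" where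
  locc_id: "locc a b a b [1\<^sub>m (a * b)]"
| locc_alice: "\<lbrakk> \<forall>k<m. A k \<in> carrier_mat (c k) a;
     msum a a (\<lambda>k. mat_adjoint (A k) * A k) {..<m} = 1\<^sub>m a;
     \<forall>k<m. locc (c k) b a' b' (Ks k) \<rbrakk> \<Longrightarrow>
     locc a b a' b' (concat (map (\<lambda>k. map (\<lambda>K. K * kron (A k) (1\<^sub>m b)) (Ks k)) [0..<m]))"
| locc_bob: "\<lbrakk> \<forall>k<m. B k \<in> carrier_mat (c k) b;
     msum b b (\<lambda>k. mat_adjoint (B k) * B k) {..<m} = 1\<^sub>m b;
     \<forall>k<m. locc a (c k) a' b' (Ks k) \<rbrakk> \<Longrightarrow>
     locc a b a' b' (concat (map (\<lambda>k. map (\<lambda>K. K * kron (1\<^sub>m a) (B k)) (Ks k)) [0..<m]))"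

definition apply_kraus :: "nat \<Rightarrow> complex mat list \<Rightarrow> complex mat \<Rightarrow> complex mat" where
  "apply_kraus n Ks \<rho> = msum n n (\<lambda>i. Ks ! i * \<rho> * mat_adjoint (Ks ! i)) {..<length Ks}"

definition phi_max :: "nat \<Rightarrow> complex vec" where
  "phi_max K = vec (K * K) (\<lambda>i. if i div K = i mod K then complex_of_real (1 / sqrt (real K)) else 0)"

definition digit :: "nat \<Rightarrow> nat \<Rightarrow> nat \<Rightarrow> nat" where
  "digit d t x = (x div d ^ t) mod d"

text \<open>rho^{(x) n} for rho on C^dX (x) C^dY, with the systems reordered as X^n (x) Y^n.\<close>
definition tpow :: "nat \<Rightarrow> nat \<Rightarrow> nat \<Rightarrow> complex mat \<Rightarrow> complex mat" where
  "tpow dX dY n \<rho> = mat (dX ^ n * dY ^ n) (dX ^ n * dY ^ n) (\<lambda>(i,j). \<Prod>t<n.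
     \<rho> $$ (digit dX t (i div dY ^ n) * dY + digit dY t (i mod dY ^ n),
           digit dX t (j div dY ^ n) * dY + digit dY t (j mod dY ^ n)))"

definition distill_rate :: "nat \<Rightarrow> nat \<Rightarrow> complex mat \<Rightarrow> real \<Rightarrow> bool" where
  "distill_rate dX dY \<rho> r \<longleftrightarrow> (\<exists>K \<Lambda>.
     (\<forall>n. 1 \<le> K n \<and> locc (dX ^ n) (dY ^ n) (K n) (K n) (\<Lambda> n)) \<and>
     (\<lambda>n. Re (cinner (phi_max (K n))
              (apply_kraus (K n * K n) (\<Lambda> n) (tpow dX dY n \<rho>) *\<^sub>v phi_max (K n)))) \<longlonglongrightarrow> 1 \<and>
     (\<forall>\<epsilon>>0. eventually (\<lambda>n. r - \<epsilon> \<le> log 2 (real (K n)) / real n) sequentially))"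

definition E_D :: "nat \<Rightarrow> nat \<Rightarrow> complex mat \<Rightarrow> real" where
  "E_D dX dY \<rho> = Sup {r. distill_rate dX dY \<rho> r}"

end

theory Submission
  imports Defs "HOL-Analysis.L2_Norm" "Jordan_Normal_Form.Spectral_Radius"
begin

text \<open>
  Write the pure state as a matrix \<open>T\<close> from \<open>C\<close> to \<open>AB\<close>, so that \<open>\<rho>\<^sub>A\<^sub>B = T T\<^sup>\<dagger>\<close>. The state to be
  analysed is \<open>P P\<^sup>\<dagger>\<close>, where \<open>P\<close> stacks the operators \<open>Z\<^sub>j T\<close>, whose ranges are mutually orthogonal.

  (i) Every LOCC protocol is a test that accepts separable states with probability at most \<open>1/K\<close>. Typical
  projectors show that a test accepting \<open>\<rho>\<^sup>n\<close> with high probability accepts \<open>\<sigma>\<^sup>n\<close> with probability at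
  least about \<open>2\<close> to the power \<open>- n D(\<rho>||\<sigma>)\<close>, hence \<open>E\<^sub>D \<le> D(\<rho>||\<sigma>)\<close> for every separable \<open>\<sigma>\<close>; no data
  processing inequality is needed. The dephased state \<open>\<sigma> = \<Sum>\<^sub>j |j\<rangle>\<langle>j| \<otimes> Z\<^sub>j \<rho>\<^sub>A\<^sub>B Z\<^sub>j\<close> has relative entropy
  exactly \<open>H(Z|C)\<close>. Conversely, hashing the register to \<open>K\<close> values makes it nearly uniform and independent
  of \<open>C\<close> as long as the rate is below \<open>H(Z|C)\<close>; a polar decomposition then gives Bob's decoder. Thus
  \<open>H(Z|C) \<le> E\<^sub>D \<le> E\<^sub>R \<le> H(Z|C)\<close>.

  (ii) By Uhlmann's theorem the square root of the fidelity with a separable state \<open>Y Y\<^sup>\<dagger>\<close> is the maximum of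
  \<open>|Tr (W P\<^sup>\<dagger> Y)|\<close> over contractions \<open>W\<close>, and contractions together with the local vectors of the
  product decomposition of \<open>Y\<close> are the same thing as measurements on \<open>C\<close>.
\<close>

section \<open>Matrices, Frobenius norm and contractions\<close>

text \<open>States are handled through rectangular factors: each is a Gram matrix
  \<open>X * X\<^sup>\<dagger>\<close>, and acceptance probabilities and distances are expressed by
  the Frobenius norm \<open>fnorm\<close> of products of such factors with contractions. The freedom
  in choosing a factor is itself a contraction (\<open>gram_factor\<close>). This stands in for
  operator norm and operator order. The spectral functions are given by \<open>SOME\<close>, so each
  needs independence of the chosen decomposition; the common source is
  \<open>functional_calculus_commute\<close>. The decoder needs closeness in trace norm, while
  hashing controls Frobenius norms. The conversion costs the root of the dimension of
  \<open>C\<close>, which is affordable for \<open>n\<close> copies only after cutting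
  \<open>C\<close> to its typical subspace. A similar cut on the dephased state of \<open>AB\<close>
  bounds the collision weights. The two typical sizes leave as rate the entropy of the dephased
  state minus that of \<open>C\<close>, which is H(Z|C) because the global state is pure. Reductions
  to \<open>C\<close> come out as complex conjugates of the matrices analysed; conjugation preserves
  entropies and permutes measurements, so it is removed at the very end.\<close>

notation mat_adjoint ("_\<^sup>\<dagger>" [1000] 1000)

text \<open>Entries of products are unfolded only on demand, through \<open>mult_index\<close> with
  its explicit sum; otherwise simplification would break up products in the middle of algebraic
  manipulations.\<close>

declare index_mult_mat(1) [simp del]

section \<open>Entries, adjoints, diagonal matrices and traces\<close>

lemma mat_adjoint_dims [simp]:
  "dim_row (A\<^sup>\<dagger>) = dim_col A" "dim_col (A\<^sup>\<dagger>) = dim_row A"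
  unfolding mat_adjoint_def by auto

lemma mat_adjoint_index [simp]:
  fixes A :: "complex mat"
  shows "i < dim_col A \<Longrightarrow> j < dim_row A \<Longrightarrow> A\<^sup>\<dagger> $$ (i,j) = cnj (A $$ (j,i))"
  unfolding mat_adjoint_def by (simp add: mat_of_rows_def)

lemma mult_index:
  "i < dim_row A \<Longrightarrow> j < dim_col B \<Longrightarrow> dim_col A = dim_row B \<Longrightarrow>
   (A * B) $$ (i,j) = (\<Sum>k<dim_row B. A $$ (i,k) * (B $$ (k,j) :: complex))"
  by (simp add: index_mult_mat(1) scalar_prod_def atLeast0LessThan)

text \<open>Side conditions are equations between dimensions, here and in the laws that follow,
  because the simplifier discharges these by computing \<open>dim_row\<close> and
  \<open>dim_col\<close>; the carrier form would make it guess the inner dimensions.\<close>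

lemma mult_assoc_dim:
  fixes A B C :: "complex mat"
  shows "dim_col A = dim_row B \<Longrightarrow> dim_col B = dim_row C \<Longrightarrow> A * B * C = A * (B * C)"
  by (rule assoc_mult_mat) (auto intro: carrier_matI)

lemma mult_add_distrib_dim:
  fixes A B C :: "complex mat"
  shows "dim_col A = dim_row B \<Longrightarrow> dim_row B = dim_row C \<Longrightarrow> dim_col B = dim_col C \<Longrightarrow>
    A * (B + C) = A * B + A * C"
  by (rule mult_add_distrib_mat) (auto intro: carrier_matI)

lemma add_mult_distrib_dim:
  fixes A B C :: "complex mat"
  shows "dim_col B = dim_row A \<Longrightarrow> dim_row B = dim_row C \<Longrightarrow> dim_col B = dim_col C \<Longrightarrow>
    (B + C) * A = B * A + C * A"
  by (rule add_mult_distrib_mat[where n = "dim_row A"]) (auto intro: carrier_matI)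

lemma mult_minus_distrib_dim:
  fixes A B C :: "complex mat"
  shows "dim_col A = dim_row B \<Longrightarrow> dim_row B = dim_row C \<Longrightarrow> dim_col B = dim_col C \<Longrightarrow>
    A * (B - C) = A * B - A * C"
  by (rule mult_minus_distrib_mat) (auto intro: carrier_matI)

lemma minus_mult_distrib_dim:
  fixes A B C :: "complex mat"
  shows "dim_col B = dim_row A \<Longrightarrow> dim_row B = dim_row C \<Longrightarrow> dim_col B = dim_col C \<Longrightarrow>
    (B - C) * A = B * A - C * A"
  by (rule minus_mult_distrib_mat[where n = "dim_row A"]) (auto intro: carrier_matI)

lemma smult_mult_dim:
  fixes A B :: "complex mat"
  shows "dim_col A = dim_row B \<Longrightarrow> (k \<cdot>\<^sub>m A) * B = k \<cdot>\<^sub>m (A * B)"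
    "dim_col A = dim_row B \<Longrightarrow> A * (k \<cdot>\<^sub>m B) = k \<cdot>\<^sub>m (A * B)"
  by (auto intro!: mult_smult_assoc_mat mult_smult_distrib carrier_matI)

lemma one_mult_dim [simp]:
  fixes A :: "complex mat"
  shows "dim_row A = n \<Longrightarrow> 1\<^sub>m n * A = A" "dim_col A = n \<Longrightarrow> A * 1\<^sub>m n = A"
  by (auto intro: left_mult_one_mat' right_mult_one_mat')

lemma adjoint_mult:
  fixes A B :: "complex mat"
  assumes "dim_col A = dim_row B"
  shows "(A * B)\<^sup>\<dagger> = B\<^sup>\<dagger> * A\<^sup>\<dagger>"
  by (rule eq_matI) (use assms in \<open>auto simp: mult_index mult.commute\<close>)

lemma adjoint_adjoint [simp]: fixes A :: "complex mat" shows "A\<^sup>\<dagger>\<^sup>\<dagger> = A"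
  by (rule eq_matI) auto

lemma adjoint_one [simp]: "(1\<^sub>m n :: complex mat)\<^sup>\<dagger> = 1\<^sub>m n"
  by (rule eq_matI) auto

lemma adjoint_minus:
  fixes A B :: "complex mat"
  shows "dim_row A = dim_row B \<Longrightarrow> dim_col A = dim_col B \<Longrightarrow> (A - B)\<^sup>\<dagger> = A\<^sup>\<dagger> - B\<^sup>\<dagger>"
  by (rule eq_matI) auto

lemma adjoint_add:
  fixes A B :: "complex mat"
  shows "dim_row A = dim_row B \<Longrightarrow> dim_col A = dim_col B \<Longrightarrow> (A + B)\<^sup>\<dagger> = A\<^sup>\<dagger> + B\<^sup>\<dagger>"
  by (rule eq_matI) auto

lemma adjoint_smult:
  fixes A :: "complex mat" shows "(k \<cdot>\<^sub>m A)\<^sup>\<dagger> = cnj k \<cdot>\<^sub>m A\<^sup>\<dagger>"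
  by (rule eq_matI) auto

lemma mat_diag_dims [simp]: "dim_row (mat_diag n f) = n" "dim_col (mat_diag n f) = n"
  by (auto simp: mat_diag_def)

lemma mat_diag_index [simp]:
  "i < n \<Longrightarrow> j < n \<Longrightarrow> mat_diag n f $$ (i,j) = (if i = j then f j else 0)"
  by (auto simp: mat_diag_def)

lemma adjoint_mat_diag [simp]: "(mat_diag n f)\<^sup>\<dagger> = mat_diag n (\<lambda>i. cnj (f i))"
  by (rule eq_matI) auto

lemma mult_mat_diag_index:
  fixes A :: "complex mat"
  shows "i < dim_row A \<Longrightarrow> j < n \<Longrightarrow> dim_col A = n \<Longrightarrow> (A * mat_diag n f) $$ (i,j) = A $$ (i,j) * f j"
  by (subst mat_diag_mult_right[of _ "dim_row A"]) (auto intro: carrier_matI)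

lemma mat_diag_mult_index:
  fixes A :: "complex mat"
  shows "i < n \<Longrightarrow> j < dim_col A \<Longrightarrow> dim_row A = n \<Longrightarrow> (mat_diag n f * A) $$ (i,j) = f i * A $$ (i,j)"
  by (subst mat_diag_mult_left[of _ _ "dim_col A"]) (auto intro: carrier_matI)

lemma conj_diag_index:
  fixes U :: "complex mat"
  assumes "i < dim_row U" "j < dim_row U" "dim_col U = n"
  shows "(U * mat_diag n f * U\<^sup>\<dagger>) $$ (i,j) = (\<Sum>k<n. U $$ (i,k) * f k * cnj (U $$ (j,k)))"
  using assms by (subst mult_index) (simp_all add: mult_mat_diag_index)

lemma mtrace_mult: "dim_col A = dim_row B \<Longrightarrow> dim_col B = dim_row A \<Longrightarrow>
    mtrace (A * B) = (\<Sum>i<dim_row A. \<Sum>k<dim_row B. A $$ (i,k) * B $$ (k,i))"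
  unfolding mtrace_def by (simp add: mult_index)

lemma mtrace_cyclic:
  assumes "dim_col A = dim_row B" "dim_col B = dim_row A"
  shows "mtrace (A * B) = mtrace (B * A)"
  unfolding mtrace_mult[OF assms] mtrace_mult[OF assms(2,1)]
  by (subst sum.swap) (simp add: mult.commute)

lemma mtrace_add: "dim_row A = dim_row B \<Longrightarrow> dim_col A = dim_row A \<Longrightarrow> dim_col B = dim_row B \<Longrightarrow>
    mtrace (A + B) = mtrace A + mtrace B"
  unfolding mtrace_def by (simp add: sum.distrib)

lemma mtrace_minus: "dim_row A = dim_row B \<Longrightarrow> dim_col A = dim_row A \<Longrightarrow> dim_col B = dim_row B \<Longrightarrow>
    mtrace (A - B) = mtrace A - mtrace B"
  unfolding mtrace_def by (simp add: sum_subtractf)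

lemma mtrace_smult: "dim_col A = dim_row A \<Longrightarrow> mtrace (k \<cdot>\<^sub>m A) = k * mtrace A"
  unfolding mtrace_def by (simp add: sum_distrib_left)

lemma mtrace_mat_diag: "mtrace (mat_diag n f) = (\<Sum>i<n. f i)"
  unfolding mtrace_def by simp

section \<open>Frobenius norm\<close>

definition fnorm :: "complex mat \<Rightarrow> real" where
  "fnorm A = L2_set (\<lambda>ij. cmod (A $$ ij)) ({..<dim_row A} \<times> {..<dim_col A})"

lemma fnorm_nonneg [simp]: "0 \<le> fnorm A"
  by (simp add: fnorm_def)

lemma fnorm_sq: "(fnorm A)\<^sup>2 = (\<Sum>i<dim_row A. \<Sum>j<dim_col A. (cmod (A $$ (i,j)))\<^sup>2)"
  unfolding fnorm_def L2_set_def
  by (subst real_sqrt_pow2) (auto simp: sum_nonneg sum.cartesian_product)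

lemma fnorm_triangle:
  assumes "dim_row A = dim_row B" "dim_col A = dim_col B"
  shows "fnorm (A + B) \<le> fnorm A + fnorm B"
proof -
  let ?I = "{..<dim_row B} \<times> {..<dim_col B}"
  have "fnorm (A + B) \<le> L2_set (\<lambda>ij. cmod (A $$ ij) + cmod (B $$ ij)) ?I"
    unfolding fnorm_def using assms by (auto intro!: L2_set_mono norm_triangle_ineq)
  also have "\<dots> \<le> fnorm A + fnorm B"
    unfolding fnorm_def using assms L2_set_triangle_ineq by auto
  finally show ?thesis .
qed

lemma fnorm_minus_commute:
  assumes "dim_row A = dim_row B" "dim_col A = dim_col B"
  shows "fnorm (A - B) = fnorm (B - A)"
  unfolding fnorm_def using assms by (auto intro!: L2_set_cong simp: norm_minus_commute)

lemma fnorm_le_add_diff: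
  assumes "dim_row A = dim_row B" "dim_col A = dim_col B"
  shows "fnorm A \<le> fnorm B + fnorm (A - B)"
proof -
  have "A = B + (A - B)" by (rule eq_matI) (use assms in auto)
  then show ?thesis using fnorm_triangle[of B "A - B"] assms by simp
qed

lemma fnorm_diff_triangle:
  assumes "dim_row A = dim_row B" "dim_col A = dim_col B" "dim_row C = dim_row B" "dim_col C = dim_col B"
  shows "fnorm (A - C) \<le> fnorm (A - B) + fnorm (B - C)"
proof -
  have "A - C = (A - B) + (B - C)" by (rule eq_matI) (use assms in auto)
  then show ?thesis using fnorm_triangle[of "A - B" "B - C"] assms by simp
qed

lemma fnorm_smult: "fnorm (k \<cdot>\<^sub>m A) = cmod k * fnorm A"
  unfolding fnorm_def by (simp add: L2_set_right_distrib) (auto intro!: L2_set_cong simp: norm_mult)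

lemma mtrace_adjoint_mult:
  assumes "dim_row A = dim_row B" "dim_col A = dim_col B"
  shows "mtrace (A\<^sup>\<dagger> * B) = (\<Sum>i<dim_row B. \<Sum>j<dim_col B. cnj (A $$ (i,j)) * B $$ (i,j))"
  using assms by (subst mtrace_mult) (auto simp: sum.swap[of _ "{..<dim_col B}"])

lemma fnorm_sq_mtrace: "mtrace (A\<^sup>\<dagger> * A) = complex_of_real ((fnorm A)\<^sup>2)"
  unfolding fnorm_sq by (subst mtrace_adjoint_mult)
    (auto intro!: sum.cong simp: complex_norm_square mult.commute simp flip: of_real_power)

lemma fnorm_sq_Re_mtrace: "(fnorm A)\<^sup>2 = Re (mtrace (A\<^sup>\<dagger> * A))"
  by (simp add: fnorm_sq_mtrace)

lemma mtrace_Cauchy_Schwarz: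
  assumes "dim_row A = dim_row B" "dim_col A = dim_col B"
  shows "cmod (mtrace (A\<^sup>\<dagger> * B)) \<le> fnorm A * fnorm B"
proof -
  let ?I = "{..<dim_row B} \<times> {..<dim_col B}"
  have "cmod (mtrace (A\<^sup>\<dagger> * B)) = cmod (\<Sum>ij\<in>?I. cnj (A $$ ij) * B $$ ij)"
    unfolding mtrace_adjoint_mult[OF assms] by (simp add: sum.cartesian_product)
  also have "\<dots> \<le> (\<Sum>ij\<in>?I. \<bar>cmod (A $$ ij)\<bar> * \<bar>cmod (B $$ ij)\<bar>)"
    by (rule order_trans[OF norm_sum]) (auto simp: norm_mult)
  also have "\<dots> \<le> fnorm A * fnorm B"
    unfolding fnorm_def assms by (rule L2_set_mult_ineq)
  finally show ?thesis .
qed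

lemma fnorm_adjoint [simp]: "fnorm (A\<^sup>\<dagger>) = fnorm A"
proof -
  have "(fnorm (A\<^sup>\<dagger>))\<^sup>2 = (fnorm A)\<^sup>2"
    unfolding fnorm_sq by (subst sum.swap) simp
  then show ?thesis by (simp add: power2_eq_iff_nonneg)
qed

lemma fnorm_eq_0:
  assumes "fnorm A = 0" shows "A = 0\<^sub>m (dim_row A) (dim_col A)"
  by (rule eq_matI) (use assms in \<open>auto simp: fnorm_def L2_set_eq_0_iff\<close>)

lemma fnorm_zero [simp]: "fnorm (0\<^sub>m m n) = 0"
  unfolding fnorm_def by (auto simp: L2_set_eq_0_iff)

text \<open>This is operator norm at most 1, tested on matrices with any number of columns. In this
  form a contraction acts directly on a Gram factor of a state.\<close>

definition contr :: "complex mat \<Rightarrow> bool" where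
  "contr W \<longleftrightarrow> (\<forall>A. dim_row A = dim_col W \<longrightarrow> fnorm (W * A) \<le> fnorm A)"

lemma contrD: "contr W \<Longrightarrow> dim_row A = dim_col W \<Longrightarrow> fnorm (W * A) \<le> fnorm A"
  by (simp add: contr_def)

text \<open>The squared norm of \<open>W\<^sup>\<dagger> * A\<close> is the inner product of
  \<open>A\<close> with \<open>W * (W\<^sup>\<dagger> * A)\<close>; Cauchy-Schwarz and contractivity
  of \<open>W\<close> bound it by \<open>fnorm A * fnorm (W\<^sup>\<dagger> * A)\<close>, and one
  factor cancels.\<close>

lemma contr_adjoint: assumes "contr W" shows "contr (W\<^sup>\<dagger>)"
  unfolding contr_def
proof (intro allI impI)
  fix A :: "complex mat" assume A: "dim_row A = dim_col (W\<^sup>\<dagger>)"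
  then have [simp]: "dim_row A = dim_row W" by simp
  have "(fnorm (W\<^sup>\<dagger> * A))\<^sup>2 = cmod (mtrace (A\<^sup>\<dagger> * (W * (W\<^sup>\<dagger> * A))))"
    using fnorm_sq_mtrace[of "W\<^sup>\<dagger> * A"] by (simp add: adjoint_mult mult_assoc_dim norm_power)
  also have "\<dots> \<le> fnorm A * fnorm (W * (W\<^sup>\<dagger> * A))"
    by (rule mtrace_Cauchy_Schwarz) auto
  also have "\<dots> \<le> fnorm A * fnorm (W\<^sup>\<dagger> * A)"
    using contrD[OF assms, of "W\<^sup>\<dagger> * A"] by (simp add: mult_left_mono)
  finally have "fnorm (W\<^sup>\<dagger> * A) * fnorm (W\<^sup>\<dagger> * A) \<le> fnorm A * fnorm (W\<^sup>\<dagger> * A)"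
    by (simp add: power2_eq_square)
  then show "fnorm (W\<^sup>\<dagger> * A) \<le> fnorm A"
    using fnorm_nonneg[of "W\<^sup>\<dagger> * A"] fnorm_nonneg[of A]
    by (cases "fnorm (W\<^sup>\<dagger> * A) = 0") (simp_all add: mult_le_cancel_right order_less_le del: fnorm_nonneg)
qed

lemma contr_mult: "contr V \<Longrightarrow> contr W \<Longrightarrow> dim_col V = dim_row W \<Longrightarrow> contr (V * W)"
  unfolding contr_def
proof (intro allI impI)
  fix A :: "complex mat"
  assume *: "\<forall>A. dim_row A = dim_col V \<longrightarrow> fnorm (V * A) \<le> fnorm A"
    "\<forall>A. dim_row A = dim_col W \<longrightarrow> fnorm (W * A) \<le> fnorm A"
    and [simp]: "dim_col V = dim_row W" and "dim_row A = dim_col (V * W)"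
  then have [simp]: "dim_row A = dim_col W" by simp
  have "fnorm (V * (W * A)) \<le> fnorm (W * A)" using *(1) by simp
  also have "\<dots> \<le> fnorm A" using *(2) by simp
  finally show "fnorm (V * W * A) \<le> fnorm A" by (simp add: mult_assoc_dim)
qed

lemma contr_right:
  assumes "contr W" "dim_col A = dim_row W" shows "fnorm (A * W) \<le> fnorm A"
proof -
  have "fnorm ((A * W)\<^sup>\<dagger>) \<le> fnorm (A\<^sup>\<dagger>)"
    using contrD[OF contr_adjoint[OF assms(1)], of "A\<^sup>\<dagger>"] assms(2) by (simp add: adjoint_mult)
  then show ?thesis by simp
qed

text \<open>Pythagoras: the mixed terms of the trace vanish since \<open>P\<close> fixes
  \<open>P * A\<close>.\<close>

lemma fnorm_projection:
  assumes [simp]: "dim_row P = n" "dim_col P = n" "dim_row A = n" and P: "P\<^sup>\<dagger> = P" "P * P = P"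
  shows "(fnorm A)\<^sup>2 = (fnorm (P * A))\<^sup>2 + (fnorm (A - P * A))\<^sup>2"
proof -
  have PP: "P * (P * A) = P * A" by (simp add: mult_assoc_dim[symmetric] P)
  have "mtrace (A\<^sup>\<dagger> * A) = mtrace ((P * A)\<^sup>\<dagger> * (P * A)) + mtrace ((A - P * A)\<^sup>\<dagger> * (A - P * A))"
    by (simp add: adjoint_minus adjoint_mult P mult_assoc_dim PP mult_minus_distrib_dim minus_mult_distrib_dim mtrace_minus)
  then show ?thesis by (simp add: fnorm_sq_Re_mtrace)
qed

lemma contr_projection:
  assumes "dim_row P = n" "dim_col P = n" "P\<^sup>\<dagger> = P" "P * P = P"
  shows "contr P"
  unfolding contr_def
proof (intro allI impI)
  fix A :: "complex mat" assume "dim_row A = dim_col P"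
  then have "(fnorm (P * A))\<^sup>2 \<le> (fnorm A)\<^sup>2"
    using fnorm_projection[of P n A] assms by simp
  then show "fnorm (P * A) \<le> fnorm A" by (rule power2_le_imp_le) simp
qed

text \<open>The hypothesis makes \<open>W\<^sup>\<dagger> * W\<close> a projection, so
  \<open>W\<close> is a partial isometry and \<open>W * A\<close> has the same norm as the projected
  \<open>A\<close>.\<close>

lemma contr_partial_isometry:
  assumes "W\<^sup>\<dagger> * W * (W\<^sup>\<dagger> * W) = W\<^sup>\<dagger> * W"
  shows "contr W"
proof -
  have P: "contr (W\<^sup>\<dagger> * W)"
    by (rule contr_projection) (use assms in \<open>auto simp: adjoint_mult\<close>)
  show ?thesis unfolding contr_def
  proof (intro allI impI)
    fix A :: "complex mat" assume [simp]: "dim_row A = dim_col W"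
    have "(W\<^sup>\<dagger> * W * A)\<^sup>\<dagger> * (W\<^sup>\<dagger> * W * A) = A\<^sup>\<dagger> * (W\<^sup>\<dagger> * W * (W\<^sup>\<dagger> * W)) * A"
      by (simp add: adjoint_mult mult_assoc_dim)
    also have "\<dots> = (W * A)\<^sup>\<dagger> * (W * A)"
      unfolding assms by (simp add: adjoint_mult mult_assoc_dim)
    finally have "(fnorm (W\<^sup>\<dagger> * W * A))\<^sup>2 = (fnorm (W * A))\<^sup>2"
      unfolding fnorm_sq_Re_mtrace by simp
    then have "fnorm (W * A) = fnorm (W\<^sup>\<dagger> * W * A)" by (simp add: power2_eq_iff_nonneg)
    then show "fnorm (W * A) \<le> fnorm A" using contrD[OF P, of A] by simp
  qed
qed

section \<open>Unitary invariance and column scaling\<close>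

lemma unitaryD:
  assumes "unitary n U"
  shows "dim_row U = n" "dim_col U = n" "U * U\<^sup>\<dagger> = 1\<^sub>m n" "U\<^sup>\<dagger> * U = 1\<^sub>m n"
  using assms unfolding unitary_def by auto

lemma unitary_adjoint: "unitary n U \<Longrightarrow> unitary n (U\<^sup>\<dagger>)"
  unfolding unitary_def by (auto intro: carrier_matI)

lemma unitary_cancel:
  assumes "unitary n U" "dim_row A = n"
  shows "U * (U\<^sup>\<dagger> * A) = A" "U\<^sup>\<dagger> * (U * A) = A"
  using unitaryD[OF assms(1)] assms(2) by (auto simp: mult_assoc_dim[symmetric])

lemma unitary_mult:
  assumes "unitary n U" "unitary n V" shows "unitary n (U * V)"
proof -
  note [simp] = unitaryD[OF assms(1)] unitaryD[OF assms(2)]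
  show ?thesis
    unfolding unitary_def
    by (simp add: adjoint_mult mult_assoc_dim unitary_cancel[OF assms(1)] unitary_cancel[OF assms(2)] carrier_matI)
qed

lemma fnorm_unitary_mult:
  assumes "unitary n U" "dim_row A = n"
  shows "fnorm (U * A) = fnorm A"
proof -
  have "(fnorm (U * A))\<^sup>2 = (fnorm A)\<^sup>2"
    unfolding fnorm_sq_Re_mtrace
    by (simp add: adjoint_mult mult_assoc_dim unitaryD[OF assms(1)] assms(2) unitary_cancel[OF assms])
  then show ?thesis by (simp add: power2_eq_iff_nonneg)
qed

lemma fnorm_mult_unitary:
  assumes "unitary n U" "dim_col A = n"
  shows "fnorm (A * U) = fnorm A"
proof -
  have "fnorm ((A * U)\<^sup>\<dagger>) = fnorm (A\<^sup>\<dagger>)"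
    using fnorm_unitary_mult[OF unitary_adjoint[OF assms(1)], of "A\<^sup>\<dagger>"] assms unitaryD[OF assms(1)]
    by (simp add: adjoint_mult)
  then show ?thesis by simp
qed

lemma fnorm_mult_diag_sq:
  assumes "dim_col A = n"
  shows "(fnorm (A * mat_diag n f))\<^sup>2 = (\<Sum>j<n. (cmod (f j))\<^sup>2 * (\<Sum>i<dim_row A. (cmod (A $$ (i,j)))\<^sup>2))"
  unfolding fnorm_sq using assms
  by (subst sum.swap) (simp add: mult_mat_diag_index norm_mult power_mult_distrib sum_distrib_left mult.commute)

lemma fnorm_mult_diag_le:
  assumes "dim_col A = n" "\<And>j. j < n \<Longrightarrow> (cmod (f j))\<^sup>2 \<le> l"
  shows "(fnorm (A * mat_diag n f))\<^sup>2 \<le> l * (fnorm A)\<^sup>2"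
proof -
  have "(fnorm (A * mat_diag n f))\<^sup>2 \<le> (\<Sum>j<n. l * (\<Sum>i<dim_row A. (cmod (A $$ (i,j)))\<^sup>2))"
    unfolding fnorm_mult_diag_sq[OF assms(1)]
    by (intro sum_mono mult_right_mono assms(2)) (auto intro: sum_nonneg)
  also have "\<dots> = l * (fnorm A)\<^sup>2"
    unfolding fnorm_sq using assms(1) by (subst sum.swap) (simp add: sum_distrib_left)
  finally show ?thesis .
qed

section \<open>Spectral theorem and functional calculus\<close>

lemma cinner_mult_mat_vec:
  assumes "dim_vec v = dim_row A" "dim_vec w = dim_col A"
  shows "cinner v (A *\<^sub>v w) = (\<Sum>i<dim_row A. \<Sum>j<dim_col A. cnj (v $ i) * A $$ (i,j) * w $ j)"
  using assms unfolding cinner_def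
  by (auto simp: scalar_prod_def atLeast0LessThan sum_distrib_left mult.assoc)

lemma hermitianD: "hermitian n A \<Longrightarrow> dim_row A = n" "hermitian n A \<Longrightarrow> dim_col A = n"
  "hermitian n A \<Longrightarrow> A\<^sup>\<dagger> = A"
  unfolding hermitian_def by auto

text \<open>Householder reflection: reflecting along the difference \<open>w\<close> of the unit
  vector \<open>u\<close> and the first basis vector exchanges these two, provided that their inner
  product is real; so \<open>u\<close> becomes the first column.\<close>

lemma unitary_householder:
  assumes n: "n > 0" and v: "(\<Sum>i<n. (cmod (v i))\<^sup>2) = 1"
  shows "\<exists>W t. unitary n W \<and> (\<forall>i<n. W $$ (i,0) = t * v i)"
proof -
  \<comment> \<open>The phase makes the first coordinate of \<open>u\<close> real and nonnegative,
    as the reflection requires.\<close>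
  define t where "t = (if v 0 = 0 then 1 else cnj (v 0) / cmod (v 0))"
  define u where "u i = t * v i" for i
  define w where "w i = u i - (if i = 0 then 1 else 0)" for i :: nat
  define s where "s = (\<Sum>i<n. (cmod (w i))\<^sup>2)"
  \<comment> \<open>If \<open>u\<close> already is the first basis vector then \<open>s = 0\<close>;
    division by zero gives \<open>c = 0\<close>, and \<open>W\<close> is the identity, as
    desired.\<close>
  define c where "c = 2 / s"
  have t1: "cmod t = 1" by (auto simp: t_def norm_divide)
  have u0: "u 0 = complex_of_real (cmod (v 0))"
    by (auto simp: u_def t_def complex_norm_square[symmetric] mult.commute power2_eq_square)
  have un: "(\<Sum>i<n. (cmod (u i))\<^sup>2) = 1"
    using v by (simp add: u_def norm_mult t1)
  obtain m where m: "n = Suc m" using n by (cases n) auto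
  have s: "s = 2 - 2 * cmod (v 0)"
  proof -
    have a: "(cmod (w 0))\<^sup>2 = (cmod (u 0))\<^sup>2 + 1 - 2 * cmod (v 0)"
    proof -
      have "w 0 = complex_of_real (cmod (v 0) - 1)" by (simp add: w_def u0)
      then have "(cmod (w 0))\<^sup>2 = (cmod (v 0) - 1)\<^sup>2" by (metis norm_of_real power2_abs)
      then show ?thesis by (simp add: u0 power2_eq_square algebra_simps)
    qed
    have "s = (cmod (w 0))\<^sup>2 + (\<Sum>i<m. (cmod (u (Suc i)))\<^sup>2)"
      unfolding s_def m by (subst sum.lessThan_Suc_shift) (simp add: w_def)
    moreover have "1 = (cmod (u 0))\<^sup>2 + (\<Sum>i<m. (cmod (u (Suc i)))\<^sup>2)"
      using un unfolding m by (subst (asm) sum.lessThan_Suc_shift) simp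
    ultimately show ?thesis using a by simp
  qed
  have w0: "cnj (w 0) = - complex_of_real (s / 2)"
    unfolding w_def u0 s by (simp add: field_simps)
  have w_zero: "w i = 0" if "s = 0" "i < n" for i
    using that unfolding s_def by (subst (asm) sum_nonneg_eq_0_iff) auto
  define W where "W = mat n n (\<lambda>(i,j). (if i = j then 1 else 0) - complex_of_real c * w i * cnj (w j))"
  have Wadj: "W\<^sup>\<dagger> = W" by (rule eq_matI) (auto simp: W_def)
  have ws: "(\<Sum>k<n. cnj (w k) * w k) = complex_of_real s"
    unfolding s_def by (simp add: complex_norm_square mult.commute del: of_real_power)
  have WW: "W * W = 1\<^sub>m n"
  proof (rule eq_matI)
    fix i j assume ij: "i < dim_row (1\<^sub>m n :: complex mat)" "j < dim_col (1\<^sub>m n :: complex mat)"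
    have "(W * W) $$ (i,j) = (\<Sum>k<n. ((if i = k then 1 else 0) - c * w i * cnj (w k)) * ((if k = j then 1 else 0) - c * w k * cnj (w j)))"
      using ij by (simp add: W_def mult_index)
    also have "\<dots> = (\<Sum>k<n. if k = i then (if k = j then 1 else 0) - c * w k * cnj (w j) else 0)
        - (\<Sum>k<n. if k = j then c * w i * cnj (w k) else 0) + c * c * w i * cnj (w j) * (\<Sum>k<n. cnj (w k) * w k)"
      unfolding sum_distrib_left sum_subtractf[symmetric] sum.distrib[symmetric]
      by (intro sum.cong) (auto simp: algebra_simps)
    also have "\<dots> = (if i = j then 1 else 0) - 2 * c * w i * cnj (w j) + c * c * s * w i * cnj (w j)"
      using ij unfolding ws by (auto simp: algebra_simps)
    also have "c * c * s = 2 * c" by (simp add: c_def)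
    finally show "(W * W) $$ (i,j) = 1\<^sub>m n $$ (i,j)"
      using ij by (simp flip: of_real_mult)
  qed (auto simp: W_def)
  have "W $$ (i,0) = t * v i" if "i < n" for i
  proof -
    have "W $$ (i,0) = (if i = 0 then 1 else 0) + complex_of_real (c * s / 2) * w i"
      using that n by (simp add: W_def w0)
    also have "complex_of_real (c * s / 2) * w i = w i"
      using w_zero[OF _ that] by (cases "s = 0") (auto simp: c_def)
    finally show ?thesis by (simp add: w_def u_def)
  qed
  moreover have "unitary n W" unfolding unitary_def by (auto simp: Wadj WW) (auto simp: W_def)
  ultimately show ?thesis by blast
qed

lemma normalized_eigenvector:
  assumes A: "A \<in> carrier_mat n n" and n: "n > 0"
  shows "\<exists>v e. (\<Sum>i<n. (cmod (v i))\<^sup>2) = 1 \<and> (\<forall>i<n. (\<Sum>j<n. A $$ (i,j) * v j) = e * v i)"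
proof -
  obtain e where "eigenvalue A e"
    using spectrum_non_empty[OF A n] by (auto simp: spectrum_def)
  then obtain x where x: "x \<in> carrier_vec n" "x \<noteq> 0\<^sub>v n" "A *\<^sub>v x = e \<cdot>\<^sub>v x"
    using A by (auto simp: eigenvalue_def eigenvector_def)
  define s where "s = (\<Sum>i<n. (cmod (x $ i))\<^sup>2)"
  have "s \<noteq> 0"
  proof
    assume "s = 0"
    then have "x $ i = 0" if "i < n" for i
      using that unfolding s_def by (subst (asm) sum_nonneg_eq_0_iff) auto
    then have "x = 0\<^sub>v n" using x(1) by (intro eq_vecI) auto
    then show False using x(2) by simp
  qed
  then have s: "s > 0" unfolding s_def by (simp add: order_less_le sum_nonneg)
  define v where "v i = x $ i / complex_of_real (sqrt s)" for i
  have "(\<Sum>i<n. (cmod (v i))\<^sup>2) = s / s"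
    unfolding v_def s_def[symmetric] using s
    by (simp add: norm_divide power_divide sum_divide_distrib[symmetric] s_def[symmetric])
  moreover have "(\<Sum>j<n. A $$ (i,j) * v j) = e * v i" if "i < n" for i
  proof -
    have "(\<Sum>j<n. A $$ (i,j) * x $ j) = e * x $ i"
      using arg_cong[OF x(3), of "\<lambda>y. y $ i"] that A x(1)
      by (auto simp: scalar_prod_def atLeast0LessThan)
    then show ?thesis unfolding v_def by (simp add: sum_divide_distrib[symmetric])
  qed
  ultimately show ?thesis using s by force
qed

text \<open>Deflation: a Householder unitary has a unit eigenvector as its first column, up to a
  phase. In that basis hermiticity clears the first row along with the first column, and the
  remaining block falls to the induction hypothesis.\<close>

theorem spectral_theorem:
  assumes "hermitian n A"
  shows "\<exists>U d. spec_decomp A U d"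
  using assms
proof (induction n arbitrary: A)
  case 0
  then show ?case
    by (intro exI[of _ "1\<^sub>m 0"]) (auto simp: spec_decomp_def unitary_def hermitian_def intro!: eq_matI)
next
  case (Suc n)
  note [simp] = hermitianD(1,2)[OF Suc.prems]
  obtain v e where v: "(\<Sum>i<Suc n. (cmod (v i))\<^sup>2) = 1"
    and ev: "\<And>i. i < Suc n \<Longrightarrow> (\<Sum>j<Suc n. A $$ (i,j) * v j) = e * v i"
    using normalized_eigenvector[of A "Suc n"] Suc.prems by (auto simp: hermitian_def)
  obtain W t where W: "unitary (Suc n) W" and Wv: "\<And>i. i < Suc n \<Longrightarrow> W $$ (i,0) = t * v i"
    using unitary_householder[of "Suc n" v] v by auto
  note [simp] = unitaryD(1,2)[OF W]
  define B where "B = W\<^sup>\<dagger> * (A * W)"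
  have [simp]: "dim_row B = Suc n" "dim_col B = Suc n" by (simp_all add: B_def)
  have Badj: "B\<^sup>\<dagger> = B"
    unfolding B_def using hermitianD(3)[OF Suc.prems] by (simp add: adjoint_mult mult_assoc_dim)
  have B0: "B $$ (i,0) = (if i = 0 then e else 0)" if "i < Suc n" for i
  proof -
    have "(A * W) $$ (k,0) = e * W $$ (k,0)" if "k < Suc n" for k
    proof -
      have "(A * W) $$ (k,0) = t * (\<Sum>j<Suc n. A $$ (k,j) * v j)"
        using that by (simp add: mult_index Wv sum_distrib_left algebra_simps del: sum.lessThan_Suc)
      then show ?thesis using ev[OF that] Wv[OF that] by simp
    qed
    then have "B $$ (i,0) = e * (W\<^sup>\<dagger> * W) $$ (i,0)"
      using that unfolding B_def by (simp add: mult_index[of i] sum_distrib_left algebra_simps del: sum.lessThan_Suc)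
    then show ?thesis using unitaryD(4)[OF W] that by simp
  qed
  have Bsym: "B $$ (i,j) = cnj (B $$ (j,i))" if "i < Suc n" "j < Suc n" for i j
    using arg_cong[OF Badj, of "\<lambda>M. M $$ (i,j)"] that by simp
  have e_real: "e = complex_of_real (Re e)"
    using Bsym[of 0 0] B0[of 0] by (simp add: complex_eq_iff)
  define A' where "A' = mat n n (\<lambda>(i,j). B $$ (Suc i, Suc j))"
  have "hermitian n A'" unfolding hermitian_def
    by (auto simp: A'_def intro!: eq_matI) (metis Bsym Suc_mono complex_cnj_cnj)
  from Suc.IH[OF this] obtain U' d' where sd: "spec_decomp A' U' d'" by blast
  have [simp]: "dim_row A' = n" by (simp add: A'_def)
  have U': "unitary n U'" and A'eq: "A' = U' * mat_diag n (\<lambda>i. complex_of_real (d' i)) * U'\<^sup>\<dagger>"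
    using sd unfolding spec_decomp_def by auto
  note [simp] = unitaryD(1,2)[OF U']
  \<comment> \<open>The direct sum of the scalar 1 and \<open>U'\<close> extends the inductive
    eigenbasis without touching the eigenvector already split off.\<close>
  define V where "V = mat (Suc n) (Suc n) (\<lambda>(i,j). if i = 0 \<or> j = 0 then (if i = j then 1 else 0) else U' $$ (i-1,j-1))"
  define d where "d i = (if i = 0 then Re e else d' (i-1))" for i
  have [simp]: "dim_row V = Suc n" "dim_col V = Suc n" by (simp_all add: V_def)
  have V0: "V $$ (0,0) = 1" "\<And>i. i < n \<Longrightarrow> V $$ (0,Suc i) = 0" "\<And>i. i < n \<Longrightarrow> V $$ (Suc i,0) = 0"
    "\<And>i j. i < n \<Longrightarrow> j < n \<Longrightarrow> V $$ (Suc i,Suc j) = U' $$ (i,j)"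
    by (auto simp: V_def)
  have U'U': "(\<Sum>k<n. U' $$ (i,k) * cnj (U' $$ (j,k))) = (if i = j then 1 else 0)"
     "(\<Sum>k<n. cnj (U' $$ (k,i)) * U' $$ (k,j)) = (if i = j then 1 else 0)" if "i < n" "j < n" for i j
    using arg_cong[OF unitaryD(3)[OF U'], of "\<lambda>M. M $$ (i,j)"] arg_cong[OF unitaryD(4)[OF U'], of "\<lambda>M. M $$ (i,j)"] that
    by (simp_all add: mult_index)
  have V: "unitary (Suc n) V" unfolding unitary_def
  proof (intro conjI eq_matI)
    fix i j assume "i < dim_row (1\<^sub>m (Suc n) :: complex mat)" "j < dim_col (1\<^sub>m (Suc n) :: complex mat)"
    then show "(V * V\<^sup>\<dagger>) $$ (i,j) = 1\<^sub>m (Suc n) $$ (i,j)" "(V\<^sup>\<dagger> * V) $$ (i,j) = 1\<^sub>m (Suc n) $$ (i,j)"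
      by (cases i; cases j; simp add: mult_index sum.lessThan_Suc_shift V0 U'U' del: sum.lessThan_Suc)+
  qed (auto intro: carrier_matI)
  have A'sum: "B $$ (Suc i, Suc j) = (\<Sum>k<n. U' $$ (i,k) * complex_of_real (d' k) * cnj (U' $$ (j,k)))"
    if "i < n" "j < n" for i j
    using arg_cong[OF A'eq, of "\<lambda>M. M $$ (i,j)"] that by (simp add: conj_diag_index A'_def)
  have Beq: "B = V * mat_diag (Suc n) (\<lambda>i. complex_of_real (d i)) * V\<^sup>\<dagger>"
  proof (rule eq_matI)
    fix i j assume ij: "i < dim_row (V * mat_diag (Suc n) (\<lambda>i. complex_of_real (d i)) * V\<^sup>\<dagger>)"
      "j < dim_col (V * mat_diag (Suc n) (\<lambda>i. complex_of_real (d i)) * V\<^sup>\<dagger>)"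
    have B0': "B $$ (0,Suc j) = 0" if "j < n" for j using Bsym[of 0 "Suc j"] B0[of "Suc j"] that by simp
    show "B $$ (i,j) = (V * mat_diag (Suc n) (\<lambda>i. complex_of_real (d i)) * V\<^sup>\<dagger>) $$ (i,j)"
      using ij e_real by (cases i; cases j; simp add: conj_diag_index sum.lessThan_Suc_shift V0 B0 B0' A'sum d_def del: sum.lessThan_Suc)
  qed auto
  have "A = W * (B * W\<^sup>\<dagger>)"
    unfolding B_def using unitary_cancel[OF W] by (simp add: mult_assoc_dim unitaryD[OF W])
  also have "\<dots> = (W * V) * mat_diag (Suc n) (\<lambda>i. complex_of_real (d i)) * (W * V)\<^sup>\<dagger>"
    unfolding Beq by (simp add: adjoint_mult mult_assoc_dim)
  finally have "spec_decomp A (W * V) d"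
    unfolding spec_decomp_def using unitary_mult[OF W V] by simp
  then show ?case by blast
qed

section \<open>Functional calculus and its independence of the decomposition\<close>

lemma spec_decompD:
  assumes "spec_decomp A U d" "dim_row A = n"
  shows "unitary n U" "A = U * mat_diag n (\<lambda>i. complex_of_real (d i)) * U\<^sup>\<dagger>" "hermitian n A"
proof -
  show U: "unitary n U" and A: "A = U * mat_diag n (\<lambda>i. complex_of_real (d i)) * U\<^sup>\<dagger>"
    using assms by (auto simp: spec_decomp_def)
  note [simp] = unitaryD(1,2)[OF U]
  show "hermitian n A"
    unfolding hermitian_def by (subst (1 2 3) A) (auto simp: adjoint_mult mult_assoc_dim intro!: carrier_matI)
qed

text \<open>The entry \<open>M i j\<close> of \<open>M = U\<^sup>\<dagger> B V\<close> vanishes unless the \<open>i\<close>-th and \<open>j\<close>-th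
  eigenvalues of the two decompositions agree.\<close>
lemma functional_calculus_commute:
  fixes B U V :: "complex mat" and d e :: "nat \<Rightarrow> real"
  assumes U: "unitary m U" and V: "unitary n V" and B [simp]: "dim_row B = m" "dim_col B = n"
    and eq: "U * mat_diag m (\<lambda>i. complex_of_real (d i)) * U\<^sup>\<dagger> * B = B * (V * mat_diag n (\<lambda>i. complex_of_real (e i)) * V\<^sup>\<dagger>)"
  shows "U * mat_diag m (\<lambda>i. complex_of_real (f (d i))) * U\<^sup>\<dagger> * B = B * (V * mat_diag n (\<lambda>i. complex_of_real (f (e i))) * V\<^sup>\<dagger>)"
proof -
  note [simp] = unitaryD(1,2)[OF U] unitaryD(1,2)[OF V]
  define M where "M = U\<^sup>\<dagger> * (B * V)"
  have [simp]: "dim_row M = m" "dim_col M = n" by (simp_all add: M_def)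
  have UM: "U * M = B * V" unfolding M_def using unitary_cancel[OF U] by simp
  have MV: "M * V\<^sup>\<dagger> = U\<^sup>\<dagger> * B" unfolding M_def by (simp add: mult_assoc_dim unitaryD[OF V])
  have key: "mat_diag m (\<lambda>i. complex_of_real (d i)) * M = M * mat_diag n (\<lambda>i. complex_of_real (e i))"
  proof -
    have "mat_diag m (\<lambda>i. complex_of_real (d i)) * M = U\<^sup>\<dagger> * (U * mat_diag m (\<lambda>i. complex_of_real (d i)) * U\<^sup>\<dagger> * B) * V"
      unfolding M_def by (simp add: mult_assoc_dim unitary_cancel[OF U])
    also have "\<dots> = M * mat_diag n (\<lambda>i. complex_of_real (e i))"
      unfolding eq M_def by (simp add: mult_assoc_dim unitaryD(4)[OF V])
    finally show ?thesis .
  qed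
  have "mat_diag m (\<lambda>i. complex_of_real (f (d i))) * M = M * mat_diag n (\<lambda>i. complex_of_real (f (e i)))"
  proof (rule eq_matI)
    fix i j assume "i < dim_row (M * mat_diag n (\<lambda>i. complex_of_real (f (e i))))"
      "j < dim_col (M * mat_diag n (\<lambda>i. complex_of_real (f (e i))))"
    then have ij: "i < m" "j < n" by auto
    have "complex_of_real (d i) * M $$ (i,j) = M $$ (i,j) * complex_of_real (e j)"
      using arg_cong[OF key, of "\<lambda>X. X $$ (i,j)"] ij by (simp add: mult_mat_diag_index mat_diag_mult_index)
    then have "M $$ (i,j) = 0 \<or> d i = e j" by (auto simp: mult.commute)
    then show "(mat_diag m (\<lambda>i. complex_of_real (f (d i))) * M) $$ (i,j) = (M * mat_diag n (\<lambda>i. complex_of_real (f (e i)))) $$ (i,j)"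
      using ij by (auto simp: mult_mat_diag_index mat_diag_mult_index mult.commute)
  qed auto
  then have "U * (mat_diag m (\<lambda>i. complex_of_real (f (d i))) * M) * V\<^sup>\<dagger> = U * (M * mat_diag n (\<lambda>i. complex_of_real (f (e i)))) * V\<^sup>\<dagger>"
    by simp
  then show ?thesis
    by (simp add: mult_assoc_dim MV) (simp add: mult_assoc_dim[symmetric] UM)
qed

text \<open>\<open>mfun\<close> selects by \<open>SOME\<close> among all decompositions. Two
  decompositions of the same matrix are intertwined by the identity, so the commutation lemma with
  \<open>B\<close> the identity shows that all of them give the same value.\<close>

lemma mfun_spec_decomp:
  assumes sd: "spec_decomp A U d"
  shows "mfun f A = U * mat_diag (dim_row A) (\<lambda>i. complex_of_real (f (d i))) * U\<^sup>\<dagger>"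
proof -
  define n where "n = dim_row A"
  note U = spec_decompD[OF sd n_def[symmetric]]
  have "B = U * mat_diag n (\<lambda>i. complex_of_real (f (d i))) * U\<^sup>\<dagger>"
    if "spec_decomp A V e" and B: "B = V * mat_diag n (\<lambda>i. complex_of_real (f (e i))) * V\<^sup>\<dagger>" for B V e
  proof -
    note V = spec_decompD[OF that(1) n_def[symmetric]]
    note [simp] = unitaryD(1,2)[OF U(1)] unitaryD(1,2)[OF V(1)]
    have "U * mat_diag n (\<lambda>i. complex_of_real (f (d i))) * U\<^sup>\<dagger> * 1\<^sub>m n = 1\<^sub>m n * (V * mat_diag n (\<lambda>i. complex_of_real (f (e i))) * V\<^sup>\<dagger>)"
      by (rule functional_calculus_commute[OF U(1) V(1)]) (use U(2) V(2) in auto)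
    then show ?thesis using B by simp
  qed
  then show ?thesis unfolding mfun_def n_def[symmetric]
    by (intro some_equality) (use sd in blast)+
qed

lemma mtrace_unitary_conj:
  assumes "unitary n U" "dim_row A = n" "dim_col A = n"
  shows "mtrace (U * A * U\<^sup>\<dagger>) = mtrace A"
  using unitaryD[OF assms(1)] assms(2,3) unitary_cancel[OF assms(1)]
  by (subst mtrace_cyclic) (auto simp: mult_assoc_dim[symmetric])

text \<open>The candidates for the \<open>SOME\<close> agree because each of them is the trace of
  \<open>mfun eta A\<close>.\<close>

lemma vN_entropy_spec_decomp:
  assumes sd: "spec_decomp A U d"
  shows "vN_entropy A = (\<Sum>i<dim_row A. eta (d i))"
proof -
  have "mtrace (mfun eta A) = complex_of_real (\<Sum>i<dim_row A. eta (e i))" if "spec_decomp A V e" for V e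
    unfolding mfun_spec_decomp[OF that] using spec_decompD(1)[OF that refl]
    by (subst mtrace_unitary_conj[where n = "dim_row A"]) (auto simp: mtrace_mat_diag)
  then have "(\<Sum>i<dim_row A. eta (e i)) = Re (mtrace (mfun eta A))" if "spec_decomp A V e" for V e
    using that by fastforce
  then show ?thesis unfolding vN_entropy_def using sd
    by (intro some_equality) metis+
qed

section \<open>Positive matrices, fidelity and entropy\<close>

lemma diag_conj_mult:
  assumes "unitary n U"
  shows "(U * mat_diag n f * U\<^sup>\<dagger>) * (U * mat_diag n g * U\<^sup>\<dagger>) = U * mat_diag n (\<lambda>i. f i * g i) * U\<^sup>\<dagger>"
proof -
  note [simp] = unitaryD(1,2)[OF assms]
  have "mat_diag n f * (mat_diag n g * U\<^sup>\<dagger>) = mat_diag n (\<lambda>i. f i * g i) * U\<^sup>\<dagger>"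
    by (subst mult_assoc_dim[symmetric]) auto
  then show ?thesis
    by (simp add: mult_assoc_dim unitary_cancel[OF assms])
qed

lemma diag_conj_adjoint:
  assumes "unitary n U"
  shows "(U * mat_diag n f * U\<^sup>\<dagger>)\<^sup>\<dagger> = U * mat_diag n (\<lambda>i. cnj (f i)) * U\<^sup>\<dagger>"
  using unitaryD[OF assms] by (simp add: adjoint_mult mult_assoc_dim)

text \<open>A vector as a one-column matrix turns \<open>cinner\<close> into the trace of a matrix
  product, so that the Frobenius calculus covers quadratic forms too.\<close>

definition col_mat :: "complex vec \<Rightarrow> complex mat" where
  "col_mat v = mat (dim_vec v) 1 (\<lambda>(i,_). v $ i)"

lemma col_mat_simps [simp]: "dim_row (col_mat v) = dim_vec v" "dim_col (col_mat v) = 1"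
  "i < dim_vec v \<Longrightarrow> col_mat v $$ (i,0) = v $ i"
  by (auto simp: col_mat_def)

lemma cinner_eq_mtrace:
  assumes "dim_vec v = dim_row A" "dim_vec w = dim_col A"
  shows "cinner v (A *\<^sub>v w) = mtrace ((col_mat v)\<^sup>\<dagger> * (A * col_mat w))"
  using assms by (subst cinner_mult_mat_vec) (auto simp: mtrace_mult mult_index sum_distrib_left mult.assoc)

section \<open>Gram matrices and square roots of positive matrices\<close>

lemma psd_gram:
  assumes "dim_col B = n" shows "psd n (B\<^sup>\<dagger> * B)"
proof -
  have "cinner v (B\<^sup>\<dagger> * B *\<^sub>v v) = complex_of_real ((fnorm (B * col_mat v))\<^sup>2)" if "dim_vec v = n" for v
    using assms that by (subst cinner_eq_mtrace) (auto simp: fnorm_sq_mtrace[symmetric] adjoint_mult mult_assoc_dim simp del: of_real_power)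
  then show ?thesis
    using assms unfolding psd_def hermitian_def by (auto simp: adjoint_mult intro!: carrier_matI)
qed

lemma psd_gram': "dim_row B = n \<Longrightarrow> psd n (B * B\<^sup>\<dagger>)"
  using psd_gram[of "B\<^sup>\<dagger>" n] by simp

lemma psdD: "psd n A \<Longrightarrow> dim_row A = n" "psd n A \<Longrightarrow> dim_col A = n"
  "psd n A \<Longrightarrow> A\<^sup>\<dagger> = A" "psd n A \<Longrightarrow> hermitian n A"
  unfolding psd_def hermitian_def by auto

text \<open>The eigenvalue \<open>d i\<close> is the quadratic form of \<open>A\<close> at column
  \<open>i\<close> of \<open>U\<close>.\<close>

lemma psd_spec_decomp_nonneg:
  assumes A: "psd n A" and sd: "spec_decomp A U d" and i: "i < n"
  shows "0 \<le> d i"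
proof -
  note [simp] = psdD(1,2)[OF A]
  note U = spec_decompD[OF sd psdD(1)[OF A]]
  note [simp] = unitaryD(1,2)[OF U(1)]
  have "U\<^sup>\<dagger> * (A * U) = mat_diag n (\<lambda>i. complex_of_real (d i))"
    by (subst U(2)) (simp add: mult_assoc_dim unitary_cancel[OF U(1)] unitaryD(4)[OF U(1)])
  then have "(U\<^sup>\<dagger> * (A * U)) $$ (i,i) = complex_of_real (d i)" using i by simp
  moreover have "(U\<^sup>\<dagger> * (A * U)) $$ (i,i) = cinner (col U i) (A *\<^sub>v col U i)"
  proof -
    have "cinner (col U i) (A *\<^sub>v col U i) = (\<Sum>a<n. \<Sum>b<n. cnj (U $$ (a,i)) * A $$ (a,b) * U $$ (b,i))"
      using i by (simp add: cinner_mult_mat_vec)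
    also have "\<dots> = (U\<^sup>\<dagger> * (A * U)) $$ (i,i)"
      using i by (simp add: mult_index sum_distrib_left mult.assoc)
    finally show ?thesis by simp
  qed
  ultimately have di: "complex_of_real (d i) = cinner (col U i) (A *\<^sub>v col U i)" by (rule trans[OF sym])
  have "0 \<le> Re (cinner (col U i) (A *\<^sub>v col U i))"
  proof -
    have "col U i \<in> carrier_vec n" by (rule carrier_vecI) (simp add: unitaryD(1)[OF U(1)])
    then show ?thesis using A psd_def by blast
  qed
  then show ?thesis unfolding di[symmetric] by simp
qed

lemma psd_spectral:
  assumes "psd n A"
  obtains U d where "spec_decomp A U d" "unitary n U" "A = U * mat_diag n (\<lambda>i. complex_of_real (d i)) * U\<^sup>\<dagger>"
    "\<And>i. i < n \<Longrightarrow> 0 \<le> d i"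
  using spectral_theorem[OF psdD(4)[OF assms]] spec_decompD psdD(1)[OF assms] psd_spec_decomp_nonneg[OF assms]
  by metis

lemma psd_diag_conj:
  assumes U: "unitary n U" and d: "\<And>i. i < n \<Longrightarrow> 0 \<le> d i"
  shows "psd n (U * mat_diag n (\<lambda>i. complex_of_real (d i)) * U\<^sup>\<dagger>)"
proof -
  note [simp] = unitaryD(1,2)[OF U]
  let ?B = "U * mat_diag n (\<lambda>i. complex_of_real (sqrt (d i))) * U\<^sup>\<dagger>"
  have "?B\<^sup>\<dagger> * ?B = U * mat_diag n (\<lambda>i. complex_of_real (sqrt (d i)) * complex_of_real (sqrt (d i))) * U\<^sup>\<dagger>"
    by (simp add: diag_conj_adjoint[OF U] diag_conj_mult[OF U])
  also have "mat_diag n (\<lambda>i. complex_of_real (sqrt (d i)) * complex_of_real (sqrt (d i))) = mat_diag n (\<lambda>i. complex_of_real (d i))"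
    by (rule eq_matI) (use d in \<open>auto simp flip: of_real_mult\<close>)
  finally show ?thesis using psd_gram[of ?B n] by simp
qed

lemma psd_sqrt:
  assumes A: "psd n A"
  shows "psd n (mfun sqrt A)" "mfun sqrt A * mfun sqrt A = A"
proof -
  obtain U d where U: "spec_decomp A U d" "unitary n U" "A = U * mat_diag n (\<lambda>i. complex_of_real (d i)) * U\<^sup>\<dagger>"
    and d: "\<And>i. i < n \<Longrightarrow> 0 \<le> d i" using psd_spectral[OF A] by blast
  have S: "mfun sqrt A = U * mat_diag n (\<lambda>i. complex_of_real (sqrt (d i))) * U\<^sup>\<dagger>"
    using mfun_spec_decomp[OF U(1)] psdD(1)[OF A] by simp
  show "psd n (mfun sqrt A)" unfolding S by (rule psd_diag_conj[OF U(2)]) (simp add: d)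
  have "mat_diag n (\<lambda>i. complex_of_real (sqrt (d i)) * complex_of_real (sqrt (d i))) = mat_diag n (\<lambda>i. complex_of_real (d i))"
    by (rule eq_matI) (use d in \<open>auto simp flip: of_real_mult\<close>)
  then show "mfun sqrt A * mfun sqrt A = A"
    unfolding S diag_conj_mult[OF U(2)] using U(3) by simp
qed

lemma psd_mtrace:
  assumes A: "psd n A"
  shows "mtrace A = complex_of_real ((fnorm (mfun sqrt A))\<^sup>2)"
  unfolding fnorm_sq_mtrace[symmetric] using psdD[OF psd_sqrt(1)[OF A]] psd_sqrt(2)[OF A] by simp

text \<open>Splitting \<open>R\<close> into two copies of its square root \<open>S\<close> makes the
  trace an inner product of \<open>S\<close> with \<open>C * S\<close>; Cauchy-Schwarz leaves the
  squared norm of \<open>S\<close>, which is the trace of \<open>R\<close>.\<close>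

lemma mtrace_contr_psd:
  assumes R: "psd n R" and C: "contr C" "dim_row C = n" "dim_col C = n"
  shows "cmod (mtrace (C * R)) \<le> Re (mtrace R)"
proof -
  define S where "S = mfun sqrt R"
  note S = psd_sqrt[OF R, folded S_def]
  note [simp] = psdD(1-3)[OF S(1)] C(2,3)
  have "mtrace (C * R) = mtrace (C * S * S)" using S(2) by (simp add: mult_assoc_dim)
  also have "\<dots> = mtrace (S * (C * S))" by (subst mtrace_cyclic) auto
  also have "\<dots> = mtrace (S\<^sup>\<dagger> * (C * S))" by simp
  finally have "cmod (mtrace (C * R)) \<le> fnorm S * fnorm (C * S)"
    using mtrace_Cauchy_Schwarz[of S "C * S"] by simp
  also have "\<dots> \<le> fnorm S * fnorm S" by (intro mult_left_mono contrD[OF C(1)]) auto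
  finally show ?thesis unfolding psd_mtrace[OF R] S_def by (simp add: power2_eq_square)
qed

text \<open>With \<open>G\<close> the pseudo-inverse of the common Gram matrix,
  \<open>R\<^sup>\<dagger> * (G * X)\<close> is a partial isometry that does the job. It is the
  polar decomposition when one factor is a square root, and the freedom of purification in
  general.\<close>

lemma gram_factor:
  assumes X [simp]: "dim_row X = n" and R [simp]: "dim_row R = n" and eq: "X * X\<^sup>\<dagger> = R * R\<^sup>\<dagger>"
  shows "\<exists>W. dim_row W = dim_col R \<and> dim_col W = dim_col X \<and> contr W \<and> X = R * W"
proof -
  obtain U d where sd: "spec_decomp (X * X\<^sup>\<dagger>) U d" and U: "unitary n U"
    and A: "X * X\<^sup>\<dagger> = U * mat_diag n (\<lambda>i. complex_of_real (d i)) * U\<^sup>\<dagger>"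
    using psd_spectral[OF psd_gram'[OF X]] by blast
  note [simp] = unitaryD(1,2)[OF U]
  \<comment> \<open>Since \<open>1 / 0 = 0\<close> and \<open>0 / 0 = 0\<close>, \<open>G\<close>
    inverts only the nonzero eigenvalues and \<open>P\<close> is the projector onto the support of
    \<open>X * X\<^sup>\<dagger>\<close>.\<close>
  define G where "G = U * mat_diag n (\<lambda>i. complex_of_real (1 / d i)) * U\<^sup>\<dagger>"
  define P where "P = U * mat_diag n (\<lambda>i. complex_of_real (d i / d i)) * U\<^sup>\<dagger>"
  have [simp]: "dim_row G = n" "dim_col G = n" "dim_row P = n" "dim_col P = n"
    by (simp_all add: G_def P_def)
  have G: "G\<^sup>\<dagger> = G" unfolding G_def diag_conj_adjoint[OF U] by simp
  have Padj: "P\<^sup>\<dagger> = P" unfolding P_def diag_conj_adjoint[OF U] by simp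
  have AG: "X * X\<^sup>\<dagger> * G = P" unfolding A G_def P_def diag_conj_mult[OF U]
    by (rule arg_cong[where f = "\<lambda>D. U * D * U\<^sup>\<dagger>"]) (auto intro!: eq_matI simp flip: of_real_mult)
  have PA: "P * (X * X\<^sup>\<dagger>) = X * X\<^sup>\<dagger>" unfolding A P_def diag_conj_mult[OF U]
    by (rule arg_cong[where f = "\<lambda>D. U * D * U\<^sup>\<dagger>"]) (auto intro!: eq_matI simp flip: of_real_mult)
  have GP: "G * P = G" unfolding G_def P_def diag_conj_mult[OF U]
    by (rule arg_cong[where f = "\<lambda>D. U * D * U\<^sup>\<dagger>"]) (auto intro!: eq_matI simp flip: of_real_mult)
  \<comment> \<open>The squared norm of \<open>X - P * X\<close> is a trace involving only the Gram
    matrix, which \<open>P\<close> fixes.\<close>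
  have PX: "P * X = X"
  proof -
    have "(X - P * X) * (X - P * X)\<^sup>\<dagger> = X * X\<^sup>\<dagger> - P * (X * X\<^sup>\<dagger>) - (X * X\<^sup>\<dagger> - P * (X * X\<^sup>\<dagger>)) * P"
      by (simp add: adjoint_minus adjoint_mult Padj minus_mult_distrib_dim mult_minus_distrib_dim mult_assoc_dim)
    also have "\<dots> = 0\<^sub>m n n" unfolding PA
      by (rule eq_matI) (simp_all add: mult_index[where A = "_ - _"])
    finally have "(fnorm ((X - P * X)\<^sup>\<dagger>))\<^sup>2 = 0"
      unfolding fnorm_sq_Re_mtrace by (simp add: mtrace_def)
    then have "X - P * X = 0\<^sub>m n (dim_col X)" using fnorm_eq_0[of "X - P * X"] by simp
    then have "(X - P * X) $$ (i,j) = 0" if "i < n" "j < dim_col X" for i j using that by simp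
    then show ?thesis by (intro eq_matI) auto
  qed
  define W where "W = R\<^sup>\<dagger> * (G * X)"
  have [simp]: "dim_row W = dim_col R" "dim_col W = dim_col X" by (simp_all add: W_def)
  have AGX: "X * (X\<^sup>\<dagger> * (G * X)) = X"
    using AG PX by (simp add: mult_assoc_dim[symmetric])
  have RRA: "R * (R\<^sup>\<dagger> * B) = X * (X\<^sup>\<dagger> * B)" if "dim_row B = n" for B
    using eq that by (simp add: mult_assoc_dim[symmetric])
  have RW: "R * W = X" unfolding W_def using AGX by (simp add: RRA)
  have WW: "W\<^sup>\<dagger> * W = X\<^sup>\<dagger> * (G * X)"
    unfolding W_def by (simp add: adjoint_mult G mult_assoc_dim RRA AGX)
  have "contr W"
    by (rule contr_partial_isometry) (simp add: WW mult_assoc_dim AGX)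
  then show ?thesis by (intro exI[of _ W] conjI RW[symmetric]) simp_all
qed

text \<open>The right-hand side is the trace norm of \<open>Z\<close>. The polar decomposition
  \<open>Z = R * V\<close> reduces the claim to \<open>mtrace_contr_psd\<close> for the contraction
  \<open>V * W\<close>. Together with the next lemma this is the variational formula behind the
  fidelity.\<close>

lemma trace_norm_upper:
  assumes W: "contr W" "dim_row W = dim_col Z" "dim_col W = dim_row Z"
  shows "cmod (mtrace (W * Z)) \<le> Re (mtrace (mfun sqrt (Z * Z\<^sup>\<dagger>)))"
proof -
  define n where "n = dim_row Z"
  define R where "R = mfun sqrt (Z * Z\<^sup>\<dagger>)"
  note R = psd_sqrt[OF psd_gram'[of Z n], folded R_def, OF n_def[symmetric]]
  note [simp] = psdD(1-3)[OF R(1)] n_def[symmetric] W(2,3)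
  obtain V where V: "dim_row V = dim_col R" "dim_col V = dim_col Z" "contr V" "Z = R * V"
    using gram_factor[of Z n R] R by auto
  note [simp] = V(1,2)
  have "mtrace (W * Z) = mtrace (W * R * V)" using V(4) by (simp add: mult_assoc_dim)
  also have "\<dots> = mtrace (V * W * R)" by (subst mtrace_cyclic) (auto simp: mult_assoc_dim)
  finally show ?thesis
    using mtrace_contr_psd[OF R(1) contr_mult[OF V(3) W(1)]] unfolding R_def[symmetric] by simp
qed

lemma trace_norm_attained:
  "\<exists>W. contr W \<and> dim_row W = dim_col Z \<and> dim_col W = dim_row Z \<and>
     mtrace (W * Z) = complex_of_real (Re (mtrace (mfun sqrt (Z * Z\<^sup>\<dagger>))))"
proof -
  define n where "n = dim_row Z"
  define R where "R = mfun sqrt (Z * Z\<^sup>\<dagger>)"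
  note R = psd_sqrt[OF psd_gram'[of Z n], folded R_def, OF n_def[symmetric]]
  note [simp] = psdD(1-3)[OF R(1)] n_def[symmetric]
  obtain V where V: "dim_row V = dim_col Z" "dim_col V = dim_col R" "contr V" "R = Z * V"
    using gram_factor[of R n Z] R by auto
  have "mtrace (V * Z) = mtrace R" unfolding V(4) using V(1,2) by (subst mtrace_cyclic) auto
  also have "\<dots> = complex_of_real (Re (mtrace R))" using psd_mtrace[OF R(1)] by simp
  finally show ?thesis using V(1-3) unfolding R_def[symmetric] by auto
qed

text \<open>Sandwiching \<open>Y * Y\<^sup>\<dagger>\<close> between two copies of the square root
  \<open>R\<close> gives the Gram matrix of \<open>R * Y\<close>, so the root of the fidelity is the
  trace norm of \<open>R * Y\<close>.\<close>

lemma fidelity_gram: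
  assumes [simp]: "dim_row X = n" "dim_row Y = n"
  defines "R \<equiv> mfun sqrt (X * X\<^sup>\<dagger>)"
  shows "fidelity (X * X\<^sup>\<dagger>) (Y * Y\<^sup>\<dagger>) = (Re (mtrace (mfun sqrt ((R * Y) * (R * Y)\<^sup>\<dagger>))))\<^sup>2"
    "psd n R" "R * R = X * X\<^sup>\<dagger>"
proof -
  note R = psd_sqrt[OF psd_gram'[of X n], folded R_def, OF assms(1)]
  show "psd n R" "R * R = X * X\<^sup>\<dagger>" by fact+
  note [simp] = psdD(1-3)[OF R(1)]
  show "fidelity (X * X\<^sup>\<dagger>) (Y * Y\<^sup>\<dagger>) = (Re (mtrace (mfun sqrt ((R * Y) * (R * Y)\<^sup>\<dagger>))))\<^sup>2"
    unfolding fidelity_def R_def[symmetric] by (simp add: adjoint_mult mult_assoc_dim)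
qed

text \<open>One half of Uhlmann's theorem: \<open>X = R * V\<close> moves the contraction
  \<open>V\<close> from the arbitrary factor \<open>X\<close> over to the test \<open>W\<close>, and
  the variational bound for \<open>R * Y\<close> applies.\<close>

lemma fidelity_lower:
  assumes XY [simp]: "dim_row X = n" "dim_row Y = n"
    and W: "contr W" "dim_row W = dim_col Y" "dim_col W = dim_col X"
  shows "(cmod (mtrace (W * (X\<^sup>\<dagger> * Y))))\<^sup>2 \<le> fidelity (X * X\<^sup>\<dagger>) (Y * Y\<^sup>\<dagger>)"
proof -
  define R where "R = mfun sqrt (X * X\<^sup>\<dagger>)"
  note R = fidelity_gram[OF XY, folded R_def]
  note [simp] = psdD(1-3)[OF R(2)] W(2,3)
  obtain V where V: "dim_row V = dim_col R" "dim_col V = dim_col X" "contr V" "X = R * V"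
    using gram_factor[of X n R] R by auto
  note [simp] = V(1,2)
  have "mtrace (W * (X\<^sup>\<dagger> * Y)) = mtrace (W * V\<^sup>\<dagger> * (R * Y))"
    by (subst V(4)) (simp add: adjoint_mult mult_assoc_dim)
  then have "cmod (mtrace (W * (X\<^sup>\<dagger> * Y))) \<le> Re (mtrace (mfun sqrt ((R * Y) * (R * Y)\<^sup>\<dagger>)))"
    using trace_norm_upper[OF contr_mult[OF W(1) contr_adjoint[OF V(3)]], of "R * Y"] by simp
  then show ?thesis unfolding R(1) by (rule power_mono) simp
qed

text \<open>The other half factors in the opposite direction, \<open>R = X * V\<close>, which turns
  the contraction optimal for \<open>R * Y\<close> into one for \<open>X\<close>.\<close>

lemma fidelity_attained:
  assumes XY [simp]: "dim_row X = n" "dim_row Y = n"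
  shows "\<exists>W. contr W \<and> dim_row W = dim_col Y \<and> dim_col W = dim_col X \<and>
     fidelity (X * X\<^sup>\<dagger>) (Y * Y\<^sup>\<dagger>) = (cmod (mtrace (W * (X\<^sup>\<dagger> * Y))))\<^sup>2"
proof -
  define R where "R = mfun sqrt (X * X\<^sup>\<dagger>)"
  note R = fidelity_gram[OF XY, folded R_def]
  note [simp] = psdD(1-3)[OF R(2)]
  obtain V where V: "dim_row V = dim_col X" "dim_col V = dim_col R" "contr V" "R = X * V"
    using gram_factor[of R n X] R by auto
  note [simp] = V(1,2)
  have R': "R = V\<^sup>\<dagger> * X\<^sup>\<dagger>" using arg_cong[OF V(4), of mat_adjoint] by (simp add: adjoint_mult)
  obtain W where W: "contr W" "dim_row W = dim_col (R * Y)" "dim_col W = dim_row (R * Y)"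
    "mtrace (W * (R * Y)) = complex_of_real (Re (mtrace (mfun sqrt ((R * Y) * (R * Y)\<^sup>\<dagger>))))"
    using trace_norm_attained[of "R * Y"] by blast
  have "mtrace (W * (R * Y)) = mtrace (W * V\<^sup>\<dagger> * (X\<^sup>\<dagger> * Y))"
    using W(2,3) by (subst R') (simp add: mult_assoc_dim)
  then have "fidelity (X * X\<^sup>\<dagger>) (Y * Y\<^sup>\<dagger>) = (cmod (mtrace (W * V\<^sup>\<dagger> * (X\<^sup>\<dagger> * Y))))\<^sup>2"
    using arg_cong[OF W(4), of "\<lambda>z. (cmod z)\<^sup>2"] unfolding R(1) by simp
  moreover have "contr (W * V\<^sup>\<dagger>)" using W(3) by (intro contr_mult contr_adjoint W(1) V(3)) simp
  ultimately show ?thesis using W(2) by (intro exI[of _ "W * V\<^sup>\<dagger>"] conjI) simp_all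
qed

text \<open>The two Gram matrices share their nonzero eigenvalues. To avoid matching these up,
  \<open>eta x\<close> is written as \<open>x * g x\<close>; the commutation lemma moves
  \<open>g\<close> across \<open>R\<close>, and cyclicity of the trace does the rest.\<close>

lemma vN_entropy_gram_swap:
  "vN_entropy (R * R\<^sup>\<dagger>) = vN_entropy (R\<^sup>\<dagger> * R)"
proof -
  define m where "m = dim_row R"
  define n where "n = dim_col R"
  note [simp] = m_def[symmetric] n_def[symmetric]
  obtain U d where U: "spec_decomp (R * R\<^sup>\<dagger>) U d" "unitary m U"
    "R * R\<^sup>\<dagger> = U * mat_diag m (\<lambda>i. complex_of_real (d i)) * U\<^sup>\<dagger>" using psd_spectral[OF psd_gram'[of R m, OF m_def[symmetric]]] by blast
  obtain V e where V: "spec_decomp (R\<^sup>\<dagger> * R) V e" "unitary n V"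
    "R\<^sup>\<dagger> * R = V * mat_diag n (\<lambda>i. complex_of_real (e i)) * V\<^sup>\<dagger>" using psd_spectral[OF psd_gram[of R n, OF n_def[symmetric]]] by blast
  note [simp] = unitaryD(1,2)[OF U(2)] unitaryD(1,2)[OF V(2)]
  \<comment> \<open>At 0 the quotient is 0 by convention, in agreement with
    \<open>eta 0 = 0\<close>.\<close>
  define g where "g x = eta x / x" for x
  have eta: "eta x = x * g x" for x by (simp add: g_def eta_def)
  let ?gU = "U * mat_diag m (\<lambda>i. complex_of_real (g (d i))) * U\<^sup>\<dagger>"
  let ?gV = "V * mat_diag n (\<lambda>i. complex_of_real (g (e i))) * V\<^sup>\<dagger>"
  have comm: "?gU * R = R * ?gV"
    by (rule functional_calculus_commute[OF U(2) V(2)]) (auto simp: U(3)[symmetric] V(3)[symmetric] mult_assoc_dim)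
  have "complex_of_real (\<Sum>i<m. eta (d i)) = mtrace (R * R\<^sup>\<dagger> * ?gU)"
    unfolding U(3) diag_conj_mult[OF U(2)] by (subst mtrace_unitary_conj[OF U(2)]) (auto simp: mtrace_mat_diag eta)
  also have "\<dots> = mtrace (?gU * R * R\<^sup>\<dagger>)" by (subst mtrace_cyclic) (auto simp: mult_assoc_dim)
  also have "\<dots> = mtrace (R * (?gV * R\<^sup>\<dagger>))" unfolding comm by (subst mult_assoc_dim) auto
  also have "\<dots> = mtrace (?gV * R\<^sup>\<dagger> * R)" by (subst mtrace_cyclic) auto
  also have "\<dots> = mtrace (?gV * (R\<^sup>\<dagger> * R))" by (subst mult_assoc_dim) auto
  also have "\<dots> = complex_of_real (\<Sum>i<n. eta (e i))"
    unfolding V(3) diag_conj_mult[OF V(2)] by (subst mtrace_unitary_conj[OF V(2)]) (auto simp: mtrace_mat_diag eta mult.commute)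
  finally have "(\<Sum>i<m. eta (d i)) = (\<Sum>i<n. eta (e i))" by (simp only: of_real_eq_iff)
  then show ?thesis unfolding vN_entropy_spec_decomp[OF U(1)] vN_entropy_spec_decomp[OF V(1)] by simp
qed

lemma map_cnj_mult:
  "dim_col A = dim_row B \<Longrightarrow> map_mat cnj (A * B) = map_mat cnj A * map_mat cnj B"
  by (rule eq_matI) (auto simp: mult_index)

text \<open>Conjugating all entries of a decomposition gives one with the same real eigenvalues.
  This is applied to the reductions involving \<open>C\<close>, which are conjugates of the matrices
  analysed.\<close>

lemma vN_entropy_map_cnj:
  assumes "hermitian n A"
  shows "vN_entropy (map_mat cnj A) = vN_entropy A"
proof -
  obtain U d where sd: "spec_decomp A U d" using spectral_theorem[OF assms] by blast
  note U = spec_decompD[OF sd hermitianD(1)[OF assms]]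
  note [simp] = unitaryD(1,2)[OF U(1)] hermitianD(1,2)[OF assms]
  have adj: "(map_mat cnj U)\<^sup>\<dagger> = map_mat cnj (U\<^sup>\<dagger>)" by (rule eq_matI) auto
  have one: "map_mat cnj (1\<^sub>m n) = 1\<^sub>m n" by (rule eq_matI) auto
  have "unitary n (map_mat cnj U)"
    unfolding unitary_def using unitaryD[OF U(1)]
    by (auto simp: adj map_cnj_mult[symmetric] one)
  moreover have "map_mat cnj (mat_diag n (\<lambda>i. complex_of_real (d i))) = mat_diag n (\<lambda>i. complex_of_real (d i))"
    by (rule eq_matI) auto
  then have "map_mat cnj A = map_mat cnj U * mat_diag n (\<lambda>i. complex_of_real (d i)) * (map_mat cnj U)\<^sup>\<dagger>"
    by (subst U(2)) (simp add: adj map_cnj_mult)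
  ultimately have "spec_decomp (map_mat cnj A) (map_mat cnj U) d"
    unfolding spec_decomp_def by simp
  then show ?thesis unfolding vN_entropy_spec_decomp[OF sd] by (simp add: vN_entropy_spec_decomp)
qed

section \<open>Tensor powers and typicality\<close>

lemma pair_index_div_mod [simp]:
  fixes a b n :: nat
  shows "b < n \<Longrightarrow> (a * n + b) div n = a" "b < n \<Longrightarrow> (a * n + b) mod n = b"
  by auto

lemma pair_index_less [intro, simp]:
  fixes a b m n :: nat
  assumes "a < m" "b < n" shows "a * n + b < m * n"
proof -
  have "a * n + b < Suc a * n" using assms by simp
  also have "\<dots> \<le> m * n" using assms by (intro mult_le_mono1) simp
  finally show ?thesis .
qed

lemma pair_index_bounds [simp]:
  fixes i m n :: nat
  assumes "i < m * n" shows "i div n < m" "i mod n < n"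
proof -
  have "n > 0" using assms by (cases n) auto
  then show "i div n < m" "i mod n < n" using assms by (auto simp: less_mult_imp_div_less)
qed

lemma sum_lessThan_mult:
  fixes m n :: nat
  shows "(\<Sum>i<m * n. f i) = (\<Sum>a<m. \<Sum>b<n. f (a * n + b))"
proof (induction m)
  case (Suc m)
  have "(\<Sum>i<Suc m * n. f i) = (\<Sum>i<m * n. f i) + (\<Sum>i=m*n..<m*n+n. f i)"
    by (simp add: sum.atLeastLessThan_concat[symmetric] lessThan_atLeast0 add.commute)
  also have "(\<Sum>i=m*n..<m*n+n. f i) = (\<Sum>b<n. f (m * n + b))"
    using sum.shift_bounds_nat_ivl[of f 0 "m*n" n] by (simp add: add.commute lessThan_atLeast0)
  finally show ?case using Suc by simp
qed simp

lemma kron_dims [simp]: "dim_row (kron A B) = dim_row A * dim_row B" "dim_col (kron A B) = dim_col A * dim_col B"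
  by (simp_all add: kron_def)

lemma kron_index:
  "i < dim_row A * dim_row B \<Longrightarrow> j < dim_col A * dim_col B \<Longrightarrow>
   kron A B $$ (i,j) = A $$ (i div dim_row B, j div dim_col B) * B $$ (i mod dim_row B, j mod dim_col B)"
  by (simp add: kron_def)

lemma kron_mult:
  assumes [simp]: "dim_col A = dim_row C" "dim_col B = dim_row D"
  shows "kron A B * kron C D = kron (A * C) (B * D)"
  by (rule eq_matI)
    (auto simp: mult_index kron_index sum_lessThan_mult sum_product algebra_simps intro!: sum.cong)

lemma kron_adjoint: "(kron A B)\<^sup>\<dagger> = kron (A\<^sup>\<dagger>) (B\<^sup>\<dagger>)"
  by (rule eq_matI) (auto simp: kron_index)

lemma kron_one: "kron (1\<^sub>m a) (1\<^sub>m b) = 1\<^sub>m (a * b)"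
proof (rule eq_matI)
  fix i j assume ij: "i < dim_row (1\<^sub>m (a * b) :: complex mat)" "j < dim_col (1\<^sub>m (a * b) :: complex mat)"
  have "i div b = j div b \<and> i mod b = j mod b \<longleftrightarrow> i = j" by (metis div_mult_mod_eq)
  then show "kron (1\<^sub>m a) (1\<^sub>m b) $$ (i,j) = 1\<^sub>m (a * b) $$ (i,j)"
    using ij by (auto simp: kron_index)
qed auto

text \<open>An enumeration of all \<open>n\<close>-tuples over \<open>{..<r}\<close>, with
  \<open>e t i\<close> the entry at position \<open>t\<close> of tuple \<open>i\<close>. Encoding it
  as an exchange of sum and product, the form in which tuples are used, treats plain
  base-\<open>d\<close> digits and the reordered pairs of \<open>tpow\<close> alike.\<close>

definition product_index :: "nat \<Rightarrow> nat \<Rightarrow> nat \<Rightarrow> (nat \<Rightarrow> nat \<Rightarrow> nat) \<Rightarrow> bool" where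
  "product_index n D r e \<longleftrightarrow> (\<forall>i<D. \<forall>t<n. e t i < r) \<and>
     (\<forall>g::nat \<Rightarrow> nat \<Rightarrow> complex. (\<Sum>i<D. \<Prod>t<n. g t (e t i)) = (\<Prod>t<n. \<Sum>k<r. g t k))"

lemma product_index_less: "product_index n D r e \<Longrightarrow> i < D \<Longrightarrow> t < n \<Longrightarrow> e t i < r"
  by (simp add: product_index_def)

lemma product_index_sum:
  fixes g :: "nat \<Rightarrow> nat \<Rightarrow> complex"
  shows "product_index n D r e \<Longrightarrow> (\<Sum>i<D. \<Prod>t<n. g t (e t i)) = (\<Prod>t<n. \<Sum>k<r. g t k)"
  by (simp add: product_index_def)

lemma product_index_sum_real:
  fixes g :: "nat \<Rightarrow> nat \<Rightarrow> real"
  assumes "product_index n D r e"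
  shows "(\<Sum>i<D. \<Prod>t<n. g t (e t i)) = (\<Prod>t<n. \<Sum>k<r. g t k)"
proof -
  have "complex_of_real (\<Sum>i<D. \<Prod>t<n. g t (e t i)) = complex_of_real (\<Prod>t<n. \<Sum>k<r. g t k)"
    using product_index_sum[OF assms, of "\<lambda>t k. complex_of_real (g t k)"] by simp
  then show ?thesis by (simp only: of_real_eq_iff)
qed

text \<open>Injectivity of the enumeration: applied to the indicators of the entries of tuple
  \<open>j\<close>, the exchange law counts the indices that carry this tuple and yields 1.\<close>

lemma product_index_delta:
  assumes P: "product_index n D r e" and i: "i < D" and j: "j < D"
  shows "(\<Prod>t<n. if e t i = e t j then 1 else 0 :: complex) = (if i = j then 1 else 0)"
proof (cases "i = j")
  case False
  define c where "c l = (if \<forall>t<n. e t l = e t j then 1 else 0 :: real)" for l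
  have "(\<Sum>l<D. \<Prod>t<n. if e t l = e t j then 1 else 0 :: real) = (\<Prod>t<n. \<Sum>k<r. if k = e t j then 1 else 0)"
    by (rule product_index_sum_real[OF P])
  also have "\<dots> = 1" using product_index_less[OF P j] by (intro prod.neutral) auto
  also have "(\<Sum>l<D. \<Prod>t<n. if e t l = e t j then 1 else 0 :: real) = (\<Sum>l<D. c l)"
    unfolding c_def by (intro sum.cong) (auto intro!: prod_zero)
  finally have "(\<Sum>l<D. c l) = 1" .
  moreover have "(\<Sum>l\<in>{i,j}. c l) \<le> (\<Sum>l<D. c l)"
    using i j by (intro sum_mono2) (auto simp: c_def)
  moreover have "c j = 1" by (simp add: c_def)
  ultimately have "c i \<le> 0" using False by simp
  then obtain t where "t < n" "e t i \<noteq> e t j" by (auto simp: c_def split: if_splits)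
  then show ?thesis using False by (auto intro!: prod_zero)
qed simp

lemma digit_append:
  assumes "b < d ^ n"
  shows "t < n \<Longrightarrow> digit d t (a * d ^ n + b) = digit d t b"
    and "a < d \<Longrightarrow> digit d n (a * d ^ n + b) = a"
proof -
  assume t: "t < n"
  have "d > 0" using assms t by (cases d) (auto simp: power_0_left)
  have "a * d ^ n = (a * d ^ (n - Suc t) * d) * d ^ t"
  proof -
    have "d ^ n = d ^ (n - Suc t) * (d * d ^ t)"
      using t by (simp only: power_Suc[symmetric] power_add[symmetric]) simp
    then show ?thesis by (simp add: mult.assoc)
  qed
  then have "(a * d ^ n + b) div d ^ t = a * d ^ (n - Suc t) * d + b div d ^ t"
    using \<open>d > 0\<close> by (metis div_mult_self3 less_numeral_extra(3) zero_less_power add.commute)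
  then show "digit d t (a * d ^ n + b) = digit d t b"
    unfolding digit_def by simp
next
  assume "a < d"
  then show "digit d n (a * d ^ n + b) = a" using assms unfolding digit_def by simp
qed

text \<open>Induction splits off the leading digit: by \<open>digit_append\<close>, the lower digits
  of \<open>a * d ^ n + b\<close> are those of \<open>b\<close> and the top one is
  \<open>a\<close>.\<close>

lemma product_index_digit: "product_index n (d ^ n) d (digit d)"
  unfolding product_index_def
proof (intro conjI allI impI)
  fix i t assume "i < d ^ n" "t < n"
  then have "d > 0" by (cases d) (auto simp: power_0_left)
  then show "digit d t i < d" by (simp add: digit_def)
next
  fix g :: "nat \<Rightarrow> nat \<Rightarrow> complex"
  show "(\<Sum>i<d^n. \<Prod>t<n. g t (digit d t i)) = (\<Prod>t<n. \<Sum>k<d. g t k)"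
  proof (induction n)
    case (Suc n)
    have "(\<Sum>i<d^Suc n. \<Prod>t<Suc n. g t (digit d t i)) = (\<Sum>a<d. \<Sum>b<d^n. (\<Prod>t<n. g t (digit d t b)) * g n a)"
      unfolding power_Suc sum_lessThan_mult
      by (intro sum.cong refl) (simp add: digit_append)
    also have "\<dots> = (\<Sum>b<d^n. \<Prod>t<n. g t (digit d t b)) * (\<Sum>a<d. g n a)"
      by (simp add: sum_distrib_left sum_distrib_right)
    finally show ?case using Suc by simp
  qed simp
qed

definition digit2 :: "nat \<Rightarrow> nat \<Rightarrow> nat \<Rightarrow> nat \<Rightarrow> nat \<Rightarrow> nat" where
  "digit2 dX dY n t i = digit dX t (i div dY ^ n) * dY + digit dY t (i mod dY ^ n)"

lemma product_index_digit2: "product_index n (dX ^ n * dY ^ n) (dX * dY) (digit2 dX dY n)"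
  unfolding product_index_def
proof (intro conjI allI impI)
  fix i t assume "i < dX ^ n * dY ^ n" "t < n"
  then show "digit2 dX dY n t i < dX * dY"
    unfolding digit2_def by (intro pair_index_less product_index_less[OF product_index_digit]) auto
next
  fix g :: "nat \<Rightarrow> nat \<Rightarrow> complex"
  have "(\<Sum>i<dX ^ n * dY ^ n. \<Prod>t<n. g t (digit2 dX dY n t i))
      = (\<Sum>a<dX^n. \<Sum>b<dY^n. \<Prod>t<n. g t (digit dX t a * dY + digit dY t b))"
    unfolding sum_lessThan_mult digit2_def by simp
  also have "\<dots> = (\<Sum>a<dX^n. \<Prod>t<n. \<Sum>l<dY. g t (digit dX t a * dY + l))"
    by (intro sum.cong refl product_index_sum[OF product_index_digit])
  also have "\<dots> = (\<Prod>t<n. \<Sum>k<dX. \<Sum>l<dY. g t (k * dY + l))"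
    by (rule product_index_sum[OF product_index_digit])
  finally show "(\<Sum>i<dX ^ n * dY ^ n. \<Prod>t<n. g t (digit2 dX dY n t i)) = (\<Prod>t<n. \<Sum>k<dX * dY. g t k)"
    by (simp add: sum_lessThan_mult)
qed

text \<open>Rows and columns carry separate enumerations because rectangular factors of states are
  raised to powers as well: their rows follow the reordering of \<open>tpow\<close>, their columns
  plain digits.\<close>

definition tensor_power :: "nat \<Rightarrow> nat \<Rightarrow> (nat \<Rightarrow> nat \<Rightarrow> nat) \<Rightarrow> nat \<Rightarrow> (nat \<Rightarrow> nat \<Rightarrow> nat) \<Rightarrow> complex mat \<Rightarrow> complex mat" where
  "tensor_power n D e C h A = mat D C (\<lambda>(i,j). \<Prod>t<n. A $$ (e t i, h t j))"

lemma tensor_power_simps [simp]: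
  "dim_row (tensor_power n D e C h A) = D" "dim_col (tensor_power n D e C h A) = C"
  "i < D \<Longrightarrow> j < C \<Longrightarrow> tensor_power n D e C h A $$ (i,j) = (\<Prod>t<n. A $$ (e t i, h t j))"
  by (simp_all add: tensor_power_def)

lemma tpow_eq_tensor_power:
  "tpow dX dY n \<rho> = tensor_power n (dX^n * dY^n) (digit2 dX dY n) (dX^n * dY^n) (digit2 dX dY n) \<rho>"
  by (rule eq_matI) (auto simp: tpow_def digit2_def)

lemma tensor_power_mult:
  assumes e: "product_index n D (dim_row A) e" and h: "product_index n C (dim_row B) h"
    and k: "product_index n G (dim_col B) k" and [simp]: "dim_col A = dim_row B"
  shows "tensor_power n D e C h A * tensor_power n C h G k B = tensor_power n D e G k (A * B)"
proof (rule eq_matI)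
  fix i j assume "i < dim_row (tensor_power n D e G k (A * B))" "j < dim_col (tensor_power n D e G k (A * B))"
  then have ij: "i < D" "j < G" by auto
  have "(tensor_power n D e C h A * tensor_power n C h G k B) $$ (i,j)
      = (\<Sum>l<C. \<Prod>t<n. A $$ (e t i, h t l) * B $$ (h t l, k t j))"
    using ij by (simp add: mult_index prod.distrib)
  also have "\<dots> = (\<Prod>t<n. \<Sum>l<dim_row B. A $$ (e t i, l) * B $$ (l, k t j))"
    by (rule product_index_sum[OF h])
  also have "\<dots> = tensor_power n D e G k (A * B) $$ (i,j)"
    using ij product_index_less[OF e] product_index_less[OF k] by (simp add: mult_index)
  finally show "(tensor_power n D e C h A * tensor_power n C h G k B) $$ (i,j) = tensor_power n D e G k (A * B) $$ (i,j)" .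
qed auto

lemma tensor_power_adjoint:
  assumes e: "product_index n D (dim_row A) e" and h: "product_index n C (dim_col A) h"
  shows "(tensor_power n D e C h A)\<^sup>\<dagger> = tensor_power n C h D e (A\<^sup>\<dagger>)"
  by (rule eq_matI) (use product_index_less[OF e] product_index_less[OF h] in auto)

lemma tensor_power_diag:
  assumes e: "product_index n D r e"
  shows "tensor_power n D e D e (mat_diag r f) = mat_diag D (\<lambda>i. \<Prod>t<n. f (e t i))"
proof (rule eq_matI)
  fix i j assume "i < dim_row (mat_diag D (\<lambda>i. \<Prod>t<n. f (e t i)))" "j < dim_col (mat_diag D (\<lambda>i. \<Prod>t<n. f (e t i)))"
  then have ij: "i < D" "j < D" by auto
  have "tensor_power n D e D e (mat_diag r f) $$ (i,j) = (\<Prod>t<n. (if e t i = e t j then 1 else 0) * f (e t j))"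
    unfolding tensor_power_simps(3)[OF ij] using ij product_index_less[OF e]
    by (intro prod.cong refl) simp
  also have "\<dots> = (if i = j then 1 else 0) * (\<Prod>t<n. f (e t j))"
    unfolding prod.distrib product_index_delta[OF e ij] ..
  finally show "tensor_power n D e D e (mat_diag r f) $$ (i,j) = mat_diag D (\<lambda>i. \<Prod>t<n. f (e t i)) $$ (i,j)"
    using ij by auto
qed auto

lemma tensor_power_one:
  "product_index n D r e \<Longrightarrow> tensor_power n D e D e (1\<^sub>m r) = 1\<^sub>m D"
  using tensor_power_diag[of n D r e "\<lambda>_. 1"] by simp

lemma tensor_power_unitary:
  assumes e: "product_index n D r e" and U: "unitary r U"
  shows "unitary D (tensor_power n D e D e U)"
  using unitaryD[OF U] e unfolding unitary_def
  by (auto simp: tensor_power_adjoint tensor_power_mult tensor_power_one intro!: carrier_matI)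

lemma tensor_power_diag_conj:
  assumes e: "product_index n D r e" and U: "unitary r U"
  shows "tensor_power n D e D e (U * mat_diag r f * U\<^sup>\<dagger>)
    = tensor_power n D e D e U * mat_diag D (\<lambda>i. \<Prod>t<n. f (e t i)) * (tensor_power n D e D e U)\<^sup>\<dagger>"
proof -
  note [simp] = unitaryD(1,2)[OF U] e
  show ?thesis
    unfolding tensor_power_diag[OF e, symmetric] by (simp add: tensor_power_adjoint tensor_power_mult)
qed

lemma fnorm_tensor_power_sq:
  assumes e: "product_index n D (dim_row A) e" and h: "product_index n C (dim_col A) h"
  shows "(fnorm (tensor_power n D e C h A))\<^sup>2 = ((fnorm A)\<^sup>2) ^ n"
proof -
  have "(fnorm (tensor_power n D e C h A))\<^sup>2 = (\<Sum>i<D. \<Sum>j<C. \<Prod>t<n. (cmod (A $$ (e t i, h t j)))\<^sup>2)"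
    unfolding fnorm_sq by (simp add: prod_norm[symmetric] prod_power_distrib)
  also have "\<dots> = (\<Sum>i<D. \<Prod>t<n. \<Sum>j<dim_col A. (cmod (A $$ (e t i, j)))\<^sup>2)"
    by (intro sum.cong refl product_index_sum_real[OF h])
  also have "\<dots> = (\<Prod>t<n. \<Sum>i<dim_row A. \<Sum>j<dim_col A. (cmod (A $$ (i, j)))\<^sup>2)"
    by (rule product_index_sum_real[OF e])
  finally show ?thesis by (simp add: fnorm_sq)
qed

text \<open>The moment function equals 1 at \<open>s = 0\<close> and its slope there is the mean of
  \<open>u\<close>, which is negative; so it lies below 1 just to the right of 0.\<close>

lemma exponential_moment_less_one:
  fixes q u :: "nat \<Rightarrow> real"
  assumes q: "(\<Sum>k<r. q k) = 1" and neg: "(\<Sum>k<r. q k * u k) < 0"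
  shows "\<exists>s>0. (\<Sum>k<r. q k * exp (s * u k)) < 1"
proof -
  let ?\<phi> = "\<lambda>s. \<Sum>k<r. q k * exp (s * u k)"
  have "DERIV ?\<phi> 0 :> (\<Sum>k<r. q k * u k)"
    by (auto intro!: derivative_eq_intros sum.cong)
  from DERIV_neg_dec_right[OF this neg] obtain a where a: "a > 0" "\<And>h. 0 < h \<Longrightarrow> h < a \<Longrightarrow> ?\<phi> (0 + h) < ?\<phi> 0"
    by auto
  have "?\<phi> (a/2) < 1" using a(2)[of "a/2"] a(1) q by simp
  then show ?thesis using a(1) by (intro exI[of _ "a/2"]) auto
qed

text \<open>Exponential tilting with \<open>u k = ln B - ln (v k)\<close>, whose mean is
  \<open>- \<delta> * ln 2\<close>: an atypical tuple has nonnegative total \<open>u\<close>, hence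
  a tilting weight of at least 1, and the tilted sum factorises over positions. With
  \<open>v\<close> the eigenvalues of a state this controls small eigenvalues, with \<open>v\<close>
  their reciprocals large ones.\<close>

lemma product_chernoff:
  fixes q v :: "nat \<Rightarrow> real"
  assumes q0: "\<And>k. k < r \<Longrightarrow> 0 \<le> q k" and q1: "(\<Sum>k<r. q k) = 1"
    and v: "\<And>k. k < r \<Longrightarrow> 0 < q k \<Longrightarrow> 0 < v k"
    and m: "(\<Sum>k<r. q k * log 2 (v k)) = - m" and \<delta>: "\<delta> > 0"
  shows "\<exists>\<beta>. 0 \<le> \<beta> \<and> \<beta> < 1 \<and> (\<forall>n D e. product_index n D r e \<longrightarrow>
    (\<Sum>i<D. if (\<Prod>t<n. v (e t i)) < 2 powr (- real n * (m + \<delta>)) then (\<Prod>t<n. q (e t i)) else 0) \<le> \<beta> ^ n)"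
proof -
  define B where "B = 2 powr (- (m + \<delta>))"
  have B: "B > 0" by (simp add: B_def)
  define u where "u k = ln B - ln (v k)" for k
  have "(\<Sum>k<r. q k * u k) = (\<Sum>k<r. q k) * ln B - (\<Sum>k<r. q k * log 2 (v k)) * ln 2"
  proof -
    have "q k * u k = q k * ln B - q k * log 2 (v k) * ln 2" for k
      by (simp add: u_def log_def right_diff_distrib)
    then show ?thesis by (simp add: sum_subtractf sum_distrib_right)
  qed
  also have "\<dots> = - \<delta> * ln 2" using q1 m by (simp add: B_def ln_powr algebra_simps)
  finally have "(\<Sum>k<r. q k * u k) < 0" using \<delta> by simp
  from exponential_moment_less_one[OF q1 this] obtain s where s: "s > 0" "(\<Sum>k<r. q k * exp (s * u k)) < 1"
    by blast
  let ?\<beta> = "\<Sum>k<r. q k * exp (s * u k)"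
  have \<beta>0: "0 \<le> ?\<beta>" by (intro sum_nonneg mult_nonneg_nonneg) (auto simp: q0)
  have "(\<Sum>i<D. if (\<Prod>t<n. v (e t i)) < 2 powr (- real n * (m + \<delta>)) then (\<Prod>t<n. q (e t i)) else 0) \<le> ?\<beta> ^ n"
    if e: "product_index n D r e" for n D e
  proof -
    have "(if (\<Prod>t<n. v (e t i)) < 2 powr (- real n * (m + \<delta>)) then (\<Prod>t<n. q (e t i)) else 0)
        \<le> (\<Prod>t<n. q (e t i) * exp (s * u (e t i)))" if i: "i < D" for i
    \<comment> \<open>A tuple of nonzero probability has all its \<open>q\<close> positive, hence
      all its \<open>v\<close> positive, so the logarithm of the product may be taken.\<close>
    proof (cases "(\<Prod>t<n. v (e t i)) < 2 powr (- real n * (m + \<delta>)) \<and> (\<Prod>t<n. q (e t i)) \<noteq> 0")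
      case True
      have e0: "e t i < r" if "t < n" for t using product_index_less[OF e i that] .
      have qpos: "0 < q (e t i)" if "t < n" for t
        using True e0[OF that] q0[OF e0[OF that]] that by (auto simp: order_less_le)
      have vpos: "0 < v (e t i)" if "t < n" for t using v[OF e0[OF that] qpos[OF that]] .
      have "2 powr (- real n * (m + \<delta>)) = B ^ n"
        by (simp add: B_def powr_powr[symmetric] powr_realpow[symmetric] powr_powr algebra_simps)
      then have "ln (\<Prod>t<n. v (e t i)) \<le> ln (B ^ n)"
        using True B vpos by (subst ln_le_cancel_iff) (auto intro!: prod_pos)
      then have "0 \<le> (\<Sum>t<n. u (e t i))"
        unfolding u_def using vpos[THEN less_imp_neq] B
        by (subst (asm) ln_prod) (force simp: sum_subtractf ln_realpow)+
      then have "1 \<le> exp (\<Sum>t<n. s * u (e t i))" using s(1) by (simp add: sum_distrib_left[symmetric])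
      then have "(\<Prod>t<n. q (e t i)) * 1 \<le> (\<Prod>t<n. q (e t i)) * exp (\<Sum>t<n. s * u (e t i))"
        using qpos by (intro mult_left_mono prod_nonneg) (auto simp: order_less_imp_le)
      then show ?thesis using True by (simp add: exp_sum prod.distrib)
    next
      case False
      then have "(if (\<Prod>t<n. v (e t i)) < 2 powr (- real n * (m + \<delta>)) then (\<Prod>t<n. q (e t i)) else 0) = 0"
        by presburger
      moreover have "0 \<le> (\<Prod>t<n. q (e t i) * exp (s * u (e t i)))"
        using product_index_less[OF e i] by (intro prod_nonneg mult_nonneg_nonneg ballI) (auto simp: q0)
      ultimately show ?thesis by linarith
    qed
    then have "(\<Sum>i<D. if (\<Prod>t<n. v (e t i)) < 2 powr (- real n * (m + \<delta>)) then (\<Prod>t<n. q (e t i)) else 0)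
        \<le> (\<Sum>i<D. \<Prod>t<n. q (e t i) * exp (s * u (e t i)))" by (intro sum_mono) auto
    also have "\<dots> = (\<Prod>t<n. \<Sum>k<r. q k * exp (s * u k))" by (rule product_index_sum_real[OF e])
    finally show ?thesis by simp
  qed
  then show ?thesis using s(2) \<beta>0 by blast
qed

section \<open>Separable states and LOCC\<close>

text \<open>The Gram matrices of these are the unnormalised separable states, and product operators
  preserve the form, so that a protocol can be followed on the factor.\<close>

definition product_cols :: "nat \<Rightarrow> nat \<Rightarrow> nat \<Rightarrow> (nat \<Rightarrow> nat \<Rightarrow> complex) \<Rightarrow> (nat \<Rightarrow> nat \<Rightarrow> complex) \<Rightarrow> complex mat" where
  "product_cols dX dY \<kappa> a b = mat (dX * dY) \<kappa> (\<lambda>(i,k). a k (i div dY) * b k (i mod dY))"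

lemma product_cols_simps [simp]:
  "dim_row (product_cols dX dY \<kappa> a b) = dX * dY" "dim_col (product_cols dX dY \<kappa> a b) = \<kappa>"
  "i < dX * dY \<Longrightarrow> k < \<kappa> \<Longrightarrow> product_cols dX dY \<kappa> a b $$ (i,k) = a k (i div dY) * b k (i mod dY)"
  by (simp_all add: product_cols_def)

lemma msum_dims [simp]: "dim_row (msum n m A S) = n" "dim_col (msum n m A S) = m"
  by (simp_all add: msum_def)

lemma msum_index [simp]: "i < n \<Longrightarrow> j < m \<Longrightarrow> msum n m A S $$ (i,j) = (\<Sum>k\<in>S. A k $$ (i,j))"
  by (simp add: msum_def)

lemma mtrace_kron:
  assumes "dim_col A = dim_row A" "dim_col B = dim_row B"
  shows "mtrace (kron A B) = mtrace A * mtrace B"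
  unfolding mtrace_def using assms
  by (simp add: sum_lessThan_mult kron_index sum_product)

lemma densityD: "density n \<rho> \<Longrightarrow> psd n \<rho>" "density n \<rho> \<Longrightarrow> mtrace \<rho> = 1"
  by (auto simp: density_def)

lemma fnorm_sq_mtrace': "mtrace (A * A\<^sup>\<dagger>) = complex_of_real ((fnorm A)\<^sup>2)"
  using fnorm_sq_mtrace[of "A\<^sup>\<dagger>"] by simp

text \<open>Diagonalising both sides of every term refines the mixture to pure product states. All
  weights go into \<open>b\<close>, which leaves the vectors \<open>a k\<close> normalised; their
  squared moduli later become guessing distributions.\<close>

lemma sep_state_pure:
  assumes "sep_state dX dY \<sigma>"
  obtains \<kappa> a b where "\<And>k. k < \<kappa> \<Longrightarrow> (\<Sum>i<dX. (cmod (a k i))\<^sup>2) = 1"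
    "\<sigma> = product_cols dX dY \<kappa> a b * (product_cols dX dY \<kappa> a b)\<^sup>\<dagger>" "fnorm (product_cols dX dY \<kappa> a b) = 1"
proof -
  obtain K q sx sy where st: "\<And>k. k < K \<Longrightarrow> 0 \<le> q k \<and> density dX (sx k) \<and> density dY (sy k)"
    and q1: "(\<Sum>k<K. q k) = 1"
    and \<sigma>: "\<sigma> = msum (dX * dY) (dX * dY) (\<lambda>k. complex_of_real (q k) \<cdot>\<^sub>m kron (sx k) (sy k)) {..<(K::nat)}"
    using assms unfolding sep_state_def by blast
  have "\<exists>U d. unitary dX U \<and> sx k = U * mat_diag dX (\<lambda>i. complex_of_real (d i)) * U\<^sup>\<dagger> \<and> (\<forall>i<dX. 0 \<le> d i)" if "k < K" for k
    using psd_spectral[OF densityD(1)] st[OF that] by metis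
  then obtain U d where U: "\<And>k. k < K \<Longrightarrow> unitary dX (U k) \<and> sx k = U k * mat_diag dX (\<lambda>i. complex_of_real (d k i)) * (U k)\<^sup>\<dagger> \<and> (\<forall>i<dX. 0 \<le> d k i)"
    by metis
  have "\<exists>U d. unitary dY U \<and> sy k = U * mat_diag dY (\<lambda>i. complex_of_real (d i)) * U\<^sup>\<dagger> \<and> (\<forall>i<dY. 0 \<le> d i)" if "k < K" for k
    using psd_spectral[OF densityD(1)] st[OF that] by metis
  then obtain V e where V: "\<And>k. k < K \<Longrightarrow> unitary dY (V k) \<and> sy k = V k * mat_diag dY (\<lambda>i. complex_of_real (e k i)) * (V k)\<^sup>\<dagger> \<and> (\<forall>i<dY. 0 \<le> e k i)"
    by metis
  have sx: "sx k $$ (i,j) = (\<Sum>l<dX. U k $$ (i,l) * complex_of_real (d k l) * cnj (U k $$ (j,l)))"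
    if "k < K" "i < dX" "j < dX" for k i j
    using U[OF that(1)] that(2,3) by (auto simp: conj_diag_index unitaryD[of dX "U k"])
  have sy: "sy k $$ (i,j) = (\<Sum>l<dY. V k $$ (i,l) * complex_of_real (e k l) * cnj (V k $$ (j,l)))"
    if "k < K" "i < dY" "j < dY" for k i j
    using V[OF that(1)] that(2,3) by (auto simp: conj_diag_index unitaryD[of dY "V k"])
  \<comment> \<open>A column index encodes a term of the mixture and one eigenvector for each side:
    quotient by \<open>dX * dY\<close>, then quotient and remainder of the rest by
    \<open>dY\<close>.\<close>
  define \<kappa> where "\<kappa> = K * (dX * dY)"
  define a where "a l i = U (l div (dX*dY)) $$ (i, l mod (dX*dY) div dY)" for l i
  define b where "b l j = complex_of_real (sqrt (q (l div (dX*dY)) * d (l div (dX*dY)) (l mod (dX*dY) div dY) * e (l div (dX*dY)) (l mod (dX*dY) mod dY)))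
      * V (l div (dX*dY)) $$ (j, l mod (dX*dY) mod dY)" for l j
  let ?Y = "product_cols dX dY \<kappa> a b"
  have dims: "dim_row (sx k) = dX" "dim_col (sx k) = dX" "dim_row (sy k) = dY" "dim_col (sy k) = dY" if "k < K" for k
    using st[OF that] psdD densityD by metis+
  have a1: "(\<Sum>i<dX. (cmod (a k i))\<^sup>2) = 1" if k: "k < \<kappa>" for k
  proof -
    let ?k = "k div (dX*dY)" and ?l = "k mod (dX*dY) div dY"
    have kl: "?k < K" "?l < dX" using k unfolding \<kappa>_def by auto
    note Uk = U[OF kl(1), THEN conjunct1]
    have "((U ?k)\<^sup>\<dagger> * U ?k) $$ (?l,?l) = 1" using unitaryD(4)[OF Uk] kl by simp
    then have "(\<Sum>i<dX. cnj (U ?k $$ (i,?l)) * U ?k $$ (i,?l)) = 1"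
      using kl unitaryD(1,2)[OF Uk] by (simp add: mult_index)
    then have "complex_of_real (\<Sum>i<dX. (cmod (a k i))\<^sup>2) = complex_of_real 1"
      unfolding a_def by (simp add: complex_norm_square mult.commute del: of_real_power)
    then show ?thesis by (simp only: of_real_eq_iff)
  qed
  have Y: "\<sigma> = ?Y * ?Y\<^sup>\<dagger>"
  proof (rule eq_matI)
    fix x y assume "x < dim_row (?Y * ?Y\<^sup>\<dagger>)" "y < dim_col (?Y * ?Y\<^sup>\<dagger>)"
    then have xy: "x < dX * dY" "y < dX * dY" by auto
    have "(?Y * ?Y\<^sup>\<dagger>) $$ (x,y) = (\<Sum>k<K. \<Sum>i<dX. \<Sum>j<dY.
        U k $$ (x div dY,i) * (complex_of_real (sqrt (q k * d k i * e k j)) * V k $$ (x mod dY,j)) *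
        cnj (U k $$ (y div dY,i) * (complex_of_real (sqrt (q k * d k i * e k j)) * V k $$ (y mod dY,j))))"
      using xy by (simp add: mult_index) (simp add: \<kappa>_def a_def b_def sum_lessThan_mult)
    also have "\<dots> = (\<Sum>k<K. complex_of_real (q k) * (sx k $$ (x div dY, y div dY) * sy k $$ (x mod dY, y mod dY)))"
    proof (intro sum.cong refl)
      fix k assume "k \<in> {..<K}"
      then have k: "k < K" by simp
      have sq: "complex_of_real (sqrt (q k * d k i * e k j)) * complex_of_real (sqrt (q k * d k i * e k j))
        = complex_of_real (q k) * complex_of_real (d k i) * complex_of_real (e k j)" if "i < dX" "j < dY" for i j
        using U[OF k] V[OF k] st[OF k] that by (simp flip: of_real_mult)
      have "(\<Sum>i<dX. \<Sum>j<dY.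
        U k $$ (x div dY,i) * (complex_of_real (sqrt (q k * d k i * e k j)) * V k $$ (x mod dY,j)) *
        cnj (U k $$ (y div dY,i) * (complex_of_real (sqrt (q k * d k i * e k j)) * V k $$ (y mod dY,j))))
        = (\<Sum>i<dX. \<Sum>j<dY. (complex_of_real (sqrt (q k * d k i * e k j)) * complex_of_real (sqrt (q k * d k i * e k j))) *
            (U k $$ (x div dY,i) * cnj (U k $$ (y div dY,i)) * (V k $$ (x mod dY,j) * cnj (V k $$ (y mod dY,j)))))"
        by (intro sum.cong refl) (simp add: algebra_simps)
      also have "\<dots> = (\<Sum>i<dX. \<Sum>j<dY. (complex_of_real (q k) * complex_of_real (d k i) * complex_of_real (e k j)) *
            (U k $$ (x div dY,i) * cnj (U k $$ (y div dY,i)) * (V k $$ (x mod dY,j) * cnj (V k $$ (y mod dY,j)))))"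
        by (intro sum.cong refl) (simp add: sq)
      also have "\<dots> = complex_of_real (q k) * (sx k $$ (x div dY, y div dY) * sy k $$ (x mod dY, y mod dY))"
        unfolding sx[OF k pair_index_bounds(1)[OF xy(1)] pair_index_bounds(1)[OF xy(2)]]
          sy[OF k pair_index_bounds(2)[OF xy(1)] pair_index_bounds(2)[OF xy(2)]] sum_product
        unfolding sum_distrib_left by (intro sum.cong refl) (simp add: algebra_simps)
      finally show "(\<Sum>i<dX. \<Sum>j<dY.
        U k $$ (x div dY,i) * (complex_of_real (sqrt (q k * d k i * e k j)) * V k $$ (x mod dY,j)) *
        cnj (U k $$ (y div dY,i) * (complex_of_real (sqrt (q k * d k i * e k j)) * V k $$ (y mod dY,j))))
        = complex_of_real (q k) * (sx k $$ (x div dY, y div dY) * sy k $$ (x mod dY, y mod dY))" .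
    qed
    also have "\<dots> = \<sigma> $$ (x,y)"
      unfolding \<sigma> using xy by (simp add: kron_index dims)
    finally show "\<sigma> $$ (x,y) = (?Y * ?Y\<^sup>\<dagger>) $$ (x,y)" by simp
  qed (auto simp: \<sigma>)
  have "complex_of_real ((fnorm ?Y)\<^sup>2) = mtrace \<sigma>" unfolding Y by (rule fnorm_sq_mtrace'[symmetric])
  also have "\<dots> = (\<Sum>k<K. complex_of_real (q k) * mtrace (kron (sx k) (sy k)))"
    unfolding \<sigma> mtrace_def by (simp add: sum.swap[of _ "{..<dX*dY}"] sum_distrib_left dims)
  also have "\<dots> = (\<Sum>k<K. complex_of_real (q k))"
  proof (intro sum.cong refl)
    fix k assume "k \<in> {..<K}"
    then have k: "k < K" by simp
    have "mtrace (sx k) = 1" "mtrace (sy k) = 1" using st[OF k] densityD(2) by blast+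
    then show "complex_of_real (q k) * mtrace (kron (sx k) (sy k)) = complex_of_real (q k)"
      by (simp add: mtrace_kron dims[OF k])
  qed
  also have "\<dots> = complex_of_real 1" using q1 by (simp flip: of_real_sum)
  finally have "(fnorm ?Y)\<^sup>2 = 1" by (simp only: of_real_eq_iff)
  then have "fnorm ?Y = 1" using fnorm_nonneg[of ?Y] by (simp add: power2_eq_1_iff)
  then show ?thesis using that a1 Y by blast
qed

section \<open>Kraus families and LOCC protocols\<close>

lemma mtrace_conj_mult:
  assumes [simp]: "dim_row M = n" "dim_col M = n" "dim_row X = n"
  shows "mtrace (X\<^sup>\<dagger> * (M * X)) = (\<Sum>i<n. \<Sum>j<n. M $$ (i,j) * (X * X\<^sup>\<dagger>) $$ (j,i))"
proof -
  have "mtrace (X\<^sup>\<dagger> * (M * X)) = mtrace (M * (X * X\<^sup>\<dagger>))"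
    by (subst mtrace_cyclic) (simp_all add: mult_assoc_dim)
  then show ?thesis by (simp add: mtrace_mult)
qed

lemma kraus_sum_fnorm:
  assumes sum: "msum n n (\<lambda>k. (B k)\<^sup>\<dagger> * B k) {..<m} = 1\<^sub>m n"
    and B: "\<And>k. k < m \<Longrightarrow> dim_col (B k) = n" and X [simp]: "dim_row X = n"
  shows "(\<Sum>k<m. (fnorm (B k * X))\<^sup>2) = (fnorm X)\<^sup>2"
proof -
  have "complex_of_real ((fnorm (B k * X))\<^sup>2) = (\<Sum>i<n. \<Sum>j<n. ((B k)\<^sup>\<dagger> * B k) $$ (i,j) * (X * X\<^sup>\<dagger>) $$ (j,i))" if "k < m" for k
    unfolding fnorm_sq_mtrace[symmetric] using B[OF that]
    by (subst mtrace_conj_mult[symmetric]) (auto simp: adjoint_mult mult_assoc_dim)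
  then have "complex_of_real (\<Sum>k<m. (fnorm (B k * X))\<^sup>2) = (\<Sum>k<m. \<Sum>i<n. \<Sum>j<n. ((B k)\<^sup>\<dagger> * B k) $$ (i,j) * (X * X\<^sup>\<dagger>) $$ (j,i))"
    by (simp del: of_real_power)
  also have "\<dots> = (\<Sum>i<n. \<Sum>j<n. msum n n (\<lambda>k. (B k)\<^sup>\<dagger> * B k) {..<m} $$ (i,j) * (X * X\<^sup>\<dagger>) $$ (j,i))"
    by (simp add: sum.swap[of _ _ "{..<m}"] sum_distrib_right)
  also have "\<dots> = mtrace (X\<^sup>\<dagger> * (1\<^sub>m n * X))"
    unfolding sum by (subst mtrace_conj_mult) auto
  also have "\<dots> = complex_of_real ((fnorm X)\<^sup>2)" unfolding fnorm_sq_mtrace[symmetric] by simp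
  finally show ?thesis by (simp only: of_real_eq_iff)
qed

lemma msum_kron_left:
  assumes sum: "msum a a (\<lambda>k. (A k)\<^sup>\<dagger> * A k) {..<m} = 1\<^sub>m a" and A: "\<And>k. k < m \<Longrightarrow> dim_col (A k) = a"
  shows "msum (a * b) (a * b) (\<lambda>k. (kron (A k) (1\<^sub>m b))\<^sup>\<dagger> * kron (A k) (1\<^sub>m b)) {..<m} = 1\<^sub>m (a * b)"
proof (rule eq_matI)
  fix i j assume "i < dim_row (1\<^sub>m (a*b) :: complex mat)" "j < dim_col (1\<^sub>m (a*b) :: complex mat)"
  then have ij: "i < a * b" "j < a * b" by auto
  have "(\<Sum>k<m. ((kron (A k) (1\<^sub>m b))\<^sup>\<dagger> * kron (A k) (1\<^sub>m b)) $$ (i,j))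
      = (\<Sum>k<m. ((A k)\<^sup>\<dagger> * A k) $$ (i div b, j div b)) * 1\<^sub>m b $$ (i mod b, j mod b)"
    unfolding sum_distrib_right
    by (intro sum.cong refl) (use ij A in \<open>simp add: kron_adjoint kron_mult kron_index\<close>)
  also have "(\<Sum>k<m. ((A k)\<^sup>\<dagger> * A k) $$ (i div b, j div b)) = 1\<^sub>m a $$ (i div b, j div b)"
    unfolding sum[symmetric] using ij by simp
  also have "1\<^sub>m a $$ (i div b, j div b) * 1\<^sub>m b $$ (i mod b, j mod b) = kron (1\<^sub>m a) (1\<^sub>m b) $$ (i,j)"
    using ij by (simp add: kron_index del: index_one_mat(1))
  finally show "msum (a * b) (a * b) (\<lambda>k. (kron (A k) (1\<^sub>m b))\<^sup>\<dagger> * kron (A k) (1\<^sub>m b)) {..<m} $$ (i,j) = 1\<^sub>m (a*b) $$ (i,j)"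
    using ij unfolding kron_one by simp
qed auto

lemma msum_kron_right:
  assumes sum: "msum b b (\<lambda>k. (B k)\<^sup>\<dagger> * B k) {..<m} = 1\<^sub>m b" and B: "\<And>k. k < m \<Longrightarrow> dim_col (B k) = b"
  shows "msum (a * b) (a * b) (\<lambda>k. (kron (1\<^sub>m a) (B k))\<^sup>\<dagger> * kron (1\<^sub>m a) (B k)) {..<m} = 1\<^sub>m (a * b)"
proof (rule eq_matI)
  fix i j assume "i < dim_row (1\<^sub>m (a*b) :: complex mat)" "j < dim_col (1\<^sub>m (a*b) :: complex mat)"
  then have ij: "i < a * b" "j < a * b" by auto
  have "(\<Sum>k<m. ((kron (1\<^sub>m a) (B k))\<^sup>\<dagger> * kron (1\<^sub>m a) (B k)) $$ (i,j))
      = 1\<^sub>m a $$ (i div b, j div b) * (\<Sum>k<m. ((B k)\<^sup>\<dagger> * B k) $$ (i mod b, j mod b))"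
    unfolding sum_distrib_left
    by (intro sum.cong refl) (use ij B in \<open>simp add: kron_adjoint kron_mult kron_index\<close>)
  also have "(\<Sum>k<m. ((B k)\<^sup>\<dagger> * B k) $$ (i mod b, j mod b)) = 1\<^sub>m b $$ (i mod b, j mod b)"
    unfolding sum[symmetric] using ij by simp
  also have "1\<^sub>m a $$ (i div b, j div b) * 1\<^sub>m b $$ (i mod b, j mod b) = kron (1\<^sub>m a) (1\<^sub>m b) $$ (i,j)"
    using ij by (simp add: kron_index del: index_one_mat(1))
  finally show "msum (a * b) (a * b) (\<lambda>k. (kron (1\<^sub>m a) (B k))\<^sup>\<dagger> * kron (1\<^sub>m a) (B k)) {..<m} $$ (i,j) = 1\<^sub>m (a*b) $$ (i,j)"
    using ij unfolding kron_one by simp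
qed auto

text \<open>Local steps multiply to product operators, and communication only selects the branch.
  Together with trace preservation this is all that the converse uses of LOCC.\<close>

lemma locc_kraus_product:
  assumes "locc a b a' b' Ks" "K \<in> set Ks"
  shows "\<exists>A B. dim_row A = a' \<and> dim_col A = a \<and> dim_row B = b' \<and> dim_col B = b \<and> K = kron A B"
  using assms
proof (induction arbitrary: K rule: locc.induct)
  case (locc_id a b)
  then show ?case by (intro exI[of _ "1\<^sub>m a"] exI[of _ "1\<^sub>m b"]) (simp add: kron_one)
next
  case (locc_alice m A c a b a' b' Ks)
  then obtain k K' where k: "k < m" "K' \<in> set (Ks k)" "K = K' * kron (A k) (1\<^sub>m b)" by auto
  then obtain A' B' where AB: "dim_row A' = a'" "dim_col A' = c k" "dim_row B' = b'" "dim_col B' = b" "K' = kron A' B'"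
    using locc_alice by blast
  have "dim_row (A k) = c k" "dim_col (A k) = a" using locc_alice k by auto
  then show ?case using AB k by (intro exI[of _ "A' * A k"] exI[of _ B']) (simp add: kron_mult)
next
  case (locc_bob m B c b a a' b' Ks)
  then obtain k K' where k: "k < m" "K' \<in> set (Ks k)" "K = K' * kron (1\<^sub>m a) (B k)" by auto
  then obtain A' B' where AB: "dim_row A' = a'" "dim_col A' = a" "dim_row B' = b'" "dim_col B' = c k" "K' = kron A' B'"
    using locc_bob by blast
  have "dim_row (B k) = c k" "dim_col (B k) = b" using locc_bob k by auto
  then show ?case using AB k by (intro exI[of _ A'] exI[of _ "B' * B k"]) (simp add: kron_mult)
qed

lemma locc_kraus_dims:
  assumes "locc a b a' b' Ks" "K \<in> set Ks"
  shows "dim_row K = a' * b'" "dim_col K = a * b"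
  using locc_kraus_product[OF assms] by auto

lemma sum_list_concat_map:
  fixes f :: "'a \<Rightarrow> real"
  shows "sum_list (map f (concat (map g [0..<m]))) = (\<Sum>k<m. sum_list (map f (g k)))"
  by (induction m) auto

lemma locc_trace_preserving:
  assumes "locc a b a' b' Ks" "dim_row X = a * b"
  shows "(\<Sum>K\<leftarrow>Ks. (fnorm (K * X))\<^sup>2) = (fnorm X)\<^sup>2"
  using assms
proof (induction arbitrary: X rule: locc.induct)
  case (locc_alice m A c a b a' b' Ks)
  have "(\<Sum>K\<leftarrow>map (\<lambda>K. K * kron (A k) (1\<^sub>m b)) (Ks k). (fnorm (K * X))\<^sup>2) = (fnorm (kron (A k) (1\<^sub>m b) * X))\<^sup>2"
    if k: "k < m" for k
  proof -
    have d: "dim_row (A k) = c k" "dim_col (A k) = a" using locc_alice.hyps(1) k by auto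
    have l: "locc (c k) b a' b' (Ks k)" using locc_alice.IH k by blast
    have "(\<Sum>K\<leftarrow>Ks k. (fnorm (K * kron (A k) (1\<^sub>m b) * X))\<^sup>2) = (\<Sum>K\<leftarrow>Ks k. (fnorm (K * (kron (A k) (1\<^sub>m b) * X)))\<^sup>2)"
      using locc_kraus_dims[OF l] d locc_alice.prems
      by (intro arg_cong[where f = sum_list] map_cong refl) (simp add: mult_assoc_dim)
    also have "\<dots> = (fnorm (kron (A k) (1\<^sub>m b) * X))\<^sup>2" using locc_alice.IH k d by simp
    finally show ?thesis by (simp add: o_def)
  qed
  then have "(\<Sum>K\<leftarrow>concat (map (\<lambda>k. map (\<lambda>K. K * kron (A k) (1\<^sub>m b)) (Ks k)) [0..<m]). (fnorm (K * X))\<^sup>2)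
     = (\<Sum>k<m. (fnorm (kron (A k) (1\<^sub>m b) * X))\<^sup>2)"
    unfolding sum_list_concat_map by simp
  also have "\<dots> = (fnorm X)\<^sup>2"
    using locc_alice.hyps(1) locc_alice.prems
    by (intro kraus_sum_fnorm[where n = "a*b"] msum_kron_left locc_alice.hyps(2)) auto
  finally show ?case .
next
  case (locc_bob m B c b a a' b' Ks)
  have "(\<Sum>K\<leftarrow>map (\<lambda>K. K * kron (1\<^sub>m a) (B k)) (Ks k). (fnorm (K * X))\<^sup>2) = (fnorm (kron (1\<^sub>m a) (B k) * X))\<^sup>2"
    if k: "k < m" for k
  proof -
    have d: "dim_row (B k) = c k" "dim_col (B k) = b" using locc_bob.hyps(1) k by auto
    have l: "locc a (c k) a' b' (Ks k)" using locc_bob.IH k by blast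
    have "(\<Sum>K\<leftarrow>Ks k. (fnorm (K * kron (1\<^sub>m a) (B k) * X))\<^sup>2) = (\<Sum>K\<leftarrow>Ks k. (fnorm (K * (kron (1\<^sub>m a) (B k) * X)))\<^sup>2)"
      using locc_kraus_dims[OF l] d locc_bob.prems
      by (intro arg_cong[where f = sum_list] map_cong refl) (simp add: mult_assoc_dim)
    also have "\<dots> = (fnorm (kron (1\<^sub>m a) (B k) * X))\<^sup>2" using locc_bob.IH k d by simp
    finally show ?thesis by (simp add: o_def)
  qed
  then have "(\<Sum>K\<leftarrow>concat (map (\<lambda>k. map (\<lambda>K. K * kron (1\<^sub>m a) (B k)) (Ks k)) [0..<m]). (fnorm (K * X))\<^sup>2)
     = (\<Sum>k<m. (fnorm (kron (1\<^sub>m a) (B k) * X))\<^sup>2)"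
    unfolding sum_list_concat_map by simp
  also have "\<dots> = (fnorm X)\<^sup>2"
    using locc_bob.hyps(1) locc_bob.prems
    by (intro kraus_sum_fnorm[where n = "a*b"] msum_kron_right locc_bob.hyps(2)) auto
  finally show ?case .
qed simp

lemma apply_kraus_fidelity:
  assumes Ks: "\<And>K. K \<in> set Ks \<Longrightarrow> dim_row K = n \<and> dim_col K = m"
    and X [simp]: "dim_row X = m" and \<phi> [simp]: "dim_vec \<phi> = n"
  shows "Re (cinner \<phi> (apply_kraus n Ks (X * X\<^sup>\<dagger>) *\<^sub>v \<phi>)) = (\<Sum>K\<leftarrow>Ks. (fnorm ((col_mat \<phi>)\<^sup>\<dagger> * (K * X)))\<^sup>2)"
proof -
  have one: "(\<Sum>i<n. \<Sum>j<n. cnj (\<phi> $ i) * (K * (X * X\<^sup>\<dagger>) * K\<^sup>\<dagger>) $$ (i,j) * \<phi> $ j)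
      = complex_of_real ((fnorm ((col_mat \<phi>)\<^sup>\<dagger> * (K * X)))\<^sup>2)" if "K \<in> set Ks" for K
  proof -
    have [simp]: "dim_row K = n" "dim_col K = m" using Ks[OF that] by auto
    have "(\<Sum>i<n. \<Sum>j<n. cnj (\<phi> $ i) * (K * (X * X\<^sup>\<dagger>) * K\<^sup>\<dagger>) $$ (i,j) * \<phi> $ j)
      = cinner \<phi> ((K * (X * X\<^sup>\<dagger>) * K\<^sup>\<dagger>) *\<^sub>v \<phi>)" by (subst cinner_mult_mat_vec) auto
    also have "\<dots> = mtrace (((col_mat \<phi>)\<^sup>\<dagger> * (K * X)) * ((col_mat \<phi>)\<^sup>\<dagger> * (K * X))\<^sup>\<dagger>)"
      by (subst cinner_eq_mtrace) (auto simp: adjoint_mult mult_assoc_dim)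
    finally show ?thesis by (simp only: fnorm_sq_mtrace')
  qed
  have "cinner \<phi> (apply_kraus n Ks (X * X\<^sup>\<dagger>) *\<^sub>v \<phi>)
     = (\<Sum>l<length Ks. \<Sum>i<n. \<Sum>j<n. cnj (\<phi> $ i) * (Ks ! l * (X * X\<^sup>\<dagger>) * (Ks ! l)\<^sup>\<dagger>) $$ (i,j) * \<phi> $ j)"
    unfolding apply_kraus_def
    by (subst cinner_mult_mat_vec)
      (auto simp: sum_distrib_left sum_distrib_right sum.swap[of _ _ "{..<length Ks}"])
  also have "\<dots> = complex_of_real (\<Sum>l<length Ks. (fnorm ((col_mat \<phi>)\<^sup>\<dagger> * (Ks ! l * X)))\<^sup>2)"
    by (simp add: one del: of_real_power)
  finally show ?thesis
    by (simp add: sum_list_sum_nth atLeast0LessThan)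
qed

lemma phi_max_dim [simp]: "dim_vec (phi_max K) = K * K"
  by (simp add: phi_max_def)

lemma phi_max_mult:
  assumes "dim_row M = K * K" "k < dim_col M"
  shows "((col_mat (phi_max K))\<^sup>\<dagger> * M) $$ (0,k) = complex_of_real (1 / sqrt (real K)) * (\<Sum>i<K. M $$ (i * K + i, k))"
proof -
  have "((col_mat (phi_max K))\<^sup>\<dagger> * M) $$ (0,k) = (\<Sum>i<K. \<Sum>j<K. cnj (phi_max K $ (i * K + j)) * M $$ (i * K + j, k))"
    using assms by (simp add: mult_index sum_lessThan_mult)
  also have "\<dots> = (\<Sum>i<K. \<Sum>j<K. if j = i then complex_of_real (1 / sqrt (real K)) * M $$ (i * K + j, k) else 0)"
    by (intro sum.cong refl) (auto simp: phi_max_def)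
  also have "\<dots> = complex_of_real (1 / sqrt (real K)) * (\<Sum>i<K. M $$ (i * K + i, k))"
    by (simp add: sum_distrib_left)
  finally show ?thesis .
qed

lemma contr_phi_max:
  assumes "1 \<le> K" shows "contr ((col_mat (phi_max K))\<^sup>\<dagger>)"
proof -
  let ?\<phi> = "col_mat (phi_max K)"
  have "(?\<phi>\<^sup>\<dagger> * ?\<phi>) $$ (0,0) = 1"
    using assms by (subst phi_max_mult) (auto simp: phi_max_def simp flip: of_real_mult)
  then have one: "?\<phi>\<^sup>\<dagger> * ?\<phi> = 1\<^sub>m 1" by (intro eq_matI) auto
  have "?\<phi> * ?\<phi>\<^sup>\<dagger> * (?\<phi> * ?\<phi>\<^sup>\<dagger>) = ?\<phi> * (?\<phi>\<^sup>\<dagger> * ?\<phi>) * ?\<phi>\<^sup>\<dagger>" by (simp add: mult_assoc_dim)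
  then have "?\<phi> * ?\<phi>\<^sup>\<dagger> * (?\<phi> * ?\<phi>\<^sup>\<dagger>) = ?\<phi> * ?\<phi>\<^sup>\<dagger>" unfolding one by simp
  then show ?thesis by (intro contr_partial_isometry) simp
qed

text \<open>The overlap of a product vector with the maximally entangled one is the sum of
  \<open>a k i * b k i\<close> divided by the root of \<open>K\<close>; Cauchy-Schwarz bounds its
  square by the squared norm of the product vector over \<open>K\<close>. This is how the target
  size limits separable inputs.\<close>

lemma phi_max_product_cols:
  assumes "1 \<le> K"
  shows "(fnorm ((col_mat (phi_max K))\<^sup>\<dagger> * product_cols K K \<kappa> a b))\<^sup>2 \<le> (fnorm (product_cols K K \<kappa> a b))\<^sup>2 / real K"
proof -
  have "(cmod (((col_mat (phi_max K))\<^sup>\<dagger> * product_cols K K \<kappa> a b) $$ (0,k)))\<^sup>2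
      \<le> (\<Sum>i<K. (cmod (a k i))\<^sup>2) * (\<Sum>j<K. (cmod (b k j))\<^sup>2) / real K" if k: "k < \<kappa>" for k
  proof -
    have "cmod (\<Sum>i<K. a k i * b k i) \<le> (\<Sum>i<K. \<bar>cmod (a k i)\<bar> * \<bar>cmod (b k i)\<bar>)"
      by (rule order_trans[OF norm_sum]) (simp add: norm_mult)
    also have "\<dots> \<le> L2_set (\<lambda>i. cmod (a k i)) {..<K} * L2_set (\<lambda>i. cmod (b k i)) {..<K}"
      by (rule L2_set_mult_ineq)
    finally have "(cmod (\<Sum>i<K. a k i * b k i))\<^sup>2 \<le> (L2_set (\<lambda>i. cmod (a k i)) {..<K} * L2_set (\<lambda>i. cmod (b k i)) {..<K})\<^sup>2"
      by (rule power_mono) simp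
    also have "\<dots> = (\<Sum>i<K. (cmod (a k i))\<^sup>2) * (\<Sum>j<K. (cmod (b k j))\<^sup>2)"
      unfolding L2_set_def power_mult_distrib by (simp add: sum_nonneg)
    finally have *: "(cmod (\<Sum>i<K. a k i * b k i))\<^sup>2 \<le> (\<Sum>i<K. (cmod (a k i))\<^sup>2) * (\<Sum>j<K. (cmod (b k j))\<^sup>2)" .
    have "((col_mat (phi_max K))\<^sup>\<dagger> * product_cols K K \<kappa> a b) $$ (0,k) = complex_of_real (1 / sqrt (real K)) * (\<Sum>i<K. a k i * b k i)"
      using k by (subst phi_max_mult) auto
    then have "(cmod (((col_mat (phi_max K))\<^sup>\<dagger> * product_cols K K \<kappa> a b) $$ (0,k)))\<^sup>2 = (cmod (\<Sum>i<K. a k i * b k i))\<^sup>2 / real K"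
      by (simp add: norm_mult norm_divide power_mult_distrib power_divide)
    then show ?thesis using * by (simp add: divide_right_mono)
  qed
  then have "(fnorm ((col_mat (phi_max K))\<^sup>\<dagger> * product_cols K K \<kappa> a b))\<^sup>2
      \<le> (\<Sum>k<\<kappa>. (\<Sum>i<K. (cmod (a k i))\<^sup>2) * (\<Sum>j<K. (cmod (b k j))\<^sup>2) / real K)"
    unfolding fnorm_sq by (auto intro!: sum_mono)
  also have "\<dots> = (fnorm (product_cols K K \<kappa> a b))\<^sup>2 / real K"
    unfolding fnorm_sq by (simp add: sum.swap[of _ _ "{..<\<kappa>}"] sum_lessThan_mult sum_product norm_mult power_mult_distrib sum_divide_distrib)
  finally show ?thesis .
qed

lemma kron_mult_product_cols:
  assumes "dim_row A = a'" "dim_col A = a" "dim_row B = b'" "dim_col B = b"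
  shows "kron A B * product_cols a b \<kappa> u v
    = product_cols a' b' \<kappa> (\<lambda>k i. \<Sum>l<a. A $$ (i,l) * u k l) (\<lambda>k j. \<Sum>l<b. B $$ (j,l) * v k l)"
  by (rule eq_matI)
    (use assms in \<open>auto simp: mult_index kron_index sum_lessThan_mult sum_product algebra_simps intro!: sum.cong\<close>)

text \<open>\<open>M\<close> stacks the row vectors \<open>\<langle>\<phi>| K\<close> over all Kraus operators \<open>K\<close>, so that \<open>M\<^sup>\<dagger> M\<close> is the
  test that the protocol performs.\<close>
lemma locc_test_operator:
  assumes locc: "locc a b K K Ks" and K: "1 \<le> K"
  obtains M where "dim_col M = a * b" "contr M"
    "\<And>X. dim_row X = a * b \<Longrightarrow>
       Re (cinner (phi_max K) (apply_kraus (K * K) Ks (X * X\<^sup>\<dagger>) *\<^sub>v phi_max K)) = (fnorm (M * X))\<^sup>2"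
    "\<And>\<kappa> u v. (fnorm (M * product_cols a b \<kappa> u v))\<^sup>2 \<le> (fnorm (product_cols a b \<kappa> u v))\<^sup>2 / real K"
proof -
  let ?\<phi> = "col_mat (phi_max K)"
  define M where "M = mat (length Ks) (a * b) (\<lambda>(l,j). (?\<phi>\<^sup>\<dagger> * Ks ! l) $$ (0,j))"
  note dims = locc_kraus_dims[OF locc]
  have MX: "(fnorm (M * X))\<^sup>2 = (\<Sum>K\<leftarrow>Ks. (fnorm (?\<phi>\<^sup>\<dagger> * (K * X)))\<^sup>2)" if X: "dim_row X = a * b" for X
  proof -
    have "(M * X) $$ (l,c) = (?\<phi>\<^sup>\<dagger> * (Ks ! l * X)) $$ (0,c)" if "l < length Ks" "c < dim_col X" for l c
    proof -
      have d: "dim_row (Ks ! l) = K * K" "dim_col (Ks ! l) = a * b" using dims that by auto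
      have "(?\<phi>\<^sup>\<dagger> * (Ks ! l * X)) $$ (0,c) = (?\<phi>\<^sup>\<dagger> * Ks ! l * X) $$ (0,c)"
        using d X by (simp add: mult_assoc_dim)
      also have "\<dots> = (\<Sum>k<a*b. (?\<phi>\<^sup>\<dagger> * Ks ! l) $$ (0,k) * X $$ (k,c))"
        using d X that by (subst mult_index) auto
      also have "\<dots> = (M * X) $$ (l,c)"
        using X that by (subst mult_index) (auto simp: M_def)
      finally show ?thesis by simp
    qed
    moreover have "dim_row (M * X) = length Ks" by (simp add: M_def)
    ultimately show ?thesis
      unfolding fnorm_sq by (simp add: sum_list_sum_nth atLeast0LessThan)
  qed
  show ?thesis
  proof (rule that[of M])
    show M: "dim_col M = a * b" by (simp add: M_def)
    show "contr M" unfolding contr_def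
    proof (intro allI impI)
      fix X :: "complex mat" assume "dim_row X = dim_col M"
      then have X: "dim_row X = a * b" by (simp add: M_def)
      have "(fnorm (M * X))\<^sup>2 \<le> (\<Sum>K\<leftarrow>Ks. (fnorm (K * X))\<^sup>2)"
        unfolding MX[OF X] using dims(1)
        by (intro sum_list_mono power_mono contrD[OF contr_phi_max[OF K]]) auto
      also have "\<dots> = (fnorm X)\<^sup>2" by (rule locc_trace_preserving[OF locc X])
      finally show "fnorm (M * X) \<le> fnorm X" by (rule power2_le_imp_le) simp
    qed
    show "Re (cinner (phi_max K) (apply_kraus (K * K) Ks (X * X\<^sup>\<dagger>) *\<^sub>v phi_max K)) = (fnorm (M * X))\<^sup>2"
      if "dim_row X = a * b" for X
      unfolding MX[OF that] using dims that by (intro apply_kraus_fidelity) auto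
    fix \<kappa> u v
    let ?Y = "product_cols a b \<kappa> u v"
    have "(fnorm (M * ?Y))\<^sup>2 = (\<Sum>K\<leftarrow>Ks. (fnorm (?\<phi>\<^sup>\<dagger> * (K * ?Y)))\<^sup>2)" by (rule MX) simp
    also have "\<dots> \<le> (\<Sum>Kr\<leftarrow>Ks. (fnorm (Kr * ?Y))\<^sup>2 / real K)"
    proof (rule sum_list_mono)
      fix Kr assume "Kr \<in> set Ks"
      then obtain A B where "dim_row A = K" "dim_col A = a" "dim_row B = K" "dim_col B = b" "Kr = kron A B"
        using locc_kraus_product[OF locc] by blast
      then show "(fnorm (?\<phi>\<^sup>\<dagger> * (Kr * ?Y)))\<^sup>2 \<le> (fnorm (Kr * ?Y))\<^sup>2 / real K"
        using phi_max_product_cols[OF K] by (simp add: kron_mult_product_cols)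
    qed
    also have "\<dots> = (\<Sum>Kr\<leftarrow>Ks. (fnorm (Kr * ?Y))\<^sup>2) / real K"
      by (simp add: divide_inverse sum_list_mult_const)
    also have "\<dots> = (fnorm ?Y)\<^sup>2 / real K" by (simp add: locc_trace_preserving[OF locc])
    finally show "(fnorm (M * ?Y))\<^sup>2 \<le> (fnorm ?Y)\<^sup>2 / real K" .
  qed
qed

section \<open>Spectral projectors and the test bound\<close>

definition spectral_projector :: "nat \<Rightarrow> complex mat \<Rightarrow> (nat \<Rightarrow> bool) \<Rightarrow> complex mat" where
  "spectral_projector n V \<chi> = V * mat_diag n (\<lambda>i. complex_of_real (if \<chi> i then 1 else 0)) * V\<^sup>\<dagger>"

lemma spectral_projector:
  assumes V: "unitary n V"
  shows "dim_row (spectral_projector n V \<chi>) = n" "dim_col (spectral_projector n V \<chi>) = n"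
    "(spectral_projector n V \<chi>)\<^sup>\<dagger> = spectral_projector n V \<chi>"
    "spectral_projector n V \<chi> * spectral_projector n V \<chi> = spectral_projector n V \<chi>"
    "contr (spectral_projector n V \<chi>)"
proof -
  note [simp] = unitaryD(1,2)[OF V]
  show *: "dim_row (spectral_projector n V \<chi>) = n" "dim_col (spectral_projector n V \<chi>) = n"
    by (simp_all add: spectral_projector_def)
  show a: "(spectral_projector n V \<chi>)\<^sup>\<dagger> = spectral_projector n V \<chi>"
    unfolding spectral_projector_def diag_conj_adjoint[OF V] by simp
  show b: "spectral_projector n V \<chi> * spectral_projector n V \<chi> = spectral_projector n V \<chi>"
    unfolding spectral_projector_def diag_conj_mult[OF V]
    by (rule arg_cong[where f = "\<lambda>D. V * D * V\<^sup>\<dagger>"]) (auto intro!: eq_matI)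
  show "contr (spectral_projector n V \<chi>)" by (rule contr_projection[OF * a b])
qed

lemma spectral_projector_mult:
  assumes V: "unitary n V" and "dim_row X = n"
  shows "fnorm (spectral_projector n V \<chi> * X) = fnorm (mat_diag n (\<lambda>i. complex_of_real (if \<chi> i then 1 else 0)) * (V\<^sup>\<dagger> * X))"
proof -
  note [simp] = unitaryD(1,2)[OF V] assms(2)
  have "spectral_projector n V \<chi> * X = V * (mat_diag n (\<lambda>i. complex_of_real (if \<chi> i then 1 else 0)) * (V\<^sup>\<dagger> * X))"
    by (simp add: spectral_projector_def mult_assoc_dim)
  then show ?thesis by (simp add: fnorm_unitary_mult[OF V])
qed

lemma spectral_projector_complement:
  assumes V: "unitary n V" and [simp]: "dim_row X = n"
  shows "X - spectral_projector n V \<chi> * X = spectral_projector n V (\<lambda>i. \<not> \<chi> i) * X"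
proof -
  note [simp] = unitaryD[OF V] spectral_projector(1,2)[OF V]
  have "mat_diag n (\<lambda>i. complex_of_real (if \<not> \<chi> i then 1 else 0)) = 1\<^sub>m n - mat_diag n (\<lambda>i. complex_of_real (if \<chi> i then 1 else 0))"
    by (rule eq_matI) auto
  then have "spectral_projector n V (\<lambda>i. \<not> \<chi> i) = V * (1\<^sub>m n - mat_diag n (\<lambda>i. complex_of_real (if \<chi> i then 1 else 0))) * V\<^sup>\<dagger>"
    by (simp add: spectral_projector_def)
  also have "\<dots> = 1\<^sub>m n - spectral_projector n V \<chi>"
    unfolding spectral_projector_def by (simp add: mult_minus_distrib_dim minus_mult_distrib_dim)
  finally show ?thesis by (simp add: minus_mult_distrib_dim)
qed

text \<open>Only the diagonal of the state in the eigenbasis \<open>V\<close> matters, even when the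
  state does not commute with the projector.\<close>

lemma fnorm_spectral_projector_sq:
  assumes V: "unitary n V" and [simp]: "dim_row X = n"
  shows "(fnorm (spectral_projector n V \<chi> * X))\<^sup>2 = (\<Sum>i<n. if \<chi> i then Re ((V\<^sup>\<dagger> * (X * X\<^sup>\<dagger>) * V) $$ (i,i)) else 0)"
proof -
  note [simp] = unitaryD(1,2)[OF V]
  have "(V\<^sup>\<dagger> * (X * X\<^sup>\<dagger>) * V) $$ (i,i) = complex_of_real (\<Sum>j<dim_col X. (cmod ((V\<^sup>\<dagger> * X) $$ (i,j)))\<^sup>2)" if "i < n" for i
  proof -
    have eq: "V\<^sup>\<dagger> * (X * X\<^sup>\<dagger>) * V = (V\<^sup>\<dagger> * X) * (V\<^sup>\<dagger> * X)\<^sup>\<dagger>" by (simp add: adjoint_mult mult_assoc_dim)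
    have "(V\<^sup>\<dagger> * (X * X\<^sup>\<dagger>) * V) $$ (i,i) = (\<Sum>j<dim_col X. (V\<^sup>\<dagger> * X) $$ (i,j) * cnj ((V\<^sup>\<dagger> * X) $$ (i,j)))"
      unfolding eq using that by (subst mult_index) auto
    then show ?thesis by (simp add: complex_norm_square del: of_real_power)
  qed
  then show ?thesis
    unfolding spectral_projector_mult[OF assms] fnorm_sq
    by (auto simp: mat_diag_mult_index intro!: sum.cong)
qed

text \<open>The norm depends on the factor only through its Gram matrix. This permits switching
  between the product-vector factor of a separable state and its eigenvector factor.\<close>

lemma fnorm_mult_gram_cong:
  assumes "X * X\<^sup>\<dagger> = Y * Y\<^sup>\<dagger>" "dim_row X = dim_col M" "dim_row Y = dim_col M"
  shows "fnorm (M * X) = fnorm (M * Y)"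
proof -
  have "(M * X) * (M * X)\<^sup>\<dagger> = M * (X * X\<^sup>\<dagger>) * M\<^sup>\<dagger>" using assms(2,3) by (simp add: adjoint_mult mult_assoc_dim)
  also have "\<dots> = (M * Y) * (M * Y)\<^sup>\<dagger>" unfolding assms(1) using assms(2,3) by (simp add: adjoint_mult mult_assoc_dim)
  finally have "complex_of_real ((fnorm (M * X))\<^sup>2) = complex_of_real ((fnorm (M * Y))\<^sup>2)"
    unfolding fnorm_sq_mtrace'[symmetric] by simp
  then have "(fnorm (M * X))\<^sup>2 = (fnorm (M * Y))\<^sup>2" by (simp only: of_real_eq_iff)
  then show ?thesis by (simp add: power2_eq_iff_nonneg)
qed

lemma diag_sqrt_gram:
  assumes U: "unitary n U" and p: "\<And>i. i < n \<Longrightarrow> 0 \<le> p i"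
  shows "(U * mat_diag n (\<lambda>i. complex_of_real (sqrt (p i)))) * (U * mat_diag n (\<lambda>i. complex_of_real (sqrt (p i))))\<^sup>\<dagger>
    = U * mat_diag n (\<lambda>i. complex_of_real (p i)) * U\<^sup>\<dagger>"
proof -
  note [simp] = unitaryD(1,2)[OF U]
  have "mat_diag n (\<lambda>i. complex_of_real (sqrt (p i)) * complex_of_real (sqrt (p i))) = mat_diag n (\<lambda>i. complex_of_real (p i))"
    by (rule eq_matI) (use p in \<open>auto simp flip: of_real_mult\<close>)
  moreover have "mat_diag n (\<lambda>i. complex_of_real (sqrt (p i))) * (mat_diag n (\<lambda>i. complex_of_real (sqrt (p i))) * U\<^sup>\<dagger>)
     = mat_diag n (\<lambda>i. complex_of_real (sqrt (p i)) * complex_of_real (sqrt (p i))) * U\<^sup>\<dagger>"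
    by (subst mult_assoc_dim[symmetric]) auto
  ultimately show ?thesis by (simp add: adjoint_mult mult_assoc_dim)
qed

text \<open>A test that accepts \<open>\<rho> = U p U\<^sup>\<dagger>\<close> with high probability accepts \<open>\<sigma> = V s V\<^sup>\<dagger>\<close> with
  probability at least about \<open>\<mu> / \<nu>\<close>, because up to atypical parts \<open>\<rho> \<le> \<nu> Q\<close> and \<open>\<mu> Q \<le> \<sigma>\<close>
  for the projector \<open>Q\<close> on the eigenvalues of \<open>\<sigma>\<close> above \<open>\<mu>\<close>.\<close>
lemma test_converse:
  assumes U: "unitary n U" and V: "unitary n V"
    and p: "\<And>i. i < n \<Longrightarrow> 0 \<le> p i" and s: "\<And>i. i < n \<Longrightarrow> 0 \<le> s i"
    and M: "contr M" and [simp]: "dim_col M = n" and \<nu>: "0 < \<nu>" and \<mu>: "0 < \<mu>"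
  defines "X \<equiv> U * mat_diag n (\<lambda>i. complex_of_real (sqrt (p i)))"
    and "Y \<equiv> V * mat_diag n (\<lambda>i. complex_of_real (sqrt (s i)))"
  shows "fnorm (M * X) \<le> sqrt (\<nu> / \<mu>) * fnorm (M * Y)
    + sqrt (\<Sum>i<n. if s i < \<mu> then Re ((V\<^sup>\<dagger> * (X * X\<^sup>\<dagger>) * V) $$ (i,i)) else 0)
    + sqrt (\<Sum>i<n. if \<nu> < p i then p i else 0)"
proof -
  note [simp] = unitaryD(1,2)[OF U] unitaryD(1,2)[OF V]
  define Q where "Q = spectral_projector n V (\<lambda>i. \<not> s i < \<mu>)"
  \<comment> \<open>\<open>X'\<close> drops the eigenvalues of the first state above
    \<open>\<nu>\<close>, so every diagonal weight left has square at most
    \<open>\<nu>\<close>.\<close>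
  define X' where "X' = U * mat_diag n (\<lambda>i. complex_of_real (if \<nu> < p i then 0 else sqrt (p i)))"
  note Q = spectral_projector[OF V, of "\<lambda>i. \<not> s i < \<mu>", folded Q_def]
  note [simp] = Q(1,2)
  have [simp]: "dim_row X = n" "dim_col X = n" "dim_row X' = n" "dim_col X' = n" by (simp_all add: X_def X'_def)
  have 1: "fnorm (X - Q * X) = sqrt (\<Sum>i<n. if s i < \<mu> then Re ((V\<^sup>\<dagger> * (X * X\<^sup>\<dagger>) * V) $$ (i,i)) else 0)"
  proof -
    have "X - Q * X = spectral_projector n V (\<lambda>i. s i < \<mu>) * X"
      unfolding Q_def by (subst spectral_projector_complement[OF V]) auto
    then have "(fnorm (X - Q * X))\<^sup>2 = (\<Sum>i<n. if s i < \<mu> then Re ((V\<^sup>\<dagger> * (X * X\<^sup>\<dagger>) * V) $$ (i,i)) else 0)"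
      using fnorm_spectral_projector_sq[OF V, of X "\<lambda>i. s i < \<mu>"] by simp
    then show ?thesis by (rule real_sqrt_unique[symmetric]) simp
  qed
  have 2: "fnorm (X - X') = sqrt (\<Sum>i<n. if \<nu> < p i then p i else 0)"
  proof -
    have "X - X' = U * mat_diag n (\<lambda>i. complex_of_real (if \<nu> < p i then sqrt (p i) else 0))"
      unfolding X_def X'_def
      by (subst mult_minus_distrib_dim[symmetric]) (auto intro!: arg_cong[where f = "\<lambda>D. U * D"] eq_matI)
    then have "fnorm (X - X') = fnorm (1\<^sub>m n * mat_diag n (\<lambda>i. complex_of_real (if \<nu> < p i then sqrt (p i) else 0)))"
      by (simp add: fnorm_unitary_mult[OF U])
    moreover have "(fnorm (1\<^sub>m n * mat_diag n (\<lambda>i. complex_of_real (if \<nu> < p i then sqrt (p i) else 0))))\<^sup>2 = (\<Sum>i<n. if \<nu> < p i then p i else 0)"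
      by (subst fnorm_mult_diag_sq) (auto intro!: sum.cong simp: if_distrib[of cmod] if_distrib[of "\<lambda>x. x\<^sup>2"] p sum.delta cong: if_cong)
    ultimately have "(fnorm (X - X'))\<^sup>2 = (\<Sum>i<n. if \<nu> < p i then p i else 0)" by simp
    then show ?thesis by (rule real_sqrt_unique[symmetric]) simp
  qed
  have 3: "(fnorm (M * Q * X'))\<^sup>2 \<le> \<nu> * (fnorm (M * Q))\<^sup>2"
  proof -
    have "(fnorm (M * Q * X'))\<^sup>2 = (fnorm (M * Q * U * mat_diag n (\<lambda>i. complex_of_real (if \<nu> < p i then 0 else sqrt (p i)))))\<^sup>2"
      by (simp add: X'_def mult_assoc_dim)
    also have "\<dots> \<le> \<nu> * (fnorm (M * Q * U))\<^sup>2"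
      by (rule fnorm_mult_diag_le) (use \<nu> p in auto)
    also have "fnorm (M * Q * U) = fnorm (M * Q)" by (rule fnorm_mult_unitary[OF U]) simp
    finally show ?thesis .
  qed
  \<comment> \<open>The operator inequality between \<open>\<mu>\<close> times \<open>Q\<close> and
    the second state, in Gram form: on the columns kept by \<open>Q\<close> the eigenvalue is at
    least \<open>\<mu>\<close>.\<close>
  have 4: "\<mu> * (fnorm (M * Q))\<^sup>2 \<le> (fnorm (M * Y))\<^sup>2"
  proof -
    have "fnorm (M * Q) = fnorm (M * Q * V)" by (rule fnorm_mult_unitary[OF V, symmetric]) simp
    also have "M * Q * V = M * V * mat_diag n (\<lambda>i. complex_of_real (if \<not> s i < \<mu> then 1 else 0))"
      unfolding Q_def spectral_projector_def by (simp add: mult_assoc_dim unitaryD(4)[OF V])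
    finally have "\<mu> * (fnorm (M * Q))\<^sup>2 = (\<Sum>j<n. \<mu> * (if \<not> s j < \<mu> then 1 else 0) * (\<Sum>i<dim_row M. (cmod ((M * V) $$ (i,j)))\<^sup>2))"
      by (simp add: fnorm_mult_diag_sq sum_distrib_left) (auto intro!: sum.cong)
    also have "\<dots> \<le> (\<Sum>j<n. s j * (\<Sum>i<dim_row M. (cmod ((M * V) $$ (i,j)))\<^sup>2))"
      by (intro sum_mono mult_right_mono) (use s in \<open>auto intro: sum_nonneg\<close>)
    also have "\<dots> = (fnorm (M * V * mat_diag n (\<lambda>i. complex_of_real (sqrt (s i)))))\<^sup>2"
      by (subst fnorm_mult_diag_sq) (auto simp: s)
    also have "M * V * mat_diag n (\<lambda>i. complex_of_real (sqrt (s i))) = M * Y" by (simp add: Y_def mult_assoc_dim)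
    finally show ?thesis .
  qed
  have "(fnorm (M * Q * X'))\<^sup>2 \<le> \<nu> / \<mu> * (fnorm (M * Y))\<^sup>2"
    using 3 mult_left_mono[OF 4, of "\<nu> / \<mu>"] \<nu> \<mu> by simp
  then have 6: "(fnorm (M * Q * X'))\<^sup>2 \<le> (sqrt (\<nu> / \<mu>) * fnorm (M * Y))\<^sup>2"
    using \<nu> \<mu> by (simp add: power_mult_distrib)
  have 5: "fnorm (M * (Q * X')) \<le> sqrt (\<nu> / \<mu>) * fnorm (M * Y)"
  proof (rule power2_le_imp_le)
    show "(fnorm (M * (Q * X')))\<^sup>2 \<le> (sqrt (\<nu> / \<mu>) * fnorm (M * Y))\<^sup>2"
      using 6 by (simp add: mult_assoc_dim)
  qed (use \<nu> \<mu> in simp)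
  \<comment> \<open>Replacing \<open>X\<close> by \<open>Q * X'\<close> costs the part of
    \<open>X\<close> outside \<open>Q\<close> and the dropped eigenvalues, each once, because
    \<open>M\<close> and \<open>Q\<close> are contractions.\<close>
  have "fnorm (M * X) \<le> fnorm (M * (Q * X')) + fnorm (M * X - M * (Q * X'))"
    by (rule fnorm_le_add_diff) auto
  also have "M * X - M * (Q * X') = M * (X - Q * X')" by (simp add: mult_minus_distrib_dim)
  also have "fnorm (M * (X - Q * X')) \<le> fnorm (X - Q * X')" by (rule contrD[OF M]) simp
  also have "\<dots> \<le> fnorm (X - Q * X) + fnorm (Q * X - Q * X')" by (rule fnorm_diff_triangle) auto
  also have "Q * X - Q * X' = Q * (X - X')" by (simp add: mult_minus_distrib_dim)
  also have "fnorm (Q * (X - X')) \<le> fnorm (X - X')" by (rule contrD[OF Q(5)]) simp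
  finally show ?thesis using 5 unfolding 1 2 by linarith
qed

section \<open>Converse: rates are bounded by the relative entropy to separable states\<close>

text \<open>Powers of a separable state stay separable: the reordering in \<open>digit2\<close>
  collects all digits of the first party in front of those of the second, and a product of product
  vectors splits accordingly.\<close>

lemma tensor_power_product_cols:
  "tensor_power n (dX^n * dY^n) (digit2 dX dY n) (\<kappa>^n) (digit \<kappa>) (product_cols dX dY \<kappa> a b)
   = product_cols (dX^n) (dY^n) (\<kappa>^n) (\<lambda>k x. \<Prod>t<n. a (digit \<kappa> t k) (digit dX t x)) (\<lambda>k y. \<Prod>t<n. b (digit \<kappa> t k) (digit dY t y))"
  (is "?L = ?R")
proof (rule eq_matI)
  fix i k assume "i < dim_row ?R" "k < dim_col ?R"
  then have ik: "i < dX^n * dY^n" "k < \<kappa>^n" by auto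
  have "product_cols dX dY \<kappa> a b $$ (digit2 dX dY n t i, digit \<kappa> t k)
     = a (digit \<kappa> t k) (digit dX t (i div dY^n)) * b (digit \<kappa> t k) (digit dY t (i mod dY^n))" if t: "t < n" for t
  proof -
    have "digit dY t (i mod dY^n) < dY"
      by (rule product_index_less[OF product_index_digit pair_index_bounds(2)[OF ik(1)] t])
    then show ?thesis
      using product_index_less[OF product_index_digit2 ik(1) t] product_index_less[OF product_index_digit ik(2) t]
      by (simp add: digit2_def)
  qed
  then show "?L $$ (i,k) = ?R $$ (i,k)" using ik by (simp add: prod.distrib)
qed auto

lemma tensor_power_gram:
  assumes "product_index n D (dim_row A) e" "product_index n C (dim_col A) h"
  shows "tensor_power n D e C h A * (tensor_power n D e C h A)\<^sup>\<dagger> = tensor_power n D e D e (A * A\<^sup>\<dagger>)"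
  using assms by (simp add: tensor_power_adjoint tensor_power_mult)

text \<open>The diagonal of \<open>\<rho>\<close> in the eigenbasis of \<open>\<sigma>\<close> is the distribution against which the typicality of
  the eigenvalues of \<open>\<sigma>\<close> is measured.\<close>
lemma rel_entropy_diagonal:
  assumes \<rho>: "density n \<rho>" and \<sigma>: "psd n \<sigma>" and sd: "spec_decomp \<sigma> V s"
    and supp: "\<forall>v\<in>carrier_vec (dim_row \<sigma>). \<sigma> *\<^sub>v v = 0\<^sub>v (dim_row \<sigma>) \<longrightarrow> \<rho> *\<^sub>v v = 0\<^sub>v (dim_row \<rho>)"
  obtains q where "\<And>k. k < n \<Longrightarrow> (V\<^sup>\<dagger> * \<rho> * V) $$ (k,k) = complex_of_real (q k)" "\<And>k. k < n \<Longrightarrow> 0 \<le> q k"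
    "(\<Sum>k<n. q k) = 1" "\<And>k. k < n \<Longrightarrow> 0 < q k \<Longrightarrow> 0 < s k"
    "(\<Sum>k<n. q k * log 2 (s k)) = Re (mtrace (\<rho> * mfun (\<lambda>x. if 0 < x then log 2 x else 0) \<sigma>))"
proof -
  note \<rho>' = densityD(1)[OF \<rho>]
  note V = spec_decompD[OF sd psdD(1)[OF \<sigma>]]
  note [simp] = psdD(1,2)[OF \<rho>'] psdD(1,2)[OF \<sigma>] unitaryD(1,2)[OF V(1)]
  define R where "R = mfun sqrt \<rho>"
  note R = psd_sqrt[OF \<rho>', folded R_def]
  note [simp] = psdD(1-3)[OF R(1)]
  define G where "G = V\<^sup>\<dagger> * \<rho> * V"
  have [simp]: "dim_row G = n" "dim_col G = n" by (simp_all add: G_def)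
  define q where "q k = (\<Sum>j<n. (cmod ((R * V) $$ (j,k)))\<^sup>2)" for k
  have G: "G = (R * V)\<^sup>\<dagger> * (R * V)"
    unfolding G_def R(2)[symmetric] by (simp add: adjoint_mult mult_assoc_dim)
  have q: "G $$ (k,k) = complex_of_real (q k)" if "k < n" for k
    unfolding G q_def using that
    by (subst mult_index) (auto simp: complex_norm_square mult.commute simp del: of_real_power)
  have q0: "0 \<le> q k" for k unfolding q_def by (intro sum_nonneg) simp
  have "complex_of_real (\<Sum>k<n. q k) = mtrace G" unfolding mtrace_def by (simp add: q)
  also have "\<dots> = mtrace \<rho>"
    unfolding G_def using mtrace_unitary_conj[OF unitary_adjoint[OF V(1)], of \<rho>] by simp
  also have "\<dots> = complex_of_real 1" using densityD(2)[OF \<rho>] by simp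
  finally have q1: "(\<Sum>k<n. q k) = 1" by (simp only: of_real_eq_iff)
  have s0: "0 \<le> s k" if "k < n" for k by (rule psd_spec_decomp_nonneg[OF \<sigma> sd that])
  \<comment> \<open>The support condition leaves no weight of \<open>\<rho>\<close> on the kernel of
    \<open>\<sigma>\<close>, so the value 0 that the truncated logarithm takes there never
    matters.\<close>
  have qs: "q k = 0" if k: "k < n" "s k = 0" for k
  proof -
    have \<sigma>V: "\<sigma> * V = V * mat_diag n (\<lambda>i. complex_of_real (s i))"
      by (subst V(2)) (simp add: mult_assoc_dim unitaryD(4)[OF V(1)])
    have "\<sigma> *\<^sub>v col V k = 0\<^sub>v n"
    proof (rule eq_vecI)
      fix i assume "i < dim_vec (0\<^sub>v n :: complex vec)"
      then have i: "i < n" by simp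
      have "(\<sigma> *\<^sub>v col V k) $ i = (\<sigma> * V) $$ (i,k)" using i k by (simp add: index_mult_mat(1))
      also have "\<dots> = 0" unfolding \<sigma>V using i k by (simp add: mult_mat_diag_index)
      finally show "(\<sigma> *\<^sub>v col V k) $ i = 0\<^sub>v n $ i" using i by simp
    qed simp
    moreover have "col V k \<in> carrier_vec n" by (rule carrier_vecI) simp
    ultimately have *: "\<rho> *\<^sub>v col V k = 0\<^sub>v n" using supp by simp
    have z: "(\<rho> * V) $$ (i,k) = 0" if "i < n" for i
      using arg_cong[OF *, of "\<lambda>v. v $ i"] that k by (simp add: index_mult_mat(1))
    have "G = V\<^sup>\<dagger> * (\<rho> * V)" by (simp add: G_def mult_assoc_dim)
    then have "G $$ (k,k) = 0" using k z by (simp add: mult_index[of k "V\<^sup>\<dagger>"])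
    then show ?thesis using q[OF k(1)] by simp
  qed
  define f where "f x = (if 0 < x then log 2 x else 0)" for x :: real
  have "mtrace (\<rho> * mfun f \<sigma>) = mtrace (\<rho> * V * mat_diag n (\<lambda>i. complex_of_real (f (s i))) * V\<^sup>\<dagger>)"
    using mfun_spec_decomp[OF sd, of f] by (simp add: mult_assoc_dim)
  also have "\<dots> = mtrace (G * mat_diag n (\<lambda>i. complex_of_real (f (s i))))"
    unfolding G_def by (subst mtrace_cyclic) (simp_all add: mult_assoc_dim)
  also have "\<dots> = complex_of_real (\<Sum>k<n. q k * f (s k))"
    unfolding mtrace_def by (simp add: mult_mat_diag_index q)
  also have "(\<Sum>k<n. q k * f (s k)) = (\<Sum>k<n. q k * log 2 (s k))"
  proof (intro sum.cong refl)
    fix k assume "k \<in> {..<n}"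
    then have k: "k < n" by simp
    show "q k * f (s k) = q k * log 2 (s k)"
      using qs[OF k] s0[OF k] by (cases "s k = 0") (auto simp: f_def)
  qed
  finally have "(\<Sum>k<n. q k * log 2 (s k)) = Re (mtrace (\<rho> * mfun f \<sigma>))" by simp
  moreover have "0 < s k" if "k < n" "0 < q k" for k
    using qs[OF that(1)] s0[OF that(1)] that(2) by (cases "s k = 0") auto
  ultimately show ?thesis using that[of q] q q0 q1 unfolding G_def f_def by blast
qed

lemma vN_entropy_eq_sum_log:
  assumes \<rho>: "psd n \<rho>" and sd: "spec_decomp \<rho> U p"
  shows "(\<Sum>i<n. p i * log 2 (1 / p i)) = vN_entropy \<rho>"
proof -
  have "eta (p i) = p i * log 2 (1 / p i)" if "i < n" for i
    using psd_spec_decomp_nonneg[OF \<rho> sd that] by (auto simp: eta_def log_divide)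
  then show ?thesis using vN_entropy_spec_decomp[OF sd] psdD(1)[OF \<rho>] by simp
qed

text \<open>The test accepts the separable power with probability at most
  \<open>1 / real (K n)\<close>, and typicality limits the ratio of the two acceptance probabilities
  to about 2 to the power of \<open>n\<close> times the relative entropy. A larger rate would
  therefore drive the fidelity to 0 instead of 1.\<close>

theorem distill_rate_le_rel_entropy:
  assumes \<rho>: "density (dX * dY) \<rho>" and sep: "sep_state dX dY \<sigma>" and rate: "distill_rate dX dY \<rho> r"
  shows "ereal r \<le> rel_entropy \<rho> \<sigma>"
proof (cases "\<forall>v\<in>carrier_vec (dim_row \<sigma>). \<sigma> *\<^sub>v v = 0\<^sub>v (dim_row \<sigma>) \<longrightarrow> \<rho> *\<^sub>v v = 0\<^sub>v (dim_row \<rho>)")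
  case False
  then show ?thesis unfolding rel_entropy_def by (subst if_not_P) auto
next
  case supp: True
  define d where "d = dX * dY"
  have \<rho>d: "density d \<rho>" using \<rho> by (simp add: d_def)
  note \<rho>' = densityD(1)[OF \<rho>d]
  obtain \<kappa> a b where \<sigma>: "\<sigma> = product_cols dX dY \<kappa> a b * (product_cols dX dY \<kappa> a b)\<^sup>\<dagger>"
    and Y1: "fnorm (product_cols dX dY \<kappa> a b) = 1" using sep_state_pure[OF sep] by metis
  have \<sigma>': "psd d \<sigma>" unfolding \<sigma> by (rule psd_gram') (simp add: d_def)
  obtain U p where U: "spec_decomp \<rho> U p" "unitary d U" "\<rho> = U * mat_diag d (\<lambda>i. complex_of_real (p i)) * U\<^sup>\<dagger>"
    and p0: "\<And>i. i < d \<Longrightarrow> 0 \<le> p i" using psd_spectral[OF \<rho>'] by metis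
  obtain V s where V: "spec_decomp \<sigma> V s" "unitary d V" "\<sigma> = V * mat_diag d (\<lambda>i. complex_of_real (s i)) * V\<^sup>\<dagger>"
    and s0: "\<And>i. i < d \<Longrightarrow> 0 \<le> s i" using psd_spectral[OF \<sigma>'] by metis
  note [simp] = unitaryD(1,2)[OF U(2)] unitaryD(1,2)[OF V(2)] psdD(1,2)[OF \<rho>'] psdD(1,2)[OF \<sigma>']
  define L where "L = Re (mtrace (\<rho> * mfun (\<lambda>x. if 0 < x then log 2 x else 0) \<sigma>))"
  obtain q where q: "\<And>k. k < d \<Longrightarrow> (V\<^sup>\<dagger> * \<rho> * V) $$ (k,k) = complex_of_real (q k)" "\<And>k. k < d \<Longrightarrow> 0 \<le> q k"
    "(\<Sum>k<d. q k) = 1" "\<And>k. k < d \<Longrightarrow> 0 < q k \<Longrightarrow> 0 < s k" "(\<Sum>k<d. q k * log 2 (s k)) = L"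
    using rel_entropy_diagonal[OF \<rho>d \<sigma>' V(1) supp] unfolding L_def by blast
  define S where "S = vN_entropy \<rho>"
  have S: "(\<Sum>i<d. p i * log 2 (1 / p i)) = S"
    unfolding S_def by (rule vN_entropy_eq_sum_log[OF \<rho>' U(1)])
  have "complex_of_real (\<Sum>i<d. p i) = mtrace \<rho>"
    by (subst U(3)) (simp add: mtrace_unitary_conj[OF U(2)] mtrace_mat_diag)
  then have p1: "(\<Sum>i<d. p i) = 1" using densityD(2)[OF \<rho>d] by (metis of_real_eq_1_iff)
  have "r \<le> - S - L"
  proof (rule ccontr)
    assume "\<not> r \<le> - S - L"
    then have r: "- S - L < r" by simp
    \<comment> \<open>A quarter of the gap: the two typicality cuts use one \<open>\<delta>\<close>
      each, the rate condition a third, and the last one is the decay exponent.\<close>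
    define \<delta> where "\<delta> = (r - (- S - L)) / 4"
    have \<delta>: "\<delta> > 0" using r by (simp add: \<delta>_def)
    obtain \<beta>1 where \<beta>1: "0 \<le> \<beta>1" "\<beta>1 < 1" "\<And>n D e. product_index n D d e \<Longrightarrow>
      (\<Sum>i<D. if (\<Prod>t<n. s (e t i)) < 2 powr (- real n * (- L + \<delta>)) then (\<Prod>t<n. q (e t i)) else 0) \<le> \<beta>1 ^ n"
      using product_chernoff[of d q s "- L" \<delta>] q \<delta> by auto
    \<comment> \<open>Reciprocals turn the bound on small weights into one on large eigenvalues of
      \<open>\<rho>\<close>. The mean of the logarithm of \<open>1 / p\<close> is the entropy, hence
      the parameter \<open>- S\<close>.\<close>
    obtain \<beta>2 where \<beta>2: "0 \<le> \<beta>2" "\<beta>2 < 1" "\<And>n D e. product_index n D d e \<Longrightarrow>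
      (\<Sum>i<D. if (\<Prod>t<n. 1 / p (e t i)) < 2 powr (- real n * (- S + \<delta>)) then (\<Prod>t<n. p (e t i)) else 0) \<le> \<beta>2 ^ n"
      using product_chernoff[of d p "\<lambda>i. 1 / p i" "- S" \<delta>] p0 p1 S \<delta> by auto
    obtain K \<Lambda> where K: "\<And>n. 1 \<le> K n" and locc: "\<And>n. locc (dX ^ n) (dY ^ n) (K n) (K n) (\<Lambda> n)"
      and fid: "(\<lambda>n. Re (cinner (phi_max (K n)) (apply_kraus (K n * K n) (\<Lambda> n) (tpow dX dY n \<rho>) *\<^sub>v phi_max (K n)))) \<longlonglongrightarrow> 1"
      and rt: "\<And>\<epsilon>. \<epsilon> > 0 \<Longrightarrow> eventually (\<lambda>n. r - \<epsilon> \<le> log 2 (real (K n)) / real n) sequentially"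
      using rate unfolding distill_rate_def by blast
    define F where "F n = Re (cinner (phi_max (K n)) (apply_kraus (K n * K n) (\<Lambda> n) (tpow dX dY n \<rho>) *\<^sub>v phi_max (K n)))" for n
    have bound: "sqrt (F n) \<le> sqrt (2 powr (real n * (- S - L + 2 * \<delta>)) / real (K n)) + sqrt \<beta>1 ^ n + sqrt \<beta>2 ^ n" for n
    proof -
      define D where "D = dX ^ n * dY ^ n"
      define e where "e = digit2 dX dY n"
      have e: "product_index n D d e" unfolding D_def e_def d_def by (rule product_index_digit2)
      define Uten where "Uten = tensor_power n D e D e U"
      define Vten where "Vten = tensor_power n D e D e V"
      define Y where "Y = product_cols (dX^n) (dY^n) (\<kappa>^n) (\<lambda>k x. \<Prod>t<n. a (digit \<kappa> t k) (digit dX t x)) (\<lambda>k y. \<Prod>t<n. b (digit \<kappa> t k) (digit dY t y))"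
      define pn where "pn i = (\<Prod>t<n. p (e t i))" for i
      define sn where "sn i = (\<Prod>t<n. s (e t i))" for i
      define qn where "qn i = (\<Prod>t<n. q (e t i))" for i
      have Uten: "unitary D Uten" and Vten: "unitary D Vten"
        unfolding Uten_def Vten_def using tensor_power_unitary[OF e] U(2) V(2) by auto
      note [simp] = unitaryD(1,2)[OF Uten] unitaryD(1,2)[OF Vten]
      have pn0: "0 \<le> pn i" and sn0: "0 \<le> sn i" if "i < D" for i
        unfolding pn_def sn_def using product_index_less[OF e that] p0 s0 by (auto intro!: prod_nonneg)
      define Xn where "Xn = Uten * mat_diag D (\<lambda>i. complex_of_real (sqrt (pn i)))"
      define Yn where "Yn = Vten * mat_diag D (\<lambda>i. complex_of_real (sqrt (sn i)))"
      have [simp]: "dim_row Xn = D" "dim_row Yn = D" "dim_row Y = D" by (simp_all add: Xn_def Yn_def Y_def D_def)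
      have tp\<rho>: "tensor_power n D e D e \<rho> = Xn * Xn\<^sup>\<dagger>"
      proof -
        have "Xn * Xn\<^sup>\<dagger> = Uten * mat_diag D (\<lambda>i. complex_of_real (pn i)) * Uten\<^sup>\<dagger>"
          unfolding Xn_def by (rule diag_sqrt_gram[OF Uten]) (rule pn0)
        then show ?thesis
          by (subst U(3)) (simp add: tensor_power_diag_conj[OF e U(2)] Uten_def pn_def)
      qed
      have tp\<sigma>: "tensor_power n D e D e \<sigma> = Yn * Yn\<^sup>\<dagger>"
      proof -
        have "Yn * Yn\<^sup>\<dagger> = Vten * mat_diag D (\<lambda>i. complex_of_real (sn i)) * Vten\<^sup>\<dagger>"
          unfolding Yn_def by (rule diag_sqrt_gram[OF Vten]) (rule sn0)
        then show ?thesis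
          by (subst V(3)) (simp add: tensor_power_diag_conj[OF e V(2)] Vten_def sn_def)
      qed
      have Yeq: "Y = tensor_power n D e (\<kappa>^n) (digit \<kappa>) (product_cols dX dY \<kappa> a b)"
        unfolding Y_def D_def e_def by (rule tensor_power_product_cols[symmetric])
      have YY: "Y * Y\<^sup>\<dagger> = Yn * Yn\<^sup>\<dagger>"
        unfolding tp\<sigma>[symmetric] Yeq \<sigma> using e product_index_digit[of n \<kappa>]
        by (intro tensor_power_gram) (auto simp: d_def)
      have "(fnorm Y)\<^sup>2 = ((fnorm (product_cols dX dY \<kappa> a b))\<^sup>2) ^ n"
        unfolding Yeq using e product_index_digit[of n \<kappa>]
        by (intro fnorm_tensor_power_sq) (auto simp: d_def)
      then have fY: "(fnorm Y)\<^sup>2 = 1" using Y1 by simp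
      obtain M where M: "dim_col M = D" "contr M"
        "\<And>X. dim_row X = D \<Longrightarrow> Re (cinner (phi_max (K n)) (apply_kraus (K n * K n) (\<Lambda> n) (X * X\<^sup>\<dagger>) *\<^sub>v phi_max (K n))) = (fnorm (M * X))\<^sup>2"
        "\<And>\<kappa> u v. (fnorm (M * product_cols (dX^n) (dY^n) \<kappa> u v))\<^sup>2 \<le> (fnorm (product_cols (dX^n) (dY^n) \<kappa> u v))\<^sup>2 / real (K n)"
        using locc_test_operator[OF locc[of n] K[of n]] unfolding D_def by blast
      have Fn: "F n = (fnorm (M * Xn))\<^sup>2"
        unfolding F_def tpow_eq_tensor_power D_def[symmetric] e_def[symmetric] tp\<rho> by (rule M(3)) simp
      \<comment> \<open>The separable bound is known for the product columns \<open>Y\<close>;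
        equality of Gram matrices carries it over to the spectral factor \<open>Yn\<close>.\<close>
      have "(fnorm (M * Yn))\<^sup>2 \<le> 1 / real (K n)"
        using M(4)[of "\<kappa>^n" "\<lambda>k x. \<Prod>t<n. a (digit \<kappa> t k) (digit dX t x)" "\<lambda>k y. \<Prod>t<n. b (digit \<kappa> t k) (digit dY t y)"]
          fnorm_mult_gram_cong[OF YY, of M] fY M(1) unfolding Y_def[symmetric] by simp
      then have MYn: "fnorm (M * Yn) \<le> sqrt (1 / real (K n))" by (rule real_le_rsqrt)
      have qn: "Re ((Vten\<^sup>\<dagger> * (Xn * Xn\<^sup>\<dagger>) * Vten) $$ (i,i)) = qn i" if i: "i < D" for i
      proof -
        have "Vten\<^sup>\<dagger> * (Xn * Xn\<^sup>\<dagger>) * Vten = tensor_power n D e D e (V\<^sup>\<dagger> * \<rho> * V)"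
          unfolding tp\<rho>[symmetric] Vten_def using e by (simp add: tensor_power_adjoint tensor_power_mult)
        then have "(Vten\<^sup>\<dagger> * (Xn * Xn\<^sup>\<dagger>) * Vten) $$ (i,i) = (\<Prod>t<n. complex_of_real (q (e t i)))"
          using i q(1) product_index_less[OF e i] by simp
        then show ?thesis unfolding qn_def by (simp flip: of_real_prod)
      qed
      \<comment> \<open>\<open>\<nu>\<close> caps the typical eigenvalues of the power of
        \<open>\<rho>\<close>; \<open>\<mu>\<close> is the floor for those of the power of
        \<open>\<sigma>\<close>, typical with respect to the diagonal distribution
        \<open>qn\<close>.\<close>
      define \<nu> where "\<nu> = 2 powr (- real n * (S - \<delta>))"
      define \<mu> where "\<mu> = 2 powr (- real n * (- L + \<delta>))"
      have "fnorm (M * Xn) \<le> sqrt (\<nu> / \<mu>) * fnorm (M * Yn)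
        + sqrt (\<Sum>i<D. if sn i < \<mu> then Re ((Vten\<^sup>\<dagger> * (Xn * Xn\<^sup>\<dagger>) * Vten) $$ (i,i)) else 0)
        + sqrt (\<Sum>i<D. if \<nu> < pn i then pn i else 0)"
        unfolding Xn_def Yn_def by (rule test_converse[OF Uten Vten, of pn sn, OF pn0 sn0 M(2,1)]) (auto simp: \<nu>_def \<mu>_def)
      moreover have "(\<Sum>i<D. if sn i < \<mu> then Re ((Vten\<^sup>\<dagger> * (Xn * Xn\<^sup>\<dagger>) * Vten) $$ (i,i)) else 0) \<le> \<beta>1 ^ n"
      proof -
        have "(\<Sum>i<D. if sn i < \<mu> then Re ((Vten\<^sup>\<dagger> * (Xn * Xn\<^sup>\<dagger>) * Vten) $$ (i,i)) else 0) = (\<Sum>i<D. if sn i < \<mu> then qn i else 0)"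
          by (intro sum.cong refl) (simp add: qn)
        then show ?thesis using \<beta>1(3)[OF e] unfolding sn_def \<mu>_def qn_def by simp
      qed
      moreover have "(\<Sum>i<D. if \<nu> < pn i then pn i else 0) \<le> \<beta>2 ^ n"
      proof -
        have "(if \<nu> < pn i then pn i else 0) \<le> (if (\<Prod>t<n. 1 / p (e t i)) < 2 powr (- real n * (- S + \<delta>)) then pn i else 0)" if "i < D" for i
        proof (cases "\<nu> < pn i")
          case True
          have "\<nu> > 0" by (simp add: \<nu>_def)
          have "(\<Prod>t<n. 1 / p (e t i)) = 1 / pn i" by (simp add: pn_def prod_dividef)
          also have "\<dots> < 1 / \<nu>" using True \<open>\<nu> > 0\<close> by (simp add: frac_less2)
          also have "1 / \<nu> = 2 powr (- real n * (- S + \<delta>))"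
            unfolding \<nu>_def by (simp add: powr_minus_divide[symmetric] algebra_simps)
          finally show ?thesis using pn0[OF that] by simp
        qed (use pn0[OF that] in auto)
        then have "(\<Sum>i<D. if \<nu> < pn i then pn i else 0) \<le> (\<Sum>i<D. if (\<Prod>t<n. 1 / p (e t i)) < 2 powr (- real n * (- S + \<delta>)) then pn i else 0)"
          by (intro sum_mono) auto
        also have "\<dots> \<le> \<beta>2 ^ n" using \<beta>2(3)[OF e] unfolding pn_def .
        finally show ?thesis .
      qed
      moreover have "sqrt (\<nu> / \<mu>) * fnorm (M * Yn) \<le> sqrt (2 powr (real n * (- S - L + 2 * \<delta>)) / real (K n))"
      proof -
        have "\<nu> / \<mu> = 2 powr (real n * (- S - L + 2 * \<delta>))"
          unfolding \<nu>_def \<mu>_def by (simp add: powr_diff[symmetric] algebra_simps)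
        then show ?thesis using mult_left_mono[OF MYn, of "sqrt (\<nu> / \<mu>)"]
          by (simp add: real_sqrt_mult[symmetric] \<nu>_def \<mu>_def)
      qed
      ultimately have "fnorm (M * Xn) \<le> sqrt (2 powr (real n * (- S - L + 2 * \<delta>)) / real (K n)) + sqrt (\<beta>1 ^ n) + sqrt (\<beta>2 ^ n)"
        by (smt (verit) real_sqrt_le_mono)
      then show ?thesis unfolding Fn by (simp add: real_sqrt_power)
    qed
    have ev: "eventually (\<lambda>n. sqrt (F n) \<le> sqrt (2 powr (- \<delta>)) ^ n + sqrt \<beta>1 ^ n + sqrt \<beta>2 ^ n) sequentially"
      using rt[OF \<delta>] eventually_gt_at_top[of 0]
    proof eventually_elim
      case (elim n)
      have Kpos: "real (K n) > 0" using K[of n] by simp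
      have "real n * (r - \<delta>) \<le> log 2 (real (K n))" using elim by (simp add: field_simps)
      then have "2 powr (real n * (r - \<delta>)) \<le> 2 powr (log 2 (real (K n)))" by (intro powr_mono) auto
      then have "2 powr (real n * (r - \<delta>)) \<le> real (K n)" using Kpos by simp
      then have "2 powr (real n * (- S - L + 2 * \<delta>)) / real (K n) \<le> 2 powr (real n * (- S - L + 2 * \<delta>)) / 2 powr (real n * (r - \<delta>))"
        by (intro divide_left_mono) (use Kpos in auto)
      also have "\<dots> = 2 powr (- \<delta> * real n)"
        unfolding powr_diff[symmetric] \<delta>_def by (rule arg_cong[where f = "\<lambda>x. 2 powr x"]) (simp add: field_simps)
      also have "\<dots> = (2 powr (- \<delta>)) ^ n" by (simp add: powr_powr powr_realpow[symmetric])
      finally have "sqrt (2 powr (real n * (- S - L + 2 * \<delta>)) / real (K n)) \<le> sqrt (2 powr (- \<delta>)) ^ n"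
        by (simp add: real_sqrt_power[symmetric])
      then show ?case using bound[of n] by linarith
    qed
    have "2 powr (- \<delta>) < 1" using \<delta> powr_less_mono[of "- \<delta>" 0 2] by simp
    then have "(\<lambda>n. sqrt (2 powr (- \<delta>)) ^ n + sqrt \<beta>1 ^ n + sqrt \<beta>2 ^ n) \<longlonglongrightarrow> 0 + 0 + 0"
      using \<beta>1 \<beta>2 by (intro tendsto_add LIMSEQ_power_zero) auto
    moreover have "(\<lambda>n. sqrt (F n)) \<longlonglongrightarrow> sqrt 1" using fid unfolding F_def by (rule tendsto_real_sqrt)
    ultimately have "sqrt 1 \<le> 0 + 0 + (0::real)" using ev
      by (intro tendsto_le[OF sequentially_bot]) auto
    then show False by simp
  qed
  then show ?thesis using supp unfolding rel_entropy_def S_def L_def by simp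
qed

section \<open>Decoupling by hashing\<close>

lemma psd_conj_diag:
  assumes A: "psd n A" and [simp]: "dim_row V = n" and i: "i < dim_col V"
  shows "\<exists>r\<ge>0. (V\<^sup>\<dagger> * A * V) $$ (i,i) = complex_of_real r"
proof -
  define R where "R = mfun sqrt A"
  note R = psd_sqrt[OF A, folded R_def]
  note [simp] = psdD(1-3)[OF R(1)]
  have "V\<^sup>\<dagger> * A * V = (R * V)\<^sup>\<dagger> * (R * V)"
    unfolding R(2)[symmetric] by (simp add: adjoint_mult mult_assoc_dim)
  also have "((R * V)\<^sup>\<dagger> * (R * V)) $$ (i,i) = complex_of_real (\<Sum>j<n. (cmod ((R * V) $$ (j,i)))\<^sup>2)"
    using i by (subst mult_index) (auto simp: complex_norm_square mult.commute simp del: of_real_power)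
  finally show ?thesis
    by (intro exI[of _ "\<Sum>j<n. (cmod ((R * V) $$ (j,i)))\<^sup>2"] conjI sum_nonneg) simp_all
qed

text \<open>Powers-Stormer inequality, with the trace norm expressed through the sign
  \<open>S\<close> of \<open>a - b\<close>. The trace on the right pairs the modulus of
  \<open>a - b\<close> with \<open>a + b\<close>, and in the eigenbasis of \<open>a - b\<close> the
  modulus of an eigenvalue is at most the sum of the nonnegative diagonal entries of
  \<open>a\<close> and \<open>b\<close>.\<close>

lemma powers_stormer:
  assumes a: "psd n a" and b: "psd n b"
  shows "\<exists>S. dim_row S = n \<and> dim_col S = n \<and> contr S \<and> (fnorm (a - b))\<^sup>2 \<le> Re (mtrace (S * (a * a - b * b)))"
proof -
  note [simp] = psdD(1,2)[OF a] psdD(1,2)[OF b]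
  have "hermitian n (a - b)"
    unfolding hermitian_def using psdD(3)[OF a] psdD(3)[OF b] by (simp add: adjoint_minus carrier_matI)
  then obtain U x where sd: "spec_decomp (a - b) U x" using spectral_theorem by blast
  note U = spec_decompD[OF sd, of n, simplified]
  note [simp] = unitaryD(1,2)[OF U(1)]
  define S where "S = U * mat_diag n (\<lambda>i. complex_of_real (sgn (x i))) * U\<^sup>\<dagger>"
  define Y where "Y = U * mat_diag n (\<lambda>i. complex_of_real \<bar>x i\<bar>) * U\<^sup>\<dagger>"
  have [simp]: "dim_row S = n" "dim_col S = n" "dim_row Y = n" "dim_col Y = n" by (simp_all add: S_def Y_def)
  have diag_cong: "U * mat_diag n f * U\<^sup>\<dagger> = U * mat_diag n g * U\<^sup>\<dagger>" if "\<And>i. f i = g i" for f g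
    using that by presburger
  have SX: "S * (a - b) = Y" "(a - b) * S = Y"
    unfolding S_def Y_def U(2) diag_conj_mult[OF U(1)]
    by (rule diag_cong; simp add: abs_sgn mult.commute flip: of_real_mult)+
  have "contr S"
  proof (rule contr_partial_isometry)
    have "S\<^sup>\<dagger> = S" unfolding S_def diag_conj_adjoint[OF U(1)] by simp
    moreover have "S * S * (S * S) = S * S" unfolding S_def diag_conj_mult[OF U(1)]
      by (rule diag_cong) (simp add: sgn_if)
    ultimately show "S\<^sup>\<dagger> * S * (S\<^sup>\<dagger> * S) = S\<^sup>\<dagger> * S" by simp
  qed
  have "\<forall>i<n. \<exists>r\<ge>0. (U\<^sup>\<dagger> * a * U) $$ (i,i) = complex_of_real r" using psd_conj_diag[OF a] by simp
  then obtain \<alpha> where \<alpha>: "\<And>i. i < n \<Longrightarrow> 0 \<le> \<alpha> i" "\<And>i. i < n \<Longrightarrow> (U\<^sup>\<dagger> * a * U) $$ (i,i) = complex_of_real (\<alpha> i)" by metis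
  have "\<forall>i<n. \<exists>r\<ge>0. (U\<^sup>\<dagger> * b * U) $$ (i,i) = complex_of_real r" using psd_conj_diag[OF b] by simp
  then obtain \<beta> where \<beta>: "\<And>i. i < n \<Longrightarrow> 0 \<le> \<beta> i" "\<And>i. i < n \<Longrightarrow> (U\<^sup>\<dagger> * b * U) $$ (i,i) = complex_of_real (\<beta> i)" by metis
  have xi: "\<alpha> i - \<beta> i = x i" if i: "i < n" for i
  proof -
    have "U\<^sup>\<dagger> * (a - b) * U = mat_diag n (\<lambda>i. complex_of_real (x i))"
      unfolding U(2) by (simp add: mult_assoc_dim unitary_cancel[OF U(1)] unitaryD(4)[OF U(1)])
    moreover have "U\<^sup>\<dagger> * (a - b) * U = U\<^sup>\<dagger> * a * U - U\<^sup>\<dagger> * b * U"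
      by (simp add: mult_minus_distrib_dim minus_mult_distrib_dim)
    ultimately have "(U\<^sup>\<dagger> * a * U - U\<^sup>\<dagger> * b * U) $$ (i,i) = complex_of_real (x i)" using i by simp
    then have "complex_of_real (\<alpha> i - \<beta> i) = complex_of_real (x i)" using \<alpha>(2) \<beta>(2) i by simp
    then show ?thesis by (simp only: of_real_eq_iff)
  qed
  have trY: "mtrace (Y * M) = (\<Sum>i<n. complex_of_real \<bar>x i\<bar> * (U\<^sup>\<dagger> * M * U) $$ (i,i))"
    if [simp]: "dim_row M = n" "dim_col M = n" for M
  proof -
    have "mtrace (Y * M) = mtrace (U * (mat_diag n (\<lambda>i. complex_of_real \<bar>x i\<bar>) * (U\<^sup>\<dagger> * M)))"
      by (simp add: Y_def mult_assoc_dim)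
    also have "\<dots> = mtrace (mat_diag n (\<lambda>i. complex_of_real \<bar>x i\<bar>) * (U\<^sup>\<dagger> * M * U))"
      by (subst mtrace_cyclic) (simp_all add: mult_assoc_dim)
    finally show ?thesis unfolding mtrace_def by (simp add: mat_diag_mult_index)
  qed
  \<comment> \<open>A factorisation that holds without commutation; under the trace, cyclicity
    brings \<open>S\<close> next to \<open>a - b\<close> in both terms.\<close>
  have ab: "a * a - b * b = (a - b) * a + b * (a - b)"
    by (simp add: mult_minus_distrib_dim minus_mult_distrib_dim) (rule eq_matI, auto)
  have "mtrace (S * (a * a - b * b)) = mtrace (S * ((a - b) * a)) + mtrace (S * (b * (a - b)))"
    unfolding ab by (simp add: mult_add_distrib_dim mtrace_add)
  also have "mtrace (S * ((a - b) * a)) = mtrace (Y * a)"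
    by (simp add: mult_assoc_dim[symmetric] SX)
  also have "mtrace (S * (b * (a - b))) = mtrace ((a - b) * (S * b))"
    using mtrace_cyclic[of "S * b" "a - b"] by (simp add: mult_assoc_dim)
  also have "\<dots> = mtrace (Y * b)" by (simp add: mult_assoc_dim[symmetric] SX)
  also have "mtrace (Y * a) + mtrace (Y * b) = complex_of_real (\<Sum>i<n. \<bar>x i\<bar> * (\<alpha> i + \<beta> i))"
    by (simp add: trY \<alpha>(2) \<beta>(2) distrib_left sum.distrib)
  finally have "mtrace (S * (a * a - b * b)) = complex_of_real (\<Sum>i<n. \<bar>x i\<bar> * (\<alpha> i + \<beta> i))" .
  moreover have "(\<Sum>i<n. (x i)\<^sup>2) \<le> (\<Sum>i<n. \<bar>x i\<bar> * (\<alpha> i + \<beta> i))"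
  proof (rule sum_mono)
    fix i assume "i \<in> {..<n}"
    then have i: "i < n" by simp
    have "\<bar>x i\<bar> \<le> \<alpha> i + \<beta> i" using xi[OF i] \<alpha>(1)[OF i] \<beta>(1)[OF i] by linarith
    then have "\<bar>x i\<bar> * \<bar>x i\<bar> \<le> \<bar>x i\<bar> * (\<alpha> i + \<beta> i)" by (intro mult_left_mono) auto
    then show "(x i)\<^sup>2 \<le> \<bar>x i\<bar> * (\<alpha> i + \<beta> i)" by (simp add: power2_eq_square)
  qed
  moreover have "(fnorm (a - b))\<^sup>2 = (\<Sum>i<n. (x i)\<^sup>2)"
  proof -
    have "fnorm (a - b) = fnorm (1\<^sub>m n * mat_diag n (\<lambda>i. complex_of_real (x i)))"
      unfolding U(2) using fnorm_mult_unitary[OF unitary_adjoint[OF U(1)], of "U * mat_diag n (\<lambda>i. complex_of_real (x i))"]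
      by (simp add: fnorm_unitary_mult[OF U(1)])
    moreover have "(fnorm (1\<^sub>m n * mat_diag n (\<lambda>i. complex_of_real (x i))))\<^sup>2 = (\<Sum>i<n. (x i)\<^sup>2)"
      by (subst fnorm_mult_diag_sq)
        (auto intro!: sum.cong simp: if_distrib[of cmod] if_distrib[of "\<lambda>x. x\<^sup>2"] sum.delta cong: if_cong)
    ultimately show ?thesis by (simp only:)
  qed
  ultimately show ?thesis using \<open>contr S\<close> by (intro exI[of _ S]) simp
qed

lemma cmod_add_sq:
  "(cmod (u + complex_of_real c * w))\<^sup>2 = (cmod u)\<^sup>2 + 2 * c * Re (u * cnj w) + c\<^sup>2 * (cmod w)\<^sup>2"
  unfolding cmod_power2 by (simp add: power2_eq_square algebra_simps)

text \<open>Instead of averaging over random hash functions, the value of \<open>f\<close> at the next point is chosen such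
  that the cross term is nonpositive; this is possible because the cross terms sum to zero.\<close>
lemma greedy_hash:
  fixes \<sigma> :: "nat \<Rightarrow> 'i \<Rightarrow> complex"
  assumes K: "1 \<le> K"
  shows "\<exists>f. (\<forall>x. f x < K) \<and>
    (\<Sum>m<K. \<Sum>i\<in>I. (cmod (\<Sum>x<D. complex_of_real ((if f x = m then 1 else 0) - 1 / real K) * \<sigma> x i))\<^sup>2)
      \<le> (\<Sum>x<D. \<Sum>i\<in>I. (cmod (\<sigma> x i))\<^sup>2)"
proof (induction D)
  case 0
  show ?case using K by (intro exI[of _ "\<lambda>_. 0"]) auto
next
  case (Suc D)
  then obtain f where f: "\<And>x. f x < K" and IH:
    "(\<Sum>m<K. \<Sum>i\<in>I. (cmod (\<Sum>x<D. complex_of_real ((if f x = m then 1 else 0) - 1 / real K) * \<sigma> x i))\<^sup>2)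
      \<le> (\<Sum>x<D. \<Sum>i\<in>I. (cmod (\<sigma> x i))\<^sup>2)" by blast
  define v where "v m i = (\<Sum>x<D. complex_of_real ((if f x = m then 1 else 0) - 1 / real K) * \<sigma> x i)" for m i
  define R where "R m = (\<Sum>i\<in>I. Re (v m i * cnj (\<sigma> D i)))" for m
  have one: "(\<Sum>m<K. (if k = m then 1 else 0) - 1 / real K) = 0" if "k < K" for k
    using that K by (simp add: sum_subtractf)
  have "(\<Sum>m<K. v m i) = 0" for i
  proof -
    have "(\<Sum>m<K. v m i) = (\<Sum>x<D. complex_of_real (\<Sum>m<K. (if f x = m then 1 else 0) - 1 / real K) * \<sigma> x i)"
      unfolding v_def by (subst sum.swap) (simp add: sum_distrib_right)
    then show ?thesis by (simp only: one[OF f]) simp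
  qed
  then have R0: "(\<Sum>m<K. R m) = 0"
    unfolding R_def by (subst sum.swap) (simp only: Re_sum[symmetric] sum_distrib_right[symmetric], simp)
  have "\<exists>m0<K. R m0 \<le> 0"
  proof (rule ccontr)
    assume "\<not> ?thesis"
    then have "0 < (\<Sum>m<K. R m)" using K by (intro sum_pos) (auto simp: not_le lessThan_empty_iff)
    then show False using R0 by simp
  qed
  then obtain m0 where m0: "m0 < K" "R m0 \<le> 0" by blast
  define f' where "f' = f(D := m0)"
  define c where "c m = (if m0 = m then 1 else 0) - 1 / real K" for m
  have step: "(\<Sum>x<Suc D. complex_of_real ((if f' x = m then 1 else 0) - 1 / real K) * \<sigma> x i) = v m i + complex_of_real (c m) * \<sigma> D i" for m i
    unfolding v_def c_def f'_def by simp
  \<comment> \<open>The part \<open>- 1 / real K\<close> of \<open>c\<close> only contributes a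
    multiple of the vanishing sum of all \<open>R m\<close>.\<close>
  have cR: "(\<Sum>m<K. c m * R m) = R m0"
  proof -
    have "c m * R m = (if m = m0 then R m else 0) - R m / real K" for m by (simp add: c_def left_diff_distrib)
    then show ?thesis using m0(1) R0 by (simp add: sum_subtractf sum_divide_distrib[symmetric])
  qed
  have c2: "(\<Sum>m<K. (c m)\<^sup>2) \<le> 1"
  proof -
    have "(c m)\<^sup>2 = (if m = m0 then 1 - 2 / real K else 0) + 1 / (real K)\<^sup>2" for m
      unfolding c_def by (auto simp: power2_diff power_divide)
    then have "(\<Sum>m<K. (c m)\<^sup>2) = 1 - 2 / real K + real K / (real K)\<^sup>2"
      using m0(1) by (simp add: sum.distrib)
    also have "\<dots> = 1 - 1 / real K" using K by (simp add: power2_eq_square field_simps)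
    finally show ?thesis by simp
  qed
  have "(\<Sum>m<K. \<Sum>i\<in>I. (cmod (v m i + complex_of_real (c m) * \<sigma> D i))\<^sup>2)
     = (\<Sum>m<K. \<Sum>i\<in>I. (cmod (v m i))\<^sup>2) + 2 * (\<Sum>m<K. c m * R m) + (\<Sum>m<K. (c m)\<^sup>2) * (\<Sum>i\<in>I. (cmod (\<sigma> D i))\<^sup>2)"
    unfolding cmod_add_sq R_def
    by (simp add: sum.distrib sum_distrib_left sum_distrib_right mult.assoc del: times_complex.simps) (rule sum.swap)
  also have "\<dots> \<le> (\<Sum>x<D. \<Sum>i\<in>I. (cmod (\<sigma> x i))\<^sup>2) + 0 + 1 * (\<Sum>i\<in>I. (cmod (\<sigma> D i))\<^sup>2)"
    using IH m0(2) unfolding cR v_def[symmetric]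
    by (intro add_mono mult_right_mono c2) (auto intro: sum_nonneg)
  finally have bound: "(\<Sum>m<K. \<Sum>i\<in>I. (cmod (v m i + complex_of_real (c m) * \<sigma> D i))\<^sup>2)
    \<le> (\<Sum>x<D. \<Sum>i\<in>I. (cmod (\<sigma> x i))\<^sup>2) + 0 + 1 * (\<Sum>i\<in>I. (cmod (\<sigma> D i))\<^sup>2)" .
  show ?case
  proof (intro exI[of _ f'] conjI allI)
    show "f' x < K" for x using f m0(1) by (simp add: f'_def)
    show "(\<Sum>m<K. \<Sum>i\<in>I. (cmod (\<Sum>x<Suc D. complex_of_real ((if f' x = m then 1 else 0) - 1 / real K) * \<sigma> x i))\<^sup>2)
      \<le> (\<Sum>x<Suc D. \<Sum>i\<in>I. (cmod (\<sigma> x i))\<^sup>2)"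
      unfolding step using bound by simp
  qed
qed

section \<open>Matrix sums and the completion of instruments\<close>

lemma msum_mult:
  assumes "\<And>k. k \<in> S \<Longrightarrow> dim_row (A k) = n" "\<And>k. k \<in> S \<Longrightarrow> dim_col (A k) = dim_row B" "dim_row B = m"
  shows "msum n m A S * B = msum n (dim_col B) (\<lambda>k. A k * B) S"
  by (rule eq_matI)
    (use assms in \<open>auto simp: mult_index sum_distrib_right sum.swap[of _ S] intro!: sum.cong\<close>)

lemma mult_msum:
  assumes "\<And>k. k \<in> S \<Longrightarrow> dim_row (A k) = m" "\<And>k. k \<in> S \<Longrightarrow> dim_col (A k) = n" "dim_col B = m"
  shows "B * msum m n A S = msum (dim_row B) n (\<lambda>k. B * A k) S"
  by (rule eq_matI)
    (use assms in \<open>auto simp: mult_index sum_distrib_left sum.swap[of _ S] intro!: sum.cong\<close>)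

lemma msum_adjoint:
  assumes "\<And>k. k \<in> S \<Longrightarrow> dim_row (A k) = n" "\<And>k. k \<in> S \<Longrightarrow> dim_col (A k) = m"
  shows "(msum n m A S)\<^sup>\<dagger> = msum m n (\<lambda>k. (A k)\<^sup>\<dagger>) S"
  by (rule eq_matI) (use assms in auto)

lemma msum_cong: "(\<And>k. k \<in> S \<Longrightarrow> A k = B k) \<Longrightarrow> msum n m A S = msum n m B S"
  unfolding msum_def by (intro eq_matI) auto

lemma msum_single:
  assumes "finite S" "k \<in> S" "\<And>l. l \<in> S \<Longrightarrow> l \<noteq> k \<Longrightarrow> A l = 0\<^sub>m n m" "dim_row (A k) = n" "dim_col (A k) = m"
  shows "msum n m A S = A k"
proof (rule eq_matI)
  fix i j assume "i < dim_row (A k)" "j < dim_col (A k)"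
  then have ij: "i < n" "j < m" using assms by auto
  have "msum n m A S $$ (i,j) = (\<Sum>l\<in>S. if l = k then A k $$ (i,j) else 0)"
    using ij assms(3) by (auto intro!: sum.cong)
  then show "msum n m A S $$ (i,j) = A k $$ (i,j)" using assms(1,2) by simp
qed (use assms in auto)

lemma mtrace_msum: "mtrace (msum n n A S) = (\<Sum>k\<in>S. \<Sum>i<n. A k $$ (i,i))"
  unfolding mtrace_def by (simp add: sum.swap[of _ S])

lemma fnorm_msum_le:
  assumes "finite S" "\<And>k. k \<in> S \<Longrightarrow> dim_row (A k) = n \<and> dim_col (A k) = m"
  shows "fnorm (msum n m A S) \<le> (\<Sum>k\<in>S. fnorm (A k))"
  using assms
proof (induction S rule: finite_induct)
  case empty
  have "msum n m A {} = 0\<^sub>m n m" by (rule eq_matI) auto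
  then show ?case by simp
next
  case (insert k S)
  have "msum n m A (insert k S) = A k + msum n m A S"
    by (rule eq_matI) (use insert in auto)
  then have "fnorm (msum n m A (insert k S)) \<le> fnorm (A k) + fnorm (msum n m A S)"
    using fnorm_triangle[of "A k" "msum n m A S"] insert by simp
  then show ?case using insert by simp
qed

lemma sum_sq_le_card:
  fixes g :: "nat \<Rightarrow> real"
  shows "(\<Sum>m<K. g m)\<^sup>2 \<le> real K * (\<Sum>m<K. (g m)\<^sup>2)"
proof -
  have "(\<Sum>m<K. \<bar>g m\<bar> * \<bar>1\<bar>) \<le> L2_set g {..<K} * L2_set (\<lambda>_. 1) {..<K}" by (rule L2_set_mult_ineq)
  then have "(\<Sum>m<K. \<bar>g m\<bar>) \<le> sqrt (real K) * L2_set g {..<K}" by (simp add: L2_set_constant mult.commute)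
  then have "(\<Sum>m<K. \<bar>g m\<bar>)\<^sup>2 \<le> (sqrt (real K) * L2_set g {..<K})\<^sup>2" by (intro power_mono sum_nonneg) auto
  also have "\<dots> = real K * (\<Sum>m<K. (g m)\<^sup>2)" unfolding power_mult_distrib L2_set_def by (simp add: sum_nonneg)
  finally have "(\<Sum>m<K. \<bar>g m\<bar>)\<^sup>2 \<le> real K * (\<Sum>m<K. (g m)\<^sup>2)" .
  moreover have "(\<Sum>m<K. g m)\<^sup>2 \<le> (\<Sum>m<K. \<bar>g m\<bar>)\<^sup>2"
    using power_mono[OF sum_abs[of g "{..<K}"], of 2] by simp
  ultimately show ?thesis by linarith
qed

text \<open>Positivity of the defect is what allows a subnormalised family to be completed to an
  instrument or a measurement.\<close>

lemma psd_kraus_complement: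
  assumes B: "\<And>k. k < m \<Longrightarrow> dim_col (B k) = n"
    and le: "\<And>A. dim_row A = n \<Longrightarrow> (\<Sum>k<m. (fnorm (B k * A))\<^sup>2) \<le> (fnorm A)\<^sup>2"
  shows "psd n (1\<^sub>m n - msum n n (\<lambda>k. (B k)\<^sup>\<dagger> * B k) {..<m})"
proof -
  let ?M = "msum n n (\<lambda>k. (B k)\<^sup>\<dagger> * B k) {..<m}"
  have M: "?M\<^sup>\<dagger> = ?M"
    by (subst msum_adjoint) (auto simp: B adjoint_mult)
  have "0 \<le> Re (cinner v ((1\<^sub>m n - ?M) *\<^sub>v v))" if "v \<in> carrier_vec n" for v
  proof -
    have [simp]: "dim_vec v = n" using that by auto
    let ?v = "col_mat v"
    have "?v\<^sup>\<dagger> * ((1\<^sub>m n - ?M) * ?v) = ?v\<^sup>\<dagger> * ?v - ?v\<^sup>\<dagger> * (?M * ?v)"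
      by (simp add: minus_mult_distrib_dim mult_minus_distrib_dim)
    then have "cinner v ((1\<^sub>m n - ?M) *\<^sub>v v) = mtrace (?v\<^sup>\<dagger> * ?v) - mtrace (?v\<^sup>\<dagger> * (?M * ?v))"
      by (subst cinner_eq_mtrace) (simp_all add: mtrace_minus)
    also have "mtrace (?v\<^sup>\<dagger> * (?M * ?v)) = (\<Sum>k<m. mtrace (?v\<^sup>\<dagger> * ((B k)\<^sup>\<dagger> * B k * ?v)))"
      by (subst mtrace_conj_mult[where n = n]) (simp_all add: mtrace_conj_mult[where n = n] B sum_distrib_right sum.swap[of _ "{..<m}"])
    also have "\<dots> = (\<Sum>k<m. complex_of_real ((fnorm (B k * ?v))\<^sup>2))"
      unfolding fnorm_sq_mtrace[symmetric] by (intro sum.cong refl) (simp add: B adjoint_mult mult_assoc_dim)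
    finally have "Re (cinner v ((1\<^sub>m n - ?M) *\<^sub>v v)) = (fnorm ?v)\<^sup>2 - (\<Sum>k<m. (fnorm (B k * ?v))\<^sup>2)"
      by (simp add: fnorm_sq_mtrace)
    then show ?thesis using le[of ?v] by simp
  qed
  then show ?thesis unfolding psd_def hermitian_def using M
    by (auto simp: adjoint_minus intro!: carrier_matI)
qed

section \<open>Types of information and the hashing protocol\<close>

lemma info_typeD:
  assumes "info_type d N Z"
  shows "\<And>j. j < N \<Longrightarrow> dim_row (Z j) = d" "\<And>j. j < N \<Longrightarrow> dim_col (Z j) = d"
    "\<And>j. j < N \<Longrightarrow> (Z j)\<^sup>\<dagger> = Z j" "\<And>j. j < N \<Longrightarrow> Z j * Z j = Z j"
    "\<And>j k. j < N \<Longrightarrow> k < N \<Longrightarrow> j \<noteq> k \<Longrightarrow> Z j * Z k = 0\<^sub>m d d"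
    "msum d d Z {..<N} = 1\<^sub>m d"
  using assms unfolding info_type_def is_projector_def hermitian_def by auto

lemma info_type_fnorm:
  assumes Z: "info_type d N Z" and A: "dim_row A = d"
  shows "(\<Sum>j<N. (fnorm (Z j * A))\<^sup>2) = (fnorm A)\<^sup>2"
proof (rule kraus_sum_fnorm[where n = d])
  have "msum d d (\<lambda>j. (Z j)\<^sup>\<dagger> * Z j) {..<N} = msum d d Z {..<N}"
    by (rule msum_cong) (simp add: info_typeD[OF Z])
  then show "msum d d (\<lambda>j. (Z j)\<^sup>\<dagger> * Z j) {..<N} = 1\<^sub>m d" by (simp add: info_typeD(6)[OF Z])
qed (auto simp: info_typeD[OF Z] A)

text \<open>This is the isometry that copies the outcome into the register, applied to a Gram factor
  \<open>T\<close>: block row \<open>j\<close> is the branch in which the register shows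
  \<open>j\<close>.\<close>

definition premeasure :: "nat \<Rightarrow> nat \<Rightarrow> (nat \<Rightarrow> complex mat) \<Rightarrow> complex mat \<Rightarrow> complex mat" where
  "premeasure d N Z T = mat (N * d) (dim_col T) (\<lambda>(i,c). (Z (i div d) * T) $$ (i mod d, c))"

lemma premeasure_simps [simp]:
  "dim_row (premeasure d N Z T) = N * d" "dim_col (premeasure d N Z T) = dim_col T"
  "i < N * d \<Longrightarrow> c < dim_col T \<Longrightarrow> premeasure d N Z T $$ (i,c) = (Z (i div d) * T) $$ (i mod d, c)"
  by (simp_all add: premeasure_def)

text \<open>For distinct indices this is a full geometric sum of a root of unity other than 1. It
  normalises the Fourier measurement of the register.\<close>

lemma roots_of_unity_orthogonal:
  assumes D: "x < D" "x' < D"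
  defines "\<zeta> \<equiv> \<lambda>k. cis (2 * pi * real k / real D)"
  shows "(\<Sum>y<D. cnj (\<zeta> x) ^ y * \<zeta> x' ^ y) = (if x = x' then of_nat D else 0)"
proof (cases "x = x'")
  case True
  have "cnj (\<zeta> x) * \<zeta> x = 1" by (simp add: \<zeta>_def cis_cnj cis_mult)
  then show ?thesis using True by (simp flip: power_mult_distrib)
next
  case False
  have D0: "D > 0" using D by simp
  have bij: "bij_betw \<zeta> {..<D} {z. z ^ D = 1}" unfolding \<zeta>_def by (rule bij_betw_roots_unity[OF D0])
  have pow: "\<zeta> k ^ D = 1" if "k < D" for k using bij that by (auto simp: bij_betw_def)
  define z where "z = cnj (\<zeta> x) * \<zeta> x'"
  have "\<zeta> x * z = \<zeta> x'" unfolding z_def by (simp add: \<zeta>_def cis_cnj cis_mult)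
  moreover have "\<zeta> x \<noteq> \<zeta> x'" using bij D False by (auto simp: bij_betw_def inj_on_def)
  ultimately have z1: "z \<noteq> 1" by auto
  have "z ^ D = cnj (\<zeta> x ^ D) * \<zeta> x' ^ D" by (simp add: z_def power_mult_distrib)
  then have "z ^ D = 1" using pow D by simp
  then have "(\<Sum>y<D. z ^ y) = 0" using geometric_sum[OF z1, of D] by simp
  then show ?thesis using False by (simp add: z_def power_mult_distrib)
qed

text \<open>Alice hashes her register while measuring it in a Fourier basis; Bob, who can read off the
  register from \<open>Z\<close>, undoes the phases and then applies the decoder \<open>W\<close>.\<close>
lemma hashing_protocol:
  assumes Z: "info_type d D Z" and f: "\<And>x. f x < K" and K: "1 \<le> K" and T [simp]: "dim_row T = d"
    and W: "\<And>m. m < K \<Longrightarrow> dim_row (W m) = L \<and> dim_col (W m) = d"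
    and WW: "\<And>A. dim_row A = d \<Longrightarrow> (\<Sum>m<K. (fnorm (W m * A))\<^sup>2) \<le> (fnorm A)\<^sup>2"
  shows "\<exists>Ks. locc D d K K Ks \<and>
    (fnorm (msum L d (\<lambda>x. W (f x) * Z x) {..<D} * T))\<^sup>2 / real K
      \<le> Re (cinner (phi_max K) (apply_kraus (K * K) Ks (premeasure d D Z T * (premeasure d D Z T)\<^sup>\<dagger>) *\<^sub>v phi_max K))"
proof -
  note Zd = info_typeD[OF Z]
  define P where "P = premeasure d D Z T"
  define \<zeta> where "\<zeta> k = cis (2 * pi * real k / real D)" for k
  have \<zeta>1: "cnj (\<zeta> x) * \<zeta> x = 1" for x by (simp add: \<zeta>_def cis_cnj cis_mult)
  \<comment> \<open>The hash value \<open>f x\<close> is kept as output; the rest of the information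
    on \<open>x\<close> survives only as the phase \<open>\<zeta> x ^ y\<close> belonging to outcome
    \<open>y\<close>.\<close>
  define A where "A y = mat K D (\<lambda>(i,x). if f x = i then \<zeta> x ^ y / complex_of_real (sqrt (real D)) else 0)" for y
  have A_dims: "dim_row (A y) = K" "dim_col (A y) = D" for y by (simp_all add: A_def)
  have A_sum: "msum D D (\<lambda>y. (A y)\<^sup>\<dagger> * A y) {..<D} = 1\<^sub>m D"
  proof (rule eq_matI)
    fix x x' assume "x < dim_row (1\<^sub>m D :: complex mat)" "x' < dim_col (1\<^sub>m D :: complex mat)"
    then have x: "x < D" "x' < D" by auto
    have "((A y)\<^sup>\<dagger> * A y) $$ (x,x') = (if f x = f x' then cnj (\<zeta> x) ^ y * \<zeta> x' ^ y / of_nat D else 0)" for y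
    proof -
      have "((A y)\<^sup>\<dagger> * A y) $$ (x,x') = (\<Sum>i<K. cnj (A y $$ (i,x)) * A y $$ (i,x'))"
        using x by (simp add: mult_index A_dims)
      also have "\<dots> = (\<Sum>i<K. if i = f x then (if f x = f x' then cnj (\<zeta> x) ^ y * \<zeta> x' ^ y / of_nat D else 0) else 0)"
        using x by (intro sum.cong refl) (auto simp: A_def simp flip: of_real_mult)
      finally show ?thesis using f by simp
    qed
    then have "(\<Sum>y<D. ((A y)\<^sup>\<dagger> * A y) $$ (x,x')) = (if f x = f x' then (\<Sum>y<D. cnj (\<zeta> x) ^ y * \<zeta> x' ^ y) / of_nat D else 0)"
      by (simp add: sum_divide_distrib)
    also have "\<dots> = (if x = x' then 1 else 0)"
      using roots_of_unity_orthogonal[OF x] x unfolding \<zeta>_def by auto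
    finally show "msum D D (\<lambda>y. (A y)\<^sup>\<dagger> * A y) {..<D} $$ (x,x') = 1\<^sub>m D $$ (x,x')" using x by simp
  qed auto
  \<comment> \<open>Bob's phase correction: on his side \<open>Z x\<close> identifies the register
    value coherently, so after learning \<open>y\<close> he can undo the phase block by
    block.\<close>
  define \<Theta> where "\<Theta> y = msum d d (\<lambda>x. cnj (\<zeta> x) ^ y \<cdot>\<^sub>m Z x) {..<D}" for y
  have \<Theta>_dims [simp]: "dim_row (\<Theta> y) = d" "dim_col (\<Theta> y) = d" for y by (simp_all add: \<Theta>_def)
  have \<Theta>Z: "\<Theta> y * Z x = cnj (\<zeta> x) ^ y \<cdot>\<^sub>m Z x" if x: "x < D" for x y
  proof -
    have "\<Theta> y * Z x = msum d d (\<lambda>x'. (cnj (\<zeta> x') ^ y \<cdot>\<^sub>m Z x') * Z x) {..<D}"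
      unfolding \<Theta>_def using x by (subst msum_mult) (auto simp: Zd)
    also have "\<dots> = (cnj (\<zeta> x) ^ y \<cdot>\<^sub>m Z x) * Z x"
      using x by (intro msum_single) (auto simp: Zd smult_mult_dim)
    finally show ?thesis using x by (simp add: smult_mult_dim Zd)
  qed
  have \<Theta>adj: "(\<Theta> y)\<^sup>\<dagger> = msum d d (\<lambda>x. \<zeta> x ^ y \<cdot>\<^sub>m Z x) {..<D}" for y
  proof -
    have "(\<Theta> y)\<^sup>\<dagger> = msum d d (\<lambda>x. (cnj (\<zeta> x) ^ y \<cdot>\<^sub>m Z x)\<^sup>\<dagger>) {..<D}"
      unfolding \<Theta>_def by (rule msum_adjoint) (auto simp: Zd)
    also have "\<dots> = msum d d (\<lambda>x. \<zeta> x ^ y \<cdot>\<^sub>m Z x) {..<D}"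
      by (rule msum_cong) (auto simp: adjoint_smult Zd)
    finally show ?thesis .
  qed
  have \<Theta>\<Theta>: "(\<Theta> y)\<^sup>\<dagger> * \<Theta> y = 1\<^sub>m d" for y
  proof -
    have Z\<Theta>: "Z x * \<Theta> y = cnj (\<zeta> x) ^ y \<cdot>\<^sub>m Z x" if x: "x < D" for x
    proof -
      have "Z x * \<Theta> y = msum d d (\<lambda>x'. Z x * (cnj (\<zeta> x') ^ y \<cdot>\<^sub>m Z x')) {..<D}"
        unfolding \<Theta>_def using x by (subst mult_msum) (auto simp: Zd)
      also have "\<dots> = Z x * (cnj (\<zeta> x) ^ y \<cdot>\<^sub>m Z x)"
        using x by (intro msum_single) (auto simp: Zd smult_mult_dim)
      finally show ?thesis using x by (simp add: smult_mult_dim Zd)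
    qed
    have "(\<Theta> y)\<^sup>\<dagger> * \<Theta> y = msum d d (\<lambda>x. (\<zeta> x ^ y \<cdot>\<^sub>m Z x) * \<Theta> y) {..<D}"
      unfolding \<Theta>adj by (subst msum_mult) (auto simp: Zd)
    also have "\<dots> = msum d d Z {..<D}"
    proof (rule msum_cong)
      fix x assume "x \<in> {..<D}"
      then have x: "x < D" by simp
      have "(\<zeta> x ^ y \<cdot>\<^sub>m Z x) * \<Theta> y = (\<zeta> x ^ y * cnj (\<zeta> x) ^ y) \<cdot>\<^sub>m Z x"
        using x by (simp add: smult_mult_dim Zd Z\<Theta>) (rule eq_matI, auto)
      also have "\<zeta> x ^ y * cnj (\<zeta> x) ^ y = 1" using \<zeta>1[of x] by (simp flip: power_mult_distrib add: mult.commute)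
      finally show "(\<zeta> x ^ y \<cdot>\<^sub>m Z x) * \<Theta> y = Z x" by (intro eq_matI) auto
    qed
    finally show ?thesis by (simp add: Zd)
  qed
  \<comment> \<open>The decoders \<open>W m\<close> may be incomplete; \<open>E\<close> supplies the
    missing weight.\<close>
  define E where "E = mfun sqrt (1\<^sub>m d - msum d d (\<lambda>m. (W m)\<^sup>\<dagger> * W m) {..<K})"
  have psdE: "psd d (1\<^sub>m d - msum d d (\<lambda>m. (W m)\<^sup>\<dagger> * W m) {..<K})"
    by (rule psd_kraus_complement) (use W WW in auto)
  note E = psd_sqrt[OF psdE, folded E_def]
  note [simp] = psdD(1-3)[OF E(1)]
  \<comment> \<open>Outcome \<open>k < L\<close> collects row \<open>k\<close> of every
    \<open>W i\<close> and outputs the hash value \<open>i\<close>. The outcomes from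
    \<open>L\<close> on carry the rows of \<open>E\<close>; row 0 is an arbitrary place for them,
    since the bound discards these outcomes.\<close>
  define B where "B k = mat K d (\<lambda>(i,z). if k < L then W i $$ (k,z) else if i = 0 then E $$ (k - L, z) else 0)" for k
  have B_dims [simp]: "dim_row (B k) = K" "dim_col (B k) = d" for k by (simp_all add: B_def)
  have B_sum: "msum d d (\<lambda>k. (B k)\<^sup>\<dagger> * B k) {..<L + d} = 1\<^sub>m d"
  proof (rule eq_matI)
    fix z z' assume "z < dim_row (1\<^sub>m d :: complex mat)" "z' < dim_col (1\<^sub>m d :: complex mat)"
    then have z: "z < d" "z' < d" by auto
    have split: "(\<Sum>k<L + d. g k) = (\<Sum>k<L. g k) + (\<Sum>k<d. g (L + k))" for g :: "nat \<Rightarrow> complex"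
    proof -
      have "(\<Sum>k<L + d. g k) = (\<Sum>k<L. g k) + (\<Sum>k=L..<L+d. g k)"
        by (simp add: sum.atLeastLessThan_concat[symmetric] lessThan_atLeast0)
      also have "(\<Sum>k=L..<L+d. g k) = (\<Sum>k<d. g (L + k))"
        using sum.shift_bounds_nat_ivl[of g 0 L d] by (simp add: add.commute lessThan_atLeast0)
      finally show ?thesis .
    qed
    have "(\<Sum>k<L. ((B k)\<^sup>\<dagger> * B k) $$ (z,z')) = (\<Sum>k<L. \<Sum>m<K. cnj (W m $$ (k,z)) * W m $$ (k,z'))"
      using z by (intro sum.cong refl) (simp add: mult_index B_def)
    also have "\<dots> = (\<Sum>m<K. ((W m)\<^sup>\<dagger> * W m) $$ (z,z'))"
      using z W by (subst sum.swap) (simp add: mult_index)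
    finally have 1: "(\<Sum>k<L. ((B k)\<^sup>\<dagger> * B k) $$ (z,z')) = msum d d (\<lambda>m. (W m)\<^sup>\<dagger> * W m) {..<K} $$ (z,z')"
      using z by simp
    have "((B (L + k))\<^sup>\<dagger> * B (L + k)) $$ (z,z') = cnj (E $$ (k,z)) * E $$ (k,z')" for k
    proof -
      have "((B (L + k))\<^sup>\<dagger> * B (L + k)) $$ (z,z') = (\<Sum>i<K. cnj (B (L + k) $$ (i,z)) * B (L + k) $$ (i,z'))"
        using z by (simp add: mult_index)
      also have "\<dots> = (\<Sum>i<K. if i = 0 then cnj (E $$ (k,z)) * E $$ (k,z') else 0)"
        by (intro sum.cong refl) (use z in \<open>auto simp: B_def\<close>)
      finally show ?thesis using K by simp
    qed
    then have "(\<Sum>k<d. ((B (L + k))\<^sup>\<dagger> * B (L + k)) $$ (z,z')) = (\<Sum>k<d. cnj (E $$ (k,z)) * E $$ (k,z'))"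
      by simp
    also have "\<dots> = (E\<^sup>\<dagger> * E) $$ (z,z')"
      using z by (subst mult_index) (simp_all del: psdD(3)[OF E(1)])
    also have "E\<^sup>\<dagger> * E = 1\<^sub>m d - msum d d (\<lambda>m. (W m)\<^sup>\<dagger> * W m) {..<K}" using E(2) by simp
    finally have 2: "(\<Sum>k<d. ((B (L + k))\<^sup>\<dagger> * B (L + k)) $$ (z,z')) = 1\<^sub>m d $$ (z,z') - msum d d (\<lambda>m. (W m)\<^sup>\<dagger> * W m) {..<K} $$ (z,z')"
      using z by simp
    show "msum d d (\<lambda>k. (B k)\<^sup>\<dagger> * B k) {..<L + d} $$ (z,z') = 1\<^sub>m d $$ (z,z')"
      using z unfolding msum_index[OF z] split 1 2 by simp
  qed auto
  have B\<Theta>_sum: "msum d d (\<lambda>k. (B k * \<Theta> y)\<^sup>\<dagger> * (B k * \<Theta> y)) {..<L + d} = 1\<^sub>m d" for y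
  proof -
    have "msum d d (\<lambda>k. (B k * \<Theta> y)\<^sup>\<dagger> * (B k * \<Theta> y)) {..<L + d} = msum d d (\<lambda>k. (\<Theta> y)\<^sup>\<dagger> * ((B k)\<^sup>\<dagger> * B k * \<Theta> y)) {..<L + d}"
      by (rule msum_cong) (simp add: adjoint_mult mult_assoc_dim)
    also have "\<dots> = (\<Theta> y)\<^sup>\<dagger> * (msum d d (\<lambda>k. (B k)\<^sup>\<dagger> * B k) {..<L + d} * \<Theta> y)"
      by (subst msum_mult) (auto simp: mult_msum)
    finally show ?thesis unfolding B_sum by (simp add: \<Theta>\<Theta>)
  qed
  define Kb where "Kb y = concat (map (\<lambda>k. map (\<lambda>M. M * kron (1\<^sub>m K) (B k * \<Theta> y)) [1\<^sub>m (K * K)]) [0..<L + d])" for y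
  define Ks where "Ks = concat (map (\<lambda>y. map (\<lambda>M. M * kron (A y) (1\<^sub>m d)) (Kb y)) [0..<D])"
  have Kb: "locc K d K K (Kb y)" for y
    unfolding Kb_def
    by (rule locc_bob[where c = "\<lambda>_. K" and Ks = "\<lambda>_. [1\<^sub>m (K * K)]" and B = "\<lambda>k. B k * \<Theta> y"])
      (auto simp: B\<Theta>_sum locc_id intro!: carrier_matI)
  have locc: "locc D d K K Ks"
    unfolding Ks_def
    by (rule locc_alice[where c = "\<lambda>_. K"]) (auto simp: A_sum A_dims Kb intro!: carrier_matI)
  let ?\<phi> = "col_mat (phi_max K)"
  define Q where "Q = msum L d (\<lambda>x. W (f x) * Z x) {..<D} * T"
  have Qkc: "Q $$ (k,c) = (\<Sum>x<D. (W (f x) * Z x * T) $$ (k,c))" if "k < L" "c < dim_col T" for k c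
    unfolding Q_def using that f W by (subst msum_mult) (auto simp: Zd)
  \<comment> \<open>The overlap does not depend on \<open>y\<close>: the phases of
    \<open>A y\<close> and \<open>\<Theta> y\<close> cancel, and the sum over the diagonal of the
    maximally entangled vector recombines the hash classes into row \<open>k\<close> of
    \<open>Q\<close>.\<close>
  have ent: "(?\<phi>\<^sup>\<dagger> * (1\<^sub>m (K * K) * kron (1\<^sub>m K) (B k * \<Theta> y) * kron (A y) (1\<^sub>m d) * P)) $$ (0,c)
      = complex_of_real (1 / sqrt (real K)) * (Q $$ (k,c) / complex_of_real (sqrt (real D)))"
    if k: "k < L" and c: "c < dim_col T" for k c y
  proof -
    have kr: "1\<^sub>m (K * K) * kron (1\<^sub>m K) (B k * \<Theta> y) * kron (A y) (1\<^sub>m d) = kron (A y) (B k * \<Theta> y)"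
      by (simp add: kron_mult A_dims)
    have BZ: "(\<Sum>z<d. (B k * \<Theta> y) $$ (i,z) * (Z x * T) $$ (z,c)) = cnj (\<zeta> x) ^ y * (W i * Z x * T) $$ (k,c)"
      if x: "x < D" and i: "i < K" for x i
    proof -
      have "(\<Sum>z<d. (B k * \<Theta> y) $$ (i,z) * (Z x * T) $$ (z,c)) = (B k * \<Theta> y * (Z x * T)) $$ (i,c)"
        using x i c by (subst (2) mult_index) (auto simp: Zd)
      also have "B k * \<Theta> y * (Z x * T) = B k * ((\<Theta> y * Z x) * T)" using x by (simp add: mult_assoc_dim Zd)
      also have "\<dots> = cnj (\<zeta> x) ^ y \<cdot>\<^sub>m (B k * (Z x * T))" using x by (simp add: \<Theta>Z smult_mult_dim Zd)
      also have "(cnj (\<zeta> x) ^ y \<cdot>\<^sub>m (B k * (Z x * T))) $$ (i,c) = cnj (\<zeta> x) ^ y * (B k * (Z x * T)) $$ (i,c)"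
        using i c by simp
      also have "(B k * (Z x * T)) $$ (i,c) = (W i * (Z x * T)) $$ (k,c)"
        using x i c k W[OF i] by (subst (1 2) mult_index) (auto simp: Zd B_def)
      finally show ?thesis using x W[OF i] by (simp add: mult_assoc_dim Zd)
    qed
    have "(kron (A y) (B k * \<Theta> y) * P) $$ (i * K + i, c)
        = (\<Sum>x<D. (if f x = i then (W (f x) * Z x * T) $$ (k,c) else 0) / complex_of_real (sqrt (real D)))" if i: "i < K" for i
    proof -
      have "(kron (A y) (B k * \<Theta> y) * P) $$ (i * K + i, c) = (\<Sum>x<D. \<Sum>z<d. A y $$ (i,x) * (B k * \<Theta> y) $$ (i,z) * (Z x * T) $$ (z,c))"
        using i c by (subst mult_index) (auto simp: A_dims P_def sum_lessThan_mult kron_index intro!: sum.cong)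
      also have "\<dots> = (\<Sum>x<D. A y $$ (i,x) * (\<Sum>z<d. (B k * \<Theta> y) $$ (i,z) * (Z x * T) $$ (z,c)))"
        by (simp add: sum_distrib_left mult.assoc)
      also have "\<dots> = (\<Sum>x<D. A y $$ (i,x) * (cnj (\<zeta> x) ^ y * (W i * Z x * T) $$ (k,c)))"
        using i by (intro sum.cong refl) (simp add: BZ)
      also have "\<dots> = (\<Sum>x<D. (if f x = i then (W (f x) * Z x * T) $$ (k,c) else 0) / complex_of_real (sqrt (real D)))"
      proof (intro sum.cong refl)
        fix x assume "x \<in> {..<D}"
        then have x: "x < D" by simp
        have "\<zeta> x ^ y * cnj (\<zeta> x) ^ y = 1" using \<zeta>1[of x] by (simp flip: power_mult_distrib add: mult.commute)
        then have "\<zeta> x ^ y * (cnj (\<zeta> x) ^ y * w) = w" for w by (simp add: mult.assoc[symmetric])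
        then show "A y $$ (i,x) * (cnj (\<zeta> x) ^ y * (W i * Z x * T) $$ (k,c))
          = (if f x = i then (W (f x) * Z x * T) $$ (k,c) else 0) / complex_of_real (sqrt (real D))"
          using x i by (auto simp: A_def)
      qed
      finally show ?thesis .
    qed
    then have "(\<Sum>i<K. (kron (A y) (B k * \<Theta> y) * P) $$ (i * K + i, c))
      = (\<Sum>x<D. \<Sum>i<K. (if f x = i then (W (f x) * Z x * T) $$ (k,c) else 0) / complex_of_real (sqrt (real D)))"
      by (simp add: sum.swap[of _ "{..<K}"])
    also have "\<dots> = Q $$ (k,c) / complex_of_real (sqrt (real D))"
      using k c f by (simp add: Qkc sum_divide_distrib if_distrib[of "\<lambda>x. x / _"] cong: if_cong)
    finally have "(\<Sum>i<K. (kron (A y) (B k * \<Theta> y) * P) $$ (i * K + i, c)) = Q $$ (k,c) / complex_of_real (sqrt (real D))" .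
    then show ?thesis unfolding kr using c by (subst phi_max_mult) (auto simp: A_dims P_def)
  qed
  have nm: "(\<Sum>k<L. (fnorm (?\<phi>\<^sup>\<dagger> * (1\<^sub>m (K * K) * kron (1\<^sub>m K) (B k * \<Theta> y) * kron (A y) (1\<^sub>m d) * P)))\<^sup>2) = (fnorm Q)\<^sup>2 / (real K * real D)" for y
  proof -
    have "(fnorm (?\<phi>\<^sup>\<dagger> * (1\<^sub>m (K * K) * kron (1\<^sub>m K) (B k * \<Theta> y) * kron (A y) (1\<^sub>m d) * P)))\<^sup>2 = (\<Sum>c<dim_col T. (cmod (Q $$ (k,c)))\<^sup>2) / (real K * real D)"
      if "k < L" for k
    proof -
      have "(fnorm (?\<phi>\<^sup>\<dagger> * (1\<^sub>m (K * K) * kron (1\<^sub>m K) (B k * \<Theta> y) * kron (A y) (1\<^sub>m d) * P)))\<^sup>2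
          = (\<Sum>c<dim_col T. (cmod ((?\<phi>\<^sup>\<dagger> * (1\<^sub>m (K * K) * kron (1\<^sub>m K) (B k * \<Theta> y) * kron (A y) (1\<^sub>m d) * P)) $$ (0,c)))\<^sup>2)"
        unfolding fnorm_sq by (simp add: P_def)
      also have "\<dots> = (\<Sum>c<dim_col T. (cmod (Q $$ (k,c)))\<^sup>2 / (real K * real D))"
      proof (intro sum.cong refl)
        fix c assume "c \<in> {..<dim_col T}"
        then have c: "c < dim_col T" by simp
        show "(cmod ((?\<phi>\<^sup>\<dagger> * (1\<^sub>m (K * K) * kron (1\<^sub>m K) (B k * \<Theta> y) * kron (A y) (1\<^sub>m d) * P)) $$ (0,c)))\<^sup>2
          = (cmod (Q $$ (k,c)))\<^sup>2 / (real K * real D)"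
          unfolding ent[OF that c] by (simp add: norm_mult norm_divide power_mult_distrib power_divide)
      qed
      finally show ?thesis by (simp add: sum_divide_distrib)
    qed
    then show ?thesis unfolding fnorm_sq[of Q] by (simp add: sum_divide_distrib Q_def)
  qed
  have fid1: "Re (cinner (phi_max K) (apply_kraus (K * K) Ks (P * P\<^sup>\<dagger>) *\<^sub>v phi_max K)) = (\<Sum>M\<leftarrow>Ks. (fnorm (?\<phi>\<^sup>\<dagger> * (M * P)))\<^sup>2)"
    using locc_kraus_dims[OF locc] by (intro apply_kraus_fidelity) (auto simp: P_def)
  have fid2: "(\<Sum>M\<leftarrow>Ks. (fnorm (?\<phi>\<^sup>\<dagger> * (M * P)))\<^sup>2) = (\<Sum>y<D. \<Sum>k<L + d. (fnorm (?\<phi>\<^sup>\<dagger> * (1\<^sub>m (K * K) * kron (1\<^sub>m K) (B k * \<Theta> y) * kron (A y) (1\<^sub>m d) * P)))\<^sup>2)"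
    unfolding Ks_def Kb_def sum_list_concat_map by (simp add: map_concat o_def sum_list_concat_map interv_sum_list_conv_sum_set_nat atLeast0LessThan del: upt_Suc)
  \<comment> \<open>The completing outcomes contribute a nonnegative amount and are dropped.\<close>
  have "(\<Sum>y<D. \<Sum>k<L. (fnorm (?\<phi>\<^sup>\<dagger> * (1\<^sub>m (K * K) * kron (1\<^sub>m K) (B k * \<Theta> y) * kron (A y) (1\<^sub>m d) * P)))\<^sup>2)
    \<le> (\<Sum>y<D. \<Sum>k<L + d. (fnorm (?\<phi>\<^sup>\<dagger> * (1\<^sub>m (K * K) * kron (1\<^sub>m K) (B k * \<Theta> y) * kron (A y) (1\<^sub>m d) * P)))\<^sup>2)"
    by (intro sum_mono sum_mono2) auto
  then have "(\<Sum>y<D. (fnorm Q)\<^sup>2 / (real K * real D)) \<le> Re (cinner (phi_max K) (apply_kraus (K * K) Ks (P * P\<^sup>\<dagger>) *\<^sub>v phi_max K))"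
    unfolding nm fid1 fid2 .
  moreover have "(\<Sum>y<D. (fnorm Q)\<^sup>2 / (real K * real D)) = (fnorm Q)\<^sup>2 / real K"
  proof (cases "D = 0")
    case True
    have "Q = 0\<^sub>m L (dim_col T)"
      unfolding Q_def by (rule eq_matI) (auto simp: mult_index True)
    then show ?thesis using True by simp
  qed simp
  ultimately show ?thesis using locc unfolding P_def Q_def by auto
qed

lemma psd_smult:
  assumes A: "psd n A" and r: "0 \<le> r"
  shows "psd n (complex_of_real r \<cdot>\<^sub>m A)"
proof -
  define R where "R = mfun sqrt A"
  note R = psd_sqrt[OF A, folded R_def]
  note [simp] = psdD(1-3)[OF R(1)]
  have "(complex_of_real (sqrt r) \<cdot>\<^sub>m R)\<^sup>\<dagger> * (complex_of_real (sqrt r) \<cdot>\<^sub>m R) = complex_of_real r \<cdot>\<^sub>m A"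
    unfolding R(2)[symmetric]
    by (simp add: adjoint_smult smult_mult_dim) (rule eq_matI, use r in \<open>auto simp flip: mult.assoc of_real_mult\<close>)
  then show ?thesis using psd_gram[of "complex_of_real (sqrt r) \<cdot>\<^sub>m R" n] by simp
qed

text \<open>Decoupling in Gram form. Hash value \<open>m\<close> leaves \<open>C\<close> in the
  unnormalised state \<open>S m\<close>; if all of these were \<open>\<rho> / K\<close>, polar
  decomposition would provide a perfect decoder up to the weight of \<open>T'\<close>.
  Powers-Stormer turns the deviations \<open>\<Delta> m\<close> into overlaps of square roots, and
  \<open>\<Omega>\<close>, which acts as the identity on \<open>T'\<close> from the right, converts
  trace norm to Frobenius norm at the cost \<open>fnorm \<Omega>\<close>. \<open>T'\<close> is an
  approximation of \<open>T\<close> for which the collision sum \<open>l\<close> is under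
  control.\<close>

lemma hashing_one_shot:
  assumes Z: "info_type d D Z" and T [simp]: "dim_row T = d" "dim_col T = c"
    and T' [simp]: "dim_row T' = d" "dim_col T' = c"
    and \<Omega> [simp]: "dim_row \<Omega> = c" "dim_col \<Omega> = c" and \<Omega>adj: "\<Omega>\<^sup>\<dagger> = \<Omega>" and T'\<Omega>: "T' * \<Omega> = T'"
    and T'1: "fnorm T' \<le> 1" and K: "1 \<le> K"
    and l: "(\<Sum>x<D. (fnorm (T'\<^sup>\<dagger> * (Z x * T')))\<^sup>2) \<le> l"
    and g: "g \<le> (fnorm T')\<^sup>2 - fnorm \<Omega> * sqrt (real K * l) / 2 - fnorm (T - T')"
  shows "\<exists>Ks. locc D d K K Ks \<and>
    (max 0 g)\<^sup>2 \<le> Re (cinner (phi_max K) (apply_kraus (K * K) Ks (premeasure d D Z T * (premeasure d D Z T)\<^sup>\<dagger>) *\<^sub>v phi_max K))"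
proof -
  note Zd = info_typeD[OF Z]
  define \<sigma> where "\<sigma> x = T'\<^sup>\<dagger> * (Z x * T')" for x
  have \<sigma>_dims [simp]: "dim_row (\<sigma> x) = c" "dim_col (\<sigma> x) = c" for x by (simp_all add: \<sigma>_def)
  obtain f where f: "\<And>x. f x < K" and hash:
    "(\<Sum>m<K. \<Sum>i\<in>{..<c} \<times> {..<c}. (cmod (\<Sum>x<D. complex_of_real ((if f x = m then 1 else 0) - 1 / real K) * \<sigma> x $$ i))\<^sup>2)
      \<le> (\<Sum>x<D. \<Sum>i\<in>{..<c} \<times> {..<c}. (cmod (\<sigma> x $$ i))\<^sup>2)"
    using greedy_hash[OF K, where I = "{..<c} \<times> {..<c}" and \<sigma> = "\<lambda>x i. \<sigma> x $$ i" and D = D] by blast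
  define P where "P m = msum d d (\<lambda>x. if f x = m then Z x else 0\<^sub>m d d) {..<D}" for m
  have P_dims [simp]: "dim_row (P m) = d" "dim_col (P m) = d" for m by (simp_all add: P_def)
  have Padj: "(P m)\<^sup>\<dagger> = P m" for m
    unfolding P_def by (subst msum_adjoint) (auto simp: Zd intro!: msum_cong eq_matI)
  have PZ: "P m * Z x = (if f x = m then Z x else 0\<^sub>m d d)" if x: "x < D" for m x
  proof -
    have "P m * Z x = msum d d (\<lambda>x'. (if f x' = m then Z x' else 0\<^sub>m d d) * Z x) {..<D}"
      unfolding P_def using x by (subst msum_mult) (auto simp: Zd)
    also have "\<dots> = (if f x = m then Z x else 0\<^sub>m d d) * Z x"
      using x by (intro msum_single) (auto simp: Zd left_mult_zero_mat' )
    finally show ?thesis using x by (auto simp: Zd)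
  qed
  have PP: "P m * P m = P m" for m
  proof -
    have "P m * P m = msum d d (\<lambda>x. P m * (if f x = m then Z x else 0\<^sub>m d d)) {..<D}"
      by (subst (2) P_def, subst mult_msum) (auto simp: Zd)
    also have "\<dots> = P m" unfolding P_def[of m, symmetric]
      by (subst (2) P_def, rule msum_cong) (auto simp: PZ)
    finally show ?thesis .
  qed
  have Psum: "msum d d P {..<K} = 1\<^sub>m d"
  proof -
    have "msum d d P {..<K} = msum d d Z {..<D}"
    proof (rule eq_matI)
      fix i j assume "i < dim_row (msum d d Z {..<D})" "j < dim_col (msum d d Z {..<D})"
      then have ij: "i < d" "j < d" by auto
      have "(\<Sum>m<K. P m $$ (i,j)) = (\<Sum>x<D. \<Sum>m<K. if m = f x then Z x $$ (i,j) else 0)"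
        unfolding P_def using ij by (subst sum.swap) (auto intro!: sum.cong)
      then show "msum d d P {..<K} $$ (i,j) = msum d d Z {..<D} $$ (i,j)" using ij f by simp
    qed auto
    then show ?thesis by (simp add: Zd)
  qed
  have Pnorm: "(\<Sum>m<K. (fnorm (P m * A))\<^sup>2) = (fnorm A)\<^sup>2" if "dim_row A = d" for A
    by (rule kraus_sum_fnorm[where n = d]) (auto simp: Padj PP Psum that)
  define S where "S m = (P m * T')\<^sup>\<dagger> * (P m * T')" for m
  have S_dims [simp]: "dim_row (S m) = c" "dim_col (S m) = c" for m by (simp_all add: S_def)
  have S_psd: "psd c (S m)" for m unfolding S_def by (rule psd_gram) simp
  have S_alt: "S m = T'\<^sup>\<dagger> * (P m * T')" for m
    unfolding S_def by (simp add: adjoint_mult Padj mult_assoc_dim) (simp add: mult_assoc_dim[symmetric] PP)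
  have S_sum: "S m $$ (i,j) = (\<Sum>x<D. (if f x = m then 1 else 0) * \<sigma> x $$ (i,j))" if ij: "i < c" "j < c" for m i j
  proof -
    have "P m * T' = msum d c (\<lambda>x. (if f x = m then Z x else 0\<^sub>m d d) * T') {..<D}"
      unfolding P_def by (subst msum_mult) (auto simp: Zd)
    then have "S m = msum c c (\<lambda>x. T'\<^sup>\<dagger> * ((if f x = m then Z x else 0\<^sub>m d d) * T')) {..<D}"
      unfolding S_alt by (simp only:) (subst mult_msum, auto simp: Zd)
    then show ?thesis using ij by (auto intro!: sum.cong simp: \<sigma>_def mult_index)
  qed
  define \<rho> where "\<rho> = T'\<^sup>\<dagger> * T'"
  have \<rho>_dims [simp]: "dim_row \<rho> = c" "dim_col \<rho> = c" by (simp_all add: \<rho>_def)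
  have \<rho>_psd: "psd c \<rho>" unfolding \<rho>_def by (rule psd_gram) simp
  have \<rho>_sum: "\<rho> $$ (i,j) = (\<Sum>x<D. \<sigma> x $$ (i,j))" if ij: "i < c" "j < c" for i j
  proof -
    have "T' = msum d d Z {..<D} * T'" by (simp add: Zd)
    also have "\<dots> = msum d c (\<lambda>x. Z x * T') {..<D}" by (subst msum_mult) (auto simp: Zd)
    finally have "\<rho> = T'\<^sup>\<dagger> * msum d c (\<lambda>x. Z x * T') {..<D}"
      unfolding \<rho>_def by (rule arg_cong)
    also have "\<dots> = msum c c \<sigma> {..<D}"
      unfolding \<sigma>_def by (subst mult_msum) (auto simp: Zd)
    finally have "\<rho> = msum c c \<sigma> {..<D}" .
    then show ?thesis using ij by simp
  qed
  define w where "w = (fnorm T')\<^sup>2"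
  have trS: "(\<Sum>m<K. Re (mtrace (S m))) = w"
    unfolding S_def fnorm_sq_mtrace w_def using Pnorm[of T'] by simp
  have tr\<rho>: "mtrace \<rho> = complex_of_real w" unfolding \<rho>_def w_def by (rule fnorm_sq_mtrace)
  define a where "a m = mfun sqrt (S m)" for m
  note a = psd_sqrt[OF S_psd, folded a_def]
  note [simp] = psdD(1-3)[OF a(1)]
  define G where "G = mfun sqrt \<rho>"
  note G = psd_sqrt[OF \<rho>_psd, folded G_def]
  note [simp] = psdD(1-3)[OF G(1)]
  have "complex_of_real ((fnorm G)\<^sup>2) = complex_of_real w"
    unfolding G_def psd_mtrace[OF \<rho>_psd, symmetric] by (rule tr\<rho>)
  then have Gn: "fnorm G = fnorm T'" unfolding w_def by (simp only: of_real_eq_iff) (simp add: power2_eq_iff_nonneg)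
  have "\<exists>V. dim_row V = d \<and> dim_col V = c \<and> contr V \<and> a m = (P m * T')\<^sup>\<dagger> * V" for m
    using gram_factor[of "a m" c "(P m * T')\<^sup>\<dagger>"] a(2)[of m] by (simp add: S_def)
  then obtain V where V: "\<And>m. dim_row (V m) = d" "\<And>m. dim_col (V m) = c" "\<And>m. contr (V m)"
    "\<And>m. a m = (P m * T')\<^sup>\<dagger> * V m" by metis
  note [simp] = V(1,2)
  \<comment> \<open>The adjoint polar factor maps branch \<open>m\<close> of \<open>T'\<close> to
    the square root \<open>a m\<close>; restricting it to \<open>P m\<close> makes the family
    jointly subnormalised.\<close>
  define W where "W m = (V m)\<^sup>\<dagger> * P m" for m
  have W_dims [simp]: "dim_row (W m) = c" "dim_col (W m) = d" for m by (simp_all add: W_def)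
  have WT': "W m * T' = a m" for m
  proof -
    have "W m * T' = ((P m * T')\<^sup>\<dagger> * V m)\<^sup>\<dagger>"
      by (simp add: W_def adjoint_mult mult_assoc_dim)
    also have "\<dots> = a m" unfolding V(4)[symmetric] by simp
    finally show ?thesis .
  qed
  have WW: "(\<Sum>m<K. (fnorm (W m * A))\<^sup>2) \<le> (fnorm A)\<^sup>2" if A: "dim_row A = d" for A
  proof -
    have "fnorm (W m * A) \<le> fnorm (P m * A)" for m
      using contrD[OF contr_adjoint[OF V(3)], of "P m * A" m] A by (simp add: W_def mult_assoc_dim)
    then have "(\<Sum>m<K. (fnorm (W m * A))\<^sup>2) \<le> (\<Sum>m<K. (fnorm (P m * A))\<^sup>2)" by (intro sum_mono power_mono) auto
    then show ?thesis using Pnorm[OF A] by simp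
  qed
  define L where "L = msum c d (\<lambda>x. W (f x) * Z x) {..<D}"
  have [simp]: "dim_row L = c" "dim_col L = d" by (simp_all add: L_def)
  have L: "L = msum c d W {..<K}"
  proof (rule eq_matI)
    fix i j assume "i < dim_row (msum c d W {..<K})" "j < dim_col (msum c d W {..<K})"
    then have ij: "i < c" "j < d" by auto
    have "W m = W m * P m" for m by (simp add: W_def mult_assoc_dim PP)
    then have "W m $$ (i,j) = (W m * P m) $$ (i,j)" for m by metis
    moreover have "W m * P m = msum c d (\<lambda>x. W m * (if f x = m then Z x else 0\<^sub>m d d)) {..<D}" for m
      unfolding P_def by (subst mult_msum) (auto simp: Zd)
    ultimately have "W m $$ (i,j) = (\<Sum>x<D. (W m * (if f x = m then Z x else 0\<^sub>m d d)) $$ (i,j))" for m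
      using ij by simp
    also have "(\<Sum>x<D. (W m * (if f x = m then Z x else 0\<^sub>m d d)) $$ (i,j)) = (\<Sum>x<D. if m = f x then (W (f x) * Z x) $$ (i,j) else 0)" for m
      using ij by (intro sum.cong refl) (auto simp: mult_index)
    finally have "(\<Sum>m<K. W m $$ (i,j)) = (\<Sum>x<D. \<Sum>m<K. if m = f x then (W (f x) * Z x) $$ (i,j) else 0)"
      by (simp only:) (rule sum.swap)
    then show "L $$ (i,j) = msum c d W {..<K} $$ (i,j)" using ij f by (simp add: L_def)
  qed auto
  \<comment> \<open>Adding up \<open>K\<close> operators with jointly bounded squares costs the root
    of \<open>K\<close>, which is compensated by the normalisation \<open>k\<close> of the maximally
    entangled vector.\<close>
  have Lnorm: "fnorm (L * A) \<le> sqrt (real K) * fnorm A" if A: "dim_row A = d" for A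
  proof -
    have "L * A = msum c (dim_col A) (\<lambda>m. W m * A) {..<K}" unfolding L using A by (subst msum_mult) auto
    then have "fnorm (L * A) \<le> (\<Sum>m<K. fnorm (W m * A))" by (simp add: fnorm_msum_le)
    then have "(fnorm (L * A))\<^sup>2 \<le> (\<Sum>m<K. fnorm (W m * A))\<^sup>2" by (intro power_mono) auto
    also have "\<dots> \<le> real K * (\<Sum>m<K. (fnorm (W m * A))\<^sup>2)" by (rule sum_sq_le_card)
    also have "\<dots> \<le> real K * (fnorm A)\<^sup>2" by (intro mult_left_mono WW A) simp
    finally have "(fnorm (L * A))\<^sup>2 \<le> (sqrt (real K) * fnorm A)\<^sup>2" by (simp add: power_mult_distrib)
    then show ?thesis by (rule power2_le_imp_le) simp
  qed
  define k where "k = 1 / sqrt (real K)"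
  have k0: "k \<ge> 0" and kk: "k * k = 1 / real K" and kK: "sqrt (real K) * k = 1" using K by (simp_all add: k_def flip: real_sqrt_mult)
  \<comment> \<open>\<open>b\<close> is the square root of the ideal state
    \<open>\<rho> / K\<close>, the target of every \<open>a m\<close>.\<close>
  define b where "b = complex_of_real k \<cdot>\<^sub>m G"
  have b: "psd c b" unfolding b_def by (rule psd_smult[OF G(1) k0])
  note [simp] = psdD(1-3)[OF b]
  have bb: "b * b = complex_of_real (1 / real K) \<cdot>\<^sub>m \<rho>"
    unfolding b_def G(2)[symmetric] kk[symmetric]
    by (simp add: smult_mult_dim) (rule eq_matI, auto)
  define \<Delta> where "\<Delta> m = S m - complex_of_real (1 / real K) \<cdot>\<^sub>m \<rho>" for m
  have [simp]: "dim_row (\<Delta> m) = c" "dim_col (\<Delta> m) = c" for m by (simp_all add: \<Delta>_def)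
  have \<Delta>\<Omega>: "\<Delta> m * \<Omega> = \<Delta> m" for m
    unfolding \<Delta>_def S_alt \<rho>_def by (simp add: minus_mult_distrib_dim smult_mult_dim mult_assoc_dim T'\<Omega>)
  have \<Delta>sum: "(\<Sum>m<K. (fnorm (\<Delta> m))\<^sup>2) \<le> l"
  proof -
    have "(fnorm (\<Delta> m))\<^sup>2 = (\<Sum>i\<in>{..<c} \<times> {..<c}. (cmod (\<Sum>x<D. complex_of_real ((if f x = m then 1 else 0) - 1 / real K) * \<sigma> x $$ i))\<^sup>2)" for m
    proof -
      have "\<Delta> m $$ (i,j) = (\<Sum>x<D. complex_of_real ((if f x = m then 1 else 0) - 1 / real K) * \<sigma> x $$ (i,j))" if "i < c" "j < c" for i j
      proof -
        have "\<Delta> m $$ (i,j) = (\<Sum>x<D. (if f x = m then 1 else 0) * \<sigma> x $$ (i,j)) - (\<Sum>x<D. complex_of_real (1 / real K) * \<sigma> x $$ (i,j))"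
          unfolding \<Delta>_def using that by (simp add: S_sum \<rho>_sum sum_distrib_left)
        also have "\<dots> = (\<Sum>x<D. complex_of_real ((if f x = m then 1 else 0) - 1 / real K) * \<sigma> x $$ (i,j))"
          unfolding sum_subtractf[symmetric] by (intro sum.cong refl) (auto simp: left_diff_distrib)
        finally show ?thesis .
      qed
      then show ?thesis unfolding fnorm_sq by (simp add: sum.cartesian_product)
    qed
    moreover have "(fnorm (\<sigma> x))\<^sup>2 = (\<Sum>i\<in>{..<c} \<times> {..<c}. (cmod (\<sigma> x $$ i))\<^sup>2)" for x
      unfolding fnorm_sq by (simp add: sum.cartesian_product)
    ultimately show ?thesis using hash l unfolding \<sigma>_def[symmetric] by simp
  qed
  have ps: "Re (mtrace (S m)) + w / real K - 2 * Re (mtrace (b * a m)) \<le> fnorm \<Omega> * fnorm (\<Delta> m)" for m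
  proof -
    obtain R where R: "dim_row R = c" "dim_col R = c" "contr R"
      and le: "(fnorm (a m - b))\<^sup>2 \<le> Re (mtrace (R * (a m * a m - b * b)))"
      using powers_stormer[OF a(1) b] by blast
    note [simp] = R(1,2)
    have "a m * a m - b * b = \<Delta> m" unfolding a(2) bb \<Delta>_def ..
    \<comment> \<open>Inserting \<open>\<Omega>\<close> before Cauchy-Schwarz leaves
      \<open>fnorm \<Omega>\<close> where the contraction \<open>R\<close> alone could contribute
      the root of the full dimension \<open>c\<close>.\<close>
    moreover have "mtrace (R * \<Delta> m) = mtrace ((R\<^sup>\<dagger> * \<Omega>)\<^sup>\<dagger> * \<Delta> m)"
    proof -
      have "mtrace (R * \<Delta> m) = mtrace (R * \<Delta> m * \<Omega>)" by (simp add: mult_assoc_dim \<Delta>\<Omega>)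
      also have "\<dots> = mtrace (\<Omega> * (R * \<Delta> m))" by (rule mtrace_cyclic) auto
      finally show ?thesis by (simp add: adjoint_mult \<Omega>adj mult_assoc_dim)
    qed
    moreover have "Re (mtrace ((R\<^sup>\<dagger> * \<Omega>)\<^sup>\<dagger> * \<Delta> m)) \<le> cmod (mtrace ((R\<^sup>\<dagger> * \<Omega>)\<^sup>\<dagger> * \<Delta> m))" by (rule complex_Re_le_cmod)
    moreover have "\<dots> \<le> fnorm (R\<^sup>\<dagger> * \<Omega>) * fnorm (\<Delta> m)" by (rule mtrace_Cauchy_Schwarz) auto
    moreover have "\<dots> \<le> fnorm \<Omega> * fnorm (\<Delta> m)"
      by (intro mult_right_mono contrD[OF contr_adjoint[OF R(3)]]) auto
    ultimately have 1: "(fnorm (a m - b))\<^sup>2 \<le> fnorm \<Omega> * fnorm (\<Delta> m)" using le by simp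
    have "mtrace ((a m - b)\<^sup>\<dagger> * (a m - b)) = mtrace (a m * a m) - mtrace (b * a m) - (mtrace (a m * b) - mtrace (b * b))"
      by (simp add: adjoint_minus minus_mult_distrib_dim mult_minus_distrib_dim mtrace_minus)
    also have "mtrace (a m * b) = mtrace (b * a m)" by (rule mtrace_cyclic) auto
    also have "mtrace (a m * a m) = mtrace (S m)" by (simp add: a(2))
    also have "mtrace (b * b) = complex_of_real (w / real K)" unfolding bb by (simp add: mtrace_smult tr\<rho>)
    finally have "(fnorm (a m - b))\<^sup>2 = Re (mtrace (S m)) + w / real K - 2 * Re (mtrace (b * a m))"
      unfolding fnorm_sq_Re_mtrace by simp
    then show ?thesis using 1 by simp
  qed
  have \<Delta>1: "(\<Sum>m<K. fnorm (\<Delta> m)) \<le> sqrt (real K * l)"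
  proof (rule real_le_rsqrt)
    have "(\<Sum>m<K. fnorm (\<Delta> m))\<^sup>2 \<le> real K * (\<Sum>m<K. (fnorm (\<Delta> m))\<^sup>2)" by (rule sum_sq_le_card)
    also have "\<dots> \<le> real K * l" by (intro mult_left_mono \<Delta>sum) simp
    finally show "(\<Sum>m<K. fnorm (\<Delta> m))\<^sup>2 \<le> real K * l" .
  qed
  \<comment> \<open>Summed over \<open>m\<close>, the two trace terms give \<open>w\<close> each, so
    the total overlap of \<open>b\<close> with the \<open>a m\<close> falls short of
    \<open>w\<close> by at most half the total deviation.\<close>
  have "(\<Sum>m<K. Re (mtrace (S m)) + w / real K - 2 * Re (mtrace (b * a m))) \<le> (\<Sum>m<K. fnorm \<Omega> * fnorm (\<Delta> m))"
    by (intro sum_mono ps)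
  also have "\<dots> \<le> fnorm \<Omega> * sqrt (real K * l)"
    unfolding sum_distrib_left[symmetric] by (intro mult_left_mono \<Delta>1) simp
  also have "(\<Sum>m<K. Re (mtrace (S m)) + w / real K - 2 * Re (mtrace (b * a m))) = w + w - 2 * (\<Sum>m<K. Re (mtrace (b * a m)))"
    using K trS by (simp add: sum_subtractf sum.distrib sum_distrib_left)
  finally have ba: "w - fnorm \<Omega> * sqrt (real K * l) / 2 \<le> (\<Sum>m<K. Re (mtrace (b * a m)))" by simp
  have LT': "L * T' = msum c c a {..<K}"
    unfolding L by (subst msum_mult) (auto simp: WT')
  have "mtrace (G\<^sup>\<dagger> * (L * T')) = (\<Sum>m<K. mtrace (G * a m))"
  proof -
    have "G\<^sup>\<dagger> * (L * T') = msum c c (\<lambda>m. G * a m) {..<K}" unfolding LT' by (subst mult_msum) auto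
    then have "mtrace (G\<^sup>\<dagger> * (L * T')) = (\<Sum>m<K. \<Sum>i<c. (G * a m) $$ (i,i))" by (simp add: mtrace_msum)
    then show ?thesis unfolding mtrace_def[of "G * _"] by simp
  qed
  moreover have "complex_of_real k * mtrace (G * a m) = mtrace (b * a m)" for m
    unfolding b_def by (simp add: smult_mult_dim mtrace_smult)
  ultimately have kG: "complex_of_real k * mtrace (G\<^sup>\<dagger> * (L * T')) = (\<Sum>m<K. mtrace (b * a m))"
    by (simp add: sum_distrib_left)
  \<comment> \<open>The total overlap is an inner product of \<open>G\<close> with
    \<open>L * T'\<close>, up to the factor \<open>k\<close>; as the norm of \<open>G\<close> is at
    most 1, only the norm of \<open>L * T'\<close> remains.\<close>
  have "Re (\<Sum>m<K. mtrace (b * a m)) \<le> cmod (complex_of_real k * mtrace (G\<^sup>\<dagger> * (L * T')))"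
    unfolding kG by (rule complex_Re_le_cmod)
  also have "\<dots> = k * cmod (mtrace (G\<^sup>\<dagger> * (L * T')))" using k0 by (simp add: norm_mult)
  also have "\<dots> \<le> k * (fnorm G * fnorm (L * T'))" by (intro mult_left_mono mtrace_Cauchy_Schwarz k0) auto
  also have "\<dots> \<le> k * (1 * fnorm (L * T'))" using Gn T'1 by (intro mult_left_mono mult_right_mono k0) auto
  finally have 1: "(\<Sum>m<K. Re (mtrace (b * a m))) \<le> k * fnorm (L * T')" by simp
  have "fnorm (L * T') \<le> fnorm (L * T) + fnorm (L * T' - L * T)" by (rule fnorm_le_add_diff) auto
  also have "L * T' - L * T = L * (T' - T)" by (simp add: mult_minus_distrib_dim)
  also have "fnorm (L * (T' - T)) \<le> sqrt (real K) * fnorm (T' - T)" by (rule Lnorm) simp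
  also have "fnorm (T' - T) = fnorm (T - T')" by (rule fnorm_minus_commute) auto
  finally have "k * fnorm (L * T') \<le> k * (fnorm (L * T) + sqrt (real K) * fnorm (T - T'))" by (intro mult_left_mono k0) auto
  also have "\<dots> = k * fnorm (L * T) + fnorm (T - T')" using kK by (simp add: distrib_left mult.assoc[symmetric] mult.commute)
  finally have "g \<le> k * fnorm (L * T)" using g ba 1 unfolding w_def by linarith
  \<comment> \<open>\<open>g\<close> may be negative, so only its positive part can be
    squared.\<close>
  then have "max 0 g \<le> k * fnorm (L * T)" using k0 by simp
  then have "(max 0 g)\<^sup>2 \<le> (k * fnorm (L * T))\<^sup>2" by (intro power_mono) auto
  also have "\<dots> = (fnorm (L * T))\<^sup>2 / real K" unfolding power_mult_distrib power2_eq_square[of k] kk by simp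
  finally have gL: "(max 0 g)\<^sup>2 \<le> (fnorm (L * T))\<^sup>2 / real K" .
  have "\<exists>Ks. locc D d K K Ks \<and> (fnorm (msum c d (\<lambda>x. W (f x) * Z x) {..<D} * T))\<^sup>2 / real K
      \<le> Re (cinner (phi_max K) (apply_kraus (K * K) Ks (premeasure d D Z T * (premeasure d D Z T)\<^sup>\<dagger>) *\<^sub>v phi_max K))"
    by (rule hashing_protocol[OF Z f K]) (use WW in auto)
  then show ?thesis using gL unfolding L_def by (meson order_trans)
qed

text \<open>Counterpart of \<open>premeasure\<close> with the branches in a row: the Gram matrix on
  \<open>AB\<close> is the dephased state, and the one on the columns is, up to conjugation, the
  joint state of register and \<open>C\<close>.\<close>

definition blocks :: "nat \<Rightarrow> nat \<Rightarrow> (nat \<Rightarrow> complex mat) \<Rightarrow> complex mat \<Rightarrow> complex mat" where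
  "blocks d N Z T = mat d (N * dim_col T) (\<lambda>(y,i). (Z (i div dim_col T) * T) $$ (y, i mod dim_col T))"

lemma blocks_simps [simp]:
  "dim_row (blocks d N Z T) = d" "dim_col (blocks d N Z T) = N * dim_col T"
  "y < d \<Longrightarrow> i < N * dim_col T \<Longrightarrow> blocks d N Z T $$ (y,i) = (Z (i div dim_col T) * T) $$ (y, i mod dim_col T)"
  by (simp_all add: blocks_def)

lemma blocks_gram_index:
  assumes "y < d" "y' < d"
  shows "(blocks d N Z T * (blocks d N Z T)\<^sup>\<dagger>) $$ (y,y')
    = (\<Sum>j<N. \<Sum>c<dim_col T. (Z j * T) $$ (y,c) * cnj ((Z j * T) $$ (y',c)))"
  using assms by (subst mult_index) (auto simp: sum_lessThan_mult)

lemma blocks_gram: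
  assumes Z: "info_type d N Z" and T: "dim_row T = d"
  shows "blocks d N Z T * (blocks d N Z T)\<^sup>\<dagger> = msum d d (\<lambda>j. (Z j * T) * (Z j * T)\<^sup>\<dagger>) {..<N}"
proof (rule eq_matI)
  fix y y' assume "y < dim_row (msum d d (\<lambda>j. (Z j * T) * (Z j * T)\<^sup>\<dagger>) {..<N})" "y' < dim_col (msum d d (\<lambda>j. (Z j * T) * (Z j * T)\<^sup>\<dagger>) {..<N})"
  then have y: "y < d" "y' < d" by auto
  have "((Z j * T) * (Z j * T)\<^sup>\<dagger>) $$ (y,y') = (\<Sum>c<dim_col T. (Z j * T) $$ (y,c) * cnj ((Z j * T) $$ (y',c)))" if "j < N" for j
    using y that by (subst mult_index) (auto simp: info_typeD[OF Z])
  then show "(blocks d N Z T * (blocks d N Z T)\<^sup>\<dagger>) $$ (y,y') = msum d d (\<lambda>j. (Z j * T) * (Z j * T)\<^sup>\<dagger>) {..<N} $$ (y,y')"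
    using y by (simp add: blocks_gram_index)
qed auto

lemma fnorm_mult_blocks:
  assumes Z: "info_type d N Z" and T: "dim_row T = d" and A: "dim_col A = d"
  shows "(fnorm (A * blocks d N Z T))\<^sup>2 = (\<Sum>j<N. (fnorm (A * (Z j * T)))\<^sup>2)"
proof -
  have "(A * blocks d N Z T) $$ (i, j * dim_col T + c) = (A * (Z j * T)) $$ (i,c)"
    if "i < dim_row A" "j < N" "c < dim_col T" for i j c
    using that A by (subst (1 2) mult_index) (auto simp: info_typeD[OF Z])
  then show ?thesis
    unfolding fnorm_sq using A
    by (simp add: sum_lessThan_mult info_typeD[OF Z]) (rule sum.swap)
qed

lemma fnorm_gram_swap: "fnorm (A\<^sup>\<dagger> * A) = fnorm (A * A\<^sup>\<dagger>)"
proof -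
  have "mtrace ((A\<^sup>\<dagger> * A)\<^sup>\<dagger> * (A\<^sup>\<dagger> * A)) = mtrace (A\<^sup>\<dagger> * (A * (A\<^sup>\<dagger> * A)))"
    by (simp add: adjoint_mult mult_assoc_dim)
  also have "\<dots> = mtrace ((A * (A\<^sup>\<dagger> * A)) * A\<^sup>\<dagger>)" by (rule mtrace_cyclic) auto
  also have "\<dots> = mtrace ((A * A\<^sup>\<dagger>)\<^sup>\<dagger> * (A * A\<^sup>\<dagger>))" by (simp add: adjoint_mult mult_assoc_dim)
  finally have "(fnorm (A\<^sup>\<dagger> * A))\<^sup>2 = (fnorm (A * A\<^sup>\<dagger>))\<^sup>2" unfolding fnorm_sq_Re_mtrace by simp
  then show ?thesis by (simp add: power2_eq_iff_nonneg)
qed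

text \<open>The truncation is by two spectral cuts: \<open>E\<close> removes eigenvalues above
  \<open>\<nu>\<close> of the dephased state, which bounds the collision sum by
  \<open>\<nu>\<close>, and \<open>\<Omega>\<close> removes eigenvalues below \<open>\<mu>\<close>
  on \<open>C\<close>, which leaves at most \<open>1 / \<mu>\<close> dimensions. Hence the critical
  ratio \<open>K * \<nu> / \<mu>\<close>. Of the factor 3, two parts pay for the norm of
  \<open>T'\<close> and one for its distance to \<open>T\<close>.\<close>

lemma hashing_spectral:
  assumes Z: "info_type d D Z" and T [simp]: "dim_row T = d" "dim_col T = c" and T1: "fnorm T = 1"
    and V: "unitary d V" and s0: "\<And>i. i < d \<Longrightarrow> 0 \<le> s i"
    and RR: "blocks d D Z T * (blocks d D Z T)\<^sup>\<dagger> = V * mat_diag d (\<lambda>i. complex_of_real (s i)) * V\<^sup>\<dagger>"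
    and U: "unitary c U" and u0: "\<And>i. i < c \<Longrightarrow> 0 \<le> u i"
    and TT: "T\<^sup>\<dagger> * T = U * mat_diag c (\<lambda>i. complex_of_real (u i)) * U\<^sup>\<dagger>"
    and \<nu>: "0 < \<nu>" and \<mu>: "0 < \<mu>" and K: "1 \<le> K"
    and e: "e1 = (\<Sum>i<d. if \<nu> < s i then s i else 0)" "e2 = (\<Sum>i<c. if u i < \<mu> then u i else 0)"
    and g: "g = 1 - 3 * (sqrt e1 + sqrt e2) - sqrt (real K * \<nu> / \<mu>)"
  shows "\<exists>Ks. locc D d K K Ks \<and>
    (max 0 g)\<^sup>2 \<le> Re (cinner (phi_max K) (apply_kraus (K * K) Ks (premeasure d D Z T * (premeasure d D Z T)\<^sup>\<dagger>) *\<^sub>v phi_max K))"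
proof -
  note Zd = info_typeD[OF Z]
  note [simp] = unitaryD(1,2)[OF V] unitaryD(1,2)[OF U]
  let ?R = "blocks d D Z T"
  define E where "E = spectral_projector d V (\<lambda>i. \<not> \<nu> < s i)"
  define \<Omega> where "\<Omega> = spectral_projector c U (\<lambda>i. \<not> u i < \<mu>)"
  note E = spectral_projector[OF V, of "\<lambda>i. \<not> \<nu> < s i", folded E_def]
  note \<Omega> = spectral_projector[OF U, of "\<lambda>i. \<not> u i < \<mu>", folded \<Omega>_def]
  note [simp] = E(1,2) \<Omega>(1,2)
  define T' where "T' = E * T * \<Omega>"
  have [simp]: "dim_row T' = d" "dim_col T' = c" by (simp_all add: T'_def)
  define M where "M = ?R * ?R\<^sup>\<dagger>"
  have [simp]: "dim_row M = d" "dim_col M = d" by (simp_all add: M_def)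
  have Madj: "M\<^sup>\<dagger> = M" unfolding M_def by (simp add: adjoint_mult)
  have ZM: "Z x * M = (Z x * T) * (Z x * T)\<^sup>\<dagger>" if x: "x < D" for x
  proof -
    have "Z x * M = msum d d (\<lambda>j. Z x * ((Z j * T) * (Z j * T)\<^sup>\<dagger>)) {..<D}"
      unfolding M_def blocks_gram[OF Z T(1)] using x by (subst mult_msum) (auto simp: Zd)
    also have "\<dots> = Z x * ((Z x * T) * (Z x * T)\<^sup>\<dagger>)"
    proof (rule msum_single)
      fix j assume j: "j \<in> {..<D}" "j \<noteq> x"
      have "Z x * ((Z j * T) * (Z j * T)\<^sup>\<dagger>) = (Z x * Z j) * (T * (Z j * T)\<^sup>\<dagger>)"
        using x j by (simp add: mult_assoc_dim Zd(1,2))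
      also have "Z x * Z j = 0\<^sub>m d d" using x j by (intro Zd(5)) auto
      also have "0\<^sub>m d d * (T * (Z j * T)\<^sup>\<dagger>) = 0\<^sub>m d d"
        using j by (intro left_mult_zero_mat carrier_matI) (auto simp: Zd)
      finally show "Z x * ((Z j * T) * (Z j * T)\<^sup>\<dagger>) = 0\<^sub>m d d" .
    qed (use x in \<open>auto simp: Zd\<close>)
    also have "\<dots> = (Z x * Z x * T) * (Z x * T)\<^sup>\<dagger>" using x by (simp add: mult_assoc_dim Zd(1,2))
    finally show ?thesis using x by (simp add: Zd(4))
  qed
  have MZ: "M * Z x = Z x * M" if x: "x < D" for x
  proof -
    have "M * Z x = (Z x * M)\<^sup>\<dagger>" using x by (simp add: adjoint_mult Zd Madj)
    also have "\<dots> = Z x * M" unfolding ZM[OF x] using x by (simp add: adjoint_mult Zd)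
    finally show ?thesis .
  qed
  \<comment> \<open>Each \<open>Z x\<close> commutes with the dephased state and hence with its
    spectral projectors, so a cut on \<open>AB\<close> does not mix the measured branches.\<close>
  have commute: "V * mat_diag d (\<lambda>i. complex_of_real (h (s i))) * V\<^sup>\<dagger> * Z x
      = Z x * (V * mat_diag d (\<lambda>i. complex_of_real (h (s i))) * V\<^sup>\<dagger>)" if x: "x < D" for x h
    by (rule functional_calculus_commute[OF V V Zd(1)[OF x] Zd(2)[OF x], where d = s and e = s])
      (use MZ[OF x] in \<open>simp only: M_def RR\<close>)
  have EZ: "E * Z x = Z x * E" if x: "x < D" for x
    using commute[OF x, of "\<lambda>r. if \<not> \<nu> < r then 1 else 0"] by (simp only: E_def spectral_projector_def)
  have e1: "fnorm (T - E * T) = sqrt e1"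
  proof -
    define F where "F = spectral_projector d V (\<lambda>i. \<nu> < s i)"
    note F = spectral_projector[OF V, of "\<lambda>i. \<nu> < s i", folded F_def]
    note [simp] = F(1,2)
    have FT: "T - E * T = F * T"
      unfolding E_def F_def by (subst spectral_projector_complement[OF V]) auto
    have FZ: "F * Z x = Z x * F" if x: "x < D" for x
      using commute[OF x, of "\<lambda>r. if \<nu> < r then 1 else 0"] by (simp only: F_def spectral_projector_def)
    \<comment> \<open>The diagonal in the basis \<open>V\<close> is known for the dephased factor,
      not for \<open>T\<close>; since \<open>F\<close> commutes with every \<open>Z x\<close>, it
      passes the same weight of both.\<close>
    have "(fnorm (F * T))\<^sup>2 = (\<Sum>x<D. (fnorm (Z x * (F * T)))\<^sup>2)" by (rule info_type_fnorm[OF Z, symmetric]) simp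
    also have "\<dots> = (\<Sum>x<D. (fnorm (F * (Z x * T)))\<^sup>2)"
    proof (intro sum.cong refl)
      fix x assume "x \<in> {..<D}"
      then have x: "x < D" by simp
      have "Z x * (F * T) = F * (Z x * T)" using x FZ[OF x] by (simp add: Zd flip: mult_assoc_dim)
      then show "(fnorm (Z x * (F * T)))\<^sup>2 = (fnorm (F * (Z x * T)))\<^sup>2" by simp
    qed
    also have "\<dots> = (fnorm (F * ?R))\<^sup>2" by (rule fnorm_mult_blocks[OF Z, symmetric]) auto
    also have "\<dots> = (\<Sum>i<d. if \<nu> < s i then Re ((V\<^sup>\<dagger> * (?R * ?R\<^sup>\<dagger>) * V) $$ (i,i)) else 0)"
      unfolding F_def by (rule fnorm_spectral_projector_sq[OF V]) simp
    also have "V\<^sup>\<dagger> * (?R * ?R\<^sup>\<dagger>) * V = mat_diag d (\<lambda>i. complex_of_real (s i))"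
      unfolding RR by (simp add: mult_assoc_dim unitary_cancel[OF V] unitaryD(4)[OF V])
    finally have "(fnorm (F * T))\<^sup>2 = e1" unfolding e(1) by (simp cong: if_cong)
    then show ?thesis unfolding FT by (intro real_sqrt_unique[symmetric]) auto
  qed
  have e2: "fnorm (T - T * \<Omega>) = sqrt e2"
  proof -
    have "fnorm (T - T * \<Omega>) = fnorm (T\<^sup>\<dagger> - \<Omega> * T\<^sup>\<dagger>)"
      using fnorm_adjoint[of "T - T * \<Omega>"] by (simp add: adjoint_minus adjoint_mult \<Omega>(3))
    also have "T\<^sup>\<dagger> - \<Omega> * T\<^sup>\<dagger> = spectral_projector c U (\<lambda>i. u i < \<mu>) * T\<^sup>\<dagger>"
      unfolding \<Omega>_def by (subst spectral_projector_complement[OF U]) auto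
    finally have "(fnorm (T - T * \<Omega>))\<^sup>2 = (\<Sum>i<c. if u i < \<mu> then Re ((U\<^sup>\<dagger> * (T\<^sup>\<dagger> * T) * U) $$ (i,i)) else 0)"
      using fnorm_spectral_projector_sq[OF U, of "T\<^sup>\<dagger>" "\<lambda>i. u i < \<mu>", unfolded adjoint_adjoint] by simp
    also have "U\<^sup>\<dagger> * (T\<^sup>\<dagger> * T) * U = mat_diag c (\<lambda>i. complex_of_real (u i))"
      unfolding TT by (simp add: mult_assoc_dim unitary_cancel[OF U] unitaryD(4)[OF U])
    finally have "(fnorm (T - T * \<Omega>))\<^sup>2 = e2" unfolding e(2) by (simp cong: if_cong)
    then show ?thesis by (intro real_sqrt_unique[symmetric]) auto
  qed
  have close: "fnorm (T - T') \<le> sqrt e1 + sqrt e2"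
  proof -
    have "fnorm (T - T') \<le> fnorm (T - T * \<Omega>) + fnorm (T * \<Omega> - T')" by (rule fnorm_diff_triangle) auto
    also have "T * \<Omega> - T' = (T - E * T) * \<Omega>" unfolding T'_def by (simp add: minus_mult_distrib_dim)
    also have "fnorm ((T - E * T) * \<Omega>) \<le> fnorm (T - E * T)" by (rule contr_right[OF \<Omega>(5)]) simp
    finally show ?thesis unfolding e1 e2 by simp
  qed
  have T'le: "fnorm T' \<le> 1"
  proof -
    have "fnorm T' \<le> fnorm (E * T)" unfolding T'_def by (rule contr_right[OF \<Omega>(5)]) simp
    also have "\<dots> \<le> fnorm T" by (rule contrD[OF E(5)]) simp
    finally show ?thesis using T1 by simp
  qed
  have T'\<Omega>: "T' * \<Omega> = T'" unfolding T'_def by (simp add: mult_assoc_dim \<Omega>(4))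
  have \<Omega>n: "fnorm \<Omega> \<le> sqrt (1 / \<mu>)"
  proof (rule real_le_rsqrt)
    have "fnorm \<Omega> = fnorm (1\<^sub>m c * mat_diag c (\<lambda>i. complex_of_real (if \<not> u i < \<mu> then 1 else 0)))"
      unfolding \<Omega>_def spectral_projector_def
      using fnorm_mult_unitary[OF unitary_adjoint[OF U], of "U * mat_diag c (\<lambda>i. complex_of_real (if \<not> u i < \<mu> then 1 else 0))"]
      by (simp add: fnorm_unitary_mult[OF U])
    then have "(fnorm \<Omega>)\<^sup>2 = (\<Sum>i<c. (if \<not> u i < \<mu> then 1 else 0))"
      by (simp only: fnorm_mult_diag_sq index_one_mat)
        (auto intro!: sum.cong simp: if_distrib[of cmod] if_distrib[of "\<lambda>x. x\<^sup>2"] sum.delta cong: if_cong)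
    \<comment> \<open>A kept eigenvalue is at least \<open>\<mu>\<close>, so
      \<open>u i / \<mu>\<close> pays for its dimension.\<close>
    also have "\<dots> \<le> (\<Sum>i<c. u i / \<mu>)" using u0 \<mu> by (intro sum_mono) auto
    also have "\<dots> = (\<Sum>i<c. u i) / \<mu>" by (simp add: sum_divide_distrib)
    also have "(\<Sum>i<c. u i) = 1"
    proof -
      have "complex_of_real (\<Sum>i<c. u i) = mtrace (T\<^sup>\<dagger> * T)"
        unfolding TT by (simp add: mtrace_unitary_conj[OF U] mtrace_mat_diag)
      also have "\<dots> = complex_of_real 1" unfolding fnorm_sq_mtrace T1 by simp
      finally show ?thesis by (simp only: of_real_eq_iff)
    qed
    finally show "(fnorm \<Omega>)\<^sup>2 \<le> 1 / \<mu>" .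
  qed
  have l: "(\<Sum>x<D. (fnorm (T'\<^sup>\<dagger> * (Z x * T')))\<^sup>2) \<le> \<nu>"
  proof -
    have "(fnorm (T'\<^sup>\<dagger> * (Z x * T')))\<^sup>2 \<le> (fnorm (Z x * (E * (M * E))))\<^sup>2" if x: "x < D" for x
    proof -
      define A where "A = E * (Z x * T)"
      have [simp]: "dim_row A = d" "dim_col A = c" using x by (simp_all add: A_def Zd)
      have ZET: "Z x * (E * T) = A" unfolding A_def using x EZ[OF x] by (simp add: Zd flip: mult_assoc_dim)
      have ZA: "Z x * A = A"
        unfolding ZET[symmetric] using x by (simp add: Zd flip: mult_assoc_dim)
      have TA: "T'\<^sup>\<dagger> * (Z x * T') = \<Omega> * (A\<^sup>\<dagger> * A * \<Omega>)"
      proof -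
        have "A\<^sup>\<dagger> * A = (Z x * (E * T))\<^sup>\<dagger> * (Z x * (E * T))" unfolding ZET ..
        also have "\<dots> = (E * T)\<^sup>\<dagger> * ((Z x * Z x) * (E * T))" using x by (simp add: adjoint_mult mult_assoc_dim Zd(1-3))
        also have "\<dots> = (E * T)\<^sup>\<dagger> * (Z x * (E * T))" using x by (simp add: Zd(4))
        finally show ?thesis using x unfolding T'_def by (simp add: adjoint_mult mult_assoc_dim \<Omega>(3) Zd)
      qed
      have "fnorm (\<Omega> * (A\<^sup>\<dagger> * A * \<Omega>)) \<le> fnorm (A\<^sup>\<dagger> * A * \<Omega>)" by (rule contrD[OF \<Omega>(5)]) simp
      also have "\<dots> \<le> fnorm (A\<^sup>\<dagger> * A)" by (rule contr_right[OF \<Omega>(5)]) simp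
      also have "\<dots> = fnorm (A * A\<^sup>\<dagger>)" by (rule fnorm_gram_swap)
      also have "A * A\<^sup>\<dagger> = E * (Z x * M * E)"
        unfolding ZM[OF x] A_def using x by (simp add: adjoint_mult mult_assoc_dim Zd E(3))
      also have "\<dots> = Z x * (E * (M * E))"
      proof -
        have "E * (Z x * M * E) = (E * Z x) * (M * E)" using x by (simp add: mult_assoc_dim Zd)
        then show ?thesis unfolding EZ[OF x] using x by (simp add: mult_assoc_dim Zd)
      qed
      finally show ?thesis unfolding TA by (intro power_mono) auto
    qed
    then have "(\<Sum>x<D. (fnorm (T'\<^sup>\<dagger> * (Z x * T')))\<^sup>2) \<le> (\<Sum>x<D. (fnorm (Z x * (E * (M * E))))\<^sup>2)"
      by (intro sum_mono) auto
    \<comment> \<open>The branches reassemble to the truncated dephased state, whose purity is at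
      most the cap \<open>\<nu>\<close> times its trace.\<close>
    also have "\<dots> = (fnorm (E * (M * E)))\<^sup>2" by (rule info_type_fnorm[OF Z]) simp
    also have "E * (M * E) = V * mat_diag d (\<lambda>i. complex_of_real (if \<nu> < s i then 0 else s i)) * V\<^sup>\<dagger>"
      unfolding M_def RR E_def spectral_projector_def diag_conj_mult[OF V]
      by (rule arg_cong[where f = "\<lambda>D. V * D * V\<^sup>\<dagger>"]) (auto intro!: eq_matI)
    also have "fnorm (V * mat_diag d (\<lambda>i. complex_of_real (if \<nu> < s i then 0 else s i)) * V\<^sup>\<dagger>)
        = fnorm (1\<^sub>m d * mat_diag d (\<lambda>i. complex_of_real (if \<nu> < s i then 0 else s i)))"
      using fnorm_mult_unitary[OF unitary_adjoint[OF V], of "V * mat_diag d (\<lambda>i. complex_of_real (if \<nu> < s i then 0 else s i))"]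
      by (simp add: fnorm_unitary_mult[OF V])
    also have "(fnorm (1\<^sub>m d * mat_diag d (\<lambda>i. complex_of_real (if \<nu> < s i then 0 else s i))))\<^sup>2 = (\<Sum>i<d. (if \<nu> < s i then 0 else s i)\<^sup>2)"
      by (simp only: fnorm_mult_diag_sq index_one_mat)
        (auto intro!: sum.cong simp: if_distrib[of cmod] if_distrib[of "\<lambda>x. x\<^sup>2"] sum.delta cong: if_cong)
    also have "\<dots> \<le> (\<Sum>i<d. \<nu> * s i)"
      using s0 \<nu> by (intro sum_mono) (auto simp: power2_eq_square intro!: mult_right_mono)
    also have "\<dots> = \<nu> * (\<Sum>i<d. s i)" by (simp add: sum_distrib_left)
    also have "(\<Sum>i<d. s i) = 1"
    proof -
      have "complex_of_real (\<Sum>i<d. s i) = mtrace (?R * ?R\<^sup>\<dagger>)"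
        unfolding RR by (simp add: mtrace_unitary_conj[OF V] mtrace_mat_diag)
      also have "\<dots> = complex_of_real ((fnorm (1\<^sub>m d * ?R))\<^sup>2)" unfolding fnorm_sq_mtrace' by simp
      also have "(fnorm (1\<^sub>m d * ?R))\<^sup>2 = (\<Sum>j<D. (fnorm (1\<^sub>m d * (Z j * T)))\<^sup>2)" by (rule fnorm_mult_blocks[OF Z]) auto
      also have "\<dots> = (\<Sum>j<D. (fnorm (Z j * T))\<^sup>2)" by (intro sum.cong refl) (simp add: Zd)
      also have "\<dots> = 1" using info_type_fnorm[OF Z, of T] T1 by simp
      finally show ?thesis by (simp only: of_real_eq_iff)
    qed
    finally show ?thesis by simp
  qed
  have "1 - 2 * (sqrt e1 + sqrt e2) \<le> (fnorm T')\<^sup>2"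
  proof -
    have "1 \<le> fnorm T' + fnorm (T - T')" using fnorm_le_add_diff[of T T'] T1 by simp
    then have *: "1 - (sqrt e1 + sqrt e2) \<le> fnorm T'" using close by simp
    have "2 * fnorm T' - 1 \<le> (fnorm T')\<^sup>2"
      using zero_le_power2[of "fnorm T' - 1"] by (simp add: power2_eq_square algebra_simps)
    moreover have "1 - 2 * (sqrt e1 + sqrt e2) \<le> 2 * fnorm T' - 1" using * by (simp add: algebra_simps)
    ultimately show ?thesis by (rule order_trans[rotated])
  qed
  moreover have "fnorm \<Omega> * sqrt (real K * \<nu>) / 2 \<le> sqrt (real K * \<nu> / \<mu>)"
  proof -
    have "fnorm \<Omega> * sqrt (real K * \<nu>) \<le> sqrt (1 / \<mu>) * sqrt (real K * \<nu>)"
      using \<nu> by (intro mult_right_mono \<Omega>n) auto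
    also have "\<dots> = sqrt (real K * \<nu> / \<mu>)" by (simp add: real_sqrt_mult[symmetric])
    finally have "fnorm \<Omega> * sqrt (real K * \<nu>) \<le> sqrt (real K * \<nu> / \<mu>)" .
    moreover have "0 \<le> fnorm \<Omega> * sqrt (real K * \<nu>)" using \<nu> by auto
    ultimately show ?thesis by linarith
  qed
  ultimately have "g \<le> (fnorm T')\<^sup>2 - fnorm \<Omega> * sqrt (real K * \<nu>) / 2 - fnorm (T - T')"
    using close unfolding g distrib_left by linarith
  from hashing_one_shot[OF Z T _ _ _ _ \<Omega>(3) T'\<Omega> T'le K l this] show ?thesis by simp
qed

section \<open>Achievability of the coherent information\<close>

text \<open>The factor may vary with the position \<open>t\<close>, as it does in a string of
  projectors where copy \<open>t\<close> carries its own outcome.\<close>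

definition tensor_family :: "nat \<Rightarrow> nat \<Rightarrow> (nat \<Rightarrow> nat \<Rightarrow> nat) \<Rightarrow> nat \<Rightarrow> (nat \<Rightarrow> nat \<Rightarrow> nat) \<Rightarrow> (nat \<Rightarrow> complex mat) \<Rightarrow> complex mat" where
  "tensor_family n D e C h A = mat D C (\<lambda>(i,j). \<Prod>t<n. A t $$ (e t i, h t j))"

lemma tensor_family_simps [simp]:
  "dim_row (tensor_family n D e C h A) = D" "dim_col (tensor_family n D e C h A) = C"
  "i < D \<Longrightarrow> j < C \<Longrightarrow> tensor_family n D e C h A $$ (i,j) = (\<Prod>t<n. A t $$ (e t i, h t j))"
  by (simp_all add: tensor_family_def)

lemma tensor_family_mult_index:
  assumes e: "product_index n D a e" and h: "product_index n C b h" and k: "product_index n G c k"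
    and A: "\<And>t. t < n \<Longrightarrow> dim_row (A t) = a \<and> dim_col (A t) = b"
    and B: "\<And>t. t < n \<Longrightarrow> dim_row (B t) = b \<and> dim_col (B t) = c" and ij: "i < D" "j < G"
  shows "(tensor_family n D e C h A * tensor_family n C h G k B) $$ (i,j) = (\<Prod>t<n. (A t * B t) $$ (e t i, k t j))"
proof -
  have "(tensor_family n D e C h A * tensor_family n C h G k B) $$ (i,j)
      = (\<Sum>l<C. \<Prod>t<n. A t $$ (e t i, h t l) * B t $$ (h t l, k t j))"
    using ij by (simp add: mult_index prod.distrib)
  also have "\<dots> = (\<Prod>t<n. \<Sum>l<b. A t $$ (e t i, l) * B t $$ (l, k t j))"
    by (rule product_index_sum[OF h])
  also have "\<dots> = (\<Prod>t<n. (A t * B t) $$ (e t i, k t j))"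
    using A B product_index_less[OF e ij(1)] product_index_less[OF k ij(2)]
    by (intro prod.cong refl) (simp add: mult_index)
  finally show ?thesis .
qed

lemma tensor_power_eq_family: "tensor_power n D e C h A = tensor_family n D e C h (\<lambda>_. A)"
  by (simp add: tensor_power_def tensor_family_def)

definition info_power :: "nat \<Rightarrow> nat \<Rightarrow> nat \<Rightarrow> (nat \<Rightarrow> complex mat) \<Rightarrow> nat \<Rightarrow> complex mat" where
  "info_power n d N Z x = tensor_family n (d^n) (digit d) (d^n) (digit d) (\<lambda>t. Z (digit N t x))"

lemma info_power_dims [simp]: "dim_row (info_power n d N Z x) = d^n" "dim_col (info_power n d N Z x) = d^n"
  by (simp_all add: info_power_def)

lemma product_index_differ:
  assumes "product_index n D r e" "i < D" "j < D" "i \<noteq> j"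
  shows "\<exists>t<n. e t i \<noteq> e t j"
proof (rule ccontr)
  assume "\<not> ?thesis"
  then have "(\<Prod>t<n. if e t i = e t j then 1 else 0 :: complex) = 1" by (intro prod.neutral) auto
  then show False using product_index_delta[OF assms(1-3)] assms(4) by simp
qed

text \<open>Measuring all copies is one measurement with string-valued outcome: different strings
  differ at some position, where the product of the projectors vanishes.\<close>

lemma info_type_power:
  assumes Z: "info_type d N Z"
  shows "info_type (d^n) (N^n) (info_power n d N Z)"
proof -
  note Zd = info_typeD[OF Z]
  note pd = product_index_digit[of n d] and pN = product_index_digit[of n N]
  have xN: "digit N t x < N" if "x < N^n" "t < n" for t x using product_index_less[OF pN that] .
  have mult: "(info_power n d N Z x * info_power n d N Z x') $$ (i,j)
      = (\<Prod>t<n. (Z (digit N t x) * Z (digit N t x')) $$ (digit d t i, digit d t j))"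
    if "x < N^n" "x' < N^n" "i < d^n" "j < d^n" for x x' i j
    unfolding info_power_def using that xN by (intro tensor_family_mult_index[OF pd pd pd]) (auto simp: Zd)
  show ?thesis unfolding info_type_def is_projector_def hermitian_def
  proof (intro conjI allI impI)
    fix x assume x: "x < N^n"
    show "info_power n d N Z x \<in> carrier_mat (d^n) (d^n)" by (auto intro: carrier_matI)
    show "(info_power n d N Z x)\<^sup>\<dagger> = info_power n d N Z x"
    proof (rule eq_matI)
      fix i j assume "i < dim_row (info_power n d N Z x)" "j < dim_col (info_power n d N Z x)"
      then have ij: "i < d^n" "j < d^n" by auto
      have "cnj (Z (digit N t x) $$ (digit d t j, digit d t i)) = Z (digit N t x) $$ (digit d t i, digit d t j)" if t: "t < n" for t
        using arg_cong[OF Zd(3)[OF xN[OF x t]], of "\<lambda>M. M $$ (digit d t i, digit d t j)"]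
          product_index_less[OF pd ij(1) t] product_index_less[OF pd ij(2) t] Zd(1,2)[OF xN[OF x t]] by simp
      then show "(info_power n d N Z x)\<^sup>\<dagger> $$ (i,j) = info_power n d N Z x $$ (i,j)"
        using ij by (simp add: info_power_def)
    qed auto
    show "info_power n d N Z x * info_power n d N Z x = info_power n d N Z x"
    proof (rule eq_matI)
      fix i j assume "i < dim_row (info_power n d N Z x)" "j < dim_col (info_power n d N Z x)"
      then have ij: "i < d^n" "j < d^n" by auto
      show "(info_power n d N Z x * info_power n d N Z x) $$ (i,j) = info_power n d N Z x $$ (i,j)"
        unfolding mult[OF x x ij] using ij xN[OF x] by (simp add: info_power_def Zd(4))
    qed auto
  next
    fix x x' assume x: "x < N^n" "x' < N^n" "x \<noteq> x'"
    obtain t where t: "t < n" "digit N t x \<noteq> digit N t x'" using product_index_differ[OF pN x] by blast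
    show "info_power n d N Z x * info_power n d N Z x' = 0\<^sub>m (d^n) (d^n)"
    proof (rule eq_matI)
      fix i j assume "i < dim_row (0\<^sub>m (d^n) (d^n) :: complex mat)" "j < dim_col (0\<^sub>m (d^n) (d^n) :: complex mat)"
      then have ij: "i < d^n" "j < d^n" by auto
      have "(Z (digit N t x) * Z (digit N t x')) $$ (digit d t i, digit d t j) = 0"
        using Zd(5)[OF xN[OF x(1) t(1)] xN[OF x(2) t(1)] t(2)]
          product_index_less[OF pd ij(1) t(1)] product_index_less[OF pd ij(2) t(1)] by simp
      then show "(info_power n d N Z x * info_power n d N Z x') $$ (i,j) = 0\<^sub>m (d^n) (d^n) $$ (i,j)"
        unfolding mult[OF x(1,2) ij] using t(1) ij by (auto intro!: prod_zero)
    qed auto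
  next
    show "msum (d^n) (d^n) (info_power n d N Z) {..<N^n} = 1\<^sub>m (d^n)"
    proof (rule eq_matI)
      fix i j assume "i < dim_row (1\<^sub>m (d^n) :: complex mat)" "j < dim_col (1\<^sub>m (d^n) :: complex mat)"
      then have ij: "i < d^n" "j < d^n" by auto
      have "msum (d^n) (d^n) (info_power n d N Z) {..<N^n} $$ (i,j)
          = (\<Sum>x<N^n. \<Prod>t<n. Z (digit N t x) $$ (digit d t i, digit d t j))"
        using ij by (simp add: info_power_def)
      also have "\<dots> = (\<Prod>t<n. \<Sum>k<N. Z k $$ (digit d t i, digit d t j))" by (rule product_index_sum[OF pN])
      also have "\<dots> = (\<Prod>t<n. if digit d t i = digit d t j then 1 else 0)"
      proof (intro prod.cong refl)
        fix t assume "t \<in> {..<n}"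
        then have t: "digit d t i < d" "digit d t j < d" using product_index_less[OF pd] ij by auto
        show "(\<Sum>k<N. Z k $$ (digit d t i, digit d t j)) = (if digit d t i = digit d t j then 1 else 0)"
          using arg_cong[OF Zd(6), of "\<lambda>M. M $$ (digit d t i, digit d t j)"] t by simp
      qed
      also have "\<dots> = (if i = j then 1 else 0)" by (rule product_index_delta[OF pd ij])
      finally show "msum (d^n) (d^n) (info_power n d N Z) {..<N^n} $$ (i,j) = 1\<^sub>m (d^n) $$ (i,j)" using ij by simp
    qed auto
  qed
qed

lemma info_power_mult_index:
  assumes Z: "info_type d N Z" and T: "dim_row T = d" and x: "x < N^n" "y < d^n" "k < (dim_col T)^n"
  shows "(info_power n d N Z x * tensor_power n (d^n) (digit d) ((dim_col T)^n) (digit (dim_col T)) T) $$ (y,k)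
    = (\<Prod>t<n. (Z (digit N t x) * T) $$ (digit d t y, digit (dim_col T) t k))"
  unfolding info_power_def tensor_power_eq_family
  using product_index_less[OF product_index_digit x(1)] x T
  by (intro tensor_family_mult_index[OF product_index_digit product_index_digit product_index_digit])
    (auto simp: info_typeD[OF Z])

lemma premeasure_power:
  assumes Z: "info_type d N Z" and T: "dim_row T = d"
  shows "tensor_power n (N^n * d^n) (digit2 N d n) ((dim_col T)^n) (digit (dim_col T)) (premeasure d N Z T)
    = premeasure (d^n) (N^n) (info_power n d N Z) (tensor_power n (d^n) (digit d) ((dim_col T)^n) (digit (dim_col T)) T)"
    (is "?L = ?R")
proof (rule eq_matI)
  fix i k assume "i < dim_row ?R" "k < dim_col ?R"
  then have ik: "i < N^n * d^n" "k < (dim_col T)^n" by auto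
  have "premeasure d N Z T $$ (digit2 N d n t i, digit (dim_col T) t k)
     = (Z (digit N t (i div d^n)) * T) $$ (digit d t (i mod d^n), digit (dim_col T) t k)" if t: "t < n" for t
  proof -
    have "digit d t (i mod d^n) < d"
      by (rule product_index_less[OF product_index_digit pair_index_bounds(2)[OF ik(1)] t])
    then show ?thesis
      using product_index_less[OF product_index_digit2 ik(1) t] product_index_less[OF product_index_digit ik(2) t]
      by (simp add: digit2_def)
  qed
  then show "?L $$ (i,k) = ?R $$ (i,k)"
    using ik by (simp add: info_power_mult_index[OF Z T])
qed auto

text \<open>The comparison is made between Gram matrices: blocks of the power and power of the
  blocks order their columns differently, and summing over all strings and column indices erases the
  order.\<close>

lemma blocks_gram_power:
  assumes Z: "info_type d N Z" and T: "dim_row T = d"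
  shows "blocks (d^n) (N^n) (info_power n d N Z) (tensor_power n (d^n) (digit d) ((dim_col T)^n) (digit (dim_col T)) T)
    * (blocks (d^n) (N^n) (info_power n d N Z) (tensor_power n (d^n) (digit d) ((dim_col T)^n) (digit (dim_col T)) T))\<^sup>\<dagger>
    = tensor_power n (d^n) (digit d) (d^n) (digit d) (blocks d N Z T * (blocks d N Z T)\<^sup>\<dagger>)" (is "?L = ?R")
proof (rule eq_matI)
  fix y y' assume "y < dim_row ?R" "y' < dim_col ?R"
  then have y: "y < d^n" "y' < d^n" by auto
  let ?c = "dim_col T"
  have "?L $$ (y,y') = (\<Sum>x<N^n. \<Sum>k<?c^n. \<Prod>t<n. (Z (digit N t x) * T) $$ (digit d t y, digit ?c t k) *
      cnj ((Z (digit N t x) * T) $$ (digit d t y', digit ?c t k)))"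
    using y by (simp add: blocks_gram_index info_power_mult_index[OF Z T] prod.distrib)
  also have "\<dots> = (\<Sum>x<N^n. \<Prod>t<n. \<Sum>k<?c. (Z (digit N t x) * T) $$ (digit d t y, k) *
      cnj ((Z (digit N t x) * T) $$ (digit d t y', k)))"
    by (intro sum.cong refl product_index_sum[OF product_index_digit])
  also have "\<dots> = (\<Prod>t<n. \<Sum>j<N. \<Sum>k<?c. (Z j * T) $$ (digit d t y, k) * cnj ((Z j * T) $$ (digit d t y', k)))"
    by (rule product_index_sum[OF product_index_digit])
  also have "\<dots> = ?R $$ (y,y')"
    using y product_index_less[OF product_index_digit y(1)] product_index_less[OF product_index_digit y(2)]
    by (simp add: blocks_gram_index)
  finally show "?L $$ (y,y') = ?R $$ (y,y')" .
qed auto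

lemma fnorm_premeasure:
  assumes Z: "info_type d N Z" and T: "dim_row T = d"
  shows "fnorm (premeasure d N Z T) = fnorm T"
proof -
  have "(fnorm (premeasure d N Z T))\<^sup>2 = (\<Sum>j<N. (fnorm (Z j * T))\<^sup>2)"
    unfolding fnorm_sq by (simp add: sum_lessThan_mult info_typeD[OF Z])
  also have "\<dots> = (fnorm T)\<^sup>2" by (rule info_type_fnorm[OF Z T])
  finally show ?thesis by (simp add: power2_eq_iff_nonneg)
qed

lemma premeasure_tpow:
  fixes d N n :: nat and Z :: "nat \<Rightarrow> complex mat" and T :: "complex mat"
  assumes Z: "info_type d N Z" and T: "dim_row T = d"
  defines "P \<equiv> premeasure (d^n) (N^n) (info_power n d N Z) (tensor_power n (d^n) (digit d) ((dim_col T)^n) (digit (dim_col T)) T)"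
  shows "tpow N d n (premeasure d N Z T * (premeasure d N Z T)\<^sup>\<dagger>) = P * P\<^sup>\<dagger>"
  unfolding P_def premeasure_power[OF Z T, symmetric] tpow_eq_tensor_power
  by (rule tensor_power_gram[symmetric]) (auto simp: product_index_digit product_index_digit2)

lemma locc_fidelity_le:
  assumes "locc a b K K Ks" "1 \<le> K" "dim_row X = a * b" "fnorm X \<le> 1"
  shows "Re (cinner (phi_max K) (apply_kraus (K * K) Ks (X * X\<^sup>\<dagger>) *\<^sub>v phi_max K)) \<le> 1"
proof -
  obtain M where M: "dim_col M = a * b" "contr M"
    "Re (cinner (phi_max K) (apply_kraus (K * K) Ks (X * X\<^sup>\<dagger>) *\<^sub>v phi_max K)) = (fnorm (M * X))\<^sup>2"
    using locc_test_operator[OF assms(1,2)] assms(3) by metis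
  have "fnorm (M * X) \<le> 1" using contrD[OF M(2), of X] M(1) assms by simp
  then show ?thesis unfolding M(3) by (simp add: power_le_one)
qed

lemma fnorm_tensor_power_one:
  assumes "fnorm T = 1"
  shows "fnorm (tensor_power n ((dim_row T)^n) (digit (dim_row T)) ((dim_col T)^n) (digit (dim_col T)) T) = 1"
  (is "fnorm ?T = 1")
proof -
  have "(fnorm ?T)\<^sup>2 = ((fnorm T)\<^sup>2) ^ n" by (rule fnorm_tensor_power_sq) (rule product_index_digit)+
  then show ?thesis using assms fnorm_nonneg[of ?T] by (simp add: power2_eq_1_iff)
qed

text \<open>For \<open>K = 1\<close> the target carries no entanglement, and the hashing protocol
  with constant hash and identity decoder accepts with certainty. This keeps the set of rates
  nonempty even when no positive rate is available.\<close>

lemma distill_rate_0: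
  assumes Z: "info_type d N Z" and T: "dim_row T = d" and T1: "fnorm T = 1"
  shows "distill_rate N d (premeasure d N Z T * (premeasure d N Z T)\<^sup>\<dagger>) 0"
proof -
  let ?\<rho> = "premeasure d N Z T * (premeasure d N Z T)\<^sup>\<dagger>"
  have "\<exists>Ks. locc (N^n) (d^n) 1 1 Ks \<and> Re (cinner (phi_max 1) (apply_kraus (1 * 1) Ks (tpow N d n ?\<rho>) *\<^sub>v phi_max 1)) = 1" for n
  proof -
    define Zn where "Zn = info_power n d N Z"
    define Tn where "Tn = tensor_power n (d^n) (digit d) ((dim_col T)^n) (digit (dim_col T)) T"
    note Zn = info_type_power[OF Z, of n, folded Zn_def]
    have [simp]: "dim_row Tn = d^n" by (simp add: Tn_def)
    have Tn1: "fnorm Tn = 1" unfolding Tn_def using fnorm_tensor_power_one[OF T1, of n] T by simp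
    note tp = premeasure_tpow[OF Z T, of n, folded Zn_def Tn_def]
    have "\<exists>Ks. locc (N^n) (d^n) 1 1 Ks \<and>
      (fnorm (msum (d^n) (d^n) (\<lambda>x. 1\<^sub>m (d^n) * Zn x) {..<N^n} * Tn))\<^sup>2 / real 1
      \<le> Re (cinner (phi_max 1) (apply_kraus (1 * 1) Ks (premeasure (d^n) (N^n) Zn Tn * (premeasure (d^n) (N^n) Zn Tn)\<^sup>\<dagger>) *\<^sub>v phi_max 1))"
      by (rule hashing_protocol[OF Zn, of "\<lambda>_. 0" 1 Tn "\<lambda>_. 1\<^sub>m (d^n)" "d^n"]) auto
    moreover have "msum (d^n) (d^n) (\<lambda>x. 1\<^sub>m (d^n) * Zn x) {..<N^n} = 1\<^sub>m (d^n)"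
    proof -
      have "msum (d^n) (d^n) (\<lambda>x. 1\<^sub>m (d^n) * Zn x) {..<N^n} = msum (d^n) (d^n) Zn {..<N^n}"
        by (rule msum_cong) (simp add: Zn_def)
      then show ?thesis using info_typeD(6)[OF Zn] by simp
    qed
    ultimately obtain Ks where Ks: "locc (N^n) (d^n) 1 1 Ks"
      "1 \<le> Re (cinner (phi_max 1) (apply_kraus (1 * 1) Ks (tpow N d n ?\<rho>) *\<^sub>v phi_max 1))"
      unfolding tp using Tn1 by auto
    moreover have "Re (cinner (phi_max 1) (apply_kraus (1 * 1) Ks (tpow N d n ?\<rho>) *\<^sub>v phi_max 1)) \<le> 1"
      unfolding tp by (rule locc_fidelity_le[OF Ks(1)]) (auto simp: fnorm_premeasure[OF Zn] Tn1)
    ultimately show ?thesis by (intro exI[of _ Ks]) simp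
  qed
  then obtain \<Lambda> where \<Lambda>: "\<And>n. locc (N^n) (d^n) 1 1 (\<Lambda> n)"
    "\<And>n. Re (cinner (phi_max 1) (apply_kraus (1 * 1) (\<Lambda> n) (tpow N d n ?\<rho>) *\<^sub>v phi_max 1)) = 1" by metis
  show ?thesis unfolding distill_rate_def
    by (intro exI[of _ "\<lambda>_. 1"] exI[of _ \<Lambda>]) (use \<Lambda> in simp)
qed

text \<open>With cuts \<open>\<nu>\<close> near 2 to the power \<open>- n * SM\<close> and
  \<open>\<mu>\<close> near 2 to the power \<open>- n * SC\<close>, a target size near 2 to the
  power \<open>n * r\<close> keeps the critical ratio \<open>K * \<nu> / \<mu>\<close> exponentially
  small as long as \<open>r < SM - SC\<close>.\<close>

theorem hashing_rate:
  assumes Z: "info_type d N Z" and T: "dim_row T = d" and T1: "fnorm T = 1"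
    and r: "0 \<le> r" "r < vN_entropy (blocks d N Z T * (blocks d N Z T)\<^sup>\<dagger>) - vN_entropy (T\<^sup>\<dagger> * T)"
  shows "distill_rate N d (premeasure d N Z T * (premeasure d N Z T)\<^sup>\<dagger>) r"
proof -
  let ?\<rho> = "premeasure d N Z T * (premeasure d N Z T)\<^sup>\<dagger>"
  define c where "c = dim_col T"
  define RR where "RR = blocks d N Z T * (blocks d N Z T)\<^sup>\<dagger>"
  have RRp: "psd d RR" unfolding RR_def by (rule psd_gram') simp
  have TTp: "psd c (T\<^sup>\<dagger> * T)" by (rule psd_gram) (simp add: c_def)
  obtain V s where V: "spec_decomp RR V s" "unitary d V" "RR = V * mat_diag d (\<lambda>i. complex_of_real (s i)) * V\<^sup>\<dagger>"
    and s0: "\<And>i. i < d \<Longrightarrow> 0 \<le> s i" using psd_spectral[OF RRp] by metis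
  obtain U u where U: "spec_decomp (T\<^sup>\<dagger> * T) U u" "unitary c U" "T\<^sup>\<dagger> * T = U * mat_diag c (\<lambda>i. complex_of_real (u i)) * U\<^sup>\<dagger>"
    and u0: "\<And>i. i < c \<Longrightarrow> 0 \<le> u i" using psd_spectral[OF TTp] by metis
  define SM where "SM = vN_entropy RR"
  define SC where "SC = vN_entropy (T\<^sup>\<dagger> * T)"
  have sM: "(\<Sum>i<d. s i * log 2 (1 / s i)) = SM"
    unfolding SM_def by (rule vN_entropy_eq_sum_log[OF RRp V(1)])
  have "(\<Sum>i<c. u i * log 2 (1 / u i)) = SC"
    unfolding SC_def by (rule vN_entropy_eq_sum_log[OF TTp U(1)])
  moreover have "u i * log 2 (1 / u i) = - (u i * log 2 (u i))" if "i < c" for i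
    using u0[OF that] by (cases "u i = 0") (auto simp: log_divide)
  ultimately have uC: "(\<Sum>i<c. u i * log 2 (u i)) = - SC" by (simp add: sum_negf)
  have u1: "(\<Sum>i<c. u i) = 1"
  proof -
    have "complex_of_real (\<Sum>i<c. u i) = mtrace (T\<^sup>\<dagger> * T)"
      unfolding U(3) by (simp add: mtrace_unitary_conj[OF U(2)] mtrace_mat_diag unitaryD[OF U(2)])
    also have "\<dots> = complex_of_real 1" unfolding fnorm_sq_mtrace T1 by simp
    finally show ?thesis by (simp only: of_real_eq_iff)
  qed
  have s1: "(\<Sum>i<d. s i) = 1"
  proof -
    have "complex_of_real (\<Sum>i<d. s i) = mtrace RR"
      unfolding V(3) by (simp add: mtrace_unitary_conj[OF V(2)] mtrace_mat_diag unitaryD[OF V(2)])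
    also have "\<dots> = complex_of_real ((fnorm (1\<^sub>m d * blocks d N Z T))\<^sup>2)" unfolding RR_def fnorm_sq_mtrace' by simp
    also have "(fnorm (1\<^sub>m d * blocks d N Z T))\<^sup>2 = (\<Sum>j<N. (fnorm (1\<^sub>m d * (Z j * T)))\<^sup>2)"
      by (rule fnorm_mult_blocks[OF Z T]) auto
    also have "\<dots> = (\<Sum>j<N. (fnorm (Z j * T))\<^sup>2)" by (intro sum.cong refl) (simp add: info_typeD[OF Z])
    also have "\<dots> = 1" using info_type_fnorm[OF Z T] T1 by simp
    finally show ?thesis by (simp only: of_real_eq_iff)
  qed
  \<comment> \<open>The gap is four \<open>\<delta>\<close>: the two typicality margins use one
    each, and the remaining two are the decay exponent of the critical ratio.\<close>
  define \<delta> where "\<delta> = (SM - SC - r) / 4"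
  have \<delta>: "\<delta> > 0" using r(2) by (simp add: \<delta>_def SM_def SC_def RR_def)
  obtain \<beta>1 where \<beta>1: "0 \<le> \<beta>1" "\<beta>1 < 1" "\<And>n D e. product_index n D d e \<Longrightarrow>
    (\<Sum>i<D. if (\<Prod>t<n. 1 / s (e t i)) < 2 powr (- real n * (- SM + \<delta>)) then (\<Prod>t<n. s (e t i)) else 0) \<le> \<beta>1 ^ n"
    using product_chernoff[of d s "\<lambda>i. 1 / s i" "- SM" \<delta>] s0 s1 sM \<delta> by auto
  obtain \<beta>2 where \<beta>2: "0 \<le> \<beta>2" "\<beta>2 < 1" "\<And>n D e. product_index n D c e \<Longrightarrow>
    (\<Sum>i<D. if (\<Prod>t<n. u (e t i)) < 2 powr (- real n * (SC + \<delta>)) then (\<Prod>t<n. u (e t i)) else 0) \<le> \<beta>2 ^ n"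
    using product_chernoff[of c u u SC \<delta>] u0 u1 uC \<delta> by auto
  \<comment> \<open>Rounding down loses at most a factor 2, hence at most \<open>1 / n\<close> in
    the rate; a nonnegative \<open>r\<close> keeps \<open>K n\<close> at least 1.\<close>
  define K where "K n = nat \<lfloor>2 powr (real n * r)\<rfloor>" for n
  have pr: "1 \<le> 2 powr (real n * r)" for n using r(1) by (simp add: ge_one_powr_ge_zero)
  have K1: "1 \<le> K n" for n unfolding K_def using pr[of n] by linarith
  have Kle: "real (K n) \<le> 2 powr (real n * r)" for n unfolding K_def using pr[of n] by linarith
  have Kge: "2 powr (real n * r) / 2 \<le> real (K n)" for n
  proof -
    have "2 powr (real n * r) < real (K n) + 1" unfolding K_def using pr[of n] by linarith
    then show ?thesis using K1[of n] by linarith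
  qed
  define g where "g n = 1 - 3 * (sqrt \<beta>1 ^ n + sqrt \<beta>2 ^ n) - sqrt (2 powr (- 2 * \<delta>)) ^ n" for n
  define F where "F n Ks = Re (cinner (phi_max (K n)) (apply_kraus (K n * K n) Ks (tpow N d n ?\<rho>) *\<^sub>v phi_max (K n)))" for n Ks
  have "\<exists>Ks. locc (N^n) (d^n) (K n) (K n) Ks \<and> (max 0 (g n))\<^sup>2 \<le> F n Ks \<and> F n Ks \<le> 1" for n
  proof -
    define Zn where "Zn = info_power n d N Z"
    define Tn where "Tn = tensor_power n (d^n) (digit d) (c^n) (digit c) T"
    note Zn = info_type_power[OF Z, of n, folded Zn_def]
    have [simp]: "dim_row Tn = d^n" "dim_col Tn = c^n" by (simp_all add: Tn_def)
    have Tn1: "fnorm Tn = 1" unfolding Tn_def c_def using fnorm_tensor_power_one[OF T1, of n] T by simp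
    note tp = premeasure_tpow[OF Z T, of n, folded c_def, folded Zn_def Tn_def]
    note pd = product_index_digit[of n d] and pc = product_index_digit[of n c]
    define Vn where "Vn = tensor_power n (d^n) (digit d) (d^n) (digit d) V"
    define Uc where "Uc = tensor_power n (c^n) (digit c) (c^n) (digit c) U"
    define sn where "sn i = (\<Prod>t<n. s (digit d t i))" for i
    define un where "un i = (\<Prod>t<n. u (digit c t i))" for i
    have Vn: "unitary (d^n) Vn" and Uc: "unitary (c^n) Uc"
      unfolding Vn_def Uc_def using tensor_power_unitary[OF pd V(2)] tensor_power_unitary[OF pc U(2)] by auto
    have sn0: "0 \<le> sn i" if "i < d^n" for i
      unfolding sn_def using product_index_less[OF pd that] s0 by (auto intro!: prod_nonneg)
    have un0: "0 \<le> un i" if "i < c^n" for i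
      unfolding un_def using product_index_less[OF pc that] u0 by (auto intro!: prod_nonneg)
    have RRn: "blocks (d^n) (N^n) Zn Tn * (blocks (d^n) (N^n) Zn Tn)\<^sup>\<dagger> = Vn * mat_diag (d^n) (\<lambda>i. complex_of_real (sn i)) * Vn\<^sup>\<dagger>"
    proof -
      have "blocks (d^n) (N^n) Zn Tn * (blocks (d^n) (N^n) Zn Tn)\<^sup>\<dagger> = tensor_power n (d^n) (digit d) (d^n) (digit d) RR"
        unfolding Zn_def Tn_def c_def RR_def by (rule blocks_gram_power[OF Z T])
      also have "\<dots> = Vn * mat_diag (d^n) (\<lambda>i. complex_of_real (sn i)) * Vn\<^sup>\<dagger>"
        unfolding V(3) tensor_power_diag_conj[OF pd V(2)] Vn_def sn_def by simp
      finally show ?thesis .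
    qed
    have TTn: "Tn\<^sup>\<dagger> * Tn = Uc * mat_diag (c^n) (\<lambda>i. complex_of_real (un i)) * Uc\<^sup>\<dagger>"
    proof -
      have "Tn\<^sup>\<dagger> * Tn = tensor_power n (c^n) (digit c) (c^n) (digit c) (T\<^sup>\<dagger> * T)"
        unfolding Tn_def using T pd pc by (simp add: tensor_power_adjoint tensor_power_mult c_def)
      also have "\<dots> = Uc * mat_diag (c^n) (\<lambda>i. complex_of_real (un i)) * Uc\<^sup>\<dagger>"
        unfolding U(3) tensor_power_diag_conj[OF pc U(2)] Uc_def un_def by simp
      finally show ?thesis .
    qed
    define \<nu> where "\<nu> = 2 powr (- real n * (SM - \<delta>))"
    define \<mu> where "\<mu> = 2 powr (- real n * (SC + \<delta>))"
    have \<nu>: "\<nu> > 0" and \<mu>: "\<mu> > 0" by (simp_all add: \<nu>_def \<mu>_def)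
    define e1 where "e1 = (\<Sum>i<d^n. if \<nu> < sn i then sn i else 0)"
    define e2 where "e2 = (\<Sum>i<c^n. if un i < \<mu> then un i else 0)"
    obtain Ks where Ks: "locc (N^n) (d^n) (K n) (K n) Ks"
      "(max 0 (1 - 3 * (sqrt e1 + sqrt e2) - sqrt (real (K n) * \<nu> / \<mu>)))\<^sup>2 \<le> F n Ks"
      using hashing_spectral[OF Zn _ _ Tn1 Vn sn0 RRn Uc un0 TTn \<nu> \<mu> K1[of n] e1_def e2_def refl]
      unfolding F_def tp by auto
    have "e1 \<le> \<beta>1 ^ n"
    proof -
      have "(if \<nu> < sn i then sn i else 0) \<le> (if (\<Prod>t<n. 1 / s (digit d t i)) < 2 powr (- real n * (- SM + \<delta>)) then sn i else 0)" if i: "i < d^n" for i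
      proof (cases "\<nu> < sn i")
        case True
        have "(\<Prod>t<n. 1 / s (digit d t i)) = 1 / sn i" by (simp add: sn_def prod_dividef)
        also have "\<dots> < 1 / \<nu>" using True \<nu> by (simp add: frac_less2)
        also have "1 / \<nu> = 2 powr (- real n * (- SM + \<delta>))"
          unfolding \<nu>_def by (simp add: powr_minus_divide[symmetric] algebra_simps)
        finally show ?thesis using sn0[OF i] by simp
      qed (use sn0[OF i] in auto)
      then have "e1 \<le> (\<Sum>i<d^n. if (\<Prod>t<n. 1 / s (digit d t i)) < 2 powr (- real n * (- SM + \<delta>)) then sn i else 0)"
        unfolding e1_def by (intro sum_mono) auto
      also have "\<dots> \<le> \<beta>1 ^ n" using \<beta>1(3)[OF pd] unfolding sn_def .
      finally show ?thesis .
    qed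
    then have b1: "sqrt e1 \<le> sqrt \<beta>1 ^ n" unfolding real_sqrt_power[symmetric] by (rule real_sqrt_le_mono)
    have "e2 \<le> \<beta>2 ^ n" unfolding e2_def un_def \<mu>_def by (rule \<beta>2(3)[OF pc])
    then have b2: "sqrt e2 \<le> sqrt \<beta>2 ^ n" unfolding real_sqrt_power[symmetric] by (rule real_sqrt_le_mono)
    have "real (K n) * \<nu> / \<mu> \<le> 2 powr (real n * r) * \<nu> / \<mu>"
      using \<nu> \<mu> Kle[of n] by (intro divide_right_mono mult_right_mono) auto
    also have "\<dots> = 2 powr (real n * r + - real n * (SM - \<delta>) - - real n * (SC + \<delta>))"
      unfolding \<nu>_def \<mu>_def powr_diff powr_add by simp
    also have "\<dots> = 2 powr (- 2 * \<delta> * real n)"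
      unfolding \<delta>_def by (rule arg_cong[where f = "\<lambda>x. 2 powr x"]) (simp add: field_simps)
    also have "\<dots> = (2 powr (- 2 * \<delta>)) ^ n" by (simp add: powr_powr powr_realpow[symmetric])
    finally have b3: "sqrt (real (K n) * \<nu> / \<mu>) \<le> sqrt (2 powr (- 2 * \<delta>)) ^ n"
      unfolding real_sqrt_power[symmetric] by (rule real_sqrt_le_mono)
    have "g n \<le> 1 - 3 * (sqrt e1 + sqrt e2) - sqrt (real (K n) * \<nu> / \<mu>)"
      using b1 b2 b3 unfolding g_def distrib_left by linarith
    then have le: "(max 0 (g n))\<^sup>2 \<le> (max 0 (1 - 3 * (sqrt e1 + sqrt e2) - sqrt (real (K n) * \<nu> / \<mu>)))\<^sup>2"
      by (intro power_mono) auto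
    \<comment> \<open>Recorded along with the choice of protocol, because convergence to 1 is
      obtained by squeezing.\<close>
    have "F n Ks \<le> 1"
      unfolding F_def tp by (rule locc_fidelity_le[OF Ks(1) K1]) (auto simp: fnorm_premeasure[OF Zn] Tn1)
    then show ?thesis by (intro exI[of _ Ks] conjI order_trans[OF le Ks(2)] Ks(1))
  qed
  then obtain \<Lambda> where \<Lambda>: "\<And>n. locc (N^n) (d^n) (K n) (K n) (\<Lambda> n)" "\<And>n. (max 0 (g n))\<^sup>2 \<le> F n (\<Lambda> n)" "\<And>n. F n (\<Lambda> n) \<le> 1"
    by metis
  have "2 powr (- 2 * \<delta>) < 1" using \<delta> powr_less_mono[of "- 2 * \<delta>" 0 2] by simp
  then have "g \<longlonglongrightarrow> 1 - 3 * (0 + 0) - 0"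
    unfolding g_def using \<beta>1 \<beta>2 by (intro tendsto_diff tendsto_mult tendsto_add tendsto_const LIMSEQ_power_zero) auto
  then have "(\<lambda>n. (max 0 (g n))\<^sup>2) \<longlonglongrightarrow> (max 0 (1 - 3 * (0 + 0) - 0))\<^sup>2" by (intro tendsto_power tendsto_max tendsto_const)
  then have "(\<lambda>n. (max 0 (g n))\<^sup>2) \<longlonglongrightarrow> 1" by simp
  from tendsto_sandwich[OF always_eventually always_eventually this tendsto_const, rule_format, OF \<Lambda>(2) \<Lambda>(3)]
  have lim: "(\<lambda>n. F n (\<Lambda> n)) \<longlonglongrightarrow> 1" .
  have rate: "eventually (\<lambda>n. r - \<epsilon> \<le> log 2 (real (K n)) / real n) sequentially" if \<epsilon>: "\<epsilon> > 0" for \<epsilon>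
  proof -
    have "eventually (\<lambda>n. 1 / \<epsilon> < real n) sequentially"
      using filterlim_real_sequentially unfolding filterlim_at_top_dense by blast
    then show ?thesis using eventually_gt_at_top[of 0]
    proof eventually_elim
      case (elim n)
      have "log 2 (2 powr (real n * r) / 2) \<le> log 2 (real (K n))" using Kge[of n] by (intro log_mono) auto
      then have "real n * r - 1 \<le> log 2 (real (K n))" by (simp add: log_divide)
      moreover have "1 \<le> real n * \<epsilon>" using elim \<epsilon> by (simp add: field_simps)
      ultimately have "real n * (r - \<epsilon>) \<le> log 2 (real (K n))" by (simp add: right_diff_distrib)
      then show ?case using elim by (simp add: field_simps)
    qed
  qed
  show ?thesis unfolding distill_rate_def
    by (intro exI[of _ K] exI[of _ \<Lambda>]) (use K1 \<Lambda>(1) lim rate in \<open>auto simp: F_def\<close>)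
qed

section \<open>Guessing and separable states\<close>

text \<open>A Gram factor of the classical-quantum state with blocks
  \<open>C j * (C j)\<^sup>\<dagger>\<close>: giving each branch its own columns removes all
  coherence of the register.\<close>

definition block_diag :: "nat \<Rightarrow> nat \<Rightarrow> nat \<Rightarrow> (nat \<Rightarrow> complex mat) \<Rightarrow> complex mat" where
  "block_diag N d m C = mat (N * d) (N * m) (\<lambda>(i,l). if i div d = l div m then C (i div d) $$ (i mod d, l mod m) else 0)"

lemma block_diag_simps [simp]:
  "dim_row (block_diag N d m C) = N * d" "dim_col (block_diag N d m C) = N * m"
  "i < N * d \<Longrightarrow> l < N * m \<Longrightarrow> block_diag N d m C $$ (i,l) = (if i div d = l div m then C (i div d) $$ (i mod d, l mod m) else 0)"
  by (simp_all add: block_diag_def)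

lemma sum_block_delta:
  fixes g :: "nat \<Rightarrow> complex" and j N m :: nat
  assumes "j < N" shows "(\<Sum>k<N. \<Sum>b<m. if j = k then g b else 0) = (\<Sum>b<m. g b)"
proof -
  have "(\<Sum>k<N. \<Sum>b<m. if j = k then g b else 0) = (\<Sum>k<N. if k = j then (\<Sum>b<m. g b) else 0)"
    by (intro sum.cong refl) auto
  also have "\<dots> = (\<Sum>b<m. g b)" using assms by (subst sum.delta) auto
  finally show ?thesis .
qed

lemma block_diag_gram_index:
  assumes C: "\<And>j. j < N \<Longrightarrow> dim_row (C j) = d \<and> dim_col (C j) = m" and i: "i < N * d" "i' < N * d"
  shows "(block_diag N d m C * (block_diag N d m C)\<^sup>\<dagger>) $$ (i,i')
    = (if i div d = i' div d then (C (i div d) * (C (i div d))\<^sup>\<dagger>) $$ (i mod d, i' mod d) else 0)"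
proof -
  let ?j = "i div d" and ?j' = "i' div d"
  have j: "?j < N" "?j' < N" "i mod d < d" "i' mod d < d" using i by auto
  have "(block_diag N d m C * (block_diag N d m C)\<^sup>\<dagger>) $$ (i,i')
      = (\<Sum>k<N. \<Sum>b<m. (if ?j = k then C ?j $$ (i mod d, b) else 0) * cnj (if ?j' = k then C ?j' $$ (i' mod d, b) else 0))"
    using i by (subst mult_index) (auto simp: sum_lessThan_mult cong: if_cong)
  also have "\<dots> = (\<Sum>k<N. \<Sum>b<m. if ?j = k then (if ?j = ?j' then C ?j $$ (i mod d, b) * cnj (C ?j' $$ (i' mod d, b)) else 0) else 0)"
    by (intro sum.cong refl) auto
  also have "\<dots> = (\<Sum>b<m. if ?j = ?j' then C ?j $$ (i mod d, b) * cnj (C ?j' $$ (i' mod d, b)) else 0)"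
    by (rule sum_block_delta[OF j(1)])
  also have "\<dots> = (if ?j = ?j' then (C ?j * (C ?j)\<^sup>\<dagger>) $$ (i mod d, i' mod d) else 0)"
    using C[OF j(1)] C[OF j(2)] j by (auto simp: mult_index)
  finally show ?thesis .
qed

lemma fnorm_block_diag:
  assumes C: "\<And>j. j < N \<Longrightarrow> dim_row (C j) = d \<and> dim_col (C j) = m"
  shows "(fnorm (block_diag N d m C))\<^sup>2 = (\<Sum>j<N. (fnorm (C j))\<^sup>2)"
proof -
  have "complex_of_real ((fnorm (block_diag N d m C))\<^sup>2) = (\<Sum>j<N. \<Sum>y<d. (C j * (C j)\<^sup>\<dagger>) $$ (y,y))"
    unfolding fnorm_sq_mtrace'[symmetric] mtrace_def
    by (simp add: sum_lessThan_mult block_diag_gram_index[OF C])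
  also have "\<dots> = complex_of_real (\<Sum>j<N. (fnorm (C j))\<^sup>2)"
    unfolding of_real_sum fnorm_sq_mtrace'[symmetric] mtrace_def using C by simp
  finally show ?thesis by (simp only: of_real_eq_iff)
qed

definition basis_state :: "nat \<Rightarrow> nat \<Rightarrow> complex mat" where
  "basis_state n j = mat n n (\<lambda>(a,b). if a = j \<and> b = j then 1 else 0)"

lemma density_basis_state: assumes "j < n" shows "density n (basis_state n j)"
proof -
  have "basis_state n j = ket n j * (ket n j)\<^sup>\<dagger>"
    by (rule eq_matI) (auto simp: basis_state_def ket_def mult_index)
  then have "psd n (basis_state n j)" using psd_gram'[of "ket n j" n] by (simp add: ket_def)
  then show ?thesis using assms unfolding density_def mtrace_def by (simp add: basis_state_def)
qed

lemma sep_state_block_diag: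
  assumes C: "\<And>j. j < N \<Longrightarrow> dim_row (C j) = d \<and> dim_col (C j) = m" and d: "d > 0"
    and 1: "fnorm (block_diag N d m C) = 1"
  shows "sep_state N d (block_diag N d m C * (block_diag N d m C)\<^sup>\<dagger>)"
proof -
  define q where "q j = (fnorm (C j))\<^sup>2" for j
  \<comment> \<open>A block of weight 0 cannot be normalised; any density matrix serves in its
    place, and \<open>d > 0\<close> provides one.\<close>
  define sy where "sy j = (if q j = 0 then basis_state d 0 else complex_of_real (1 / q j) \<cdot>\<^sub>m (C j * (C j)\<^sup>\<dagger>))" for j
  have sy: "density d (sy j)" if j: "j < N" for j
  proof (cases "q j = 0")
    case True then show ?thesis using density_basis_state[OF d] by (simp add: sy_def)
  next
    case False
    have "psd d (complex_of_real (1 / q j) \<cdot>\<^sub>m (C j * (C j)\<^sup>\<dagger>))"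
      by (intro psd_smult psd_gram') (use C[OF j] in \<open>auto simp: q_def\<close>)
    moreover have "mtrace (complex_of_real (1 / q j) \<cdot>\<^sub>m (C j * (C j)\<^sup>\<dagger>)) = 1"
      using C[OF j] False by (simp add: mtrace_smult fnorm_sq_mtrace' q_def)
    ultimately show ?thesis using False by (simp add: density_def sy_def)
  qed
  have qsy: "complex_of_real (q j) * sy j $$ (y,y') = (C j * (C j)\<^sup>\<dagger>) $$ (y,y')" if j: "j < N" "y < d" "y' < d" for j y y'
  proof (cases "q j = 0")
    case True
    then have "C j = 0\<^sub>m d m" using fnorm_eq_0[of "C j"] C[OF j(1)] by (simp add: q_def)
    then show ?thesis using True j by (simp add: mult_index)
  next
    case False
    then show ?thesis using C[OF j(1)] j by (simp add: sy_def)
  qed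
  have q1: "(\<Sum>j<N. q j) = 1" using fnorm_block_diag[of N C d m, OF C] 1 by (simp add: q_def)
  have eq: "block_diag N d m C * (block_diag N d m C)\<^sup>\<dagger>
    = msum (N * d) (N * d) (\<lambda>k. complex_of_real (q k) \<cdot>\<^sub>m kron (basis_state N k) (sy k)) {..<N}"
  proof (rule eq_matI)
    fix i i' assume "i < dim_row (msum (N * d) (N * d) (\<lambda>k. complex_of_real (q k) \<cdot>\<^sub>m kron (basis_state N k) (sy k)) {..<N})"
      "i' < dim_col (msum (N * d) (N * d) (\<lambda>k. complex_of_real (q k) \<cdot>\<^sub>m kron (basis_state N k) (sy k)) {..<N})"
    then have i: "i < N * d" "i' < N * d" by auto
    have j: "i div d < N" "i' div d < N" "i mod d < d" "i' mod d < d" using i by auto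
    have dims: "dim_row (sy k) = d" "dim_col (sy k) = d" if "k < N" for k
      using psdD(1,2)[OF densityD(1)[OF sy[OF that]]] by auto
    have "(\<Sum>k<N. (complex_of_real (q k) \<cdot>\<^sub>m kron (basis_state N k) (sy k)) $$ (i,i'))
      = (\<Sum>k<N. if k = i div d then (if i div d = i' div d then complex_of_real (q k) * sy k $$ (i mod d, i' mod d) else 0) else 0)"
      using i j by (intro sum.cong refl) (auto simp: dims kron_index basis_state_def)
    also have "\<dots> = (if i div d = i' div d then complex_of_real (q (i div d)) * sy (i div d) $$ (i mod d, i' mod d) else 0)"
      using j by simp
    also have "\<dots> = (block_diag N d m C * (block_diag N d m C)\<^sup>\<dagger>) $$ (i,i')"
      using j by (simp add: block_diag_gram_index[OF C i] qsy)
    finally show "(block_diag N d m C * (block_diag N d m C)\<^sup>\<dagger>) $$ (i,i')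
      = msum (N * d) (N * d) (\<lambda>k. complex_of_real (q k) \<cdot>\<^sub>m kron (basis_state N k) (sy k)) {..<N} $$ (i,i')" using i by simp
  qed auto
  show ?thesis unfolding sep_state_def
    by (intro exI[of _ N] exI[of _ q] exI[of _ "basis_state N"] exI[of _ sy] conjI allI impI)
      (use sy density_basis_state q1 eq in \<open>auto simp: q_def\<close>)
qed

lemma mtrace_psd_mult_gram:
  assumes A: "psd n A" and B: "dim_col B = n"
  shows "mtrace (A * (B\<^sup>\<dagger> * B)) = complex_of_real ((fnorm (B * mfun sqrt A))\<^sup>2)"
proof -
  define R where "R = mfun sqrt A"
  note R = psd_sqrt[OF A, folded R_def]
  note [simp] = psdD(1-3)[OF R(1)] B
  have "mtrace (A * (B\<^sup>\<dagger> * B)) = mtrace (R * (R * (B\<^sup>\<dagger> * B)))"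
    unfolding R(2)[symmetric] by (simp add: mult_assoc_dim)
  also have "\<dots> = mtrace (R * (B\<^sup>\<dagger> * B) * R)" by (subst mtrace_cyclic) auto
  also have "\<dots> = mtrace ((B * R)\<^sup>\<dagger> * (B * R))" by (simp add: adjoint_mult mult_assoc_dim)
  finally show ?thesis unfolding fnorm_sq_mtrace R_def .
qed

lemma info_type_gram:
  assumes Z: "info_type d N Z" and T: "dim_row T = d" and j: "j < N"
  shows "T\<^sup>\<dagger> * (Z j * T) = (Z j * T)\<^sup>\<dagger> * (Z j * T)"
proof -
  have "(Z j * T)\<^sup>\<dagger> * (Z j * T) = T\<^sup>\<dagger> * ((Z j * Z j) * T)"
    using j T by (simp add: adjoint_mult mult_assoc_dim info_typeD(1-3)[OF Z])
  then show ?thesis using j by (simp add: info_typeD(4)[OF Z])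
qed

text \<open>From a separable state and an Uhlmann-optimal contraction \<open>W\<close>, the measurement guesses \<open>j\<close> with
  the weights \<open>\<bar>a\<^sub>k(j)\<bar>\<^sup>2\<close> after outcome \<open>k\<close> of \<open>W\<close>.\<close>
lemma fidelity_le_guess:
  assumes Z: "info_type d N Z" and T [simp]: "dim_row T = d" "dim_col T = c" and N: "N > 0" and sep: "sep_state N d \<sigma>"
  shows "\<exists>Q. povm c N Q \<and> fidelity (premeasure d N Z T * (premeasure d N Z T)\<^sup>\<dagger>) \<sigma> \<le> (\<Sum>j<N. Re (mtrace (Q j * (T\<^sup>\<dagger> * (Z j * T)))))"
proof -
  note Zd = info_typeD[OF Z]
  let ?P = "premeasure d N Z T"
  obtain \<kappa> a b where a1: "\<And>k. k < \<kappa> \<Longrightarrow> (\<Sum>i<N. (cmod (a k i))\<^sup>2) = 1"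
    and \<sigma>: "\<sigma> = product_cols N d \<kappa> a b * (product_cols N d \<kappa> a b)\<^sup>\<dagger>" and Y1: "fnorm (product_cols N d \<kappa> a b) = 1"
    using sep_state_pure[OF sep] by blast
  let ?Y = "product_cols N d \<kappa> a b"
  obtain W where W: "contr W" "dim_row W = \<kappa>" "dim_col W = c"
    and fid: "fidelity (?P * ?P\<^sup>\<dagger>) \<sigma> = (cmod (mtrace (W * (?P\<^sup>\<dagger> * ?Y))))\<^sup>2"
    using fidelity_attained[of ?P "N * d" ?Y] unfolding \<sigma> by auto
  note [simp] = W(2,3)
  define B where "B j = Z j * T * W\<^sup>\<dagger>" for j
  have B_dims: "dim_row (B j) = d" "dim_col (B j) = \<kappa>" if "j < N" for j using that by (simp_all add: B_def Zd)
  \<comment> \<open>The overlap with a product vector splits: contracting the register with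
    \<open>a k\<close> gives column \<open>k\<close> of \<open>G\<close>, and an inner product with
    \<open>b k\<close> remains. Since all \<open>b k\<close> together have norm 1, the norm of
    \<open>G\<close> bounds the overlap.\<close>
  define G where "G = mat d \<kappa> (\<lambda>(y,k). \<Sum>j<N. cnj (a k j) * B j $$ (y,k))"
  define bm where "bm = mat d \<kappa> (\<lambda>(y,k). b k y)"
  have [simp]: "dim_row G = d" "dim_col G = \<kappa>" "dim_row bm = d" "dim_col bm = \<kappa>" by (simp_all add: G_def bm_def)
  have "mtrace (W * (?P\<^sup>\<dagger> * ?Y)) = mtrace (G\<^sup>\<dagger> * bm)"
  proof -
    have WP: "(W * ?P\<^sup>\<dagger>) $$ (k, j * d + y) = cnj (B j $$ (y,k))" if k: "k < \<kappa>" "j < N" "y < d" for k j y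
    proof -
      have "(W * ?P\<^sup>\<dagger>) $$ (k, j * d + y) = (\<Sum>l<c. W $$ (k,l) * cnj ((Z j * T) $$ (y,l)))"
        using that by (subst mult_index) auto
      moreover have "B j $$ (y,k) = (\<Sum>l<c. (Z j * T) $$ (y,l) * cnj (W $$ (k,l)))"
        unfolding B_def using that by (subst mult_index) (auto simp: Zd)
      ultimately show ?thesis by (simp add: mult.commute)
    qed
    have "mtrace (W * (?P\<^sup>\<dagger> * ?Y)) = mtrace (W * ?P\<^sup>\<dagger> * ?Y)" by (simp add: mult_assoc_dim)
    also have "\<dots> = (\<Sum>k<\<kappa>. \<Sum>j<N. \<Sum>y<d. cnj (B j $$ (y,k)) * (a k j * b k y))"
      by (subst mtrace_mult) (auto simp: sum_lessThan_mult WP)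
    also have "\<dots> = (\<Sum>k<\<kappa>. \<Sum>y<d. \<Sum>j<N. cnj (B j $$ (y,k)) * (a k j * b k y))"
      by (rule sum.cong[OF refl], rule sum.swap)
    also have "\<dots> = (\<Sum>y<d. \<Sum>k<\<kappa>. \<Sum>j<N. cnj (B j $$ (y,k)) * (a k j * b k y))" by (rule sum.swap)
    also have "\<dots> = mtrace (G\<^sup>\<dagger> * bm)"
      by (subst mtrace_adjoint_mult) (auto simp: G_def bm_def sum_distrib_right sum_distrib_left algebra_simps intro!: sum.cong)
    finally show ?thesis .
  qed
  then have "cmod (mtrace (W * (?P\<^sup>\<dagger> * ?Y))) \<le> fnorm G * fnorm bm" using mtrace_Cauchy_Schwarz[of G bm] by simp
  moreover have "fnorm bm = 1"
  proof -
    have "(fnorm ?Y)\<^sup>2 = (\<Sum>k<\<kappa>. \<Sum>j<N. \<Sum>y<d. (cmod (a k j))\<^sup>2 * (cmod (b k y))\<^sup>2)"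
      unfolding fnorm_sq by (subst sum.swap) (simp add: sum_lessThan_mult norm_mult power_mult_distrib)
    also have "\<dots> = (\<Sum>k<\<kappa>. (\<Sum>j<N. (cmod (a k j))\<^sup>2) * (\<Sum>y<d. (cmod (b k y))\<^sup>2))" by (simp add: sum_product)
    also have "\<dots> = (fnorm bm)\<^sup>2" unfolding fnorm_sq bm_def by (subst sum.swap) (simp add: a1)
    finally show ?thesis using Y1 fnorm_nonneg[of bm] by (simp add: power2_eq_1_iff)
  qed
  ultimately have "cmod (mtrace (W * (?P\<^sup>\<dagger> * ?Y))) \<le> fnorm G" by simp
  then have fidG: "fidelity (?P * ?P\<^sup>\<dagger>) \<sigma> \<le> (fnorm G)\<^sup>2" unfolding fid by (intro power_mono) auto
  \<comment> \<open>The element \<open>q j\<close> weights outcome \<open>k\<close> of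
    \<open>W\<close> by the squared modulus of \<open>a k j\<close>. As every \<open>a k\<close> is
    a unit vector, these elements sum to \<open>W\<^sup>\<dagger> * W\<close>.\<close>
  define M where "M j = mat_diag \<kappa> (\<lambda>k. complex_of_real (cmod (a k j))) * W" for j
  have M_dims [simp]: "dim_row (M j) = \<kappa>" "dim_col (M j) = c" for j by (simp_all add: M_def)
  define q where "q j = (M j)\<^sup>\<dagger> * M j" for j
  have Gsum: "(fnorm G)\<^sup>2 = (\<Sum>j<N. Re (mtrace (q j * (T\<^sup>\<dagger> * (Z j * T)))))"
  proof -
    have ZG: "Z j * G = B j * mat_diag \<kappa> (\<lambda>k. cnj (a k j))" if j: "j < N" for j
    proof (rule eq_matI)
      fix y k assume "y < dim_row (B j * mat_diag \<kappa> (\<lambda>k. cnj (a k j)))" "k < dim_col (B j * mat_diag \<kappa> (\<lambda>k. cnj (a k j)))"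
      then have yk: "y < d" "k < \<kappa>" using B_dims[OF j] by auto
      have ZB: "Z j * B l = (if l = j then B j else 0\<^sub>m d \<kappa>)" if l: "l < N" for l
      proof -
        have "Z j * B l = (Z j * Z l) * (T * W\<^sup>\<dagger>)" unfolding B_def using j l by (simp add: mult_assoc_dim Zd(1,2))
        moreover have "(Z j * Z l) * (T * W\<^sup>\<dagger>) = (if l = j then B j else 0\<^sub>m d \<kappa>)"
        proof (cases "l = j")
          case True then show ?thesis using j by (simp add: B_def Zd mult_assoc_dim)
        next
          case False
          then have "Z j * Z l = 0\<^sub>m d d" using j l by (intro Zd(5)) auto
          moreover have "0\<^sub>m d d * (T * W\<^sup>\<dagger>) = 0\<^sub>m d \<kappa>" by (intro left_mult_zero_mat carrier_matI) auto
          ultimately show ?thesis using False by simp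
        qed
        ultimately show ?thesis by simp
      qed
      have "(Z j * G) $$ (y,k) = (\<Sum>x<d. \<Sum>l<N. Z j $$ (y,x) * (cnj (a k l) * B l $$ (x,k)))"
        using yk j by (subst mult_index) (auto simp: Zd G_def sum_distrib_left)
      also have "\<dots> = (\<Sum>l<N. \<Sum>x<d. Z j $$ (y,x) * (cnj (a k l) * B l $$ (x,k)))" by (rule sum.swap)
      also have "\<dots> = (\<Sum>l<N. cnj (a k l) * (Z j * B l) $$ (y,k))"
        using yk j by (intro sum.cong refl) (simp add: mult_index Zd B_dims sum_distrib_left algebra_simps)
      also have "\<dots> = (\<Sum>l<N. if l = j then cnj (a k j) * B j $$ (y,k) else 0)"
        using yk by (intro sum.cong refl) (auto simp: ZB)
      also have "\<dots> = (B j * mat_diag \<kappa> (\<lambda>k. cnj (a k j))) $$ (y,k)"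
        using yk j B_dims[OF j] by (simp add: mult_mat_diag_index)
      finally show "(Z j * G) $$ (y,k) = (B j * mat_diag \<kappa> (\<lambda>k. cnj (a k j))) $$ (y,k)" .
    qed (use j B_dims in \<open>auto simp: Zd\<close>)
    have "(fnorm (Z j * G))\<^sup>2 = Re (mtrace (q j * (T\<^sup>\<dagger> * (Z j * T))))" if j: "j < N" for j
    proof -
      have "mtrace (q j * (T\<^sup>\<dagger> * (Z j * T))) = mtrace ((M j)\<^sup>\<dagger> * (M j * ((Z j * T)\<^sup>\<dagger> * (Z j * T))))"
        unfolding q_def info_type_gram[OF Z T(1) j] using j by (simp add: mult_assoc_dim Zd)
      also have "\<dots> = mtrace (M j * ((Z j * T)\<^sup>\<dagger> * (Z j * T)) * (M j)\<^sup>\<dagger>)" by (rule mtrace_cyclic) auto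
      also have "\<dots> = mtrace ((Z j * T * (M j)\<^sup>\<dagger>)\<^sup>\<dagger> * (Z j * T * (M j)\<^sup>\<dagger>))"
        using j by (simp add: adjoint_mult mult_assoc_dim Zd)
      also have "\<dots> = complex_of_real ((fnorm (Z j * T * (M j)\<^sup>\<dagger>))\<^sup>2)" by (rule fnorm_sq_mtrace)
      also have "Z j * T * (M j)\<^sup>\<dagger> = B j * mat_diag \<kappa> (\<lambda>k. complex_of_real (cmod (a k j)))"
        unfolding M_def B_def using j by (simp add: adjoint_mult mult_assoc_dim Zd)
      \<comment> \<open>Column norms see only the modulus of \<open>a k j\<close>; this is what lets
        a coherent amplitude be replaced by a random guess.\<close>
      also have "(fnorm (B j * mat_diag \<kappa> (\<lambda>k. complex_of_real (cmod (a k j)))))\<^sup>2 = (fnorm (B j * mat_diag \<kappa> (\<lambda>k. cnj (a k j))))\<^sup>2"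
        by (simp add: fnorm_mult_diag_sq B_dims[OF j])
      finally show ?thesis unfolding ZG[OF j] by simp
    qed
    then show ?thesis using info_type_fnorm[OF Z, of G] by simp
  qed
  have q_sum: "msum c c q {..<N} = W\<^sup>\<dagger> * W"
  proof (rule eq_matI)
    fix x y assume "x < dim_row (W\<^sup>\<dagger> * W)" "y < dim_col (W\<^sup>\<dagger> * W)"
    then have xy: "x < c" "y < c" by auto
    have "q j $$ (x,y) = (\<Sum>k<\<kappa>. complex_of_real ((cmod (a k j))\<^sup>2) * (cnj (W $$ (k,x)) * W $$ (k,y)))" for j
      unfolding q_def using xy by (subst mult_index)
        (auto simp: M_def mat_diag_mult_index power2_eq_square algebra_simps intro!: sum.cong)
    then have "(\<Sum>j<N. q j $$ (x,y)) = (\<Sum>k<\<kappa>. \<Sum>j<N. complex_of_real ((cmod (a k j))\<^sup>2) * (cnj (W $$ (k,x)) * W $$ (k,y)))"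
      by (simp only:) (rule sum.swap)
    also have "\<dots> = (\<Sum>k<\<kappa>. complex_of_real (\<Sum>j<N. (cmod (a k j))\<^sup>2) * (cnj (W $$ (k,x)) * W $$ (k,y)))"
      by (simp add: sum_distrib_right)
    also have "\<dots> = (\<Sum>k<\<kappa>. cnj (W $$ (k,x)) * W $$ (k,y))" by (intro sum.cong refl) (simp only: lessThan_iff a1, simp)
    also have "\<dots> = (W\<^sup>\<dagger> * W) $$ (x,y)" using xy by (simp add: mult_index)
    finally show "msum c c q {..<N} $$ (x,y) = (W\<^sup>\<dagger> * W) $$ (x,y)" using xy by simp
  qed auto
  \<comment> \<open>The positive defect of the contraction is assigned to guess 0, which can only
    raise the success probability.\<close>
  define E where "E = 1\<^sub>m c - W\<^sup>\<dagger> * W"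
  have E: "psd c E"
  proof -
    have "psd c (1\<^sub>m c - msum c c (\<lambda>k. W\<^sup>\<dagger> * W) {..<1::nat})"
      by (rule psd_kraus_complement) (use contrD[OF W(1)] in \<open>auto intro: power_mono\<close>)
    moreover have "msum c c (\<lambda>k. W\<^sup>\<dagger> * W) {..<1::nat} = W\<^sup>\<dagger> * W" by (rule eq_matI) auto
    ultimately show ?thesis by (simp add: E_def)
  qed
  note [simp] = psdD(1,2)[OF E]
  have q_dims [simp]: "dim_row (q j) = c" "dim_col (q j) = c" for j by (simp_all add: q_def)
  define Q where "Q j = (if j = 0 then q 0 + E else q j)" for j
  have "psd c (Q j)" for j
  proof -
    have qp: "psd c (q i)" for i unfolding q_def by (rule psd_gram) simp
    have "psd c (q 0 + E)"
    proof -
      have "cinner v ((q 0 + E) *\<^sub>v v) = cinner v (q 0 *\<^sub>v v) + cinner v (E *\<^sub>v v)" if "v \<in> carrier_vec c" for v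
        using that by (simp add: cinner_mult_mat_vec sum.distrib algebra_simps)
      moreover have "hermitian c (q 0 + E)"
        using psdD(3)[OF qp] psdD(3)[OF E] unfolding hermitian_def by (auto simp: adjoint_add intro!: carrier_matI)
      ultimately show ?thesis using qp[of 0] E unfolding psd_def by simp
    qed
    then show ?thesis using qp by (simp add: Q_def)
  qed
  moreover have "msum c c Q {..<N} = 1\<^sub>m c"
  proof (rule eq_matI)
    fix x y assume "x < dim_row (1\<^sub>m c :: complex mat)" "y < dim_col (1\<^sub>m c :: complex mat)"
    then have xy: "x < c" "y < c" by auto
    have "(\<Sum>j<N. Q j $$ (x,y)) = (\<Sum>j<N. q j $$ (x,y) + (if j = 0 then E $$ (x,y) else 0))"
      using xy by (intro sum.cong refl) (auto simp: Q_def)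
    also have "\<dots> = msum c c q {..<N} $$ (x,y) + E $$ (x,y)" using xy N by (simp add: sum.distrib)
    also have "\<dots> = 1\<^sub>m c $$ (x,y)" unfolding q_sum E_def using xy by simp
    finally show "msum c c Q {..<N} $$ (x,y) = 1\<^sub>m c $$ (x,y)" using xy by simp
  qed auto
  moreover have "Re (mtrace (q j * (T\<^sup>\<dagger> * (Z j * T)))) \<le> Re (mtrace (Q j * (T\<^sup>\<dagger> * (Z j * T))))" if j: "j < N" for j
  proof (cases "j = 0")
    case True
    have "mtrace (Q 0 * (T\<^sup>\<dagger> * (Z j * T))) = mtrace (q 0 * (T\<^sup>\<dagger> * (Z j * T))) + mtrace (E * (T\<^sup>\<dagger> * (Z j * T)))"
      using j by (simp add: Q_def add_mult_distrib_dim Zd mtrace_add)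
    moreover have "mtrace (E * (T\<^sup>\<dagger> * (Z j * T))) = complex_of_real ((fnorm (Z j * T * mfun sqrt E))\<^sup>2)"
      unfolding info_type_gram[OF Z T(1) j] by (rule mtrace_psd_mult_gram[OF E]) simp
    ultimately show ?thesis using True by simp
  qed (simp add: Q_def)
  ultimately show ?thesis unfolding povm_def
    by (intro exI[of _ Q] conjI allI impI order_trans[OF fidG[unfolded Gsum]] sum_mono) auto
qed

text \<open>The separable state consists of the correctly guessed branches \<open>B j\<close>,
  renormalised by their total weight \<open>p\<close>, and the square roots of the measurement
  operators stack to an isometry \<open>W\<close>. The resulting overlap is
  \<open>p / sqrt p\<close>, whose square is \<open>p\<close>.\<close>

lemma guess_le_fidelity:
  assumes Z: "info_type d N Z" and T [simp]: "dim_row T = d" "dim_col T = c" and T1: "fnorm T = 1"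
    and d: "d > 0" and Q: "povm c N Q"
  shows "\<exists>\<sigma>. sep_state N d \<sigma> \<and> (\<Sum>j<N. Re (mtrace (Q j * (T\<^sup>\<dagger> * (Z j * T))))) \<le> fidelity (premeasure d N Z T * (premeasure d N Z T)\<^sup>\<dagger>) \<sigma>"
proof -
  note Zd = info_typeD[OF Z]
  let ?P = "premeasure d N Z T"
  have Qp: "psd c (Q j)" if "j < N" for j using Q that by (simp add: povm_def)
  define q where "q j = mfun sqrt (Q j)" for j
  have q: "psd c (q j)" "q j * q j = Q j" if "j < N" for j using psd_sqrt[OF Qp[OF that]] by (simp_all add: q_def)
  define B where "B j = Z j * T * q j" for j
  have B_dims: "dim_row (B j) = d \<and> dim_col (B j) = c" if "j < N" for j using that psdD[OF q(1)[OF that]] by (simp add: B_def Zd)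
  have tr: "mtrace (Q j * (T\<^sup>\<dagger> * (Z j * T))) = complex_of_real ((fnorm (B j))\<^sup>2)" if j: "j < N" for j
    unfolding info_type_gram[OF Z T(1) j] B_def q_def by (rule mtrace_psd_mult_gram[OF Qp[OF j]]) simp
  define p where "p = (\<Sum>j<N. (fnorm (B j))\<^sup>2)"
  have psum: "(\<Sum>j<N. Re (mtrace (Q j * (T\<^sup>\<dagger> * (Z j * T))))) = p" unfolding p_def by (simp add: tr)
  have p0: "0 \<le> p" unfolding p_def by (simp add: sum_nonneg)
  show ?thesis
  proof (cases "p = 0")
    \<comment> \<open>The fidelity is a square, hence nonnegative, so any separable state will do
      when \<open>p = 0\<close>.\<close>
    case True
    have dims: "dim_row (Z j * T) = d \<and> dim_col (Z j * T) = c" if "j < N" for j using that by (simp add: Zd)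
    have "(fnorm (block_diag N d c (\<lambda>j. Z j * T)))\<^sup>2 = 1"
      using fnorm_block_diag[of N "\<lambda>j. Z j * T", OF dims] info_type_fnorm[OF Z T(1)] T1 by simp
    then have "fnorm (block_diag N d c (\<lambda>j. Z j * T)) = 1"
      using fnorm_nonneg[of "block_diag N d c (\<lambda>j. Z j * T)"] by (simp add: power2_eq_1_iff)
    from sep_state_block_diag[OF dims d this] show ?thesis
      unfolding psum True by (intro exI conjI) (auto simp: fidelity_def)
  next
    case False
    then have p: "p > 0" using p0 by simp
    define C where "C j = complex_of_real (1 / sqrt p) \<cdot>\<^sub>m B j" for j
    have C_dims: "dim_row (C j) = d \<and> dim_col (C j) = c" if "j < N" for j using B_dims[OF that] by (simp add: C_def)
    let ?Y = "block_diag N d c C"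
    have "(fnorm ?Y)\<^sup>2 = (\<Sum>j<N. (fnorm (C j))\<^sup>2)" by (rule fnorm_block_diag[OF C_dims])
    also have "\<dots> = (\<Sum>j<N. (fnorm (B j))\<^sup>2 / p)"
      by (intro sum.cong refl) (simp add: C_def fnorm_smult norm_divide power_divide power_mult_distrib p0)
    also have "\<dots> = 1" using p by (simp add: sum_divide_distrib[symmetric] p_def[symmetric])
    finally have Y1: "fnorm ?Y = 1" using fnorm_nonneg[of ?Y] by (simp add: power2_eq_1_iff)
    have sep: "sep_state N d (?Y * ?Y\<^sup>\<dagger>)" by (rule sep_state_block_diag[OF C_dims d Y1])
    define W where "W = mat (N * c) c (\<lambda>(i,k). q (i div c) $$ (i mod c, k))"
    have [simp]: "dim_row W = N * c" "dim_col W = c" by (simp_all add: W_def)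
    have WW: "W\<^sup>\<dagger> * W = 1\<^sub>m c"
    proof (rule eq_matI)
      fix x y assume "x < dim_row (1\<^sub>m c :: complex mat)" "y < dim_col (1\<^sub>m c :: complex mat)"
      then have xy: "x < c" "y < c" by auto
      have "(W\<^sup>\<dagger> * W) $$ (x,y) = (\<Sum>j<N. \<Sum>l<c. cnj (q j $$ (l,x)) * q j $$ (l,y))"
        using xy by (subst mult_index) (auto simp: W_def sum_lessThan_mult)
      also have "\<dots> = (\<Sum>j<N. ((q j)\<^sup>\<dagger> * q j) $$ (x,y))"
        using xy psdD(1,2)[OF q(1)] by (intro sum.cong refl) (simp add: mult_index)
      also have "\<dots> = (\<Sum>j<N. Q j $$ (x,y))" using q psdD(3)[OF q(1)] by simp
      also have "\<dots> = 1\<^sub>m c $$ (x,y)"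
        using arg_cong[of _ _ "\<lambda>M. M $$ (x,y)", OF conjunct2[OF Q[unfolded povm_def]]] xy by simp
      finally show "(W\<^sup>\<dagger> * W) $$ (x,y) = 1\<^sub>m c $$ (x,y)" .
    qed auto
    have W: "contr W" by (rule contr_partial_isometry) (simp add: WW)
    have "mtrace (W * (?P\<^sup>\<dagger> * ?Y)) = (\<Sum>j<N. complex_of_real ((fnorm (B j))\<^sup>2) / complex_of_real (sqrt p))"
    proof -
      have PY: "(?P\<^sup>\<dagger> * ?Y) $$ (k, j * c + l) = ((Z j * T)\<^sup>\<dagger> * C j) $$ (k,l)" if k: "k < c" "j < N" "l < c" for k j l
      proof -
        have "(?P\<^sup>\<dagger> * ?Y) $$ (k, j * c + l) = (\<Sum>j'<N. \<Sum>y<d. cnj ((Z j' * T) $$ (y,k)) * (if j' = j then C j' $$ (y,l) else 0))"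
          using k by (subst mult_index) (auto simp: sum_lessThan_mult cong: if_cong)
        also have "\<dots> = (\<Sum>j'<N. \<Sum>y<d. if j = j' then cnj ((Z j * T) $$ (y,k)) * C j $$ (y,l) else 0)"
          by (intro sum.cong refl) auto
        also have "\<dots> = (\<Sum>y<d. cnj ((Z j * T) $$ (y,k)) * C j $$ (y,l))" by (rule sum_block_delta[OF k(2)])
        also have "\<dots> = ((Z j * T)\<^sup>\<dagger> * C j) $$ (k,l)" using k C_dims[OF k(2)] by (subst mult_index) (auto simp: Zd)
        finally show ?thesis .
      qed
      have "mtrace (W * (?P\<^sup>\<dagger> * ?Y)) = (\<Sum>j<N. \<Sum>l<c. \<Sum>k<c. q j $$ (l,k) * ((Z j * T)\<^sup>\<dagger> * C j) $$ (k,l))"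
        by (subst mtrace_mult) (auto simp: sum_lessThan_mult W_def PY)
      also have "\<dots> = (\<Sum>j<N. mtrace (q j * ((Z j * T)\<^sup>\<dagger> * C j)))"
        using psdD(1,2)[OF q(1)] C_dims by (intro sum.cong refl) (simp add: mtrace_mult Zd)
      also have "\<dots> = (\<Sum>j<N. complex_of_real ((fnorm (B j))\<^sup>2) / complex_of_real (sqrt p))"
      proof (intro sum.cong refl)
        fix j assume "j \<in> {..<N}"
        then have j: "j < N" by simp
        note [simp] = psdD(1-3)[OF q(1)[OF j]]
        have "q j * ((Z j * T)\<^sup>\<dagger> * C j) = complex_of_real (1 / sqrt p) \<cdot>\<^sub>m ((B j)\<^sup>\<dagger> * B j)"
          unfolding C_def B_def using j by (simp add: adjoint_mult mult_assoc_dim smult_mult_dim Zd(1,2))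
        then show "mtrace (q j * ((Z j * T)\<^sup>\<dagger> * C j)) = complex_of_real ((fnorm (B j))\<^sup>2) / complex_of_real (sqrt p)"
          by (simp add: mtrace_smult fnorm_sq_mtrace)
      qed
      finally show ?thesis .
    qed
    also have "\<dots> = complex_of_real (p / sqrt p)" by (simp add: sum_divide_distrib[symmetric] p_def)
    finally have "(cmod (mtrace (W * (?P\<^sup>\<dagger> * ?Y))))\<^sup>2 = p"
      using p by (simp add: norm_divide power_divide power2_eq_square)
    then have "p \<le> fidelity (?P * ?P\<^sup>\<dagger>) (?Y * ?Y\<^sup>\<dagger>)"
      using fidelity_lower[of ?P "N * d" ?Y W] W by simp
    then show ?thesis unfolding psum using sep by blast
  qed
qed

section \<open>Entanglement of the premeasured state\<close>

lemma mult_mat_vec_col_mat: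
  assumes "dim_vec v = dim_col A" "i < dim_row A"
  shows "(A *\<^sub>v v) $ i = (A * col_mat v) $$ (i,0)"
  using assms by (subst mult_index) (auto simp: scalar_prod_def atLeast0LessThan)

text \<open>The branches have mutually orthogonal ranges and add up to \<open>T\<close>, so stacking
  them acts isometrically. The entropy of the premeasured state is therefore that of
  \<open>C\<close>.\<close>

lemma premeasure_gram:
  assumes Z: "info_type d N Z" and T [simp]: "dim_row T = d"
  shows "(premeasure d N Z T)\<^sup>\<dagger> * premeasure d N Z T = T\<^sup>\<dagger> * T"
proof (rule eq_matI)
  note Zd = info_typeD[OF Z]
  fix k l assume "k < dim_row (T\<^sup>\<dagger> * T)" "l < dim_col (T\<^sup>\<dagger> * T)"
  then have kl: "k < dim_col T" "l < dim_col T" by auto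
  have "((premeasure d N Z T)\<^sup>\<dagger> * premeasure d N Z T) $$ (k,l) = (\<Sum>j<N. \<Sum>y<d. cnj ((Z j * T) $$ (y,k)) * (Z j * T) $$ (y,l))"
    using kl by (subst mult_index) (auto simp: sum_lessThan_mult)
  also have "\<dots> = (\<Sum>j<N. ((Z j * T)\<^sup>\<dagger> * (Z j * T)) $$ (k,l))"
    using kl by (intro sum.cong refl) (subst mult_index, auto simp: Zd)
  also have "\<dots> = (\<Sum>j<N. (T\<^sup>\<dagger> * (Z j * T)) $$ (k,l))"
    by (intro sum.cong refl) (simp add: info_type_gram[OF Z T])
  also have "\<dots> = (T\<^sup>\<dagger> * (msum d d Z {..<N} * T)) $$ (k,l)"
  proof -
    have "T\<^sup>\<dagger> * (msum d d Z {..<N} * T) = msum (dim_col T) (dim_col T) (\<lambda>j. T\<^sup>\<dagger> * (Z j * T)) {..<N}"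
      by (subst msum_mult, (simp_all add: Zd)[3], subst mult_msum) (simp_all add: Zd)
    then show ?thesis using kl by simp
  qed
  finally show "((premeasure d N Z T)\<^sup>\<dagger> * premeasure d N Z T) $$ (k,l) = (T\<^sup>\<dagger> * T) $$ (k,l)" by (simp add: Zd)
qed auto

text \<open>\<open>Y * Y\<^sup>\<dagger>\<close> is the block-diagonal part of
  \<open>P * P\<^sup>\<dagger>\<close>, and its logarithm is block diagonal too; both states thus
  give the same trace against the logarithm, and the relative entropy becomes a difference of
  entropies. Swapping Gram matrices identifies the two.\<close>

lemma rel_entropy_dephased:
  assumes Z: "info_type d N Z" and T [simp]: "dim_row T = d" "dim_col T = c"
  defines "P \<equiv> premeasure d N Z T" and "Y \<equiv> block_diag N d c (\<lambda>j. Z j * T)" and "R \<equiv> blocks d N Z T"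
  shows "rel_entropy (P * P\<^sup>\<dagger>) (Y * Y\<^sup>\<dagger>) = ereal (vN_entropy (R * R\<^sup>\<dagger>) - vN_entropy (T\<^sup>\<dagger> * T))"
proof -
  note Zd = info_typeD[OF Z]
  define n where "n = N * d"
  have [simp]: "dim_row P = n" "dim_col P = c" "dim_row Y = n" "dim_col Y = N * c" "dim_row R = d" "dim_col R = N * c"
    by (simp_all add: P_def Y_def R_def n_def)
  have dims: "dim_row (Z j * T) = d \<and> dim_col (Z j * T) = c" if "j < N" for j using that by (simp add: Zd)
  have same: "(P * P\<^sup>\<dagger>) $$ (i,i') = (Y * Y\<^sup>\<dagger>) $$ (i,i')" if "i < n" "i' < n" "i div d = i' div d" for i i'
  proof -
    have i: "i < N * d" "i' < N * d" using that by (simp_all add: n_def)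
    have "(P * P\<^sup>\<dagger>) $$ (i,i') = (\<Sum>k<c. (Z (i div d) * T) $$ (i mod d, k) * cnj ((Z (i div d) * T) $$ (i' mod d, k)))"
      unfolding P_def using i that(3) by (subst mult_index) auto
    also have "\<dots> = ((Z (i div d) * T) * (Z (i div d) * T)\<^sup>\<dagger>) $$ (i mod d, i' mod d)"
      using i by (subst mult_index) (auto simp: Zd)
    also have "\<dots> = (Y * Y\<^sup>\<dagger>) $$ (i,i')"
      unfolding Y_def using block_diag_gram_index[of N "\<lambda>j. Z j * T" d c i i'] dims i that(3) by simp
    finally show ?thesis .
  qed
  have off: "(Y * Y\<^sup>\<dagger>) $$ (i,i') = 0" if "i < n" "i' < n" "i div d \<noteq> i' div d" for i i'
    unfolding Y_def using that by (subst block_diag_gram_index[OF dims]) (auto simp: n_def)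
  have YY: "psd n (Y * Y\<^sup>\<dagger>)" by (rule psd_gram') simp
  obtain V s where V: "spec_decomp (Y * Y\<^sup>\<dagger>) V s" "unitary n V" "Y * Y\<^sup>\<dagger> = V * mat_diag n (\<lambda>i. complex_of_real (s i)) * V\<^sup>\<dagger>"
    and s0: "\<And>i. i < n \<Longrightarrow> 0 \<le> s i" using psd_spectral[OF YY] by metis
  note [simp] = unitaryD(1,2)[OF V(2)]
  define f where "f x = (if 0 < x then log 2 x else 0)" for x :: real
  define F where "F = V * mat_diag n (\<lambda>i. complex_of_real (f (s i))) * V\<^sup>\<dagger>"
  have [simp]: "dim_row F = n" "dim_col F = n" by (simp_all add: F_def)
  \<comment> \<open>\<open>G\<close> carries the block number on its diagonal, so commuting with
    \<open>G\<close> means being block diagonal; the commutation lemma then transfers the block form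
    from the state to its logarithm.\<close>
  define G where "G = mat_diag n (\<lambda>i. of_nat (i div d) :: complex)"
  have [simp]: "dim_row G = n" "dim_col G = n" by (simp_all add: G_def)
  have YG: "Y * Y\<^sup>\<dagger> * G = G * (Y * Y\<^sup>\<dagger>)"
  proof (rule eq_matI)
    fix i i' assume "i < dim_row (G * (Y * Y\<^sup>\<dagger>))" "i' < dim_col (G * (Y * Y\<^sup>\<dagger>))"
    then have i: "i < n" "i' < n" by auto
    then show "(Y * Y\<^sup>\<dagger> * G) $$ (i,i') = (G * (Y * Y\<^sup>\<dagger>)) $$ (i,i')"
      using off[OF i] unfolding G_def by (subst mult_mat_diag_index, (simp_all)[3], subst mat_diag_mult_index) auto
  qed auto
  have FG: "F * G = G * F"
    unfolding F_def by (rule functional_calculus_commute[OF V(2) V(2), where d = s and e = s])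
      (use YG in \<open>simp_all only: V(3) \<open>dim_row G = n\<close> \<open>dim_col G = n\<close>\<close>)
  have Foff: "F $$ (i,i') = 0" if i: "i < n" "i' < n" "i div d \<noteq> i' div d" for i i'
  proof -
    have "(F * G) $$ (i,i') = F $$ (i,i') * of_nat (i' div d)"
      unfolding G_def using i by (intro mult_mat_diag_index) auto
    moreover have "(G * F) $$ (i,i') = of_nat (i div d) * F $$ (i,i')"
      unfolding G_def using i by (intro mat_diag_mult_index) auto
    ultimately have "F $$ (i,i') * of_nat (i' div d) = F $$ (i,i') * of_nat (i div d)"
      using FG by (simp only: mult.commute)
    then show ?thesis using i(3) by (auto simp only: mult_cancel_left of_nat_eq_iff)
  qed
  have "mtrace (P * P\<^sup>\<dagger> * F) = (\<Sum>i<n. \<Sum>k<n. (P * P\<^sup>\<dagger>) $$ (i,k) * F $$ (k,i))"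
    by (subst mtrace_mult) auto
  also have "\<dots> = (\<Sum>i<n. \<Sum>k<n. (Y * Y\<^sup>\<dagger>) $$ (i,k) * F $$ (k,i))"
  proof (intro sum.cong refl)
    fix i k assume "i \<in> {..<n}" "k \<in> {..<n}"
    then have ik: "i < n" "k < n" by auto
    show "(P * P\<^sup>\<dagger>) $$ (i,k) * F $$ (k,i) = (Y * Y\<^sup>\<dagger>) $$ (i,k) * F $$ (k,i)"
      using same[OF ik] Foff[OF ik(2,1)] by (cases "i div d = k div d") auto
  qed
  also have "\<dots> = mtrace (Y * Y\<^sup>\<dagger> * F)" by (subst mtrace_mult) auto
  also have "\<dots> = (\<Sum>i<n. complex_of_real (s i) * complex_of_real (f (s i)))"
    unfolding V(3) F_def diag_conj_mult[OF V(2)] by (simp add: mtrace_unitary_conj[OF V(2)] mtrace_mat_diag)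
  also have "\<dots> = complex_of_real (- (\<Sum>i<n. eta (s i)))"
  proof -
    have "s i * f (s i) = - eta (s i)" for i by (simp add: f_def eta_def)
    then show ?thesis by (simp flip: of_real_mult add: sum_negf)
  qed
  also have "(\<Sum>i<n. eta (s i)) = vN_entropy (Y * Y\<^sup>\<dagger>)" using vN_entropy_spec_decomp[OF V(1)] by simp
  finally have tr: "Re (mtrace (P * P\<^sup>\<dagger> * mfun f (Y * Y\<^sup>\<dagger>))) = - vN_entropy (Y * Y\<^sup>\<dagger>)"
    unfolding mfun_spec_decomp[OF V(1)] F_def by simp
  have "vN_entropy (P * P\<^sup>\<dagger>) = vN_entropy (T\<^sup>\<dagger> * T)"
    unfolding vN_entropy_gram_swap P_def premeasure_gram[OF Z T(1)] ..
  \<comment> \<open>\<open>Y\<close> and \<open>R\<close> arrange the same blocks. The cross terms,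
    absent in \<open>Y\<close> by construction, vanish in \<open>R\<close> because the projectors
    are mutually orthogonal.\<close>
  moreover have "vN_entropy (Y * Y\<^sup>\<dagger>) = vN_entropy (R * R\<^sup>\<dagger>)"
  proof -
    have "Y\<^sup>\<dagger> * Y = R\<^sup>\<dagger> * R"
    proof (rule eq_matI)
      fix u v assume "u < dim_row (R\<^sup>\<dagger> * R)" "v < dim_col (R\<^sup>\<dagger> * R)"
      then have uv: "u < N * c" "v < N * c" by auto
      let ?j = "u div c" and ?j' = "v div c"
      have j: "?j < N" "?j' < N" "u mod c < c" "v mod c < c" using uv by auto
      have "(R\<^sup>\<dagger> * R) $$ (u,v) = (\<Sum>y<d. cnj ((Z ?j * T) $$ (y, u mod c)) * (Z ?j' * T) $$ (y, v mod c))"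
        unfolding R_def using uv by (subst mult_index) auto
      also have "\<dots> = ((Z ?j * T)\<^sup>\<dagger> * (Z ?j' * T)) $$ (u mod c, v mod c)"
        using j by (subst mult_index) (auto simp: Zd)
      also have "\<dots> = (if ?j = ?j' then ((Z ?j * T)\<^sup>\<dagger> * (Z ?j' * T)) $$ (u mod c, v mod c) else 0)"
      proof (cases "?j = ?j'")
        case False
        have "(Z ?j * T)\<^sup>\<dagger> * (Z ?j' * T) = T\<^sup>\<dagger> * ((Z ?j * Z ?j') * T)"
          using j by (simp add: adjoint_mult mult_assoc_dim Zd(1-3))
        also have "Z ?j * Z ?j' = 0\<^sub>m d d" by (rule Zd(5)[OF j(1,2) False])
        also have "(0\<^sub>m d d * T) = 0\<^sub>m d c" by (intro left_mult_zero_mat carrier_matI) auto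
        also have "T\<^sup>\<dagger> * 0\<^sub>m d c = 0\<^sub>m c c" by (intro right_mult_zero_mat carrier_matI) auto
        finally show ?thesis using False j by simp
      qed simp
      finally have RR: "(R\<^sup>\<dagger> * R) $$ (u,v) = (if ?j = ?j' then ((Z ?j * T)\<^sup>\<dagger> * (Z ?j' * T)) $$ (u mod c, v mod c) else 0)" .
      have "(Y\<^sup>\<dagger> * Y) $$ (u,v) = (\<Sum>k<N. \<Sum>y<d. cnj (if k = ?j then (Z k * T) $$ (y, u mod c) else 0) * (if k = ?j' then (Z k * T) $$ (y, v mod c) else 0))"
        unfolding Y_def using uv by (subst mult_index) (auto simp: sum_lessThan_mult cong: if_cong)
      also have "\<dots> = (\<Sum>k<N. \<Sum>y<d. if ?j = k then (if ?j = ?j' then cnj ((Z ?j * T) $$ (y, u mod c)) * (Z ?j' * T) $$ (y, v mod c) else 0) else 0)"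
        by (intro sum.cong refl) auto
      also have "\<dots> = (\<Sum>y<d. if ?j = ?j' then cnj ((Z ?j * T) $$ (y, u mod c)) * (Z ?j' * T) $$ (y, v mod c) else 0)"
        by (rule sum_block_delta[OF j(1)])
      also have "\<dots> = (if ?j = ?j' then ((Z ?j * T)\<^sup>\<dagger> * (Z ?j' * T)) $$ (u mod c, v mod c) else 0)"
        using j mult_index[of "u mod c" "(Z ?j * T)\<^sup>\<dagger>" "v mod c" "Z ?j' * T"] by (auto simp: Zd)
      finally show "(Y\<^sup>\<dagger> * Y) $$ (u,v) = (R\<^sup>\<dagger> * R) $$ (u,v)" unfolding RR .
    qed auto
    then show ?thesis by (simp add: vN_entropy_gram_swap)
  qed
  \<comment> \<open>Support inclusion block by block: a vector killed by the dephased state is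
    orthogonal to the columns of every single branch, hence to the stacked columns of
    \<open>P\<close>.\<close>
  moreover have "\<forall>v\<in>carrier_vec (dim_row (Y * Y\<^sup>\<dagger>)). (Y * Y\<^sup>\<dagger>) *\<^sub>v v = 0\<^sub>v (dim_row (Y * Y\<^sup>\<dagger>)) \<longrightarrow> (P * P\<^sup>\<dagger>) *\<^sub>v v = 0\<^sub>v (dim_row (P * P\<^sup>\<dagger>))"
  proof (intro ballI impI)
    fix v :: "complex vec" assume "v \<in> carrier_vec (dim_row (Y * Y\<^sup>\<dagger>))" and v0: "(Y * Y\<^sup>\<dagger>) *\<^sub>v v = 0\<^sub>v (dim_row (Y * Y\<^sup>\<dagger>))"
    then have [simp]: "dim_vec v = n" by auto
    let ?v = "col_mat v"
    have "cinner v ((Y * Y\<^sup>\<dagger>) *\<^sub>v v) = 0" unfolding v0 by (simp add: cinner_def)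
    moreover have "cinner v ((Y * Y\<^sup>\<dagger>) *\<^sub>v v) = mtrace ((Y\<^sup>\<dagger> * ?v)\<^sup>\<dagger> * (Y\<^sup>\<dagger> * ?v))"
      by (subst cinner_eq_mtrace) (simp_all add: adjoint_mult mult_assoc_dim)
    ultimately have "fnorm (Y\<^sup>\<dagger> * ?v) = 0" by (simp add: fnorm_sq_mtrace)
    then have Yv: "Y\<^sup>\<dagger> * ?v = 0\<^sub>m (N * c) 1" using fnorm_eq_0[of "Y\<^sup>\<dagger> * ?v"] by simp
    have zero: "(\<Sum>y<d. cnj ((Z j * T) $$ (y,k)) * v $ (j * d + y)) = 0" if j: "j < N" "k < c" for j k
    proof -
      have "(Y\<^sup>\<dagger> * ?v) $$ (j * c + k, 0) = (\<Sum>i<N. \<Sum>y<d. cnj (if i = j then (Z i * T) $$ (y,k) else 0) * v $ (i * d + y))"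
        unfolding Y_def using j by (subst mult_index) (auto simp: sum_lessThan_mult n_def cong: if_cong)
      also have "\<dots> = (\<Sum>i<N. \<Sum>y<d. if j = i then cnj ((Z j * T) $$ (y,k)) * v $ (j * d + y) else 0)"
        by (intro sum.cong refl) auto
      also have "\<dots> = (\<Sum>y<d. cnj ((Z j * T) $$ (y,k)) * v $ (j * d + y))" by (rule sum_block_delta[OF j(1)])
      finally show ?thesis unfolding Yv using j by simp
    qed
    have "P\<^sup>\<dagger> * ?v = 0\<^sub>m c 1"
    proof (rule eq_matI)
      fix k l assume "k < dim_row (0\<^sub>m c 1 :: complex mat)" "l < dim_col (0\<^sub>m c 1 :: complex mat)"
      then have k: "k < c" "l = 0" by auto
      have "(P\<^sup>\<dagger> * ?v) $$ (k,0) = (\<Sum>j<N. \<Sum>y<d. cnj ((Z j * T) $$ (y,k)) * v $ (j * d + y))"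
        unfolding P_def using k by (subst mult_index) (auto simp: sum_lessThan_mult n_def)
      then show "(P\<^sup>\<dagger> * ?v) $$ (k,l) = 0\<^sub>m c 1 $$ (k,l)" using k zero by simp
    qed auto
    then have "P * P\<^sup>\<dagger> * ?v = P * 0\<^sub>m c 1" by (simp add: mult_assoc_dim)
    also have "\<dots> = 0\<^sub>m n 1" by (intro right_mult_zero_mat carrier_matI) auto
    finally have Pv: "P * P\<^sup>\<dagger> * ?v = 0\<^sub>m n 1" .
    show "(P * P\<^sup>\<dagger>) *\<^sub>v v = 0\<^sub>v (dim_row (P * P\<^sup>\<dagger>))"
    proof (rule eq_vecI)
      fix i assume "i < dim_vec (0\<^sub>v (dim_row (P * P\<^sup>\<dagger>)) :: complex vec)"
      then have i: "i < n" by simp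
      have "((P * P\<^sup>\<dagger>) *\<^sub>v v) $ i = (P * P\<^sup>\<dagger> * ?v) $$ (i,0)" using i by (intro mult_mat_vec_col_mat) auto
      then show "((P * P\<^sup>\<dagger>) *\<^sub>v v) $ i = 0\<^sub>v (dim_row (P * P\<^sup>\<dagger>)) $ i" unfolding Pv using i by simp
    qed simp
  qed
  ultimately show ?thesis unfolding rel_entropy_def using tr unfolding f_def by simp
qed

theorem entanglement_of_premeasurement:
  assumes Z: "info_type d N Z" and T [simp]: "dim_row T = d" "dim_col T = c" and T1: "fnorm T = 1" and d: "d > 0"
  defines "\<rho> \<equiv> premeasure d N Z T * (premeasure d N Z T)\<^sup>\<dagger>"
    and "H \<equiv> vN_entropy (blocks d N Z T * (blocks d N Z T)\<^sup>\<dagger>) - vN_entropy (T\<^sup>\<dagger> * T)"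
  shows "E_D N d \<rho> = H" "E_R N d \<rho> = ereal H"
proof -
  let ?Y = "block_diag N d c (\<lambda>j. Z j * T)"
  have dims: "dim_row (Z j * T) = d \<and> dim_col (Z j * T) = c" if "j < N" for j using that by (simp add: info_typeD[OF Z])
  have "(fnorm ?Y)\<^sup>2 = 1"
    using fnorm_block_diag[of N "\<lambda>j. Z j * T", OF dims] info_type_fnorm[OF Z T(1)] T1 by simp
  then have "fnorm ?Y = 1" using fnorm_nonneg[of ?Y] by (simp add: power2_eq_1_iff)
  then have sep: "sep_state N d (?Y * ?Y\<^sup>\<dagger>)" by (intro sep_state_block_diag[OF dims d])
  have rel: "rel_entropy \<rho> (?Y * ?Y\<^sup>\<dagger>) = ereal H"
    unfolding \<rho>_def H_def by (rule rel_entropy_dephased[OF Z T])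
  have dens: "density (N * d) \<rho>"
    unfolding density_def \<rho>_def fnorm_sq_mtrace' fnorm_premeasure[OF Z T(1)] T1 by (auto intro: psd_gram')
  note converse = distill_rate_le_rel_entropy[OF dens]
  have upper: "r \<le> H" if "distill_rate N d \<rho> r" for r
    using converse[OF sep that] unfolding rel by simp
  have rate0: "distill_rate N d \<rho> 0" unfolding \<rho>_def by (rule distill_rate_0[OF Z T(1) T1])
  have lower: "distill_rate N d \<rho> r" if "0 \<le> r" "r < H" for r
    using that unfolding \<rho>_def H_def by (intro hashing_rate[OF Z T(1) T1])
  show ED: "E_D N d \<rho> = H" unfolding E_D_def
  proof (rule antisym)
    show "Sup {r. distill_rate N d \<rho> r} \<le> H" using rate0 upper by (intro cSup_least) auto
    have bdd: "bdd_above {r. distill_rate N d \<rho> r}" using upper by (intro bdd_aboveI) auto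
    show "H \<le> Sup {r. distill_rate N d \<rho> r}"
    proof (rule dense_le)
      fix x assume "x < H"
      then have "\<exists>r\<ge>x. distill_rate N d \<rho> r" 
      \<comment> \<open>Hashing covers nonnegative rates only; below 0 the trivial rate 0 serves,
        which settles the case \<open>H = 0\<close> as well.\<close>
      proof (cases "0 \<le> x")
        case True
        then show ?thesis using lower[of x] \<open>x < H\<close> by auto
      next
        case False
        then show ?thesis using rate0 by (intro exI[of _ 0]) auto
      qed
      then show "x \<le> Sup {r. distill_rate N d \<rho> r}" using bdd by (meson cSup_upper2 mem_Collect_eq)
    qed
  qed
  show "E_R N d \<rho> = ereal H" unfolding E_R_def
  proof (rule antisym)
    show "Inf {rel_entropy \<rho> \<sigma> |\<sigma>. sep_state N d \<sigma>} \<le> ereal H"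
      using sep rel by (intro Inf_lower) force
    show "ereal H \<le> Inf {rel_entropy \<rho> \<sigma> |\<sigma>. sep_state N d \<sigma>}"
    proof (rule Inf_greatest)
      fix e assume "e \<in> {rel_entropy \<rho> \<sigma> |\<sigma>. sep_state N d \<sigma>}"
      then obtain \<sigma> where \<sigma>: "sep_state N d \<sigma>" "e = rel_entropy \<rho> \<sigma>" by blast
      have le: "ereal r \<le> e" if "distill_rate N d \<rho> r" for r using converse[OF \<sigma>(1) that] \<sigma>(2) by simp
      show "ereal H \<le> e"
      \<comment> \<open>A finite value bounds every achievable rate and hence their supremum
        \<open>H\<close>; minus infinity is excluded by rate 0.\<close>
      proof (cases e)
        case (real v)
        have "H \<le> v" unfolding ED[symmetric] E_D_def using rate0 le real by (intro cSup_least) auto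
        then show ?thesis using real by simp
      next
        case PInf then show ?thesis by simp
      next
        case MInf then show ?thesis using le[OF rate0] by simp
      qed
    qed
  qed
qed

text \<open>Separable states and measurements are matched in both directions. Since
  \<open>Sup\<close> and \<open>Inf\<close> of reals are meaningful only for nonempty bounded sets,
  the bound 1 on guessing and the existence of a separable state are settled first.\<close>

theorem geometric_entanglement_of_premeasurement:
  assumes Z: "info_type d N Z" and T [simp]: "dim_row T = d" "dim_col T = c" and T1: "fnorm T = 1"
    and d: "d > 0" and N: "N > 0"
  shows "E_G N d (premeasure d N Z T * (premeasure d N Z T)\<^sup>\<dagger>)
    = 1 - Sup {(\<Sum>j<N. Re (mtrace (Q j * (T\<^sup>\<dagger> * (Z j * T))))) | Q. povm c N Q}"
proof -
  let ?\<rho> = "premeasure d N Z T * (premeasure d N Z T)\<^sup>\<dagger>"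
  let ?G = "{(\<Sum>j<N. Re (mtrace (Q j * (T\<^sup>\<dagger> * (Z j * T))))) | Q. povm c N Q}"
  let ?F = "{1 - fidelity ?\<rho> \<sigma> | \<sigma>. sep_state N d \<sigma>}"
  have g1: "g \<le> 1" if "g \<in> ?G" for g
  proof -
    obtain Q where Q: "povm c N Q" and g: "g = (\<Sum>j<N. Re (mtrace (Q j * (T\<^sup>\<dagger> * (Z j * T)))))" using \<open>g \<in> ?G\<close> by blast
    have "Re (mtrace (Q j * (T\<^sup>\<dagger> * (Z j * T)))) \<le> (fnorm (Z j * T))\<^sup>2" if j: "j < N" for j
    proof -
      have Qp: "psd c (Q i)" if "i < N" for i using Q that by (simp add: povm_def)
      define q where "q i = mfun sqrt (Q i)" for i
      have q: "psd c (q i)" "q i * q i = Q i" if "i < N" for i using psd_sqrt[OF Qp[OF that]] by (simp_all add: q_def)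
      have "msum c c (\<lambda>i. (q i)\<^sup>\<dagger> * q i) {..<N} = msum c c Q {..<N}"
        by (rule msum_cong) (simp add: q psdD(3)[OF q(1)])
      then have qs: "msum c c (\<lambda>i. (q i)\<^sup>\<dagger> * q i) {..<N} = 1\<^sub>m c" using Q by (simp add: povm_def)
      have "contr (q j)" unfolding contr_def
      proof (intro allI impI)
        fix A :: "complex mat" assume "dim_row A = dim_col (q j)"
        then have A: "dim_row A = c" using psdD(2)[OF q(1)[OF j]] by simp
        have "(\<Sum>i<N. (fnorm (q i * A))\<^sup>2) = (fnorm A)\<^sup>2"
          by (rule kraus_sum_fnorm[OF qs]) (use A psdD(2)[OF q(1)] in auto)
        moreover have "(fnorm (q j * A))\<^sup>2 \<le> (\<Sum>i<N. (fnorm (q i * A))\<^sup>2)"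
          using j by (intro member_le_sum) auto
        ultimately show "fnorm (q j * A) \<le> fnorm A" by (intro power2_le_imp_le[of "fnorm (q j * A)"]) auto
      qed
      then have "fnorm (Z j * T * q j) \<le> fnorm (Z j * T)"
        using psdD(1)[OF q(1)[OF j]] by (intro contr_right) auto
      then have "(fnorm (Z j * T * q j))\<^sup>2 \<le> (fnorm (Z j * T))\<^sup>2" by (intro power_mono) auto
      moreover have "mtrace (Q j * (T\<^sup>\<dagger> * (Z j * T))) = complex_of_real ((fnorm (Z j * T * q j))\<^sup>2)"
        unfolding info_type_gram[OF Z T(1) j] q_def by (rule mtrace_psd_mult_gram[OF Qp[OF j]]) simp
      ultimately show ?thesis by simp
    qed
    then have "g \<le> (\<Sum>j<N. (fnorm (Z j * T))\<^sup>2)" unfolding g by (intro sum_mono) auto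
    then show ?thesis using info_type_fnorm[OF Z T(1)] T1 by simp
  qed
  have bdd: "bdd_above ?G" using g1 by (intro bdd_aboveI) blast
  have le: "fidelity ?\<rho> \<sigma> \<le> Sup ?G" if sep: "sep_state N d \<sigma>" for \<sigma>
  proof -
    obtain Q where "povm c N Q" "fidelity ?\<rho> \<sigma> \<le> (\<Sum>j<N. Re (mtrace (Q j * (T\<^sup>\<dagger> * (Z j * T)))))"
      using fidelity_le_guess[OF Z T N sep] by blast
    then show ?thesis by (intro cSup_upper2[OF _ _ bdd]) auto
  qed
  have bddF: "bdd_below ?F" using le by (intro bdd_belowI[of _ "1 - Sup ?G"]) auto
  have sepZ: "\<exists>\<sigma>. sep_state N d \<sigma>"
  proof -
    have "fnorm (block_diag N d c (\<lambda>j. Z j * T)) = 1"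
    proof -
      have "(fnorm (block_diag N d c (\<lambda>j. Z j * T)))\<^sup>2 = (\<Sum>j<N. (fnorm (Z j * T))\<^sup>2)"
        by (rule fnorm_block_diag) (simp add: info_typeD[OF Z])
      then show ?thesis using info_type_fnorm[OF Z T(1)] T1 fnorm_nonneg[of "block_diag N d c (\<lambda>j. Z j * T)"]
        by (simp add: power2_eq_1_iff)
    qed
    then show ?thesis using sep_state_block_diag[of N "\<lambda>j. Z j * T" d c] d by (auto simp: info_typeD[OF Z])
  qed
  have povmZ: "?G \<noteq> {}" using fidelity_le_guess[OF Z T N] sepZ by blast
  show ?thesis unfolding E_G_def
  proof (rule antisym)
    have "Sup ?G \<le> 1 - Inf ?F"
    proof (rule cSup_least[OF povmZ])
      fix g assume "g \<in> ?G"
      then obtain Q where Q: "povm c N Q" "g = (\<Sum>j<N. Re (mtrace (Q j * (T\<^sup>\<dagger> * (Z j * T)))))" by blast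
      obtain \<sigma> where \<sigma>: "sep_state N d \<sigma>" "g \<le> fidelity ?\<rho> \<sigma>"
        using guess_le_fidelity[OF Z T T1 d Q(1)] Q(2) by blast
      have "Inf ?F \<le> 1 - fidelity ?\<rho> \<sigma>" using \<sigma>(1) by (intro cInf_lower[OF _ bddF]) blast
      then show "g \<le> 1 - Inf ?F" using \<sigma>(2) by linarith
    qed
    then show "Inf ?F \<le> 1 - Sup ?G" by simp
    show "1 - Sup ?G \<le> Inf ?F"
      using sepZ le by (intro cInf_greatest) auto
  qed
qed

section \<open>The tripartite pure state\<close>

lemma kron_one_mult_index:
  assumes A: "dim_col A = q" "dim_row X = q * m" and i: "i < dim_row A * m" "k < dim_col X"
  shows "(kron A (1\<^sub>m m) * X) $$ (i,k) = (\<Sum>a<q. A $$ (i div m, a) * X $$ (a * m + i mod m, k))"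
proof -
  have "(kron A (1\<^sub>m m) * X) $$ (i,k) = (\<Sum>a<q. \<Sum>b<m. kron A (1\<^sub>m m) $$ (i, a * m + b) * X $$ (a * m + b, k))"
    using A i by (subst mult_index) (auto simp: sum_lessThan_mult)
  also have "\<dots> = (\<Sum>a<q. \<Sum>b<m. if b = i mod m then A $$ (i div m, a) * X $$ (a * m + b, k) else 0)"
    using A i by (intro sum.cong refl) (auto simp: kron_index)
  also have "\<dots> = (\<Sum>a<q. A $$ (i div m, a) * X $$ (a * m + i mod m, k))"
    using i by (intro sum.cong refl) auto
  finally show ?thesis .
qed

text \<open>This absorbs \<open>B\<close>: the measured system becomes \<open>AB\<close> as a whole,
  the setting of the preceding results.\<close>

lemma info_type_kron:
  assumes Z: "info_type dA N Z"
  shows "info_type (dA * m) N (\<lambda>j. kron (Z j) (1\<^sub>m m))"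
  unfolding info_type_def is_projector_def hermitian_def
proof (intro conjI allI impI)
  note Zd = info_typeD[OF Z]
  fix j assume j: "j < N"
  show "kron (Z j) (1\<^sub>m m) \<in> carrier_mat (dA * m) (dA * m)" using j by (auto simp: Zd intro!: carrier_matI)
  show "(kron (Z j) (1\<^sub>m m))\<^sup>\<dagger> = kron (Z j) (1\<^sub>m m)" using j by (simp add: kron_adjoint Zd)
  show "kron (Z j) (1\<^sub>m m) * kron (Z j) (1\<^sub>m m) = kron (Z j) (1\<^sub>m m)" using j by (simp add: kron_mult Zd)
next
  note Zd = info_typeD[OF Z]
  fix j k assume "j < N" "k < N" "j \<noteq> k"
  then have "kron (Z j) (1\<^sub>m m) * kron (Z k) (1\<^sub>m m) = kron (0\<^sub>m dA dA) (1\<^sub>m m)" by (simp add: kron_mult Zd)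
  then show "kron (Z j) (1\<^sub>m m) * kron (Z k) (1\<^sub>m m) = 0\<^sub>m (dA * m) (dA * m)"
    by (simp, intro eq_matI) (auto simp: kron_index)
next
  note Zd = info_typeD[OF Z]
  show "msum (dA * m) (dA * m) (\<lambda>j. kron (Z j) (1\<^sub>m m)) {..<N} = 1\<^sub>m (dA * m)"
  proof (rule eq_matI)
    fix x y assume "x < dim_row (1\<^sub>m (dA * m) :: complex mat)" "y < dim_col (1\<^sub>m (dA * m) :: complex mat)"
    then have xy: "x < dA * m" "y < dA * m" by auto
    have "msum (dA * m) (dA * m) (\<lambda>j. kron (Z j) (1\<^sub>m m)) {..<N} $$ (x,y)
      = (\<Sum>j<N. Z j $$ (x div m, y div m)) * 1\<^sub>m m $$ (x mod m, y mod m)"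
      using xy by (simp add: kron_index Zd sum_distrib_right)
    also have "(\<Sum>j<N. Z j $$ (x div m, y div m)) = 1\<^sub>m dA $$ (x div m, y div m)"
      unfolding Zd(6)[symmetric] using xy by simp
    also have "1\<^sub>m dA $$ (x div m, y div m) * 1\<^sub>m m $$ (x mod m, y mod m) = kron (1\<^sub>m dA) (1\<^sub>m m) $$ (x,y)"
      using xy by (simp add: kron_index del: index_one_mat(1))
    finally show "msum (dA * m) (dA * m) (\<lambda>j. kron (Z j) (1\<^sub>m m)) {..<N} $$ (x,y) = 1\<^sub>m (dA * m) $$ (x,y)"
      unfolding kron_one .
  qed auto
qed

lemma ket_dims [simp]: "dim_row (ket N j) = N" "dim_col (ket N j) = 1"
  by (simp_all add: ket_def)

lemma ket_index: "i < N \<Longrightarrow> ket N j $$ (i,0) = (if i = j then 1 else 0)"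
  by (simp add: ket_def)

lemma VZ_dims [simp]: "dim_row (VZ N dA m Z) = N * (dA * m)" "dim_col (VZ N dA m Z) = dA * m"
  by (simp_all add: VZ_def)

lemma VZ_mult_index:
  assumes Z: "info_type dA N Z" and X: "dim_row X = dA * m" and i: "i < N * (dA * m)" "k < dim_col X"
  shows "(VZ N dA m Z * X) $$ (i,k) = (kron (Z (i div (dA * m))) (1\<^sub>m m) * X) $$ (i mod (dA * m), k)"
proof -
  note Zd = info_typeD[OF Z]
  let ?j = "i div (dA * m)"
  have j: "?j < N" "i mod (dA * m) < dA * m" using i by auto
  have "VZ N dA m Z $$ (i,y) = kron (Z ?j) (1\<^sub>m m) $$ (i mod (dA * m), y)" if y: "y < dA * m" for y
  proof -
    have "VZ N dA m Z $$ (i,y) = (\<Sum>l<N. kron (ket N l) (kron (Z l) (1\<^sub>m m)) $$ (i,y))"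
      unfolding VZ_def using i y by simp
    also have "\<dots> = (\<Sum>l<N. if l = ?j then kron (Z l) (1\<^sub>m m) $$ (i mod (dA * m), y) else 0)"
    proof (intro sum.cong refl)
      fix l assume "l \<in> {..<N}"
      then have l: "l < N" by simp
      have "kron (ket N l) (kron (Z l) (1\<^sub>m m)) $$ (i,y) = ket N l $$ (?j, 0) * kron (Z l) (1\<^sub>m m) $$ (i mod (dA * m), y)"
        using i y l by (subst kron_index) (auto simp: Zd)
      then show "kron (ket N l) (kron (Z l) (1\<^sub>m m)) $$ (i,y) = (if l = ?j then kron (Z l) (1\<^sub>m m) $$ (i mod (dA * m), y) else 0)"
        using j by (simp add: ket_index)
    qed
    finally show ?thesis using j by simp
  qed
  then show ?thesis using X i j by (subst (1 2) mult_index) (auto simp: Zd)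
qed

text \<open>A conjugated operator is the Gram matrix of the conjugated square root. Conjugation thus
  permutes the measurements on \<open>C\<close>, which cancels the conjugation of the reduced
  states.\<close>

lemma povm_map_cnj:
  assumes "povm n N Q" shows "povm n N (\<lambda>j. map_mat cnj (Q j))"
proof -
  have "psd n (map_mat cnj (Q j))" if j: "j < N" for j
  proof -
    define R where "R = mfun sqrt (Q j)"
    have "psd n (Q j)" using assms j by (simp add: povm_def)
    note R = psd_sqrt[OF this, folded R_def]
    note [simp] = psdD(1,2)[OF R(1)]
    have "map_mat cnj (Q j) = map_mat cnj (R\<^sup>\<dagger>) * map_mat cnj R"
      unfolding R(2)[symmetric] psdD(3)[OF R(1)] by (simp add: map_cnj_mult)
    also have "map_mat cnj (R\<^sup>\<dagger>) = (map_mat cnj R)\<^sup>\<dagger>" by (rule eq_matI) auto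
    finally show ?thesis using psd_gram[of "map_mat cnj R" n] by simp
  qed
  moreover have "msum n n (\<lambda>j. map_mat cnj (Q j)) {..<N} = 1\<^sub>m n"
  proof (rule eq_matI)
    fix x y assume "x < dim_row (1\<^sub>m n :: complex mat)" "y < dim_col (1\<^sub>m n :: complex mat)"
    then have xy: "x < n" "y < n" by auto
    have Qd: "dim_row (Q j) = n" "dim_col (Q j) = n" if "j < N" for j
      using assms that psdD(1,2)[of n "Q j"] by (auto simp: povm_def)
    have "msum n n (\<lambda>j. map_mat cnj (Q j)) {..<N} $$ (x,y) = cnj (msum n n Q {..<N} $$ (x,y))"
      using xy Qd by simp
    also have "msum n n Q {..<N} = 1\<^sub>m n" using assms by (simp add: povm_def)
    finally show "msum n n (\<lambda>j. map_mat cnj (Q j)) {..<N} $$ (x,y) = 1\<^sub>m n $$ (x,y)" using xy by simp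
  qed auto
  ultimately show ?thesis by (simp add: povm_def)
qed

context
  fixes dA dB dC N :: nat and \<psi> :: "complex vec" and Z :: "nat \<Rightarrow> complex mat"
  assumes \<psi>: "\<psi> \<in> carrier_vec (dA * dB * dC)" and Z: "info_type dA N Z"
begin

definition coeff_mat :: "complex mat" where
  "coeff_mat = mat (dA * dB) dC (\<lambda>(y,k). \<psi> $ (y * dC + k))"

abbreviation "ZB \<equiv> \<lambda>j. kron (Z j) (1\<^sub>m dB)"

lemma coeff_mat_simps [simp]: "dim_row coeff_mat = dA * dB" "dim_col coeff_mat = dC"
  "y < dA * dB \<Longrightarrow> k < dC \<Longrightarrow> coeff_mat $$ (y,k) = \<psi> $ (y * dC + k)"
  by (simp_all add: coeff_mat_def)

lemma dim_psi [simp]: "dim_vec \<psi> = dA * dB * dC" using \<psi> by auto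

lemma outer_psi_index:
  "i < dA * dB * dC \<Longrightarrow> j < dA * dB * dC \<Longrightarrow> outer \<psi> \<psi> $$ (i,j) = \<psi> $ i * cnj (\<psi> $ j)"
  by (simp add: outer_def)

lemma fnorm_coeff_mat: "cinner \<psi> \<psi> = complex_of_real ((fnorm coeff_mat)\<^sup>2)"
proof -
  have "cinner \<psi> \<psi> = (\<Sum>y<dA * dB. \<Sum>k<dC. cnj (\<psi> $ (y * dC + k)) * \<psi> $ (y * dC + k))"
    unfolding cinner_def dim_psi by (rule sum_lessThan_mult)
  also have "\<dots> = (\<Sum>y<dA * dB. \<Sum>k<dC. complex_of_real ((cmod (coeff_mat $$ (y,k)))\<^sup>2))"
    by (intro sum.cong refl) (simp only: lessThan_iff coeff_mat_simps complex_norm_square mult.commute)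
  finally show ?thesis by (simp add: fnorm_sq)
qed

lemma rho_AB: "ptr_last (dA * dB) dC (outer \<psi> \<psi>) = coeff_mat * coeff_mat\<^sup>\<dagger>"
  by (rule eq_matI) (auto simp: ptr_last_def mult_index outer_psi_index)

text \<open>Tracing out the row index of the coefficient matrix leaves the transpose of its Gram
  matrix on \<open>C\<close>, which by hermiticity is the conjugate. The same twist occurs in the
  other reductions that keep \<open>C\<close>.\<close>

lemma rho_C: "ptr_first (dA * dB) dC (outer \<psi> \<psi>) = map_mat cnj (coeff_mat\<^sup>\<dagger> * coeff_mat)"
  by (rule eq_matI) (auto simp: ptr_first_def mult_index outer_psi_index)

lemma VZ_coeff_mat: "VZ N dA dB Z * coeff_mat = premeasure (dA * dB) N ZB coeff_mat"
  by (rule eq_matI) (auto simp: VZ_mult_index[OF Z])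

lemma ZB_coeff_mat_index:
  assumes "j < N" "y < dA * dB" "k < dC"
  shows "(ZB j * coeff_mat) $$ (y,k) = (\<Sum>a<dA. Z j $$ (y div dB, a) * \<psi> $ ((a * dB + y mod dB) * dC + k))"
proof -
  have "(ZB j * coeff_mat) $$ (y,k) = (\<Sum>a<dA. Z j $$ (y div dB, a) * coeff_mat $$ (a * dB + y mod dB, k))"
    using assms by (intro kron_one_mult_index) (auto simp: info_typeD[OF Z])
  then show ?thesis using assms by simp
qed

text \<open>Reconciles two groupings of the index, \<open>A\<close> beside \<open>BC\<close> for the
  isometry and \<open>AB\<close> beside \<open>C\<close> for the coefficient matrix; in both,
  \<open>Z j\<close> sees only the part \<open>y div dB\<close> belonging to
  \<open>A\<close>.\<close>

lemma VZ_psi_index: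
  assumes j: "j < N" and y: "y < dA * dB" and k: "k < dC"
  shows "(VZ N dA (dB * dC) Z * col_mat \<psi>) $$ (j * (dA * dB * dC) + y * dC + k, 0) = (ZB j * coeff_mat) $$ (y,k)"
proof -
  have yk: "y * dC + k < dA * (dB * dC)" using pair_index_less[OF y k] by (simp add: mult.assoc)
  let ?i = "j * (dA * dB * dC) + y * dC + k"
  have i: "?i = j * (dA * (dB * dC)) + (y * dC + k)" by (simp add: mult.assoc)
  have "(VZ N dA (dB * dC) Z * col_mat \<psi>) $$ (?i,0)
      = (kron (Z j) (1\<^sub>m (dB * dC)) * col_mat \<psi>) $$ (y * dC + k, 0)"
    unfolding i using j yk by (subst VZ_mult_index[OF Z]) (auto simp: mult.assoc)
  also have "\<dots> = (\<Sum>a<dA. Z j $$ ((y * dC + k) div (dB * dC), a) * col_mat \<psi> $$ (a * (dB * dC) + (y * dC + k) mod (dB * dC), 0))"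
    using j yk by (intro kron_one_mult_index) (auto simp: info_typeD[OF Z] mult.assoc)
  also have "\<dots> = (\<Sum>a<dA. Z j $$ (y div dB, a) * \<psi> $ ((a * dB + y mod dB) * dC + k))"
  proof (intro sum.cong refl)
    fix a assume "a \<in> {..<dA}"
    then have a: "a < dA" by simp
    have 1: "(y * dC + k) div (dB * dC) = y div dB"
      unfolding mult.commute[of dB dC] using k by (subst div_mult2_eq) simp
    have "(y * dC + k) mod (dB * dC) = dC * (y mod dB) + k"
      unfolding mult.commute[of dB dC] using k by (subst mod_mult2_eq) simp
    then have 2: "a * (dB * dC) + (y * dC + k) mod (dB * dC) = (a * dB + y mod dB) * dC + k"
      by (simp only: distrib_right mult.assoc mult.commute[of dC] add.assoc)
    have "(a * dB + y mod dB) * dC + k < dA * dB * dC" using a y k by auto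
    then show "Z j $$ ((y * dC + k) div (dB * dC), a) * col_mat \<psi> $$ (a * (dB * dC) + (y * dC + k) mod (dB * dC), 0)
      = Z j $$ (y div dB, a) * \<psi> $ ((a * dB + y mod dB) * dC + k)"
      unfolding 1 2 by simp
  qed
  finally show ?thesis using ZB_coeff_mat_index[OF assms] by simp
qed

lemma rho_MC:
  defines "V \<equiv> VZ N dA (dB * dC) Z"
  shows "ptr_mid N (dA * dB) dC (V * outer \<psi> \<psi> * V\<^sup>\<dagger>)
    = map_mat cnj ((blocks (dA * dB) N ZB coeff_mat)\<^sup>\<dagger> * blocks (dA * dB) N ZB coeff_mat)" (is "?L = ?R")
proof (rule eq_matI)
  fix u v assume "u < dim_row ?R" "v < dim_col ?R"
  then have uv: "u < N * dC" "v < N * dC" by auto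
  let ?w = "V * col_mat \<psi>"
  have [simp]: "dim_row V = N * (dA * (dB * dC))" "dim_col V = dA * (dB * dC)" by (simp_all add: V_def)
  have out: "outer \<psi> \<psi> = col_mat \<psi> * (col_mat \<psi>)\<^sup>\<dagger>"
    by (rule eq_matI) (auto simp: outer_def mult_index)
  have "V * outer \<psi> \<psi> * V\<^sup>\<dagger> = ?w * ?w\<^sup>\<dagger>"
    unfolding out by (simp add: adjoint_mult mult_assoc_dim mult.assoc)
  then have ww: "(V * outer \<psi> \<psi> * V\<^sup>\<dagger>) $$ (x,y) = ?w $$ (x,0) * cnj (?w $$ (y,0))"
    if "x < N * (dA * dB * dC)" "y < N * (dA * dB * dC)" for x y
    using that by (simp add: mult_index[of x ?w] mult.assoc)
  have ind: "j * (dA * dB * dC) + y * dC + k < N * (dA * dB * dC)" if "j < N" "y < dA * dB" "k < dC" for j y k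
    using pair_index_less[OF that(1) pair_index_less[OF that(2,3)]] by (simp add: add.assoc)
  have "?L $$ (u,v) = (\<Sum>y<dA * dB. (V * outer \<psi> \<psi> * V\<^sup>\<dagger>) $$
      ((u div dC) * (dA * dB * dC) + y * dC + u mod dC, (v div dC) * (dA * dB * dC) + y * dC + v mod dC))"
    using uv by (simp add: ptr_mid_def)
  also have "\<dots> = (\<Sum>y<dA * dB. (ZB (u div dC) * coeff_mat) $$ (y, u mod dC) * cnj ((ZB (v div dC) * coeff_mat) $$ (y, v mod dC)))"
  proof (intro sum.cong refl)
    fix y assume "y \<in> {..<dA * dB}"
    then have y: "y < dA * dB" by simp
    have u: "u div dC < N" "u mod dC < dC" "v div dC < N" "v mod dC < dC" using uv by auto
    show "(V * outer \<psi> \<psi> * V\<^sup>\<dagger>) $$ ((u div dC) * (dA * dB * dC) + y * dC + u mod dC, (v div dC) * (dA * dB * dC) + y * dC + v mod dC)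
      = (ZB (u div dC) * coeff_mat) $$ (y, u mod dC) * cnj ((ZB (v div dC) * coeff_mat) $$ (y, v mod dC))"
      unfolding ww[OF ind[OF u(1) y u(2)] ind[OF u(3) y u(4)]] unfolding V_def
        VZ_psi_index[OF u(1) y u(2)] VZ_psi_index[OF u(3) y u(4)] ..
  qed
  also have "\<dots> = ?R $$ (u,v)"
    using uv by (simp add: mult_index[of u])
  finally show "?L $$ (u,v) = ?R $$ (u,v)" .
qed (auto simp: ptr_mid_def)

text \<open>The swapped indices on the right are the transposition caused by reducing to
  \<open>C\<close>; the next lemma moves it onto the measurement.\<close>

lemma guess_operator:
  assumes j: "j < N" and k: "k < dC" "k' < dC"
  shows "ptr_first dA dC (kron (Z j) (1\<^sub>m dC) * ptr_mid dA dB dC (outer \<psi> \<psi>)) $$ (k,k')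
    = (coeff_mat\<^sup>\<dagger> * (ZB j * coeff_mat)) $$ (k',k)"
proof -
  let ?\<rho> = "ptr_mid dA dB dC (outer \<psi> \<psi>)"
  have [simp]: "dim_row ?\<rho> = dA * dC" "dim_col ?\<rho> = dA * dC" by (simp_all add: ptr_mid_def)
  have ind: "a * (dB * dC) + b * dC + l < dA * dB * dC" if "a < dA" "b < dB" "l < dC" for a b l
    using pair_index_less[OF that(1) pair_index_less[OF that(2,3)]] by (simp add: add.assoc mult.assoc)
  have \<rho>: "?\<rho> $$ (a * dC + k, a' * dC + k') = (\<Sum>b<dB. \<psi> $ ((a * dB + b) * dC + k) * cnj (\<psi> $ ((a' * dB + b) * dC + k')))"
    if a: "a < dA" "a' < dA" for a a'
  proof -
    have "?\<rho> $$ (a * dC + k, a' * dC + k') = (\<Sum>b<dB. outer \<psi> \<psi> $$ (a * (dB * dC) + b * dC + k, a' * (dB * dC) + b * dC + k'))"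
      using a k by (simp add: ptr_mid_def)
    also have "\<dots> = (\<Sum>b<dB. \<psi> $ (a * (dB * dC) + b * dC + k) * cnj (\<psi> $ (a' * (dB * dC) + b * dC + k')))"
      using a k by (intro sum.cong refl) (simp add: outer_psi_index ind)
    finally show ?thesis by (simp add: distrib_right mult.assoc)
  qed
  have "ptr_first dA dC (kron (Z j) (1\<^sub>m dC) * ?\<rho>) $$ (k,k')
      = (\<Sum>a<dA. \<Sum>a'<dA. Z j $$ (a,a') * ?\<rho> $$ (a' * dC + k, a * dC + k'))"
  proof -
    have "(kron (Z j) (1\<^sub>m dC) * ?\<rho>) $$ (a * dC + k, a * dC + k')
      = (\<Sum>a'<dA. Z j $$ ((a * dC + k) div dC, a') * ?\<rho> $$ (a' * dC + (a * dC + k) mod dC, a * dC + k'))" if "a < dA" for a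
      using that j k by (intro kron_one_mult_index) (auto simp: info_typeD[OF Z])
    then show ?thesis using k by (simp add: ptr_first_def)
  qed
  also have "\<dots> = (\<Sum>a<dA. \<Sum>a'<dA. \<Sum>b<dB. Z j $$ (a,a') * (\<psi> $ ((a' * dB + b) * dC + k) * cnj (\<psi> $ ((a * dB + b) * dC + k'))))"
    by (intro sum.cong refl) (simp add: \<rho> sum_distrib_left)
  also have "\<dots> = (\<Sum>a<dA. \<Sum>b<dB. \<Sum>a'<dA. Z j $$ (a,a') * (\<psi> $ ((a' * dB + b) * dC + k) * cnj (\<psi> $ ((a * dB + b) * dC + k'))))"
    by (rule sum.cong[OF refl], rule sum.swap)
  also have "\<dots> = (\<Sum>a<dA. \<Sum>b<dB. cnj (coeff_mat $$ (a * dB + b, k')) * (ZB j * coeff_mat) $$ (a * dB + b, k))"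
    using j k by (intro sum.cong refl) (simp add: ZB_coeff_mat_index sum_distrib_left mult.commute[of "cnj _"] mult.assoc)
  also have "\<dots> = (coeff_mat\<^sup>\<dagger> * (ZB j * coeff_mat)) $$ (k',k)"
    using j k by (subst mult_index) (auto simp: sum_lessThan_mult info_typeD[OF Z])
  finally show ?thesis .
qed

lemma p_guess_eq:
  "p_guess dA dB dC N Z (outer \<psi> \<psi>)
    = Sup {(\<Sum>j<N. Re (mtrace (Q j * (coeff_mat\<^sup>\<dagger> * (ZB j * coeff_mat))))) | Q. povm dC N Q}"
proof -
  define \<sigma> where "\<sigma> j = ptr_first dA dC (kron (Z j) (1\<^sub>m dC) * ptr_mid dA dB dC (outer \<psi> \<psi>))" for j
  have [simp]: "dim_row (\<sigma> j) = dC" "dim_col (\<sigma> j) = dC" for j by (simp_all add: \<sigma>_def ptr_first_def)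
  have tr: "mtrace (Q * \<sigma> j) = mtrace (map_mat cnj Q * (coeff_mat\<^sup>\<dagger> * (ZB j * coeff_mat)))" if Q: "psd dC Q" and j: "j < N" for Q j
  proof -
    note [simp] = psdD(1,2)[OF Q]
    have sym: "cnj (Q $$ (x,y)) = Q $$ (y,x)" if "x < dC" "y < dC" for x y
      using arg_cong[OF psdD(3)[OF Q], of "\<lambda>M. M $$ (y,x)"] that by simp
    have "mtrace (Q * \<sigma> j) = (\<Sum>x<dC. \<Sum>y<dC. Q $$ (x,y) * (coeff_mat\<^sup>\<dagger> * (ZB j * coeff_mat)) $$ (x,y))"
    proof -
      have "\<sigma> j $$ (y,x) = (coeff_mat\<^sup>\<dagger> * (ZB j * coeff_mat)) $$ (x,y)" if "x < dC" "y < dC" for x y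
        unfolding \<sigma>_def by (rule guess_operator[OF j that(2,1)])
      then show ?thesis by (subst mtrace_mult) simp_all
    qed
    also have "\<dots> = (\<Sum>y<dC. \<Sum>x<dC. Q $$ (x,y) * (coeff_mat\<^sup>\<dagger> * (ZB j * coeff_mat)) $$ (x,y))" by (rule sum.swap)
    also have "\<dots> = mtrace (map_mat cnj Q * (coeff_mat\<^sup>\<dagger> * (ZB j * coeff_mat)))"
      using j by (subst mtrace_mult) (auto simp: sym info_typeD[OF Z] intro!: sum.cong)
    finally show ?thesis .
  qed
  \<comment> \<open>Conjugation is an involution on measurements, so the sets of success
    probabilities coincide although a fixed measurement may score differently in the two.\<close>
  have "{(\<Sum>j<N. Re (mtrace (Q j * \<sigma> j))) | Q. povm dC N Q}
      = {(\<Sum>j<N. Re (mtrace (Q j * (coeff_mat\<^sup>\<dagger> * (ZB j * coeff_mat))))) | Q. povm dC N Q}" (is "?A = ?B")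
  proof (intro equalityI subsetI)
    fix g assume "g \<in> ?A"
    then obtain Q where Q: "povm dC N Q" "g = (\<Sum>j<N. Re (mtrace (Q j * \<sigma> j)))" by blast
    then have "g = (\<Sum>j<N. Re (mtrace (map_mat cnj (Q j) * (coeff_mat\<^sup>\<dagger> * (ZB j * coeff_mat)))))"
      by (simp add: tr povm_def)
    then show "g \<in> ?B" using povm_map_cnj[OF Q(1)] by (intro CollectI exI[of _ "\<lambda>j. map_mat cnj (Q j)"] conjI)
  next
    fix g assume "g \<in> ?B"
    then obtain Q where Q: "povm dC N Q" "g = (\<Sum>j<N. Re (mtrace (Q j * (coeff_mat\<^sup>\<dagger> * (ZB j * coeff_mat)))))" by blast
    have "map_mat cnj (map_mat cnj (Q j)) = Q j" for j by (rule eq_matI) auto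
    then have "g = (\<Sum>j<N. Re (mtrace (map_mat cnj (Q j) * \<sigma> j)))"
      using povm_map_cnj[OF Q(1)] Q(2) by (simp add: tr povm_def)
    then show "g \<in> ?A" using povm_map_cnj[OF Q(1)] by (intro CollectI exI[of _ "\<lambda>j. map_mat cnj (Q j)"] conjI)
  qed
  then show ?thesis unfolding p_guess_def Let_def \<sigma>_def by simp
qed

lemma cond_entropy_Z_eq:
  defines "R \<equiv> blocks (dA * dB) N ZB coeff_mat"
  shows "cond_entropy_Z dA dB dC N Z (outer \<psi> \<psi>) = vN_entropy (R * R\<^sup>\<dagger>) - vN_entropy (coeff_mat\<^sup>\<dagger> * coeff_mat)"
proof -
  have "hermitian (N * dC) (R\<^sup>\<dagger> * R)" by (rule psdD(4), rule psd_gram) (simp add: R_def)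
  moreover have "hermitian dC (coeff_mat\<^sup>\<dagger> * coeff_mat)" by (rule psdD(4), rule psd_gram) simp
  ultimately show ?thesis
    unfolding cond_entropy_Z_def Let_def rho_MC rho_C R_def[symmetric] vN_entropy_gram_swap
    by (simp add: vN_entropy_map_cnj)
qed

end

theorem theorem2:
  fixes dA dB dC N :: nat and \<psi> :: "complex vec" and Z :: "nat \<Rightarrow> complex mat"
    and \<rho>ABC \<rho>AB \<rho>t :: "complex mat"
  assumes psi: "\<psi> \<in> carrier_vec (dA * dB * dC)" and norm: "cinner \<psi> \<psi> = 1"
    and pure: "\<rho>ABC = outer \<psi> \<psi>"
    and Z: "info_type dA N Z"
    and AB: "\<rho>AB = ptr_last (dA * dB) dC \<rho>ABC"
    and tilde: "\<rho>t = VZ N dA dB Z * \<rho>AB * mat_adjoint (VZ N dA dB Z)"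
  shows "E_D N (dA * dB) \<rho>t = cond_entropy_Z dA dB dC N Z \<rho>ABC
       \<and> E_R N (dA * dB) \<rho>t = ereal (cond_entropy_Z dA dB dC N Z \<rho>ABC)
       \<and> E_G N (dA * dB) \<rho>t = 1 - p_guess dA dB dC N Z \<rho>ABC"
proof -
  let ?T = "coeff_mat dA dB dC \<psi>" and ?Z = "\<lambda>j. kron (Z j) (1\<^sub>m dB)"
  let ?P = "premeasure (dA * dB) N ?Z ?T"
  note T_dims [simp] = coeff_mat_simps(1,2)[OF psi Z]
  have Z': "info_type (dA * dB) N ?Z" by (rule info_type_kron[OF Z])
  have T1: "fnorm ?T = 1"
  proof -
    have "complex_of_real ((fnorm ?T)\<^sup>2) = complex_of_real 1" using fnorm_coeff_mat[OF psi Z] norm by simp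
    then have "(fnorm ?T)\<^sup>2 = 1" by (simp only: of_real_eq_iff)
    then show ?thesis using fnorm_nonneg[of ?T] by (simp add: power2_eq_1_iff)
  qed
  \<comment> \<open>A normalised vector excludes dimension 0, and then the empty family of
    projectors cannot sum to the identity; this rules out the degenerate cases.\<close>
  have d: "dA * dB > 0"
  proof (rule ccontr)
    assume "\<not> ?thesis"
    then have "dim_vec \<psi> = 0" using psi by auto
    then show False using norm by (simp add: cinner_def)
  qed
  have N: "N > 0"
  proof (rule ccontr)
    assume "\<not> ?thesis"
    then have "msum (dA * dB) (dA * dB) ?Z {..<N} $$ (0,0) = 0" using d by simp
    then show False unfolding info_typeD(6)[OF Z'] using d by simp
  qed
  have \<rho>: "\<rho>t = ?P * ?P\<^sup>\<dagger>"
  proof -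
    have "\<rho>t = (VZ N dA dB Z * ?T) * (VZ N dA dB Z * ?T)\<^sup>\<dagger>"
      unfolding tilde AB pure rho_AB[OF psi Z] by (simp add: adjoint_mult mult_assoc_dim)
    then show ?thesis unfolding VZ_coeff_mat[OF psi Z] .
  qed
  show ?thesis
    unfolding \<rho> pure cond_entropy_Z_eq[OF psi Z] p_guess_eq[OF psi Z]
    using entanglement_of_premeasurement[OF Z' T_dims T1 d]
      geometric_entanglement_of_premeasurement[OF Z' T_dims T1 d N] by blast
qed

end
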